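(* Let $\mathfrak g$ be the simple complex Lie algebra of type $E_8$. For each of the following subsets $\pi$ of the set of simple roots, the standard parabolic subalgebra $\mathfrak p_\pi^+$ is quasi-reductive, and its index, the Lie algebra $M_*(\mathfrak p_\pi^+)$ of a maximal reductive stabiliser, and the embedding of $M_*(\mathfrak p_\pi^+)$ (for a suitable representative) into the standard Levi subalgebra of $\mathfrak p_\pi^+$, given by the restriction to $M_*(\mathfrak p_\pi^+)$ of the defining representation of the Levi subalgebra, are as follows. (1) $\pi=\{\alpha_1,\alpha_2,\alpha_3,\alpha_4,\alpha_5,\alpha_6,\alpha_8\}$: index $6$; $M_*=B_6$; $R(\varpi_1)+\mathrm{id}$. (2) $\pi=\{\alpha_1,\alpha_2,\alpha_3,\alpha_4,\alpha_5,\alpha_6\}$: index $3$; $M_*=C_3$; $R(\varpi_1)+\mathrm{id}$. (3) $\pi=\{\alpha_1,\alpha_2,\alpha_3,\alpha_4,\alpha_5,\alpha_8\}$: index $3$; $M_*=C_3$; $R(\varpi_1)+\mathrm{id}$. (4) $\pi=\{\alpha_1,\alpha_2,\alpha_3,\alpha_4\}$: index $2$; $M_*=C_2$; $R(\varpi_1)+\mathrm{id}$. (5) $\pi=\{\alpha_1,\alpha_2\}$: index $1$; $M_*=A_1$; $R(\varpi_1)+\mathrm{id}$.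
   Context: General notions (over $\mathbb C$). Let $Q$ be a connected linear algebraic group with Lie algebra $\mathfrak q$ and centre $Z$. For $\gamma\in\mathfrak q^*$ let $Q_\gamma$, $\mathfrak q_\gamma$ be the stabilisers for the coadjoint action. The index of $\mathfrak q$ is $\min_\gamma\dim\mathfrak q_\gamma$. $\gamma$ is of reductive type if $Q_\gamma/Z$ is a reductive subgroup of $GL(\mathfrak q)$, and of nilpotent type if $\gamma(\mathfrak q_\gamma)=0$. $\mathfrak q$ is quasi-reductive if it has a linear form of reductive type, and strongly quasi-reductive if in addition $\mathrm{Lie}\,Z$ consists of semisimple elements (automatic for parabolic subalgebras of semisimple Lie algebras). If $\mathfrak q$ is strongly quasi-reductive, the linear forms that are both of reductive and of nilpotent type form one single coadjoint orbit $Q\gamma$; $Q_\gamma$ is called a maximal reductive stabiliser, and its Lie algebra, defined up to conjugation by $Q$, is denoted $M_*(\mathfrak q)$. Notation. Simple roots of $E_8$ are numbered so that the Dynkin diagram is the chain $\alpha_1-\alpha_2-\alpha_3-\alpha_4-\alpha_5-\alpha_6-\alpha_7$ with $\alpha_8$ attached to $\alpha_5$. $\mathfrak p_\pi^+$ is the subalgebra generated by the Borel subalgebra $\mathfrak h\oplus\mathfrak n^+$ and the root spaces $\mathfrak g_{-\alpha}$, $\alpha\in\pi$; its standard Levi subalgebra is generated by $\mathfrak h$ and $\mathfrak g_{\pm\alpha}$, $\alpha\in\pi$. $R(\varpi_1)$ is the first fundamental representation ($\mathbb C^{13}$ for $B_6$, $\mathbb C^{2k}$ for $C_k$, $\mathbb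 C^2$ for $A_1$); $\mathrm{id}$ is the trivial one-dimensional representation. The defining representation of the derived algebra of the Levi is $\mathbb C^{14}$ for $D_7$ and $\mathbb C^{k+1}$ for $A_k$. *)

theory Defs
  imports "HOL-Analysis.Analysis" "HOL-Algebra.Bij" "HOL-Algebra.Coset"
begin

section \<open>Complex Lie algebras\<close>

locale complex_lie_algebra = vector_space sc
  for sc :: "complex \<Rightarrow> 'g::ab_group_add \<Rightarrow> 'g" +
  fixes br :: "'g \<Rightarrow> 'g \<Rightarrow> 'g"
  assumes br_add_left: "br (x + y) z = br x z + br y z"
    and br_add_right: "br x (y + z) = br x y + br x z"
    and br_scale_left: "br (sc c x) y = sc c (br x y)"
    and br_scale_right: "br x (sc c y) = sc c (br x y)"
    and br_self: "br x x = 0"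
    and jacobi: "br x (br y z) + br y (br z x) + br z (br x y) = 0"

definition finite_dimensional :: "(complex \<Rightarrow> 'v::ab_group_add \<Rightarrow> 'v) \<Rightarrow> bool" where
  "finite_dimensional sc \<longleftrightarrow> (\<exists>B. finite B \<and> module.span sc B = UNIV)"

definition lie_subalgebra ::
  "(complex \<Rightarrow> 'g::ab_group_add \<Rightarrow> 'g) \<Rightarrow> ('g \<Rightarrow> 'g \<Rightarrow> 'g) \<Rightarrow> 'g set \<Rightarrow> bool" where
  "lie_subalgebra sc br S \<longleftrightarrow> module.subspace sc S \<and> (\<forall>x\<in>S. \<forall>y\<in>S. br x y \<in> S)"

definition lie_ideal ::
  "(complex \<Rightarrow> 'g::ab_group_add \<Rightarrow> 'g) \<Rightarrow> ('g \<Rightarrow> 'g \<Rightarrow> 'g) \<Rightarrow> 'g set \<Rightarrow> bool" where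
  "lie_ideal sc br I \<longleftrightarrow> module.subspace sc I \<and> (\<forall>x. \<forall>y\<in>I. br x y \<in> I)"

definition lie_generated ::
  "(complex \<Rightarrow> 'g::ab_group_add \<Rightarrow> 'g) \<Rightarrow> ('g \<Rightarrow> 'g \<Rightarrow> 'g) \<Rightarrow> 'g set \<Rightarrow> 'g set" where
  "lie_generated sc br S = \<Inter>{T. lie_subalgebra sc br T \<and> S \<subseteq> T}"

definition derived_algebra ::
  "(complex \<Rightarrow> 'g::ab_group_add \<Rightarrow> 'g) \<Rightarrow> ('g \<Rightarrow> 'g \<Rightarrow> 'g) \<Rightarrow> 'g set \<Rightarrow> 'g set" where
  "derived_algebra sc br S = module.span sc {br x y | x y. x \<in> S \<and> y \<in> S}"

definition simple_lie_algebra ::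
  "(complex \<Rightarrow> 'g::ab_group_add \<Rightarrow> 'g) \<Rightarrow> ('g \<Rightarrow> 'g \<Rightarrow> 'g) \<Rightarrow> bool" where
  "simple_lie_algebra sc br \<longleftrightarrow>
     complex_lie_algebra sc br \<and> finite_dimensional sc \<and>
     (\<exists>x y. br x y \<noteq> 0) \<and> (\<forall>I. lie_ideal sc br I \<longrightarrow> I = {0} \<or> I = UNIV)"

definition diagonalisable ::
  "(complex \<Rightarrow> 'v::ab_group_add \<Rightarrow> 'v) \<Rightarrow> ('v \<Rightarrow> 'v) \<Rightarrow> bool" where
  "diagonalisable sc X \<longleftrightarrow> module.span sc {v. \<exists>c. X v = sc c v} = UNIV"


section \<open>Cartan subalgebras, roots, and type \<open>E\<^sub>8\<close>\<close>

text \<open>Cartan subalgebra of a semisimple Lie algebra: a maximal commutative subalgebra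
  all of whose elements are ad-semisimple.\<close>

definition cartan_subalgebra ::
  "(complex \<Rightarrow> 'g::ab_group_add \<Rightarrow> 'g) \<Rightarrow> ('g \<Rightarrow> 'g \<Rightarrow> 'g) \<Rightarrow> 'g set \<Rightarrow> bool" where
  "cartan_subalgebra sc br h \<longleftrightarrow>
     lie_subalgebra sc br h \<and> (\<forall>x\<in>h. \<forall>y\<in>h. br x y = 0) \<and>
     (\<forall>x. (\<forall>y\<in>h. br y x = 0) \<longrightarrow> x \<in> h) \<and>
     (\<forall>x\<in>h. diagonalisable sc (br x))"

text \<open>Weights are functions on the whole of \<open>'g\<close> of which only the values on \<open>h\<close> matter.\<close>

definition root_space ::
  "(complex \<Rightarrow> 'g::ab_group_add \<Rightarrow> 'g) \<Rightarrow> ('g \<Rightarrow> 'g \<Rightarrow> 'g) \<Rightarrow> 'g set \<Rightarrow> ('g \<Rightarrow> complex) \<Rightarrow> 'g set" where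
  "root_space sc br h \<beta> = {x. \<forall>H\<in>h. br H x = sc (\<beta> H) x}"

definition is_root ::
  "(complex \<Rightarrow> 'g::ab_group_add \<Rightarrow> 'g) \<Rightarrow> ('g \<Rightarrow> 'g \<Rightarrow> 'g) \<Rightarrow> 'g set \<Rightarrow> ('g \<Rightarrow> complex) \<Rightarrow> bool" where
  "is_root sc br h \<beta> \<longleftrightarrow> (\<exists>H\<in>h. \<beta> H \<noteq> 0) \<and> (\<exists>x\<in>root_space sc br h \<beta>. x \<noteq> 0)"

definition positive_root ::
  "(complex \<Rightarrow> 'g::ab_group_add \<Rightarrow> 'g) \<Rightarrow> ('g \<Rightarrow> 'g \<Rightarrow> 'g) \<Rightarrow> 'g set \<Rightarrow>
    nat set \<Rightarrow> (nat \<Rightarrow> 'g \<Rightarrow> complex) \<Rightarrow> ('g \<Rightarrow> complex) \<Rightarrow> bool" where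
  "positive_root sc br h I \<alpha> \<beta> \<longleftrightarrow> is_root sc br h \<beta> \<and>
     (\<exists>c::nat \<Rightarrow> nat. \<forall>H\<in>h. \<beta> H = (\<Sum>i\<in>I. of_nat (c i) * \<alpha> i H))"

definition simple_roots ::
  "(complex \<Rightarrow> 'g::ab_group_add \<Rightarrow> 'g) \<Rightarrow> ('g \<Rightarrow> 'g \<Rightarrow> 'g) \<Rightarrow> 'g set \<Rightarrow>
    nat set \<Rightarrow> (nat \<Rightarrow> 'g \<Rightarrow> complex) \<Rightarrow> bool" where
  "simple_roots sc br h I \<alpha> \<longleftrightarrow> finite I \<and>
     (\<forall>i\<in>I. is_root sc br h (\<alpha> i)) \<and>
     (\<forall>c::nat \<Rightarrow> complex. (\<forall>H\<in>h. (\<Sum>i\<in>I. c i * \<alpha> i H) = 0) \<longrightarrow> (\<forall>i\<in>I. c i = 0)) \<and>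
     (\<forall>\<beta>. is_root sc br h \<beta> \<longrightarrow>
        positive_root sc br h I \<alpha> \<beta> \<or> positive_root sc br h I \<alpha> (\<lambda>H. - \<beta> H))"

definition is_coroot ::
  "(complex \<Rightarrow> 'g::ab_group_add \<Rightarrow> 'g) \<Rightarrow> ('g \<Rightarrow> 'g \<Rightarrow> 'g) \<Rightarrow> 'g set \<Rightarrow> ('g \<Rightarrow> complex) \<Rightarrow> 'g \<Rightarrow> bool" where
  "is_coroot sc br h \<beta> H \<longleftrightarrow> \<beta> H = 2 \<and>
     H \<in> module.span sc {br x y | x y. x \<in> root_space sc br h \<beta> \<and>
                                       y \<in> root_space sc br h (\<lambda>H. - \<beta> H)}"

text \<open>The Cartan integer of the pair \<open>i, j\<close> is the value of the simple root \<open>\<alpha>\<^sub>j\<close> on the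
  coroot of \<open>\<alpha>\<^sub>i\<close>.\<close>

definition has_cartan_matrix ::
  "(complex \<Rightarrow> 'g::ab_group_add \<Rightarrow> 'g) \<Rightarrow> ('g \<Rightarrow> 'g \<Rightarrow> 'g) \<Rightarrow> 'g set \<Rightarrow>
    nat set \<Rightarrow> (nat \<Rightarrow> 'g \<Rightarrow> complex) \<Rightarrow> (nat \<Rightarrow> nat \<Rightarrow> int) \<Rightarrow> bool" where
  "has_cartan_matrix sc br h I \<alpha> A \<longleftrightarrow>
     (\<forall>i\<in>I. \<exists>H. is_coroot sc br h (\<alpha> i) H \<and> (\<forall>j\<in>I. \<alpha> j H = of_int (A i j)))"

text \<open>The chain \<open>1 - 2 - 3 - 4 - 5 - 6 - 7\<close> with \<open>8\<close> attached to \<open>5\<close>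
  (this is not the Bourbaki numbering).\<close>

definition E8_edges :: "nat set set" where
  "E8_edges = {{1,2}, {2,3}, {3,4}, {4,5}, {5,6}, {6,7}, {5,8}}"

definition E8_cartan_matrix :: "nat \<Rightarrow> nat \<Rightarrow> int" where
  "E8_cartan_matrix i j = (if i = j then 2 else if {i, j} \<in> E8_edges then - 1 else 0)"

definition simple_lie_algebra_E8 ::
  "(complex \<Rightarrow> 'g::ab_group_add \<Rightarrow> 'g) \<Rightarrow> ('g \<Rightarrow> 'g \<Rightarrow> 'g) \<Rightarrow> 'g set \<Rightarrow>
    (nat \<Rightarrow> 'g \<Rightarrow> complex) \<Rightarrow> bool" where
  "simple_lie_algebra_E8 sc br h \<alpha> \<longleftrightarrow>
     simple_lie_algebra sc br \<and> cartan_subalgebra sc br h \<and>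
     simple_roots sc br h {1..8} \<alpha> \<and>
     has_cartan_matrix sc br h {1..8} \<alpha> E8_cartan_matrix"

definition borel ::
  "(complex \<Rightarrow> 'g::ab_group_add \<Rightarrow> 'g) \<Rightarrow> ('g \<Rightarrow> 'g \<Rightarrow> 'g) \<Rightarrow> 'g set \<Rightarrow>
    nat set \<Rightarrow> (nat \<Rightarrow> 'g \<Rightarrow> complex) \<Rightarrow> 'g set" where
  "borel sc br h I \<alpha> =
     module.span sc (h \<union> (\<Union>\<beta>\<in>{\<beta>. positive_root sc br h I \<alpha> \<beta>}. root_space sc br h \<beta>))"

definition standard_parabolic ::
  "(complex \<Rightarrow> 'g::ab_group_add \<Rightarrow> 'g) \<Rightarrow> ('g \<Rightarrow> 'g \<Rightarrow> 'g) \<Rightarrow> 'g set \<Rightarrow>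
    nat set \<Rightarrow> (nat \<Rightarrow> 'g \<Rightarrow> complex) \<Rightarrow> nat set \<Rightarrow> 'g set" where
  "standard_parabolic sc br h I \<alpha> \<pi> =
     lie_generated sc br
       (borel sc br h I \<alpha> \<union> (\<Union>i\<in>\<pi>. root_space sc br h (\<lambda>H. - \<alpha> i H)))"

definition standard_levi ::
  "(complex \<Rightarrow> 'g::ab_group_add \<Rightarrow> 'g) \<Rightarrow> ('g \<Rightarrow> 'g \<Rightarrow> 'g) \<Rightarrow> 'g set \<Rightarrow>
    (nat \<Rightarrow> 'g \<Rightarrow> complex) \<Rightarrow> nat set \<Rightarrow> 'g set" where
  "standard_levi sc br h \<alpha> \<pi> =
     lie_generated sc br
       (h \<union> (\<Union>i\<in>\<pi>. root_space sc br h (\<alpha> i) \<union> root_space sc br h (\<lambda>H. - \<alpha> i H)))"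


section \<open>Linear algebraic groups\<close>

definition linear_on ::
  "(complex \<Rightarrow> 'v::ab_group_add \<Rightarrow> 'v) \<Rightarrow> (complex \<Rightarrow> 'w::ab_group_add \<Rightarrow> 'w) \<Rightarrow>
    'v set \<Rightarrow> ('v \<Rightarrow> 'w) \<Rightarrow> bool" where
  "linear_on sc sc' W f \<longleftrightarrow>
     (\<forall>x\<in>W. \<forall>y\<in>W. f (x + y) = f x + f y) \<and> (\<forall>c. \<forall>x\<in>W. f (sc c x) = sc' c (f x))"

text \<open>The general linear group of a subspace \<open>W\<close>, as a subset of the group of all
  permutations of \<open>W\<close> (extensional functions, composed by \<^term>\<open>compose W\<close>).\<close>

definition GL :: "(complex \<Rightarrow> 'v::ab_group_add \<Rightarrow> 'v) \<Rightarrow> 'v set \<Rightarrow> ('v \<Rightarrow> 'v) set" where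
  "GL sc W = {T \<in> Bij W. linear_on sc sc W T}"

text \<open>Polynomial functions on \<open>End(W)\<close>, generated by the matrix coefficients.\<close>

inductive polyfun ::
  "(complex \<Rightarrow> 'v::ab_group_add \<Rightarrow> 'v) \<Rightarrow> 'v set \<Rightarrow> (('v \<Rightarrow> 'v) \<Rightarrow> complex) \<Rightarrow> bool"
  for sc W where
  const: "polyfun sc W (\<lambda>T. c)"
| coeff: "w \<in> W \<Longrightarrow> linear_on sc (*) W l \<Longrightarrow> polyfun sc W (\<lambda>T. l (T w))"
| add: "polyfun sc W f \<Longrightarrow> polyfun sc W g \<Longrightarrow> polyfun sc W (\<lambda>T. f T + g T)"
| mult: "polyfun sc W f \<Longrightarrow> polyfun sc W g \<Longrightarrow> polyfun sc W (\<lambda>T. f T * g T)"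

definition zariski ::
  "(complex \<Rightarrow> 'v::ab_group_add \<Rightarrow> 'v) \<Rightarrow> 'v set \<Rightarrow> ('v \<Rightarrow> 'v) topology" where
  "zariski sc W =
     topology_generated_by {{T \<in> GL sc W. f T \<noteq> 0} | f. polyfun sc W f}"

definition unipotent_on :: "'v::ab_group_add set \<Rightarrow> ('v \<Rightarrow> 'v) \<Rightarrow> bool" where
  "unipotent_on W u \<longleftrightarrow> (\<exists>n. \<forall>w\<in>W. ((\<lambda>v. u v - v) ^^ n) w = 0)"

text \<open>Reductive: the unipotent radical is trivial (no connectedness of \<open>H\<close> is required).
  The predicate is only applied to algebraic groups, see below.\<close>

definition reductive_group ::
  "(complex \<Rightarrow> 'v::ab_group_add \<Rightarrow> 'v) \<Rightarrow> 'v set \<Rightarrow> ('v \<Rightarrow> 'v) set \<Rightarrow> bool" where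
  "reductive_group sc W H \<longleftrightarrow>
     subgroup H (BijGroup W) \<and> H \<subseteq> GL sc W \<and>
     (\<forall>U. U \<lhd> (BijGroup W\<lparr>carrier := H\<rparr>) \<and> closedin (zariski sc W) U \<and>
          connectedin (zariski sc W) U \<and> (\<forall>u\<in>U. unipotent_on W u)
        \<longrightarrow> U = {\<one>\<^bsub>BijGroup W\<^esub>})"

definition connected_linear_algebraic_group ::
  "(complex ^ 'n \<Rightarrow> complex ^ 'n) set \<Rightarrow> bool" where
  "connected_linear_algebraic_group Q \<longleftrightarrow>
     subgroup Q (BijGroup UNIV) \<and> Q \<subseteq> GL (*s) UNIV \<and>
     closedin (zariski (*s) UNIV) Q \<and> connectedin (zariski (*s) UNIV) Q"

text \<open>The Lie algebra of \<open>Q\<close> is its Zariski tangent space at the identity, inside \<open>gl\<^sub>n\<close>.\<close>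

definition group_lie_algebra ::
  "(complex ^ 'n \<Rightarrow> complex ^ 'n) set \<Rightarrow> (complex ^ 'n \<Rightarrow> complex ^ 'n) set" where
  "group_lie_algebra Q = {X. linear_on (*s) (*s) UNIV X \<and>
     (\<forall>f. polyfun (*s) UNIV f \<and> (\<forall>g\<in>Q. f g = 0) \<longrightarrow>
        ((\<lambda>t. f (\<lambda>v. v + t *s X v)) has_field_derivative 0) (at 0))}"

text \<open>\<open>Q\<close> is a connected linear algebraic group with Lie algebra \<open>q\<close>; the identification
  of \<open>q\<close> with the Lie algebra of \<open>Q\<close> is \<open>\<phi>\<close>.\<close>

definition has_lie_algebra ::
  "(complex \<Rightarrow> 'g::ab_group_add \<Rightarrow> 'g) \<Rightarrow> ('g \<Rightarrow> 'g \<Rightarrow> 'g) \<Rightarrow> 'g set \<Rightarrow>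
    (complex ^ 'n \<Rightarrow> complex ^ 'n) set \<Rightarrow> ('g \<Rightarrow> complex ^ 'n \<Rightarrow> complex ^ 'n) \<Rightarrow> bool" where
  "has_lie_algebra sc br q Q \<phi> \<longleftrightarrow>
     connected_linear_algebraic_group Q \<and>
     bij_betw \<phi> q (group_lie_algebra Q) \<and>
     (\<forall>x\<in>q. \<forall>y\<in>q. \<phi> (x + y) = (\<lambda>v. \<phi> x v + \<phi> y v)) \<and>
     (\<forall>c. \<forall>x\<in>q. \<phi> (sc c x) = (\<lambda>v. c *s \<phi> x v)) \<and>
     (\<forall>x\<in>q. \<forall>y\<in>q. \<phi> (br x y) = (\<lambda>v. \<phi> x (\<phi> y v) - \<phi> y (\<phi> x v)))"

definition group_centre ::
  "(complex ^ 'n \<Rightarrow> complex ^ 'n) set \<Rightarrow> (complex ^ 'n \<Rightarrow> complex ^ 'n) set" where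
  "group_centre Q = {z \<in> Q. \<forall>g\<in>Q. g \<circ> z = z \<circ> g}"

definition Ad ::
  "'g set \<Rightarrow> ('g \<Rightarrow> complex ^ 'n \<Rightarrow> complex ^ 'n) \<Rightarrow> (complex ^ 'n \<Rightarrow> complex ^ 'n) \<Rightarrow> 'g \<Rightarrow> 'g" where
  "Ad q \<phi> g = (\<lambda>x\<in>q. inv_into q \<phi> (g \<circ> \<phi> x \<circ> inv_into UNIV g))"


section \<open>Coadjoint stabilisers and quasi-reductive Lie algebras\<close>

definition dual_space ::
  "(complex \<Rightarrow> 'g::ab_group_add \<Rightarrow> 'g) \<Rightarrow> 'g set \<Rightarrow> ('g \<Rightarrow> complex) set" where
  "dual_space sc q = {\<gamma> \<in> extensional q. linear_on sc (*) q \<gamma>}"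

definition lie_stabiliser ::
  "('g \<Rightarrow> 'g \<Rightarrow> 'g) \<Rightarrow> 'g set \<Rightarrow> ('g \<Rightarrow> complex) \<Rightarrow> 'g set" where
  "lie_stabiliser br q \<gamma> = {x \<in> q. \<forall>y\<in>q. \<gamma> (br x y) = 0}"

definition lie_index ::
  "(complex \<Rightarrow> 'g::ab_group_add \<Rightarrow> 'g) \<Rightarrow> ('g \<Rightarrow> 'g \<Rightarrow> 'g) \<Rightarrow> 'g set \<Rightarrow> nat" where
  "lie_index sc br q =
     (INF \<gamma>\<in>dual_space sc q. vector_space.dim sc (lie_stabiliser br q \<gamma>))"

definition coadjoint ::
  "'g set \<Rightarrow> ('g \<Rightarrow> complex ^ 'n \<Rightarrow> complex ^ 'n) \<Rightarrow> (complex ^ 'n \<Rightarrow> complex ^ 'n) \<Rightarrow>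
    ('g \<Rightarrow> complex) \<Rightarrow> 'g \<Rightarrow> complex" where
  "coadjoint q \<phi> g \<gamma> = (\<lambda>x\<in>q. \<gamma> (Ad q \<phi> (inv_into UNIV g) x))"

definition group_stabiliser ::
  "'g set \<Rightarrow> (complex ^ 'n \<Rightarrow> complex ^ 'n) set \<Rightarrow>
    ('g \<Rightarrow> complex ^ 'n \<Rightarrow> complex ^ 'n) \<Rightarrow> ('g \<Rightarrow> complex) \<Rightarrow>
    (complex ^ 'n \<Rightarrow> complex ^ 'n) set" where
  "group_stabiliser q Q \<phi> \<gamma> = {g \<in> Q. coadjoint q \<phi> g \<gamma> = \<gamma>}"

text \<open>As \<open>Q\<close> is connected, its centre \<open>Z\<close> is the kernel of \<open>Ad\<close>, so that \<open>Q\<^sub>\<gamma>/Z\<close>, viewed as a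
  subgroup of \<open>GL(q)\<close>, is the image of \<open>Q\<^sub>\<gamma>\<close> under \<open>Ad\<close>. It is Zariski closed, being the image
  of an algebraic group under a homomorphism of algebraic groups.\<close>

definition reductive_type ::
  "(complex \<Rightarrow> 'g::ab_group_add \<Rightarrow> 'g) \<Rightarrow> 'g set \<Rightarrow> (complex ^ 'n \<Rightarrow> complex ^ 'n) set \<Rightarrow>
    ('g \<Rightarrow> complex ^ 'n \<Rightarrow> complex ^ 'n) \<Rightarrow> ('g \<Rightarrow> complex) \<Rightarrow> bool" where
  "reductive_type sc q Q \<phi> \<gamma> \<longleftrightarrow>
     reductive_group sc q (Ad q \<phi> ` group_stabiliser q Q \<phi> \<gamma>)"

definition nilpotent_type ::
  "('g \<Rightarrow> 'g \<Rightarrow> 'g) \<Rightarrow> 'g set \<Rightarrow> ('g \<Rightarrow> complex) \<Rightarrow> bool" where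
  "nilpotent_type br q \<gamma> \<longleftrightarrow> (\<forall>x\<in>lie_stabiliser br q \<gamma>. \<gamma> x = 0)"

definition quasi_reductive ::
  "(complex \<Rightarrow> 'g::ab_group_add \<Rightarrow> 'g) \<Rightarrow> 'g set \<Rightarrow> (complex ^ 'n \<Rightarrow> complex ^ 'n) set \<Rightarrow>
    ('g \<Rightarrow> complex ^ 'n \<Rightarrow> complex ^ 'n) \<Rightarrow> bool" where
  "quasi_reductive sc q Q \<phi> \<longleftrightarrow> (\<exists>\<gamma>\<in>dual_space sc q. reductive_type sc q Q \<phi> \<gamma>)"

definition strongly_quasi_reductive ::
  "(complex \<Rightarrow> 'g::ab_group_add \<Rightarrow> 'g) \<Rightarrow> 'g set \<Rightarrow> (complex ^ 'n \<Rightarrow> complex ^ 'n) set \<Rightarrow>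
    ('g \<Rightarrow> complex ^ 'n \<Rightarrow> complex ^ 'n) \<Rightarrow> bool" where
  "strongly_quasi_reductive sc q Q \<phi> \<longleftrightarrow>
     quasi_reductive sc q Q \<phi> \<and>
     (\<forall>X\<in>group_lie_algebra (group_centre Q). diagonalisable (*s) X)"

text \<open>\<open>M\<close> is the Lie algebra of a maximal reductive stabiliser, i.e. a representative of the
  \<open>Q\<close>-conjugacy class \<open>M\<^sub>*(q)\<close>. That these representatives form a single conjugacy class is a
  theorem about strongly quasi-reductive Lie algebras, not part of the definition.\<close>

definition maximal_reductive_stabiliser_algebra ::
  "(complex \<Rightarrow> 'g::ab_group_add \<Rightarrow> 'g) \<Rightarrow> ('g \<Rightarrow> 'g \<Rightarrow> 'g) \<Rightarrow> 'g set \<Rightarrow>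
    (complex ^ 'n \<Rightarrow> complex ^ 'n) set \<Rightarrow> ('g \<Rightarrow> complex ^ 'n \<Rightarrow> complex ^ 'n) \<Rightarrow> 'g set \<Rightarrow> bool" where
  "maximal_reductive_stabiliser_algebra sc br q Q \<phi> M \<longleftrightarrow>
     strongly_quasi_reductive sc q Q \<phi> \<and>
     (\<exists>\<gamma>\<in>dual_space sc q. reductive_type sc q Q \<phi> \<gamma> \<and> nilpotent_type br q \<gamma> \<and>
        M = lie_stabiliser br q \<gamma>)"


section \<open>Classical Lie algebras and the embedding in the Levi subalgebra\<close>

text \<open>Dimensions are carried by the index types: \<open>so\<close> over an index type with \<open>2k+1\<close> (\<open>2k\<close>)
  elements is of type \<open>B\<^sub>k\<close> (\<open>D\<^sub>k\<close>), \<open>sl\<close> over a type with \<open>k+1\<close> elements is of type \<open>A\<^sub>k\<close>,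
  and \<open>sp\<close> over \<open>'k + 'k\<close> is of type \<open>C\<^sub>k\<close> for \<open>k = CARD('k)\<close>. The natural module of column
  vectors is the defining representation, which is \<open>R(\<varpi>\<^sub>1)\<close>.\<close>

definition so :: "(complex ^ 'n ^ 'n) set" where
  "so = {X. transpose X = - X}"

definition sl :: "(complex ^ 'n ^ 'n) set" where
  "sl = {X. trace X = 0}"

definition symplectic_form :: "complex ^ ('k::finite + 'k) ^ ('k + 'k)" where
  "symplectic_form = (\<chi> i j. case (i, j) of
       (Inl a, Inr b) \<Rightarrow> if a = b then 1 else 0
     | (Inr a, Inl b) \<Rightarrow> if a = b then - 1 else 0
     | _ \<Rightarrow> 0)"

definition sp :: "(complex ^ ('k::finite + 'k) ^ ('k + 'k)) set" where
  "sp = {X. transpose X ** symplectic_form + symplectic_form ** X = 0}"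

definition matrix_lie_iso ::
  "(complex \<Rightarrow> 'g::ab_group_add \<Rightarrow> 'g) \<Rightarrow> ('g \<Rightarrow> 'g \<Rightarrow> 'g) \<Rightarrow> 'g set \<Rightarrow>
    ('g \<Rightarrow> complex ^ 'd ^ 'd) \<Rightarrow> (complex ^ 'd ^ 'd) set \<Rightarrow> bool" where
  "matrix_lie_iso sc br S \<rho> T \<longleftrightarrow> bij_betw \<rho> S T \<and>
     (\<forall>x\<in>S. \<forall>y\<in>S. \<rho> (x + y) = \<rho> x + \<rho> y) \<and>
     (\<forall>c. \<forall>x\<in>S. \<rho> (sc c x) = mat c ** \<rho> x) \<and>
     (\<forall>x\<in>S. \<forall>y\<in>S. \<rho> (br x y) = \<rho> x ** \<rho> y - \<rho> y ** \<rho> x)"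

text \<open>The restriction of \<open>\<rho>\<close> to \<open>M\<close> is equivalent to \<open>\<theta> + id\<close>: the map from pairs \<open>(w, c)\<close>
  to \<open>P w + c v\<close> is the general form of a linear map from \<open>\<complex>\<^sup>e \<oplus> \<complex>\<close> to \<open>\<complex>\<^sup>d\<close>; it is
  required to be an isomorphism of \<open>M\<close>-modules.\<close>

definition restricts_to_sum_with_trivial ::
  "'g set \<Rightarrow> ('g \<Rightarrow> complex ^ 'd ^ 'd) \<Rightarrow> ('g \<Rightarrow> complex ^ 'e ^ 'e) \<Rightarrow> bool" where
  "restricts_to_sum_with_trivial M \<rho> \<theta> \<longleftrightarrow>
     (\<exists>(P :: complex ^ 'e ^ 'd) (v :: complex ^ 'd).
        bij (\<lambda>(w, c). P *v w + c *s v) \<and>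
        (\<forall>x\<in>M. \<rho> x ** P = P ** \<theta> x \<and> \<rho> x *v v = 0))"

text \<open>\<open>M\<close> is contained in (the derived algebra of) \<open>L\<close>, is isomorphic to \<open>S\<close>, and the defining
  representation of the derived algebra \<open>D\<close> of \<open>L\<close> restricts to \<open>M\<close> as the natural
  representation of \<open>S\<close> plus a trivial line. An isomorphism of the derived algebra onto \<open>so\<close>
  (\<open>sl\<close>) is the defining representation up to equivalence (and duality); the choice of \<open>\<rho>\<close> and
  \<open>\<theta>\<close> is immaterial, because the modules \<open>\<theta> + id\<close> occurring here are self-dual and
  \<open>B\<^sub>k\<close>, \<open>C\<^sub>k\<close>, \<open>A\<^sub>1\<close> have no outer automorphisms.\<close>

definition embedded_as_natural_plus_trivial ::
  "(complex \<Rightarrow> 'g::ab_group_add \<Rightarrow> 'g) \<Rightarrow> ('g \<Rightarrow> 'g \<Rightarrow> 'g) \<Rightarrow> 'g set \<Rightarrow> 'g set \<Rightarrow>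
    (complex ^ 'd ^ 'd) set \<Rightarrow> (complex ^ 'e ^ 'e) set \<Rightarrow> bool" where
  "embedded_as_natural_plus_trivial sc br M L D S \<longleftrightarrow>
     M \<subseteq> derived_algebra sc br L \<and>
     (\<exists>\<rho> \<theta>. matrix_lie_iso sc br (derived_algebra sc br L) \<rho> D \<and>
            matrix_lie_iso sc br M \<theta> S \<and>
            restricts_to_sum_with_trivial M \<rho> \<theta>)"

end

theory Submission
 imports Defs "HOL-Complex_Analysis.Complex_Analysis" "HOL-Computational_Algebra.Polynomial" "HOL-Combinatorics.Permutations"
begin

text \<open>The Lie algebra gets a basis of root vectors whose structure constants are signs given by a
 bilinear cocycle on the root lattice. The forms considered on a parabolic subalgebra \<open>q\<close> are sums of
 coordinates at pairwise orthogonal roots (from the Kostant cascade), plus possibly a form \<open>d\<close> on the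
 Cartan subalgebra. For a suitable \<open>d\<close> the stabiliser is a torus \<open>T\<close>. The orbit of this form is
 transversal to the forms supported on \<open>T\<close>, all of which are stabilised by \<open>T\<close>; so the
 lowest coefficients of the minors of nearby forms vanish, and \<open>dim T\<close> is the index. For \<open>d = 0\<close> the
 stabiliser lies in the Levi subalgebra, kills one vector of its defining module, and preserves a
 symplectic or quadratic form on a complement. In suitable coordinates it is closed under conjugate transposition,
 and an ideal of nilpotent matrices in such a Lie algebra is zero. The logarithm of a unipotent element of a
 normal subgroup of the stabiliser lies in such an ideal, so the form is of reductive type.\<close>

section \<open>The root lattice\<close>

text \<open>The orthogonal roots behind the two forms come from one uniform choice. The Kostant
  cascade of E_8 has eight pairwise orthogonal members, the four in \<open>cascade\<close> and the
  simple roots 2, 4, 6, 8. The list \<open>S\<close> consists of the members outside the Levi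
  subalgebra, \<open>R\<close> of those inside it. The coroots of \<open>R\<close> span a Cartan
  subalgebra of the stabiliser M obtained for d = 0, and \<open>d\<close> is a combination of
  \<open>R\<close> that is regular there, so adding it shrinks M to that torus. This is why the
  index comes out as the length of \<open>R\<close>, the rank of M. A single form bounds the index
  only from above; the lower bound for all forms is what the minors are for. Reductivity is a
  statement about a group that may be disconnected: one-parameter subgroups lead from tangent
  vectors into a normal unipotent subgroup, logarithms of single elements lead back. The structure
  constants enter the equations of a stabiliser only through products of signs, and the parity of
  such a product is decided by the lattice form. The vanishing of coordinates is therefore settled
  by a search in the lattice, whose points are explicit octuples so that the search can be
  evaluated.\<close>

datatype lat = L int int int int int int int int

instantiation lat :: ab_group_add
begin

fun plus_lat :: "lat => lat => lat" where
 "L a1 a2 a3 a4 a5 a6 a7 a8 + L b1 b2 b3 b4 b5 b6 b7 b8 =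
 L (a1 + b1) (a2 + b2) (a3 + b3) (a4 + b4) (a5 + b5) (a6 + b6) (a7 + b7) (a8 + b8)"

fun minus_lat :: "lat => lat => lat" where
 "L a1 a2 a3 a4 a5 a6 a7 a8 - L b1 b2 b3 b4 b5 b6 b7 b8 =
 L (a1 - b1) (a2 - b2) (a3 - b3) (a4 - b4) (a5 - b5) (a6 - b6) (a7 - b7) (a8 - b8)"

fun uminus_lat :: "lat => lat" where
 "- L a1 a2 a3 a4 a5 a6 a7 a8 = L (- a1) (- a2) (- a3) (- a4) (- a5) (- a6) (- a7) (- a8)"

definition zero_lat :: lat where "0 = L 0 0 0 0 0 0 0 0"

instance
proof
 fix a b c :: lat
 show "a + b + c = a + (b + c)" by (cases a; cases b; cases c) simp
 show "a + b = b + a" by (cases a; cases b) simp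
 show "0 + a = a" by (cases a) (simp add: zero_lat_def)
 show "- a + a = 0" by (cases a) (simp add: zero_lat_def)
 show "a - b = a + - b" by (cases a; cases b) simp
qed

end

fun lc :: "lat => nat => int" where
 "lc (L a1 a2 a3 a4 a5 a6 a7 a8) i =
 (if i = 1 then a1 else if i = 2 then a2 else if i = 3 then a3 else if i = 4 then a4
 else if i = 5 then a5 else if i = 6 then a6 else if i = 7 then a7 else if i = 8 then a8 else 0)"

definition sr :: "nat => lat" where
 "sr i = L (if i = 1 then 1 else 0) (if i = 2 then 1 else 0) (if i = 3 then 1 else 0)
 (if i = 4 then 1 else 0) (if i = 5 then 1 else 0) (if i = 6 then 1 else 0)
 (if i = 7 then 1 else 0) (if i = 8 then 1 else 0)"

text \<open>A bilinear form whose symmetrisation is the Cartan matrix form \<open>ip\<close>; its parity is the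
 cocycle giving the signs of the structure constants.\<close>

fun fm :: "lat => lat => int" where
 "fm (L a1 a2 a3 a4 a5 a6 a7 a8) (L b1 b2 b3 b4 b5 b6 b7 b8) =
 a1 * (b1 - b2) + a2 * (b2 - b3) + a3 * (b3 - b4) + a4 * (b4 - b5) + a5 * (b5 - b6 - b8)
 + a6 * (b6 - b7) + a7 * b7 + a8 * b8"

definition ip :: "lat => lat => int" where
 "ip a b = fm a b + fm b a"

definition eps :: "lat => lat => int" where
 "eps a b = (if even (fm a b) then 1 else - 1)"

fun ht :: "lat => int" where
 "ht (L a1 a2 a3 a4 a5 a6 a7 a8) = a1 + a2 + a3 + a4 + a5 + a6 + a7 + a8"

text \<open>The roots of E_8 are the vectors of norm 2 in its lattice. That the roots of the given
  Lie algebra are these follows only later, in \<open>is_roo_wt\<close> and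
  \<open>is_roo_ex\<close>; until then \<open>rt\<close> is pure lattice arithmetic.\<close>

definition rt :: "lat => bool" where
 "rt c = (ip c c = 2)"

definition npos :: "lat => bool" where
 "npos c = ((ALL i:{1..8}. 0 <= lc c i))"

lemma I8: "{1..8::nat} = {1,2,3,4,5,6,7,8}" by auto

lemma lat_eqI:
 assumes "!!i. i : {1..8} ==> lc a i = lc b i"
 shows "a = b" using assms[of 1] assms[of 2] assms[of 3] assms[of 4] assms[of 5] assms[of 6] assms[of 7] assms[of 8] by (cases a; cases b) simp

lemma lc_add [simp]: "lc (a + b) i = lc a i + lc b i" by (cases a; cases b) simp
lemma lc_dif [simp]: "lc (a - b) i = lc a i - lc b i" by (cases a; cases b) simp
lemma lc_umi [simp]: "lc (- a) i = - lc a i" by (cases a) simp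
lemma lc_zer [simp]: "lc 0 i = 0" by (simp add: zero_lat_def)
lemma lc_sr: "j : {1..8} ==> lc (sr i) j = (if i = j then 1 else 0)" unfolding I8 sr_def by (elim insertE emptyE) simp_all

lemma fm_add_lef: "fm (a + b) c = fm a c + fm b c" by (cases a, cases b, cases c) (simp only: plus_lat.simps fm.simps distrib_right add_ac)

lemma fm_add_rig: "fm c (a + b) = fm c a + fm c b" by (cases a, cases b, cases c) (simp only: plus_lat.simps fm.simps distrib_left
 right_diff_distrib diff_conv_add_uminus minus_add_distrib add_ac)

lemma fm_zer [simp]: "fm 0 c = 0" "fm c 0 = 0" by (cases c, simp add: zero_lat_def)+

lemma fm_umi_lef: "fm (- a) c = - fm a c" using fm_add_lef[of a "- a" c] by simp

lemma fm_umi_rig: "fm c (- a) = - fm c a" using fm_add_rig[of c a "- a"] by simp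

lemma ip_sym: "ip a b = ip b a" by (simp add: ip_def)
lemma ip_add_lef: "ip (a + b) c = ip a c + ip b c" by (simp add: ip_def fm_add_lef fm_add_rig)
lemma ip_add_rig: "ip c (a + b) = ip c a + ip c b" by (simp add: ip_def fm_add_lef fm_add_rig)
lemma ip_umi_lef [simp]: "ip (- a) c = - ip a c" by (simp add: ip_def fm_umi_lef fm_umi_rig)
lemma ip_umi_rig [simp]: "ip c (- a) = - ip c a" by (simp add: ip_def fm_umi_lef fm_umi_rig)
lemma ip_dif_lef: "ip (a - b) c = ip a c - ip b c" using ip_add_lef[of a "- b" c] by simp
lemma ip_dif_rig: "ip c (a - b) = ip c a - ip c b" using ip_add_rig[of c a "- b"] by simp
lemma ip_zer [simp]: "ip 0 c = 0" "ip c 0 = 0" by (simp_all add: ip_def)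

lemmas ip_lin = ip_add_lef ip_add_rig ip_dif_lef ip_dif_rig

lemma ip_eve: "even (ip a a)" by (simp add: ip_def)

lemma fm_sel: "2 * fm a a = ip a a" by (simp add: ip_def)

lemma sr_sim:
 "sr 1 = L 1 0 0 0 0 0 0 0" "sr 2 = L 0 1 0 0 0 0 0 0" "sr 3 = L 0 0 1 0 0 0 0 0"
 "sr 4 = L 0 0 0 1 0 0 0 0" "sr 5 = L 0 0 0 0 1 0 0 0" "sr 6 = L 0 0 0 0 0 1 0 0"
 "sr 7 = L 0 0 0 0 0 0 1 0" "sr 8 = L 0 0 0 0 0 0 0 1" unfolding sr_def by simp_all

lemma ip_sr_row:
 "ip (sr 1) c = 2 * lc c 1 - lc c 2" "ip (sr 2) c = 2 * lc c 2 - lc c 1 - lc c 3"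
 "ip (sr 3) c = 2 * lc c 3 - lc c 2 - lc c 4" "ip (sr 4) c = 2 * lc c 4 - lc c 3 - lc c 5"
 "ip (sr 5) c = 2 * lc c 5 - lc c 4 - lc c 6 - lc c 8" "ip (sr 6) c = 2 * lc c 6 - lc c 5 - lc c 7"
 "ip (sr 7) c = 2 * lc c 7 - lc c 6" "ip (sr 8) c = 2 * lc c 8 - lc c 5" unfolding sr_sim ip_def by (cases c; simp)+

lemma ip_sr: "i : {1..8} ==> j : {1..8} ==> ip (sr j) (sr i) = E8_cartan_matrix i j" unfolding I8 E8_cartan_matrix_def E8_edges_def
 by (elim insertE emptyE; hypsubst; unfold sr_sim ip_def; simp add: doubleton_eq_iff)

lemma ip_sr_sel: "i : {1..8} ==> ip (sr i) (sr i) = 2" by (simp add: ip_sr E8_cartan_matrix_def)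

lemma ip_sr_neq: "i : {1..8} ==> j : {1..8} ==> i ~= j ==> ip (sr j) (sr i) : {0, -1}" by (simp add: ip_sr E8_cartan_matrix_def)

lemma ip_exp: "ip c d = (SUM i:{1..8}. lc c i * ip (sr i) d)"
proof -
 have "ip c d = lc c 1 * ip (sr 1) d + lc c 2 * ip (sr 2) d + lc c 3 * ip (sr 3) d
 + lc c 4 * ip (sr 4) d + lc c 5 * ip (sr 5) d + lc c 6 * ip (sr 6) d + lc c 7 * ip (sr 7) d
 + lc c 8 * ip (sr 8) d" unfolding ip_sr_row unfolding ip_def by (cases c; cases d) (simp add: algebra_simps)
 thus ?thesis unfolding I8 by simp
qed

text \<open>Squares are completed from the ends of the three arms towards the branch node 5. The
  arms have 4, 2 and 1 nodes, so what remains there is 2 - 4/5 - 2/3 - 1/2 = 1/30, still positive;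
  the factor 60 clears the denominators.\<close>

lemma ip_squ:
 "60 * ip (L a1 a2 a3 a4 a5 a6 a7 a8) (L a1 a2 a3 a4 a5 a6 a7 a8) =
 30 * (2*a1 - a2)^2 + 10 * (3*a2 - 2*a3)^2 + 5 * (4*a3 - 3*a4)^2 + 3 * (5*a4 - 4*a5)^2
 + 30 * (2*a7 - a6)^2 + 10 * (3*a6 - 2*a5)^2 + 30 * (2*a8 - a5)^2 + 2 * a5^2"
 unfolding ip_def fm.simps by algebra

lemma ip_non: "0 <= ip c c"
proof (cases c)
 case (L a1 a2 a3 a4 a5 a6 a7 a8)
 have "0 <= 60 * ip c c" unfolding L ip_squ by (intro add_nonneg_nonneg) simp_all
 thus ?thesis by simp
qed


lemma sum_eq_0:
 fixes p1 p2 p3 p4 p5 p6 p7 p8 :: int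
 assumes "0 <= p1" "0 <= p2" "0 <= p3" "0 <= p4" "0 <= p5" "0 <= p6" "0 <= p7" "0 <= p8"
 and "30 * p1 + 10 * p2 + 5 * p3 + 3 * p4 + 30 * p5 + 10 * p6 + 30 * p7 + 2 * p8 = 0"
 shows "p1 = 0" "p2 = 0" "p3 = 0" "p4 = 0" "p5 = 0" "p6 = 0" "p7 = 0" "p8 = 0" using assms by linarith+

lemma ip_eq_0:
 assumes "ip c c = 0"
 shows "c = 0"
proof (cases c)
 case (L a1 a2 a3 a4 a5 a6 a7 a8)
 have S: "30 * (2*a1 - a2)^2 + 10 * (3*a2 - 2*a3)^2 + 5 * (4*a3 - 3*a4)^2 + 3 * (5*a4 - 4*a5)^2
 + 30 * (2*a7 - a6)^2 + 10 * (3*a6 - 2*a5)^2 + 30 * (2*a8 - a5)^2 + 2 * a5^2 = 0"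
 using ip_squ[of a1 a2 a3 a4 a5 a6 a7 a8] assms[unfolded L] by presburger
 note e = sum_eq_0[OF zero_le_power2 zero_le_power2 zero_le_power2 zero_le_power2 zero_le_power2
 zero_le_power2 zero_le_power2 zero_le_power2 S, unfolded zero_eq_power2]
 have "a5 = 0" by (rule e(8))
 hence "a4 = 0" "a6 = 0" "a8 = 0" using e(4,6,7) by simp_all
 hence "a3 = 0" "a7 = 0" using e(3,5) by simp_all
 hence "a2 = 0" using e(2) by simp
 hence "a1 = 0" using e(1) by simp
 show "c = 0" unfolding L zero_lat_def
 using \<open>a1 = 0\<close> \<open>a2 = 0\<close> \<open>a3 = 0\<close> \<open>a4 = 0\<close> \<open>a5 = 0\<close> \<open>a6 = 0\<close> \<open>a7 = 0\<close> \<open>a8 = 0\<close> by simp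
qed

lemma ip_pos: "c ~= 0 ==> 0 < ip c c" using ip_non[of c] ip_eq_0[of c] by linarith

lemma eps_add_lef: "eps (a + b) c = eps a c * eps b c" by (simp add: eps_def fm_add_lef)
lemma eps_add_rig: "eps c (a + b) = eps c a * eps c b" by (simp add: eps_def fm_add_rig)
lemma eps_umi [simp]: "eps (- a) c = eps a c" "eps c (- a) = eps c a" by (simp_all add: eps_def fm_umi_lef fm_umi_rig)
lemma eps_dif_lef: "eps (a - b) c = eps a c * eps b c" using eps_add_lef[of a "- b" c] by simp
lemma eps_dif_rig: "eps c (a - b) = eps c a * eps c b" using eps_add_rig[of c a "- b"] by simp
lemma eps_zer [simp]: "eps 0 c = 1" "eps c 0 = 1" by (simp_all add: eps_def)
lemma eps_sq [simp]: "eps a b * eps a b = 1" by (simp add: eps_def)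
lemma eps_nz [simp]: "eps a b ~= 0" by (simp add: eps_def)
lemma eps_sel: "rt a ==> eps a a = - 1" using fm_sel[of a] by (simp add: rt_def eps_def)
lemma eps_swa: "eps a b = (if even (ip a b) then eps b a else - eps b a)" by (auto simp: eps_def ip_def)

lemmas eps_lin = eps_add_lef eps_add_rig eps_dif_lef eps_dif_rig


text \<open>With \<open>p\<close> and \<open>m\<close> the positive and negative parts of
  \<open>c\<close>, a coordinate occurring in \<open>p\<close> is zero in \<open>m\<close>, and
  distinct simple roots have products at most 0.\<close>

lemma ip_npo_spl: "EX p m. npos p & npos m & c = p - m & ip p m <= 0"
proof -
 obtain a1 a2 a3 a4 a5 a6 a7 a8 where c: "c = L a1 a2 a3 a4 a5 a6 a7 a8" by (cases c)
 define p where "p = L (max a1 0) (max a2 0) (max a3 0) (max a4 0) (max a5 0) (max a6 0) (max a7 0) (max a8 0)"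
 define m where "m = L (max (-a1) 0) (max (-a2) 0) (max (-a3) 0) (max (-a4) 0) (max (-a5) 0) (max (-a6) 0) (max (-a7) 0) (max (-a8) 0)"
 have p: "lc p i = max (lc c i) 0" and m: "lc m i = max (- lc c i) 0" for i by (simp_all add: p_def m_def c)
 have "lc p i * ip (sr i) m <= 0" if "i : {1..8}" for i
 proof (cases "lc c i <= 0")
 case False
 hence "lc m i = 0" "0 <= lc p i" by (simp_all add: p m)
 moreover have "ip (sr i) m <= 2 * lc m i" using that unfolding I8 by (elim insertE emptyE; simp only: ip_sr_row; simp add: m)
 ultimately show ?thesis by (simp add: mult_nonneg_nonpos)
 qed (simp add: p)
 hence "ip p m <= 0" unfolding ip_exp[of p m] by (rule sum_nonpos)
 moreover have "c = p - m" by (rule lat_eqI) (simp add: p m)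
 moreover have "npos p" "npos m" by (simp_all add: npos_def p m)
 ultimately show ?thesis by blast
qed

text \<open>Non-zero vectors have norm at least 2, norms being even and positive. If both parts of
  \<open>c\<close> were non-zero, their non-positive product would push the norm of \<open>c\<close>
  up to at least 4.\<close>

lemma rt_sig: assumes "rt c" shows "npos c | npos (- c)"
proof -
 obtain p m where pm: "npos p" "npos m" "c = p - m" "ip p m <= 0" using ip_npo_spl by blast
 have "ip p p + ip m m - 2 * ip p m = 2" using assms pm(3) ip_sym[of p m] by (simp add: rt_def ip_lin)
 moreover have "x = 0 | 2 <= ip x x" for x using ip_pos[of x] ip_eve[of x] by (cases "x = 0") (auto elim!: evenE)
 ultimately have "p = 0 | m = 0" using pm(4) by (smt (verit, ccfv_threshold))
 thus ?thesis using pm by auto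
qed

lemma rt_nz: "rt c ==> c ~= 0" by (auto simp: rt_def)
lemma rt_zer [simp]: "~ rt 0" by (simp add: rt_def)
lemma rt_umi [simp]: "rt (- c) = rt c" by (simp add: rt_def)
lemma rt_sr: "i : {1..8} ==> rt (sr i)" by (simp add: rt_def ip_sr_sel)

lemma rt_add: "rt a ==> rt b ==> rt (a + b) \<longleftrightarrow> ip a b = - 1" using ip_sym[of a b] by (auto simp: rt_def ip_lin)

lemma rt_dif: "rt a ==> rt b ==> rt (a - b) \<longleftrightarrow> ip a b = 1" using rt_add[of a "- b"] by simp

lemma rt_ip_bou:
 assumes "rt a" "rt b"
 shows "\<bar>ip a b\<bar> <= 2" "(ip a b = 2) = (a = b)" "(ip a b = - 2) = (a = - b)"
proof -
 have *: "ip a b <= 2 & (ip a b = 2 --> a = b)" if "rt a" "rt b" for a b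
 using ip_non[of "a - b"] ip_eq_0[of "a - b"] ip_sym[of a b] that by (auto simp: rt_def ip_lin)
 show "\<bar>ip a b\<bar> <= 2" using *[OF assms] *[of a "- b"] assms by auto
 show "(ip a b = 2) = (a = b)" using *[OF assms] assms by (auto simp: rt_def)
 show "(ip a b = - 2) = (a = - b)" using *[of a "- b"] assms by (auto simp: rt_def)
qed

lemma rt_add_cas:
 assumes "rt a" "rt b"
 obtains "ip a b = - 1" "rt (a + b)" | "ip a b = - 2" "a + b = 0"
 | "0 <= ip a b" "~ rt (a + b)" "a + b ~= 0"
proof -
 have "(ip a b = - 2) = (a + b = 0)" using rt_ip_bou(3)[OF assms] by (simp add: add_eq_0_iff2)
 thus ?thesis using that rt_ip_bou(1)[OF assms] rt_add[OF assms] by (smt (verit))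
qed

lemma npo_sr: "i : {1..8} ==> npos (sr i)" by (auto simp: npos_def lc_sr)

lemma npo_add: "npos a ==> npos b ==> npos (a + b)" by (auto simp: npos_def)

lemma npo_ant: "npos a ==> npos (- a) ==> a = 0" by (rule lat_eqI) (force simp: npos_def)

lemma ht_sum: "ht c = (SUM i:{1..8}. lc c i)" unfolding I8 by (cases c) simp

lemma ht_add: "ht (a + b) = ht a + ht b" by (simp add: ht_sum sum.distrib)
lemma ht_dif: "ht (a - b) = ht a - ht b" by (simp add: ht_sum sum_subtractf)
lemma ht_sr: "i : {1..8} ==> ht (sr i) = 1" unfolding I8 by (elim insertE emptyE; hypsubst; unfold sr_sim; simp)

lemma ht_npo: "npos c ==> 0 <= ht c" unfolding ht_sum npos_def by (rule sum_nonneg) blast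

lemma ex_des:
 assumes "npos c" "c ~= 0"
 obtains i where "i : {1..8}" "0 < lc c i" "0 < ip c (sr i)"
proof -
 have "EX i:{1..8}. 0 < lc c i * ip (sr i) c"
 proof (rule ccontr)
 assume "~ ?thesis"
 hence "ip c c <= 0" unfolding ip_exp[of c c] by (intro sum_nonpos) force
 thus False using ip_pos[OF assms(2)] by simp
 qed
 then obtain i where i: "i : {1..8}" "0 < lc c i * ip (sr i) c" by blast
 hence "0 <= lc c i" using assms(1) by (auto simp: npos_def)
 thus ?thesis using i that[of i] ip_sym[of c "sr i"] by (auto simp: zero_less_mult_iff)
qed

lemma npo_dif_sr: "npos c ==> 0 < lc c i ==> i : {1..8} ==> npos (c - sr i)" by (auto simp: npos_def lc_sr)

lemma sr_eq_iff: "i : {1..8} ==> j : {1..8} ==> sr i = sr j \<longleftrightarrow> i = j"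
 using lc_sr[of i i] lc_sr[of i j] by (metis zero_neq_one)

text \<open>The engine of every induction on the height. Some simple root occurring in
  \<open>c\<close> has positive product with it, since the norm of \<open>c\<close> is positive;
  between two roots this product is 1, or 2 if they coincide.\<close>

lemma rt_des:
 assumes "rt c" "npos c"
 obtains i where "i : {1..8}" "c = sr i"
 | i where "i : {1..8}" "0 < lc c i" "ip c (sr i) = 1" "rt (c - sr i)" "npos (c - sr i)"
proof -
 obtain i where i: "i : {1..8}" "0 < lc c i" "0 < ip c (sr i)" using ex_des[OF assms(2) rt_nz[OF assms(1)]] by blast
 show ?thesis
 proof (cases "c = sr i")
 case False
 hence "ip c (sr i) = 1" using i rt_ip_bou[OF assms(1) rt_sr[OF i(1)]] by auto
 thus ?thesis using that(2)[OF i(1,2)] rt_dif[OF assms(1) rt_sr[OF i(1)]]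
 npo_dif_sr[OF assms(2) i(2,1)] by blast
 qed (use that i in blast)
qed

text \<open>A root is positive or negative. If \<open>c - sr i\<close> were negative, the
  coordinates of \<open>c\<close> would be bounded by those of \<open>sr i\<close> and
  \<open>lc c i\<close> would be 0, which leaves only \<open>c = 0\<close>.\<close>

lemma npo_low:
 assumes "rt c" "npos c" "i : {1..8}" "ip c (sr i) = 1"
 shows "rt (c - sr i)" "npos (c - sr i)"
proof -
 show r: "rt (c - sr i)" using rt_dif[OF assms(1) rt_sr[OF assms(3)]] assms(4) by blast
 show "npos (c - sr i)"
 proof (rule ccontr)
 assume n: "~ npos (c - sr i)"
 hence "npos (sr i - c)" using rt_sig[OF r] by simp
 hence le: "lc c j <= (if i = j then 1 else 0)" if "j : {1..8}" for j using that lc_sr[OF that, of i] by (force simp: npos_def)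
 have "lc c i <= 0" using npo_dif_sr[OF assms(2) _ assms(3)] n by force
 hence "c = 0" using le assms(2) by (intro lat_eqI) (force simp: npos_def split: if_splits)
 thus False using assms(1) by simp
 qed
qed

section \<open>Weight decompositions\<close>

context complex_lie_algebra
begin

lemma eig_ind:
 assumes X: "Vector_Spaces.linear sc sc X"
 shows "finite C ==> (!!c. c : C ==> X (u c) = sc c (u c)) ==> (SUM c:C. u c) = 0 ==> c : C ==> u c = 0"
proof (induction C arbitrary: u c rule: finite_induct)
 case (insert d C)
 interpret X: Vector_Spaces.linear sc sc X by fact
 have "(SUM c:insert d C. X (u c) - sc d (u c)) = X (SUM c:insert d C. u c) - sc d (SUM c:insert d C. u c)"
 by (simp add: X.sum sum_subtractf scale_sum_right)
 hence "(SUM c:C. sc (c - d) (u c)) = 0" using insert.hyps insert.prems(1,2) by (simp add: X.zero scale_left_diff_distrib)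
 moreover have "X (sc (c - d) (u c)) = sc c (sc (c - d) (u c))" if "c : C" for c
 using insert.prems(1)[of c] that by (simp add: X.scale mult.commute)
 ultimately have "sc (c - d) (u c) = 0" if "c : C" for c using insert.IH[of "%c. sc (c - d) (u c)"] that by blast
 hence "u c = 0" if "c : C" for c using that insert.hyps by auto
 thus ?case using insert by auto
qed simp

lemma dia_dec:
 assumes "diagonalisable sc X" and X: "Vector_Spaces.linear sc sc X"
 shows "EX C u. finite C & (ALL c:C. X (u c) = sc c (u c)) & v = (SUM c:C. u c)"
proof -
 interpret X: Vector_Spaces.linear sc sc X by fact
 have "v : span {v. EX c. X v = sc c v}" using assms(1) by (simp add: diagonalisable_def)
 thus ?thesis
 proof (induction rule: span_induct_alt)
 case base
 show ?case by (intro exI[of _ "{}"]) simp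
 next
 case (step a x y)
 then obtain d where d: "X x = sc d x" by blast
 obtain C u where C: "finite C" "ALL c:C. X (u c) = sc c (u c)" "y = (SUM c:C. u c)" using step by blast
 define u' where "u' c = (if c : C then u c else 0) + (if c = d then sc a x else 0)" for c
 have "X (u' c) = sc c (u' c)" for c using C(2) d by (auto simp: u'_def X.add X.zero X.scale scale_right_distrib mult.commute)
 moreover have "(SUM c:insert d C. u' c) = sc a x + y"
 proof -
 have "(SUM c:insert d C. if c : C then u c else 0) = y" using C(1,3) by (cases "d : C") (auto simp: insert_absorb intro!: sum.cong)
 moreover have "(SUM c:insert d C. if c = d then sc a x else 0) = sc a x" using C(1) by (subst sum.delta) auto
 ultimately show ?thesis unfolding u'_def sum.distrib by (simp add: add.commute)
 qed
 ultimately show ?case using C(1) by (intro exI[of _ "insert d C"] exI[of _ u']) simp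
 qed
qed

text \<open>Split a joint eigenvector of \<open>F\<close> into eigenvectors \<open>u c\<close> of
  \<open>X\<close>. Each \<open>Y\<close> in \<open>F\<close> commutes with \<open>X\<close>, so
  \<open>Y (u c) - sc m (u c)\<close> is again in the eigenspace of \<open>c\<close>; these vectors
  sum to 0, hence each is 0 and the components are still joint eigenvectors.\<close>

lemma joi_eig_spa:
 assumes "finite F" and "!!X. X : F ==> Vector_Spaces.linear sc sc X & diagonalisable sc X"
 and "!!X Y v. X : F ==> Y : F ==> X (Y v) = Y (X v)"
 shows "span {v. ALL X:F. EX c. X v = sc c v} = UNIV" using assms
proof (induction F rule: finite_induct)
 case (insert X F)
 let ?E = "%F. {v. ALL X:F. EX c. X v = sc c v}"
 have dX: "Vector_Spaces.linear sc sc X" "diagonalisable sc X" using insert.prems(1)[of X] by simp_all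
 interpret X: Vector_Spaces.linear sc sc X by (rule dX)
 have "v : span (?E (insert X F))" if "v : ?E F" for v
 proof -
 obtain C u where C: "finite C" "ALL c:C. X (u c) = sc c (u c)" "v = (SUM c:C. u c)"
 using dia_dec[OF dX(2,1), of v] by (elim exE conjE)
 have "EX m. Y (u c) = sc m (u c)" if "Y : F" "c : C" for Y c
 proof -
 have "Vector_Spaces.linear sc sc Y" using insert.prems(1)[of Y] that by simp
 then interpret Y: Vector_Spaces.linear sc sc Y .
 obtain m where m: "Y v = sc m v" using \<open>v : ?E F\<close> \<open>Y : F\<close> by auto
 have "(SUM c:C. Y (u c) - sc m (u c)) = 0" using m by (simp add: C(3) Y.sum sum_subtractf scale_sum_right)
 moreover have "X (Y (u c) - sc m (u c)) = sc c (Y (u c) - sc m (u c))" if "c : C" for c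
 proof -
 have "X (Y (u c)) = Y (X (u c))" using insert.prems(2)[of X Y] \<open>Y : F\<close> by blast
 also have "... = sc c (Y (u c))" using C(2) that by (simp add: Y.scale)
 finally show ?thesis using C(2) that by (simp add: X.diff X.scale scale_right_diff_distrib mult.commute)
 qed
 ultimately have "Y (u c) - sc m (u c) = 0" using dX C(1) that by (intro eig_ind[of X C "%c. Y (u c) - sc m (u c)" c]) blast+
 thus ?thesis by auto
 qed
 hence "u c : ?E (insert X F)" if "c : C" for c using C(2) that by blast
 thus ?thesis unfolding C(3) by (intro span_sum span_base) blast
 qed
 hence "span (?E F) <= span (?E (insert X F))" by (intro span_minimal) auto
 thus ?case using insert by auto
qed auto


lemma lin_br: "Vector_Spaces.linear sc sc (br x)" by (simp add: Vector_Spaces.linear_iff vector_space_axioms br_add_right br_scale_right)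

lemma lin_br_lef: "Vector_Spaces.linear sc sc (%x. br x y)" by (simp add: Vector_Spaces.linear_iff vector_space_axioms br_add_left br_scale_left)

lemma br_zer_rig [simp]: "br x 0 = 0" using br_scale_right[of x 0 0] by simp
lemma br_zer_lef [simp]: "br 0 x = 0" using br_scale_left[of 0 0 x] by simp
lemma br_min_rig: "br x (- y) = - br x y" using br_scale_right[of x "-1" y] by simp
lemma br_min_lef: "br (- x) y = - br x y" using br_scale_left[of "-1" x y] by simp
lemma br_dif_rig: "br x (y - z) = br x y - br x z" using br_add_right[of x y "- z"] by (simp add: br_min_rig)
lemma br_dif_lef: "br (y - z) x = br y x - br z x" using br_add_left[of y "- z" x] by (simp add: br_min_lef)

lemma br_ant: "br y x = - br x y"
proof -
 have "0 = br (x + y) (x + y)" by (rule br_self[symmetric])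
 also have "... = (br x x + br y x) + (br x y + br y y)" unfolding br_add_right unfolding br_add_left ..
 also have "... = br y x + br x y" unfolding br_self by simp
 finally show ?thesis by (metis add_eq_0_iff2)
qed

lemma jac_lef: "br (br x y) z = br x (br y z) - br y (br x z)" using jacobi[of x y z] br_ant[of z "br x y"] br_ant[of "br z x"] br_ant[of x z]
 by (simp add: br_min_rig algebra_simps)

lemma jac_rig: "br x (br y z) = br (br x y) z + br y (br x z)" by (simp add: jac_lef)

lemma br_sum_rig: "br x (SUM i:I. u i) = (SUM i:I. br x (u i))" using lin_br[of x] by (rule Vector_Spaces.linear.axioms(3)[THEN module_hom.sum])

lemma br_sum_lef: "br (SUM i:I. u i) x = (SUM i:I. br (u i) x)"
 using lin_br_lef[of x] by (rule Vector_Spaces.linear.axioms(3)[THEN module_hom.sum])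

end

locale e8 =
 fixes sc :: "complex => 'g::ab_group_add => 'g" and br :: "'g => 'g => 'g" and h :: "'g set" and al :: "nat => 'g => complex"
 assumes E8: "simple_lie_algebra_E8 sc br h al"

sublocale e8 < complex_lie_algebra sc br using E8 unfolding simple_lie_algebra_E8_def simple_lie_algebra_def by blast

context e8
begin

definition wt :: "lat => 'g => complex" where
 "wt c H = (SUM i:{1..8}. of_int (lc c i) * al i H)"

text \<open>Indexing by lattice points instead of functionals makes height and norm available for
  weights directly. The point 0 and points without root vectors are included.\<close>

definition RS :: "lat => 'g set" where
 "RS c = {x. ALL H:h. br H x = sc (wt c H) x}"

lemma wt_add: "wt (c + d) H = wt c H + wt d H" by (simp add: wt_def distrib_right sum.distrib)
lemma wt_min: "wt (- c) H = - wt c H" by (simp add: wt_def sum_negf)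
lemma wt_dif: "wt (c - d) H = wt c H - wt d H" using wt_add[of c "- d" H] by (simp add: wt_min)
lemma wt_zer [simp]: "wt 0 H = 0" by (simp add: wt_def)
lemma wt_sr: "i : {1..8} ==> wt (sr i) H = al i H"
proof -
 assume i: "i : {1..8}"
 have "wt (sr i) H = (SUM j:{1..8}. if i = j then al j H else 0)" unfolding wt_def by (rule sum.cong) (auto simp: lc_sr)
 thus ?thesis using i by simp
qed

lemma cartan:
 shows h_subspace: "subspace h" and h_com: "x : h ==> y : h ==> br x y = 0" and h_max: "(!!y. y : h ==> br y x = 0) ==> x : h"
 and h_diag: "x : h ==> diagonalisable sc (br x)"
 using E8 unfolding simple_lie_algebra_E8_def cartan_subalgebra_def lie_subalgebra_def by blast+

lemma fin_dim: "EX B. finite B & span B = UNIV" using E8 unfolding simple_lie_algebra_E8_def simple_lie_algebra_def finite_dimensional_def by blast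

lemma simple_roots: "simple_roots sc br h {1..8} al" using E8 unfolding simple_lie_algebra_E8_def by blast

lemma cor_ex:
 "i : {1..8} ==> EX H. is_coroot sc br h (al i) H & (ALL j:{1..8}. al j H = of_int (E8_cartan_matrix i j))"
 using E8 unfolding simple_lie_algebra_E8_def has_cartan_matrix_def by blast

lemma h_0: "0 : h" and h_add: "x : h ==> y : h ==> x + y : h"
 and h_sca: "x : h ==> sc c x : h" and h_diff: "x : h ==> y : h ==> x - y : h" and h_neg: "x : h ==> - x : h"
 using h_subspace by (auto simp: subspace_0 subspace_add subspace_scale subspace_diff subspace_neg)

lemma h_sum: "(!!i. i : I ==> u i : h) ==> sum u I : h" using h_subspace by (rule subspace_sum)

text \<open>\<open>al i\<close> is given as a bare function; a non-zero root vector \<open>v\<close>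
  carries the linearity of the bracket over to it.\<close>

lemma alp_lin:
 assumes "i : {1..8}" "x : h" "y : h"
 shows "al i (x + y) = al i x + al i y" "al i (sc c x) = c * al i x"
proof -
 have "is_root sc br h (al i)" using simple_roots assms(1) unfolding simple_roots_def by blast
 then obtain v where v: "v ~= 0" "!!H. H : h ==> br H v = sc (al i H) v" unfolding is_root_def root_space_def by blast
 have "sc (al i (x + y)) v = sc (al i x + al i y) v"
 using v(2)[of "x + y"] v(2)[of x] v(2)[of y] assms h_add by (simp add: br_add_left scale_left_distrib)
 thus "al i (x + y) = al i x + al i y" using v(1) by simp
 have "sc (al i (sc c x)) v = sc (c * al i x) v"
 using v(2)[of "sc c x"] v(2)[of x] assms h_sca br_scale_left[of c x v] by (metis scale_scale)
 from scale_right_imp_eq[OF v(1) this] show "al i (sc c x) = c * al i x" .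
qed

lemma wt_h_add: "x : h ==> y : h ==> wt c (x + y) = wt c x + wt c y" by (simp add: wt_def alp_lin distrib_left sum.distrib)
lemma wt_h_sca: "x : h ==> wt c (sc a x) = a * wt c x" by (simp add: wt_def alp_lin sum_distrib_left mult.left_commute)
lemma wt_h_zer: "wt c 0 = 0" using wt_h_sca[OF h_0, of c 0] by simp
lemma wt_h_min: "x : h ==> wt c (- x) = - wt c x" using wt_h_sca[of x c "-1"] by simp
lemma wt_h_dif: "x : h ==> y : h ==> wt c (x - y) = wt c x - wt c y" using wt_h_add[of x "- y" c] h_neg by (simp add: wt_h_min)
lemma wt_h_sum: "finite I ==> (!!i. i : I ==> u i : h) ==> wt c (sum u I) = (SUM i:I. wt c (u i))"
 by (induction I rule: finite_induct) (simp_all add: wt_h_zer wt_h_add h_sum)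

lemma alp_ind:
 assumes "!!H. H : h ==> (SUM i:{1..8}. c i * al i H) = 0" "i : {1..8}"
 shows "c i = 0" using simple_roots assms unfolding simple_roots_def by blast

lemma wt_inj: assumes "!!H. H : h ==> wt c H = wt d H" shows "c = d"
proof -
 have "(SUM i:{1..8}. of_int (lc (c - d) i) * al i H) = 0" if "H : h" for H using assms[OF that] wt_dif[of c d H] by (simp add: wt_def)
 hence "of_int (lc (c - d) i) = (0::complex)" if "i : {1..8}" for i using alp_ind[of "%i. of_int (lc (c - d) i)" i] that by blast
 hence "c - d = 0" by (intro lat_eqI) simp
 thus ?thesis by simp
qed

lemma RS_sub: "subspace (RS c)" by (rule subspaceI) (simp_all add: RS_def br_add_right br_scale_right scale_right_distrib mult.commute)

lemmas RS_0 = subspace_0[OF RS_sub] and RS_add = subspace_add[OF RS_sub]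
 and RS_scale = subspace_scale[OF RS_sub] and RS_diff = subspace_diff[OF RS_sub] and RS_neg = subspace_neg[OF RS_sub]

lemma RS_zer: "RS 0 = h" using h_com h_max by (auto simp: RS_def)

lemma RS_h: "x : RS c ==> H : h ==> br H x = sc (wt c H) x" by (simp add: RS_def)

lemma RS_br: "x : RS c ==> y : RS d ==> br x y : RS (c + d)"
 by (auto simp: RS_def jac_rig br_scale_left br_scale_right wt_add scale_left_distrib)

lemma RS_ind:
 "finite C ==> (!!c. c : C ==> u c : RS c) ==> (SUM c:C. u c) = 0 ==> c : C ==> u c = 0"
proof (induction C arbitrary: u c rule: finite_induct)
 case (insert d C)
 have u0: "u c = 0" if "c : C" for c
 proof -
 have "c ~= d" using insert.hyps that by blast
 then obtain H where H: "H : h" "wt c H ~= wt d H" using wt_inj[of c d] by blast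
 have "(SUM c:insert d C. br H (u c) - sc (wt d H) (u c)) = 0"
 using insert.prems(2) by (simp only: sum_subtractf br_sum_rig[symmetric] scale_sum_right[symmetric]) simp
 moreover have "br H (u c) - sc (wt d H) (u c) = sc (wt c H - wt d H) (u c)" if "c : insert d C" for c
 using RS_h[OF insert.prems(1)[OF that] H(1)] by (simp add: scale_left_diff_distrib)
 ultimately have "(SUM c:insert d C. sc (wt c H - wt d H) (u c)) = 0" by simp
 hence "(SUM c:C. sc (wt c H - wt d H) (u c)) = 0" using insert.hyps by simp
 hence "sc (wt c H - wt d H) (u c) = 0" using insert.IH[of "%c. sc (wt c H - wt d H) (u c)"] insert.prems(1) RS_scale that by blast
 thus ?thesis using H(2) by simp
 qed
 hence "u d = 0" using insert by simp
 thus ?case using u0 insert.prems(3) by blast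
qed simp

lemma fin_h_bas: "EX F. finite F & F <= h & h <= span F"
proof -
 obtain B where B: "finite B" "span B = UNIV" using fin_dim by blast
 obtain F where F: "F <= h" "independent F" "h <= span F" using maximal_independent_subset[of h] by blast
 have "finite F" using independent_span_bound[OF B(1) F(2)] B(2) by blast
 thus ?thesis using F by blast
qed

text \<open>The eigenvalue function of \<open>v\<close> is zero on \<open>h\<close> or a root, and a
  root is by hypothesis plus or minus a combination of simple roots with natural coefficients. These
  coefficients are the lattice point.\<close>

lemma wei_vec_cas:
 assumes "!!H. H : h ==> EX c. br H v = sc c v"
 shows "EX c. v : RS c & (c = 0 | npos c | npos (- c))"
proof (cases "v = 0")
 case False
 define be where "be H = (SOME c. br H v = sc c v)" for H
 have be: "br H v = sc (be H) v" if "H : h" for H unfolding be_def using someI_ex[OF assms[OF that]] .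
 show ?thesis
 proof (cases "ALL H:h. be H = 0")
 case True
 hence "v : RS 0" using be by (simp add: RS_def)
 thus ?thesis by blast
 next
 case False
 have "v : root_space sc br h be" using be by (simp add: root_space_def)
 hence "is_root sc br h be" using False \<open>v ~= 0\<close> unfolding is_root_def by blast
 hence "positive_root sc br h {1..8} al be | positive_root sc br h {1..8} al (%H. - be H)"
 using simple_roots unfolding simple_roots_def by blast
 hence "EX s n. (s = 1 | s = - 1) &
 (ALL H:h. of_int s * be H = (SUM i:{1..8}. of_nat (n i) * al i H))"
 proof
 assume "positive_root sc br h {1..8} al be"
 then obtain n where "ALL H:h. be H = (SUM i:{1..8}. of_nat (n i) * al i H)" unfolding positive_root_def by (elim conjE exE)
 thus ?thesis by (intro exI[of _ 1] exI[of _ n]) simp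
 next
 assume "positive_root sc br h {1..8} al (%H. - be H)"
 then obtain n where "ALL H:h. - be H = (SUM i:{1..8}. of_nat (n i) * al i H)" unfolding positive_root_def by (elim conjE exE)
 thus ?thesis by (intro exI[of _ "- 1"] exI[of _ n]) simp
 qed
 then obtain n :: "nat => nat" and s :: int where n: "s = 1 | s = - 1"
 "!!H. H : h ==> of_int s * be H = (SUM i:{1..8}. of_nat (n i) * al i H)" by (elim exE conjE) (rule that, assumption, erule bspec)
 define c where "c = L (n 1) (n 2) (n 3) (n 4) (n 5) (n 6) (n 7) (n 8)"
 have lc: "lc c i = int (n i)" if "i : {1..8}" for i using that unfolding I8 c_def by auto
 hence "npos c" by (simp add: npos_def)
 have wt: "wt c H = of_int s * be H" if "H : h" for H unfolding wt_def n(2)[OF that] by (rule sum.cong) (simp_all add: lc)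
 show ?thesis
 proof (cases "s = 1")
 case True
 hence "v : RS c" using wt be by (simp add: RS_def)
 thus ?thesis using \<open>npos c\<close> by blast
 next
 case False
 hence "v : RS (- c)" using wt be n(1) by (simp add: RS_def wt_min)
 thus ?thesis using \<open>npos c\<close> by (intro exI[of _ "- c"]) simp
 qed
 qed
qed (use RS_0 in blast)

lemma RS_spa: "span (\<Union>c. RS c) = UNIV"
proof -
 obtain F where F: "finite F" "F <= h" "h <= span F" using fin_h_bas by blast
 let ?E = "{v. ALL X:br ` F. EX c. X v = sc c v}"
 have "span ?E = UNIV"
 proof (rule joi_eig_spa)
 show "finite (br ` F)" using F(1) by simp
 show "Vector_Spaces.linear sc sc X & diagonalisable sc X" if "X : br ` F" for X using that F(2) h_diag lin_br by blast
 fix X Y v assume "X : br ` F" "Y : br ` F"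
 then obtain x y where xy: "X = br x" "Y = br y" "x : h" "y : h" using F(2) by blast
 thus "X (Y v) = Y (X v)" using h_com[OF xy(3,4)] jac_rig[of x y v] by simp
 qed
 moreover have "?E <= (\<Union>c. RS c)"
 proof
 fix v assume "v : ?E"
 hence v: "EX c. br x v = sc c v" if "x : F" for x using that by blast
 have "EX c. br H v = sc c v" if "H : h" for H
 proof -
 have "H : span F" using that F(3) by blast
 thus ?thesis
 proof (induction rule: span_induct_alt)
 case base
 show ?case by (rule exI[of _ 0]) simp
 next
 case (step a x y)
 then obtain c d where "br x v = sc c v" "br y v = sc d v" using v by blast
 hence "br (sc a x + y) v = sc (a * c + d) v" by (simp add: br_add_left br_scale_left scale_left_distrib)
 thus ?case by blast
 qed
 qed
 thus "v : (\<Union>c. RS c)" using wei_vec_cas by blast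
 qed
 ultimately show ?thesis using span_mono[of ?E "\<Union>c. RS c"] by auto
qed

lemma RS_sig:
 assumes "x : RS c" "x ~= 0"
 shows "c = 0 | npos c | npos (- c)"
proof -
 obtain d where d: "x : RS d" "d = 0 | npos d | npos (- d)" using wei_vec_cas[of x] assms(1) RS_h by blast
 have "wt c H = wt d H" if "H : h" for H using RS_h[OF assms(1) that] RS_h[OF d(1) that] assms(2) by simp
 hence "c = d" by (rule wt_inj)
 thus ?thesis using d(2) by blast
qed

lemma fin_wei: "finite {c. RS c ~= {0}}"
proof (rule ccontr)
 obtain B where B: "finite B" "span B = UNIV" using fin_dim by blast
 assume "infinite {c. RS c ~= {0}}"
 then obtain C where C: "finite C" "card C = Suc (card B)" "C <= {c. RS c ~= {0}}" using infinite_arbitrarily_large by blast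
 have "ALL c:C. EX x. x : RS c & x ~= 0" using C(3) RS_0 by blast
 then obtain u where u: "!!c. c : C ==> u c : RS c & u c ~= 0" by metis
 have inj: "inj_on u C"
 proof (rule inj_onI)
 fix c d assume cd: "c : C" "d : C" "u c = u d"
 have "wt c H = wt d H" if "H : h" for H using RS_h[of "u c" c H] RS_h[of "u c" d H] u[of c] u[of d] cd that by simp
 thus "c = d" by (rule wt_inj)
 qed
 have "independent (u ` C)"
 proof (rule independent_if_scalars_zero)
 fix f x assume f: "(SUM x:u ` C. sc (f x) x) = 0" and "x : u ` C"
 then obtain c where c: "c : C" "x = u c" by blast
 have "(SUM c:C. sc (f (u c)) (u c)) = 0" using f inj by (simp add: sum.reindex)
 hence "sc (f (u c)) (u c) = 0" using RS_ind[of C "%c. sc (f (u c)) (u c)" c] C(1) u RS_scale c(1) by blast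
 thus "f x = 0" using u c by simp
 qed (use C in simp)
 hence "card (u ` C) <= card B" using independent_span_bound[OF B(1)] B(2) by blast
 thus False using C(2) by (simp add: card_image[OF inj])
qed

end

context e8
begin

section \<open>Root strings\<close>

text \<open>A vector of positive weight that is an eigenvector of \<open>e f\<close> with eigenvalue \<open>\<le> 0\<close> would
 generate infinitely many weights under \<open>e\<close>.\<close>

lemma sl2_cha:
 assumes e: "e : RS a" and f: "f : RS (- a)" and H: "br e f : h" "wt a (br e f) = 2"
 and v: "v : RS c" "wt c (br e f) = of_int m" "1 <= m" and k: "br e (br f v) = sc (of_int (- k)) v" "0 <= k"
 shows "v = 0"
proof (rule ccontr)
 assume "v ~= 0"
 define E where "E n = ((br e) ^^ n) v" for n
 define w where "w n = (((+) a) ^^ n) c" for n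
 have E0: "E 0 = v" and ES: "E (Suc n) = br e (E n)" for n by (simp_all add: E_def)
 have ws: "w 0 = c" "w (Suc n) = a + w n" for n by (simp_all add: w_def)
 have EW: "E n : RS (w n)" for n by (induction n) (simp_all add: E0 ES ws v RS_br[OF e])
 have wH: "wt (w n) (br e f) = of_int (m + 2 * int n)" for n by (induction n) (simp_all add: ws v(2) H(2) wt_add)
 have fe: "br f (br e x) = br e (br f x) - br (br e f) x" for x using jac_rig[of e f x] by simp
 \<comment> \<open>Moving \<open>f\<close> past \<open>e\<close> subtracts the weight of each
   \<open>E i\<close> in turn; these weights are \<open>m + 2 i\<close>, and their sum for i from 0
   to n is \<open>(n + 1) (m + n)\<close>.\<close>
 have step: "br f (E (Suc n)) = sc (of_int (- k - (int n + 1) * (m + int n))) (E n)" for n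
 proof (induction n)
 case 0
 have "br f (br e v) = sc (of_int (- k)) v - sc (of_int m) v" using fe[of v] k(1) RS_h[OF v(1) H(1)] v(2) by simp
 thus ?case by (simp add: E0 ES scale_left_diff_distrib)
 next
 case (Suc n)
 have "br f (E (Suc (Suc n))) = br e (br f (E (Suc n))) - br (br e f) (E (Suc n))" unfolding ES[of "Suc n"] by (rule fe)
 also have "br e (br f (E (Suc n))) = sc (of_int (- k - (int n + 1) * (m + int n))) (E (Suc n))" unfolding Suc.IH br_scale_right by (simp only: ES)
 also have "br (br e f) (E (Suc n)) = sc (of_int (m + 2 * int (Suc n))) (E (Suc n))" using RS_h[OF EW H(1), of "Suc n"] wH[of "Suc n"] by simp
 finally have "br f (E (Suc (Suc n))) =
 sc (of_int (- k - (int n + 1) * (m + int n) - (m + 2 * int (Suc n)))) (E (Suc n))"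
 by (simp only: scale_left_diff_distrib[symmetric] of_int_diff)
 moreover have "- k - (int n + 1) * (m + int n) - (m + 2 * int (Suc n)) =
 - k - (int (Suc n) + 1) * (m + int (Suc n))"
 by (simp add: algebra_simps)
 ultimately show ?case by (simp only:)
 qed
 have nz: "E n ~= 0" for n
 proof (induction n)
 case (Suc n)
 show ?case
 proof
 assume "E (Suc n) = 0"
 hence "sc (of_int (- k - (int n + 1) * (m + int n))) (E n) = 0" using step[of n] by simp
 moreover have "0 < (int n + 1) * (m + int n)" using v(3) by (intro mult_pos_pos) auto
 with k(2) have "- k - (int n + 1) * (m + int n) ~= 0" by linarith
 ultimately show False using Suc unfolding scale_eq_0_iff of_int_eq_0_iff by blast
 qed
 qed (simp add: E0 \<open>v ~= 0\<close>)
 have "inj w"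
 proof (rule injI)
 fix x y assume "w x = w y"
 hence "(of_int (m + 2 * int x) :: complex) = of_int (m + 2 * int y)" unfolding wH[symmetric] by (rule arg_cong)
 thus "x = y" unfolding of_int_eq_iff by simp
 qed
 hence "infinite (range w)" by (simp add: finite_image_iff)
 moreover have "range w <= {c. RS c ~= {0}}" using EW nz by blast
 ultimately show False using fin_wei finite_subset by blast
qed

text \<open>Suppose f^(j+1) kills \<open>v\<close>. The multiple of \<open>v\<close> added to
  \<open>e f v\<close> in \<open>u\<close> is chosen so that f^j kills \<open>u\<close>, hence
  \<open>u = 0\<close> by induction. Then \<open>v\<close> is an eigenvector of \<open>e f\<close>
  with eigenvalue at most 0, and \<open>sl2_cha\<close> leaves only \<open>v = 0\<close>.\<close>

lemma sl2_inj:
 assumes e: "e : RS a" and f: "f : RS (- a)" and H: "br e f : h" "wt a (br e f) = 2" and c: "wt c (br e f) = of_int m" "1 <= m"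
 shows "v : RS c ==> int j <= m ==> ((br f) ^^ j) v = 0 ==> v = 0"
proof (induction j arbitrary: v)
 case (Suc j)
 have fw: "((br f) ^^ i) v : RS ((((+) (- a)) ^^ i) c)" for i by (induction i) (simp_all add: Suc.prems(1) RS_br[OF f] del: uminus_add_conv_diff)
 have wf: "wt ((((+) (- a)) ^^ i) c) (br e f) = of_int (m - 2 * int i)" for i by (induction i) (simp_all add: c(1) H(2) wt_dif)
 have fe: "br f (br e x) = br e (br f x) - br (br e f) x" for x using jac_rig[of e f x] by simp
 have com: "((br f) ^^ i) (br e (br f v)) =
 br e (((br f) ^^ (Suc i)) v) - sc (of_int (int i * (m - 1 - int i))) (((br f) ^^ i) v)" for i
 proof (induction i)
 case (Suc i)
 let ?u = "((br f) ^^ (Suc i)) v"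
 have "((br f) ^^ (Suc i)) (br e (br f v)) = br f (br e ?u) - sc (of_int (int i * (m - 1 - int i))) ?u"
 using Suc.IH by (simp add: br_dif_rig br_scale_right)
 also have "... = br e (br f ?u) - sc (of_int (m - 2 * int (Suc i))) ?u
 - sc (of_int (int i * (m - 1 - int i))) ?u"
 using fe[of ?u] RS_h[OF fw H(1), of "Suc i"] wf[of "Suc i"] by simp
 also have "... = br e (br f ?u) - sc (of_int (m - 2 * int (Suc i) + int i * (m - 1 - int i))) ?u"
 by (simp only: of_int_add scale_left_distrib diff_diff_eq)
 also have "m - 2 * int (Suc i) + int i * (m - 1 - int i) = int (Suc i) * (m - 1 - int (Suc i))" by (simp add: algebra_simps)
 finally show ?case by simp
 qed simp
 define u where "u = br e (br f v) + sc (of_int (int j * (m - 1 - int j))) v"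
 have "br e (br f v) : RS c" using RS_br[OF e RS_br[OF f Suc.prems(1)]] by simp
 hence "u : RS c" unfolding u_def using RS_add RS_scale Suc.prems(1) by blast
 moreover have "((br f) ^^ j) u = 0"
 proof -
 have "((br f) ^^ j) (x + sc t y) = ((br f) ^^ j) x + sc t (((br f) ^^ j) y)" for x y t by (induction j) (simp_all add: br_add_right br_scale_right)
 thus ?thesis unfolding u_def using com[of j] Suc.prems(3) by simp
 qed
 ultimately have "u = 0" using Suc.IH Suc.prems(2) by simp
 hence "br e (br f v) = sc (of_int (- (int j * (m - 1 - int j)))) v" unfolding u_def by (simp add: eq_neg_iff_add_eq_0)
 moreover have "0 <= int j * (m - 1 - int j)" using Suc.prems(2) by simp
 ultimately show ?case using sl2_cha[OF e f H Suc.prems(1) c] by blast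
qed simp

lemma sl2_inj_neg:
 assumes e: "e : RS a" and f: "f : RS (- a)" and H: "br e f : h" "wt a (br e f) = 2"
 and c: "wt c (br e f) = - of_int m" "1 <= m" and v: "v : RS c" "br e v = 0"
 shows "v = 0"
proof -
 have fe: "br f e = - br e f" by (rule br_ant)
 thus ?thesis using sl2_inj[of f "- a" e c m v 1] e f H c v by (simp add: h_neg wt_min wt_h_min)
qed

text \<open>Subtract from \<open>y\<close> the multiple of \<open>e\<close> for which the Cartan
  element \<open>br f z\<close> of the remainder \<open>z\<close> has weight 0 on \<open>e\<close>.
  Then \<open>e f z = 0\<close>, and \<open>sl2_cha\<close> with \<open>k = 0\<close> removes
  \<open>z\<close>.\<close>

lemma sl2_dim_1:
 assumes e: "e : RS a" and f: "f : RS (- a)" and H: "br e f : h" "wt a (br e f) = 2" and y: "y : RS a"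
 shows "EX t. y = sc t e"
proof -
 have h0: "br f x : h" if "x : RS a" for x using RS_br[OF f that] by (simp add: RS_zer)
 have fe: "br f e = - br e f" by (rule br_ant)
 define t where "t = - wt a (br f y) / 2"
 define z where "z = y - sc t e"
 have z: "z : RS a" unfolding z_def using y e RS_diff RS_scale by blast
 have "wt a (br f z) = wt a (br f y) - t * wt a (br f e)" unfolding z_def br_dif_rig br_scale_right
 using h0[OF y] h0[OF e] by (simp add: wt_h_dif h_sca wt_h_sca)
 also have "... = 0" using H by (simp add: t_def fe wt_h_min)
 finally have "br (br f z) e = 0" using RS_h[OF e h0[OF z]] by simp
 hence "br e (br f z) = 0" using br_ant[of e "br f z"] by simp
 hence "z = 0" using sl2_cha[OF e f H z, of 2 0] H(2) by simp
 thus ?thesis unfolding z_def by auto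
qed

end

text \<open>If \<open>i\<close> were the only coordinate, \<open>c\<close> would be a multiple of
  \<open>sr i\<close>, and norm 2 singles out \<open>sr i\<close> among the positive
  multiples.\<close>

lemma rt_oth_coo:
 assumes "rt c" "npos c" "i : {1..8}" "c ~= sr i"
 shows "EX j:{1..8}. j ~= i & 0 < lc c j"
proof (rule ccontr)
 assume n: "~ ?thesis"
 have z: "lc c j = 0" if "j : {1..8}" "j ~= i" for j using n assms(2) that by (force simp: npos_def)
 have "ip c d = lc c i * ip (sr i) d" for d
 proof -
 have "ip c d = (SUM j:{1..8}. if i = j then lc c i * ip (sr i) d else 0)" unfolding ip_exp[of c d] by (rule sum.cong) (auto simp: z)
 thus ?thesis using assms(3) by simp
 qed
 hence "ip c c = lc c i * (lc c i * 2)" using ip_sym[of "sr i" c] ip_sr_sel[OF assms(3)] by (metis (no_types))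
 hence "lc c i * lc c i = 1" using assms(1) by (simp add: rt_def)
 moreover have "0 <= lc c i" using assms(2,3) by (simp add: npos_def)
 ultimately have "lc c i = 1" by (auto simp: zmult_eq_1_iff)
 hence "c = sr i" using z assms(3) by (intro lat_eqI) (auto simp: lc_sr)
 thus False using assms(4) by simp
qed

lemma npo_ht_ind [consumes 1, case_names less]:
 assumes "npos c" and "!!c. npos c ==> (!!d. npos d ==> ht d < ht c ==> P d) ==> P c"
 shows "P c" using assms(1)
proof (induction "nat (ht c)" arbitrary: c rule: less_induct)
 case less
 show ?case
 proof (rule assms(2)[OF less.prems])
 fix d assume d: "npos d" "ht d < ht c"
 hence "nat (ht d) < nat (ht c)" using ht_npo[OF d(1)] by simp
 thus "P d" using less.hyps d(1) by blast
 qed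
qed

context e8
begin

section \<open>Root spaces\<close>

lemma RS_non: "(RS c ~= {0}) = ((EX x:RS c. x ~= 0))" using RS_0[of c] by auto

lemma is_cor_iff:
 "i : {1..8} ==> is_coroot sc br h (al i) H \<longleftrightarrow>
 al i H = 2 & H : span {br x y | x y. x : RS (sr i) & y : RS (- sr i)}"
 by (simp add: is_coroot_def RS_def root_space_def wt_sr wt_min)

text \<open>The coroot is only known to lie in the span of brackets. Some bracket has non-zero
  weight \<open>sr i\<close>, for otherwise \<open>al i H\<close> would be 0; rescaled, it gives an
  sl2-triple. Both root spaces are then one-dimensional, so every bracket, and with them
  \<open>H\<close>, is a multiple of \<open>br e f\<close>.\<close>

lemma cor_tri:
 assumes i: "i : {1..8}"
 shows "EX e f. e : RS (sr i) & f : RS (- sr i) & br e f : h & (ALL c. wt c (br e f) = of_int (ip c (sr i)))"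
proof -
 obtain H where H: "al i H = 2" "H : span {br x y | x y. x : RS (sr i) & y : RS (- sr i)}"
 and HA: "!!j. j : {1..8} ==> al j H = of_int (E8_cartan_matrix i j)" using cor_ex[OF i] is_cor_iff[OF i] by blast
 have inh: "br x y : h" if "x : RS (sr i)" "y : RS (- sr i)" for x y using RS_br[OF that] by (simp add: RS_zer)
 have "EX x y. x : RS (sr i) & y : RS (- sr i) & wt (sr i) (br x y) ~= 0"
 proof (rule ccontr)
 assume n: "~ ?thesis"
 have "H : h & wt (sr i) H = 0" using H(2)
 proof (induction rule: span_induct_alt)
 case (step a x y)
 then obtain u v where uv: "x = br u v" "u : RS (sr i)" "v : RS (- sr i)" by blast
 hence "x : h" "wt (sr i) x = 0" using inh n by blast+
 thus ?case using step by (simp add: h_add h_sca wt_h_add wt_h_sca)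
 qed (simp add: h_0 wt_h_zer)
 thus False using H(1) wt_sr[OF i] by simp
 qed
 then obtain x f where xf: "x : RS (sr i)" "f : RS (- sr i)" "wt (sr i) (br x f) ~= 0" by blast
 define e where "e = sc (2 / wt (sr i) (br x f)) x"
 have e: "e : RS (sr i)" unfolding e_def using xf RS_scale by blast
 have efh: "br e f : h" using inh e xf by blast
 have e2: "wt (sr i) (br e f) = 2" unfolding e_def br_scale_left using wt_h_sca[OF inh[OF xf(1,2)]] xf(3) by simp
 have ef: "br f e = - br e f" by (rule br_ant)
 have "EX t. H = sc t (br e f)" using H(2)
 proof (induction rule: span_induct_alt)
 case base
 show ?case by (rule exI[of _ 0]) simp
 next
 case (step a x y)
 then obtain u v where uv: "x = br u v" "u : RS (sr i)" "v : RS (- sr i)" by blast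
 obtain s where s: "u = sc s e" using sl2_dim_1[OF e xf(2) efh e2 uv(2)] by blast
 have "EX r. v = sc r f" using sl2_dim_1[of f "- sr i" e v] xf(2) e uv(3) efh e2 ef by (simp add: h_neg wt_min wt_h_min)
 then obtain r where r: "v = sc r f" by blast
 obtain t where t: "y = sc t (br e f)" using step by blast
 have "sc a x + y = sc (a * (s * r) + t) (br e f)" unfolding uv(1) s r t by (simp add: br_scale_left br_scale_right scale_left_distrib)
 thus ?case by blast
 qed
 then obtain t where t: "H = sc t (br e f)" by blast
 have "t * 2 = 2" using H(1) wt_h_sca[OF efh, of "sr i" t] e2 t wt_sr[OF i] by simp
 hence "H = br e f" using t by simp
 moreover have "wt c H = of_int (ip c (sr i))" for c
 proof -
 have "of_int (lc c j) * al j H = of_int (lc c j * ip (sr j) (sr i))" if "j : {1..8}" for j using HA[OF that] ip_sr[OF i that] by simp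
 thus ?thesis unfolding wt_def ip_exp[of c "sr i"] of_int_sum by (intro sum.cong refl)
 qed
 ultimately show ?thesis using e xf(2) efh by blast
qed

lemma sim_tri:
 obtains e f where "!!i. i : {1..8} ==> e i : RS (sr i)" "!!i. i : {1..8} ==> f i : RS (- sr i)"
 "!!i. i : {1..8} ==> br (e i) (f i) : h"
 "!!i c. i : {1..8} ==> wt c (br (e i) (f i)) = of_int (ip c (sr i))"
proof -
 have ex: "ALL i:{1..8}. EX p. fst p : RS (sr i) & snd p : RS (- sr i) & br (fst p) (snd p) : h
 & (ALL c. wt c (br (fst p) (snd p)) = of_int (ip c (sr i)))" using cor_tri by simp
 then obtain p where p: "ALL i:{1..8}. fst (p i) : RS (sr i) & snd (p i) : RS (- sr i) & br (fst (p i)) (snd (p i)) : h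
 & (ALL c. wt c (br (fst (p i)) (snd (p i))) = of_int (ip c (sr i)))" using bchoice[OF ex] by (elim exE)
 show ?thesis by (rule that[of "fst \<circ> p" "snd \<circ> p"]) (use p in auto)
qed

text \<open>For \<open>y\<close> in this space \<open>br f y\<close> is a multiple of
  \<open>e\<close>, so \<open>e f y = 0\<close>, and \<open>sl2_cha\<close> applies with weight
  4.\<close>

lemma RS_dou: assumes i: "i : {1..8}" shows "RS (sr i + sr i) = {0}"
proof -
 obtain e f where ef: "e : RS (sr i)" "f : RS (- sr i)" "br e f : h"
 "!!c. wt c (br e f) = of_int (ip c (sr i))" using cor_tri[OF i] by blast
 have w2: "wt (sr i) (br e f) = 2" using ef(4) ip_sr_sel[OF i] by simp
 have "y = 0" if y: "y : RS (sr i + sr i)" for y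
 proof -
 have "br f y : RS (sr i)" using RS_br[OF ef(2) y] by simp
 then obtain t where "br f y = sc t e" using sl2_dim_1[OF ef(1-3) w2] by blast
 hence "br e (br f y) = 0" by (simp add: br_scale_right br_self)
 thus "y = 0" using sl2_cha[OF ef(1-3) w2 y, of 4 0] ef(4) ip_sr_sel[OF i] by (simp add: ip_lin)
 qed
 thus ?thesis using RS_0 by blast
qed

text \<open>Induction on the height. Applying \<open>f\<close> embeds \<open>RS c\<close> into
  \<open>RS d\<close> with \<open>d = c - sr i\<close>, a one-dimensional root space by induction.
  The product \<open>m\<close> of \<open>d\<close> with \<open>sr i\<close> has to be -1: for 0 or
  1, applying \<open>f\<close> once or twice more would give a non-zero vector whose weight has norm
  4 or 6, against the induction hypothesis.\<close>

lemma pos_roo_spa: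
 assumes "npos c" "c ~= 0" "RS c ~= {0}"
 shows "rt c & (ALL x:RS c. ALL y:RS c. x ~= 0 --> (EX t. y = sc t x))" using assms
proof (induction c rule: npo_ht_ind)
 case (less c)
 obtain i where i: "i : {1..8}" "0 < lc c i" "0 < ip c (sr i)" using ex_des[OF less(1,3)] .
 obtain e f where ef: "e : RS (sr i)" "f : RS (- sr i)" "br e f : h"
 "!!c. wt c (br e f) = of_int (ip c (sr i))" using cor_tri[OF i(1)] by blast
 have w2: "wt (sr i) (br e f) = 2" using ef(4) ip_sr_sel[OF i(1)] by simp
 show ?case
 proof (cases "c = sr i")
 case True
 have "EX t. y = sc t x" if xy: "x : RS c" "y : RS c" "x ~= 0" for x y
 proof -
 obtain s t where st: "x = sc s e" "y = sc t e" using sl2_dim_1[OF ef(1-3) w2] xy True by blast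
 hence "y = sc (t / s) x" using xy(3) by simp
 thus ?thesis by blast
 qed
 thus ?thesis using True rt_sr[OF i(1)] by blast
 next
 case False
 define d where "d = c - sr i"
 have d: "npos d" "ht d < ht c" "d ~= 0" "c = d + sr i" using npo_dif_sr[OF less(1) i(2,1)] False ht_sr[OF i(1)] by (auto simp: d_def ht_dif)
 have finj: "((br f) ^^ j) x ~= 0" if "x : RS c" "x ~= 0" "int j <= ip c (sr i)" for x j
 using sl2_inj[OF ef(1-3) w2 ef(4) _ that(1,3)] i(3) that(2) by auto
 have fd: "br f x : RS d" if "x : RS c" for x using RS_br[OF ef(2) that] by (simp add: d_def)
 obtain x0 where x0: "x0 : RS c" "x0 ~= 0" using less(4) RS_non by metis
 have "br f x0 ~= 0" using finj[OF x0, of 1] i(3) by simp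
 hence Rd: "RS d ~= {0}" using fd[OF x0(1)] RS_non by metis
 have IH: "rt d" "!!x y. x : RS d ==> y : RS d ==> x ~= 0 ==> EX t. y = sc t x" using less(2)[OF d(1,2) d(3) Rd] by blast+
 have dsi: "d ~= sr i" using RS_dou[OF i(1)] d(4) less(4) by auto
 have dims: "EX t. y = sc t x" if xy: "x : RS c" "y : RS c" "x ~= 0" for x y
 proof -
 have "br f x ~= 0" using finj[OF xy(1,3), of 1] i(3) by simp
 then obtain t where t: "br f y = sc t (br f x)" using IH(2)[OF fd[OF xy(1)] fd[OF xy(2)]] by blast
 have "y - sc t x : RS c" using xy RS_diff RS_scale by blast
 moreover have "br f (y - sc t x) = 0" using t by (simp add: br_dif_rig br_scale_right)
 ultimately have "y - sc t x = 0" using finj[of "y - sc t x" 1] i(3) by auto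
 thus ?thesis by auto
 qed
 \<comment> \<open>A positive coordinate of \<open>d\<close> away from \<open>i\<close> survives
   every subtraction of \<open>sr i\<close>. It keeps the lowered weights positive, so that the
   induction hypothesis reaches them.\<close>
 obtain j where j: "j : {1..8}" "j ~= i" "0 < lc d j" using rt_oth_coo[OF IH(1) d(1) i(1) dsi] by blast
 have small: "rt d'" if d': "RS d' ~= {0}" "lc d' j = lc d j" "ht d' < ht c" for d'
 proof -
 obtain x where x: "x : RS d'" "x ~= 0" using d'(1) RS_non by metis
 have "d' ~= 0" using d'(2) j(3) by auto
 moreover have "~ npos (- d')" using d'(2) j by (force simp: npos_def)
 ultimately have "npos d'" using RS_sig[OF x] by blast
 thus ?thesis using less(2)[of d'] d' \<open>d' ~= 0\<close> by blast
 qed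
 define m where "m = ip d (sr i)"
 have m: "ip c (sr i) = m + 2" unfolding d(4) m_def using ip_sr_sel[OF i(1)] by (simp add: ip_lin)
 have "m = - 1 | m = 0 | m = 1"
 proof -
 have "d ~= - sr i"
 proof
 assume "d = - sr i"
 hence "lc d j = 0" using lc_sr[OF j(1), of i] j(2) by simp
 thus False using j(3) by simp
 qed
 thus ?thesis using rt_ip_bou[OF IH(1) rt_sr[OF i(1)]] dsi unfolding m_def by (simp add: abs_le_iff) presburger
 qed
 moreover have "m ~= 0"
 proof
 assume m0: "m = 0"
 have "((br f) ^^ 2) x0 ~= 0" using finj[OF x0, of 2] m m0 by simp
 moreover have "((br f) ^^ 2) x0 : RS (d - sr i)" using RS_br[OF ef(2) fd[OF x0(1)]] by (simp add: numeral_2_eq_2)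
 ultimately have "rt (d - sr i)" using small[of "d - sr i"] lc_sr[OF j(1)] j(2) d(2) ht_sr[OF i(1)] by (auto simp: ht_dif)
 thus False using IH(1) rt_sr[OF i(1)] m0 rt_dif m_def by auto
 qed
 moreover have "m ~= 1"
 proof
 assume m1: "m = 1"
 have "((br f) ^^ 3) x0 ~= 0" using finj[OF x0, of 3] m m1 by simp
 moreover have "((br f) ^^ 3) x0 : RS (d - sr i - sr i)" using RS_br[OF ef(2) RS_br[OF ef(2) fd[OF x0(1)]]] by (simp add: numeral_3_eq_3)
 ultimately have "rt (d - sr i - sr i)" using small[of "d - sr i - sr i"] lc_sr[OF j(1)] j(2) d(2) ht_sr[OF i(1)] by (auto simp: ht_dif)
 thus False using IH(1) rt_sr[OF i(1)] m1 ip_sym[of d "sr i"] by (simp add: rt_def ip_lin m_def)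
 qed
 ultimately have "ip d (sr i) = - 1" unfolding m_def by blast
 hence "rt (d + sr i)" using rt_add[OF IH(1) rt_sr[OF i(1)]] by blast
 hence "rt c" using d(4) by simp
 thus ?thesis using dims by blast
 qed
qed

text \<open>Climb from a simple root: each step adds a simple root whose product with the weight
  reached is -1, and there \<open>e\<close> is injective.\<close>

lemma pos_roo_exi:
 assumes "npos c" "rt c"
 shows "EX x:RS c. x ~= 0" using assms
proof (induction c rule: npo_ht_ind)
 case (less c)
 consider i where "i : {1..8}" "c = sr i"
 | i where "i : {1..8}" "ip c (sr i) = 1" "rt (c - sr i)" "npos (c - sr i)" using rt_des[OF less(3,1)] by blast
 thus ?case
 proof cases
 case 1
 obtain e f where ef: "e : RS (sr i)" "br e f : h" "!!c. wt c (br e f) = of_int (ip c (sr i))" using cor_tri[OF 1(1)] by blast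
 hence "e ~= 0" using ip_sr_sel[OF 1(1)] wt_h_zer[of "sr i"] by force
 thus ?thesis using ef 1 by blast
 next
 case 2
 obtain e f where ef: "e : RS (sr i)" "f : RS (- sr i)" "br e f : h"
 "!!c. wt c (br e f) = of_int (ip c (sr i))" using cor_tri[OF 2(1)] by blast
 have w2: "wt (sr i) (br e f) = 2" using ef(4) ip_sr_sel[OF 2(1)] by simp
 obtain x where x: "x : RS (c - sr i)" "x ~= 0" using less(2)[OF 2(4) _ 2(3)] ht_sr[OF 2(1)] by (auto simp: ht_dif)
 have "wt (c - sr i) (br e f) = - of_int 1" using ef(4) 2(2) ip_sr_sel[OF 2(1)] by (simp add: ip_lin)
 hence "br e x ~= 0" using sl2_inj_neg[OF ef(1-3) w2 _ _ x(1)] x(2) by force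
 moreover have "br e x : RS c" using RS_br[OF ef(1) x(1)] by simp
 ultimately show ?thesis by blast
 qed
qed

end

context e8
begin

lemma neg_roo_exi:
 assumes "npos c" "rt c"
 shows "EX x:RS (- c). x ~= 0" using assms
proof (induction c rule: npo_ht_ind)
 case (less c)
 consider i where "i : {1..8}" "c = sr i"
 | i where "i : {1..8}" "ip c (sr i) = 1" "rt (c - sr i)" "npos (c - sr i)" using rt_des[OF less(3,1)] by blast
 thus ?case
 proof cases
 case 1
 obtain e f where ef: "f : RS (- sr i)" "br e f : h" "!!c. wt c (br e f) = of_int (ip c (sr i))" using cor_tri[OF 1(1)] by blast
 hence "f ~= 0" using ip_sr_sel[OF 1(1)] wt_h_zer[of "sr i"] by force
 thus ?thesis using ef 1 by blast
 next
 case 2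
 obtain e f where ef: "e : RS (sr i)" "f : RS (- sr i)" "br e f : h"
 "!!c. wt c (br e f) = of_int (ip c (sr i))" using cor_tri[OF 2(1)] by blast
 have w2: "wt (sr i) (br e f) = 2" using ef(4) ip_sr_sel[OF 2(1)] by simp
 obtain x where x: "x : RS (- (c - sr i))" "x ~= 0" using less(2)[OF 2(4) _ 2(3)] ht_sr[OF 2(1)] by (auto simp: ht_dif)
 have "wt (- (c - sr i)) (br e f) = of_int 1" using ef(4) 2(2) ip_sr_sel[OF 2(1)] by (simp add: ip_lin)
 hence "br f x ~= 0" using sl2_inj[OF ef(1-3) w2 _ _ x(1), of 1 1] x(2) by force
 moreover have "br f x : RS (- c)" using RS_br[OF ef(2) x(1)] by simp
 ultimately show ?thesis by blast
 qed
qed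

lemma is_roo_wt:
 assumes "rt c" shows "is_root sc br h (wt c)"
proof -
 have "EX x:RS c. x ~= 0" using rt_sig[OF assms] pos_roo_exi[of c] neg_roo_exi[of "- c"] assms by auto
 moreover have "EX H:h. wt c H ~= 0" using wt_inj[of c 0] rt_nz[OF assms] by auto
 ultimately show ?thesis unfolding is_root_def RS_def root_space_def by blast
qed

lemma is_roo_ex:
 assumes "is_root sc br h be"
 shows "EX c. rt c & (ALL H:h. be H = wt c H)"
proof -
 obtain x where x: "x ~= 0" "!!H. H : h ==> br H x = sc (be H) x" using assms unfolding is_root_def root_space_def by blast
 obtain c where c: "x : RS c" "c = 0 | npos c | npos (- c)" using wei_vec_cas[of x] x(2) by blast
 have be: "be H = wt c H" if "H : h" for H using x(2)[OF that] RS_h[OF c(1) that] x(1) by simp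
 have "positive_root sc br h {1..8} al be | positive_root sc br h {1..8} al (%H. - be H)"
 using simple_roots assms unfolding simple_roots_def by blast
 hence "EX y d. y ~= 0 & y : RS d & (d = c | d = - c) & npos d"
 proof
 assume p: "positive_root sc br h {1..8} al be"
 then obtain n where n: "ALL H:h. be H = (SUM i:{1..8}. of_nat (n i) * al i H)" unfolding positive_root_def by (elim conjE exE)
 define d where "d = L (n 1) (n 2) (n 3) (n 4) (n 5) (n 6) (n 7) (n 8)"
 have lc: "lc d i = int (n i)" if "i : {1..8}" for i using that unfolding I8 d_def by auto
 have "wt c H = wt d H" if "H : h" for H
 proof -
 have "wt d H = (SUM i:{1..8}. of_nat (n i) * al i H)" unfolding wt_def by (intro sum.cong refl) (simp add: lc)
 thus ?thesis using be n that by simp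
 qed
 hence "c = d" by (rule wt_inj)
 thus ?thesis using x(1) c(1) lc by (intro exI[of _ x] exI[of _ d]) (auto simp: npos_def)
 next
 assume p: "positive_root sc br h {1..8} al (%H. - be H)"
 then obtain n where n: "ALL H:h. - be H = (SUM i:{1..8}. of_nat (n i) * al i H)" unfolding positive_root_def by (elim conjE exE)
 \<comment> \<open>A negative root has, by definition, a negated function that is itself a root;
   this supplies a vector in \<open>RS (- c)\<close>, where \<open>- c\<close> is positive.\<close>
 have "is_root sc br h (%H. - be H)" using p unfolding positive_root_def by blast
 then obtain y where y: "y ~= 0" "!!H. H : h ==> br H y = sc (- be H) y" unfolding is_root_def root_space_def by blast
 define d where "d = L (n 1) (n 2) (n 3) (n 4) (n 5) (n 6) (n 7) (n 8)"
 have lc: "lc d i = int (n i)" if "i : {1..8}" for i using that unfolding I8 d_def by auto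
 have w: "wt (- c) H = wt d H" if "H : h" for H
 proof -
 have "wt d H = (SUM i:{1..8}. of_nat (n i) * al i H)" unfolding wt_def by (intro sum.cong refl) (simp add: lc)
 thus ?thesis using n[rule_format, OF that] be[OF that] unfolding wt_min by metis
 qed
 hence "- c = d" by (rule wt_inj)
 moreover have "y : RS (- c)" using y(2) be by (simp add: RS_def wt_min)
 ultimately show ?thesis using y(1) lc by (intro exI[of _ y] exI[of _ d]) (auto simp: npos_def)
 qed
 then obtain y d where d: "y ~= 0" "y : RS d" "d = c | d = - c" "npos d" by blast
 have "c ~= 0" using assms be unfolding is_root_def by auto
 hence "d ~= 0" using d(3) by auto
 moreover have "RS d ~= {0}" using d(1,2) by blast
 ultimately have "rt d" using pos_roo_spa[OF d(4)] by blast
 thus ?thesis using d(3) be by auto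
qed

text \<open>Negating the simple roots exchanges positive and negative roots and keeps the Cartan
  matrix. A second interpretation of the locale then yields for negative root spaces whatever is
  known for positive ones.\<close>

lemma oppo: "e8 sc br h (%i H. - al i H)"
proof -
 have r: "rt c ==> is_root sc br h (%H. - wt c H)" for c using is_roo_wt[of "- c"] by (simp add: wt_min[abs_def])
 have "simple_roots sc br h {1..8} (%i H. - al i H)" unfolding simple_roots_def
 proof (intro conjI ballI allI impI)
 show "finite {1..8::nat}" by simp
 show "is_root sc br h (%H. - al i H)" if "i : {1..8}" for i using r[OF rt_sr[OF that]] by (simp add: wt_sr[OF that])
 show "c i = 0" if "ALL H:h. (SUM i:{1..8}. c i * - al i H) = 0" "i : {1..8}" for c i
 using alp_ind[of c i] that by (simp add: sum_negf)
 fix be assume be: "is_root sc br h be"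
 have be': "is_root sc br h (%H. - be H)"
 proof -
 obtain c where c: "rt c" "ALL H:h. be H = wt c H" using is_roo_ex[OF be] by blast
 thus ?thesis using r[OF c(1)] unfolding is_root_def root_space_def by simp
 qed
 have "positive_root sc br h {1..8} al be | positive_root sc br h {1..8} al (%H. - be H)"
 using simple_roots be unfolding simple_roots_def by blast
 thus "positive_root sc br h {1..8} (%i H. - al i H) be
 | positive_root sc br h {1..8} (%i H. - al i H) (%H. - be H)"
 proof
 assume p: "positive_root sc br h {1..8} al be"
 then obtain n where n: "ALL H:h. be H = (SUM i:{1..8}. of_nat (n i) * al i H)" unfolding positive_root_def by (elim conjE exE)
 hence "positive_root sc br h {1..8} (%i H. - al i H) (%H. - be H)"
 unfolding positive_root_def using be' by (intro conjI exI[of _ n]) (simp_all add: sum_negf)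
 thus ?thesis by blast
 next
 assume p: "positive_root sc br h {1..8} al (%H. - be H)"
 then obtain n where n: "ALL H:h. - be H = (SUM i:{1..8}. of_nat (n i) * al i H)" unfolding positive_root_def by (elim conjE exE)
 have "ALL H:h. be H = (SUM i:{1..8}. of_nat (n i) * - al i H)"
 proof
 fix H assume "H : h"
 hence "be H = - (SUM i:{1..8}. of_nat (n i) * al i H)" using n by (metis minus_minus)
 thus "be H = (SUM i:{1..8}. of_nat (n i) * - al i H)" by (simp add: sum_negf)
 qed
 hence "positive_root sc br h {1..8} (%i H. - al i H) be" unfolding positive_root_def using be by (intro conjI exI[of _ n])
 thus ?thesis by blast
 qed
 qed
 moreover have "has_cartan_matrix sc br h {1..8} (%i H. - al i H) E8_cartan_matrix" unfolding has_cartan_matrix_def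
 proof
 fix i :: nat assume i: "i : {1..8}"
 obtain e f where ef: "e : RS (sr i)" "f : RS (- sr i)" "br e f : h"
 "!!c. wt c (br e f) = of_int (ip c (sr i))" using cor_tri[OF i] by blast
 have al: "al j (br e f) = of_int (E8_cartan_matrix i j)" if "j : {1..8}" for j
 using ef(4)[of "sr j"] ip_sr[OF i that] by (simp add: wt_sr[OF that])
 have al': "al j (br f e) = - of_int (E8_cartan_matrix i j)" if "j : {1..8}" for j
 using wt_h_min[OF ef(3), of "sr j"] al[OF that] br_ant[of f e] by (simp add: wt_sr[OF that])
 have "br f e : {br x y |x y. x : root_space sc br h (%H. - al i H) & y : root_space sc br h (%H. - (- al i H))}"
 using ef(1,2) unfolding RS_def root_space_def by (auto simp: wt_min wt_sr[OF i])
 hence "is_coroot sc br h (%H. - al i H) (br f e)"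
 unfolding is_coroot_def using al'[OF i] by (auto simp: E8_cartan_matrix_def intro: span_base)
 thus "EX H. is_coroot sc br h (%H. - al i H) H &
 (ALL j:{1..8}. - al j H = complex_of_int (E8_cartan_matrix i j))"
 using al' by (intro exI[of _ "br f e"]) simp
 qed
 ultimately show ?thesis using E8 unfolding simple_lie_algebra_E8_def by unfold_locales (simp add: simple_lie_algebra_E8_def)
qed

lemma opp_wt: "e8.wt (%i H. - al i H) c H = - wt c H" unfolding e8.wt_def[OF oppo] wt_def by (simp add: sum_negf)

lemma opp_RS: "e8.RS sc br h (%i H. - al i H) c = RS (- c)" unfolding e8.RS_def[OF oppo] RS_def opp_wt wt_min ..

lemma roo_spa_dim:
 assumes "rt c" "x : RS c" "y : RS c" "x ~= 0"
 shows "EX t. y = sc t x" using rt_sig[OF assms(1)]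
proof
 assume "npos c"
 thus ?thesis using pos_roo_spa[of c] assms rt_nz RS_non by metis
next
 assume n: "npos (- c)"
 have "ALL x:RS c. ALL y:RS c. x ~= 0 --> (EX t. y = sc t x)" using e8.pos_roo_spa[OF oppo n] assms RS_non[of c] rt_nz[OF assms(1)]
 unfolding opp_RS by auto
 thus ?thesis using assms by blast
qed

lemma RS_tri: assumes "~ rt c" "c ~= 0" shows "RS c = {0}"
proof (rule ccontr)
 assume n: "RS c ~= {0}"
 then obtain x where "x : RS c" "x ~= 0" using RS_non by blast
 hence "npos c | npos (- c)" using RS_sig assms(2) by blast
 thus False
 proof
 assume "npos c"
 thus False using pos_roo_spa[of c] n assms by blast
 next
 assume "npos (- c)"
 thus False using e8.pos_roo_spa[OF oppo, of "- c"] n assms unfolding opp_RS by simp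
 qed
qed

lemma roo_spa_ex: "rt c ==> EX x:RS c. x ~= 0" using rt_sig[of c] pos_roo_exi[of c] neg_roo_exi[of "- c"] by auto

section \<open>The Cartan subalgebra\<close>

lemma cen_tri: assumes "!!y. br x y = 0" shows "x = 0"
proof -
 let ?Z = "{x. ALL y. br x y = 0}"
 have "lie_ideal sc br ?Z" unfolding lie_ideal_def
 proof (intro conjI allI ballI)
 show "subspace ?Z" by (rule subspaceI) (auto simp: br_add_left br_scale_left)
 show "br x y : ?Z" if "y : ?Z" for x y using that br_ant[of y x] by (simp add: jac_lef br_min_lef)
 qed
 moreover have "?Z ~= UNIV"
 proof
 assume "?Z = UNIV"
 hence "!!x y. br x y = 0" by blast
 thus False using E8 unfolding simple_lie_algebra_E8_def simple_lie_algebra_def by blast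
 qed
 ultimately have "?Z = {0}" using E8 unfolding simple_lie_algebra_E8_def simple_lie_algebra_def by blast
 thus ?thesis using assms by blast
qed

text \<open>An element of \<open>h\<close> on which the simple roots vanish commutes with all weight
  vectors, so it is central and therefore 0.\<close>

lemma h_eqI:
 assumes "x : h" "y : h" "!!i. i : {1..8} ==> wt (sr i) x = wt (sr i) y"
 shows "x = y"
proof -
 have xy: "x - y : h" using assms h_diff by blast
 have "wt c (x - y) = 0" for c unfolding wt_def
 proof (rule sum.neutral, rule ballI)
 fix i assume "i : {1..8::nat}"
 thus "of_int (lc c i) * al i (x - y) = 0" using assms wt_h_dif[OF assms(1,2), of "sr i"] by (simp add: wt_sr)
 qed
 hence "br (x - y) z = 0" if "z : (\<Union>c. RS c)" for z using that RS_h[OF _ xy] by auto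
 moreover have "z : span (\<Union>c. RS c)" for z using RS_spa by simp
 ultimately have "br (x - y) z = 0" for z
 using module_hom.eq_0_on_span[OF Vector_Spaces.linear.axioms(3)[OF lin_br], of "\<Union>c. RS c" "x - y" z] by blast
 hence "x - y = 0" by (rule cen_tri)
 thus ?thesis by simp
qed

lemma Hl_ex: "EX H. H : h & (ALL c. wt c H = of_int (ip c a))"
proof -
 obtain e f where ef: "!!i. i : {1..8} ==> br (e i) (f i) : h"
 "!!i c. i : {1..8} ==> wt c (br (e i) (f i)) = of_int (ip c (sr i))" using sim_tri by metis
 define H where "H = (SUM i:{1..8}. sc (of_int (lc a i)) (br (e i) (f i)))"
 have "H : h" unfolding H_def using ef by (intro h_sum h_sca)
 moreover have "wt c H = of_int (ip c a)" for c
 proof -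
 have "wt c H = (SUM i:{1..8}. wt c (sc (of_int (lc a i)) (br (e i) (f i))))" unfolding H_def using ef by (intro wt_h_sum h_sca) auto
 also have "... = (SUM i:{1..8}. of_int (lc a i * ip (sr i) c))" using ef by (intro sum.cong refl) (simp add: wt_h_sca ip_sym[of c])
 also have "... = of_int (ip c a)" unfolding ip_sym[of c a] ip_exp[of a c] by (rule of_int_sum[symmetric])
 finally show ?thesis .
 qed
 ultimately show ?thesis by blast
qed

text \<open>For a root this is its coroot. All roots have the same length, so coroots depend
  additively on roots and \<open>Hl\<close> makes sense on the whole lattice.\<close>

definition Hl :: "lat => 'g" where
 "Hl a = (SOME H. H : h & (ALL c. wt c H = of_int (ip c a)))"

lemma Hl_h [simp]: "Hl a : h" and wt_Hl [simp]: "wt c (Hl a) = of_int (ip c a)"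
 using someI_ex[OF Hl_ex[of a]] unfolding Hl_def[symmetric] by blast+

lemma Hl_uni: "H : h ==> (!!c. wt c H = of_int (ip c a)) ==> H = Hl a" by (rule h_eqI) simp_all

lemma Hl_add: "Hl (a + b) = Hl a + Hl b" by (rule Hl_uni[symmetric]) (simp_all add: h_add wt_h_add ip_lin)
lemma Hl_min: "Hl (- a) = - Hl a" by (rule Hl_uni[symmetric]) (simp_all add: h_neg wt_h_min)
lemma Hl_zer [simp]: "Hl 0 = 0" by (rule Hl_uni[symmetric]) (simp_all add: h_0 wt_h_zer)

end

context e8
begin

section \<open>Structure constants\<close>

lemma br_sim_non:
 assumes i: "i : {1..8}" and g: "g : RS (sr i)" "g ~= 0" and x: "x : RS d" "x ~= 0" and d: "ip d (sr i) = - 1"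
 shows "br g x ~= 0"
proof
 assume 0: "br g x = 0"
 obtain e f where ef: "e : RS (sr i)" "f : RS (- sr i)" "br e f : h"
 "!!c. wt c (br e f) = of_int (ip c (sr i))" using cor_tri[OF i] by blast
 obtain t where "e = sc t g" using roo_spa_dim[OF rt_sr[OF i] g(1) ef(1) g(2)] by blast
 hence "br e x = 0" using 0 by (simp add: br_scale_left)
 hence "x = 0" using sl2_inj_neg[OF ef(1-3), of d 1 x] ef(4) ip_sr_sel[OF i] x(1) d by simp
 thus False using x(2) by simp
qed

text \<open>The vectors \<open>E c\<close> are defined by recursion on the height; independence of the chosen
 path is the Jacobi identity together with the symmetry of \<open>eps\<close>.\<close>

lemma pos_bas:
 assumes g: "!!i. i : {1..8} ==> g i : RS (sr i)" "!!i. i : {1..8} ==> g i ~= 0"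
 shows "EX E. (ALL c. rt c & npos c --> E c : RS c & E c ~= 0) & (ALL i:{1..8}. E (sr i) = g i) &
 (ALL i:{1..8}. ALL c. rt c & npos c & ip c (sr i) = 1 -->
 E c = sc (of_int (eps (sr i) (c - sr i))) (br (g i) (E (c - sr i))))"
proof -
 define ch where "ch c = (SOME i. i : {1..8} & ip c (sr i) = 1)" for c
 define step where "step F c = (if EX i:{1..8}. c = sr i then g (SOME i. i : {1..8} & c = sr i)
 else sc (of_int (eps (sr (ch c)) (c - sr (ch c)))) (br (g (ch c)) (F (c - sr (ch c)))))" for F c
 \<comment> \<open>Recursion on the height. A positive root of height 1 is simple and takes its
   value from \<open>g\<close>, so the dummy value 0 at height 0 is never reached from a positive
   root.\<close>
 define EE where "EE = rec_nat (%c. 0) (%n F. step F)"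
 define E where "E c = EE (nat (ht c)) c" for c
 have EE: "EE (Suc n) = step (EE n)" for n by (simp add: EE_def)
 have Es: "E (sr i) = g i" if "i : {1..8}" for i
 proof -
 have "(SOME j. j : {1..8} & sr i = sr j) = i" using that sr_eq_iff[OF that] by (intro some_equality) auto
 thus ?thesis using that by (auto simp: E_def ht_sr EE step_def)
 qed
 have notsr: "c ~= sr j" if "ip c (sr i) = 1" "i : {1..8}" "j : {1..8}" for c i j
 using that ip_sr_neq[of i j] ip_sr_sel[of i] by (cases "i = j") auto
 have main: "E c : RS c & E c ~= 0 & (ALL i:{1..8}. ip c (sr i) = 1 -->
 E c = sc (of_int (eps (sr i) (c - sr i))) (br (g i) (E (c - sr i))))"
 if "npos c" "rt c" for c using that
 proof (induction c rule: npo_ht_ind)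
 case (less c)
 show ?case
 proof (cases "EX i:{1..8}. c = sr i")
 case True
 then obtain j where j: "j : {1..8}" "c = sr j" by blast
 hence "ip c (sr i) ~= 1" if "i : {1..8}" for i using notsr[of c i j] that by blast
 thus ?thesis using j Es[OF j(1)] g[OF j(1)] by simp
 next
 case False
 have "EX i. i : {1..8} & ip c (sr i) = 1" using rt_des[OF less(3,1)] False by metis
 hence ch: "ch c : {1..8}" "ip c (sr (ch c)) = 1" using someI_ex[of "%i. i : {1..8} & ip c (sr i) = 1"] unfolding ch_def by blast+
 define k where "k = ch c"
 note k = ch[folded k_def]
 define c' where "c' = c - sr k"
 have c': "rt c'" "npos c'" "c = c' + sr k" "ht c' < ht c" using npo_low[OF less(3,1) k] ht_sr[OF k(1)] by (simp_all add: c'_def ht_dif)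
 have "nat (ht c) = Suc (nat (ht c'))" using ht_npo[OF c'(2)] ht_sr[OF k(1)] by (simp add: c'_def ht_dif)
 hence Ec: "E c = sc (of_int (eps (sr k) c')) (br (g k) (E c'))" using False by (simp add: E_def EE step_def k_def c'_def)
 have IHk: "E c' : RS c'" "E c' ~= 0" using less(2)[OF c'(2,4,1)] by blast+
 have "ip c' (sr k) = - 1" using k ip_sr_sel[OF k(1)] by (simp add: c'_def ip_lin)
 hence nz: "br (g k) (E c') ~= 0" using br_sim_non[OF k(1) g(1,2)[OF k(1)] IHk] by simp
 have "br (g k) (E c') : RS c" using RS_br[OF g(1)[OF k(1)] IHk(1)] c'(3) by (simp add: add.commute)
 hence A: "E c : RS c" "E c ~= 0" unfolding Ec using nz RS_scale by simp_all
 have "E c = sc (of_int (eps (sr i) (c - sr i))) (br (g i) (E (c - sr i)))" if i: "i : {1..8}" "ip c (sr i) = 1" for i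
 proof (cases "i = k")
 case True
 thus ?thesis using Ec c'_def by simp
 next
 case ik: False
 define d where "d = c - sr i"
 have d: "rt d" "npos d" "c = d + sr i" "ht d < ht c" using npo_low[OF less(3,1) i] ht_sr[OF i(1)] by (simp_all add: d_def ht_dif)
 \<comment> \<open>Orthogonal \<open>i\<close> and \<open>k\<close> have the common predecessor
   \<open>b\<close>, and the two paths are compared by the Jacobi identity; for adjacent ones
   \<open>c\<close> can only be \<open>sr i + sr k\<close>.\<close>
 consider "ip (sr i) (sr k) = 0" | "ip (sr i) (sr k) = - 1" using ip_sr_neq[OF k(1) i(1)] ik by blast
 thus ?thesis
 proof cases
 case 1
 define b where "b = c - sr i - sr k"
 have kb: "ip d (sr k) = 1" "ip c' (sr i) = 1" using i k 1 ip_sym[of "sr i" "sr k"] by (simp_all add: d_def c'_def ip_lin)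
 have "E d = sc (of_int (eps (sr k) b)) (br (g k) (E b))" using less(2)[OF d(2,4,1)] k(1) kb(1) by (simp add: b_def d_def)
 moreover have "E c' = sc (of_int (eps (sr i) b)) (br (g i) (E b))"
 using less(2)[OF c'(2,4,1)] i(1) kb(2) by (simp add: b_def c'_def diff_diff_add add.commute)
 moreover have "br (g i) (br (g k) (E b)) = br (g k) (br (g i) (E b))"
 proof -
 have "br (g i) (g k) : RS (sr i + sr k)" using RS_br g i k by blast
 moreover have "~ rt (sr i + sr k)" "sr i + sr k ~= 0"
 using rt_add[OF rt_sr[OF i(1)] rt_sr[OF k(1)]] 1 ht_sr[OF i(1)] ht_sr[OF k(1)] ht_add[of "sr i" "sr k"] by (auto simp: zero_lat_def)
 ultimately have "br (g i) (g k) = 0" using RS_tri by blast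
 thus ?thesis using jac_rig[of "g i" "g k" "E b"] by simp
 qed
 moreover have "eps (sr k) c' * eps (sr i) b = eps (sr i) d * eps (sr k) b"
 proof -
 have "c' = b + sr i" "d = b + sr k" by (simp_all add: b_def c'_def d_def)
 thus ?thesis using eps_swa[of "sr i" "sr k"] 1 by (simp add: eps_lin mult_ac)
 qed
 hence "(of_int (eps (sr k) c') * of_int (eps (sr i) b) :: complex)
 = of_int (eps (sr i) d) * of_int (eps (sr k) b)"
 by (metis of_int_mult)
 ultimately show ?thesis unfolding Ec d_def[symmetric] by (simp add: br_scale_right)
 next
 case 2
 have "ip d (sr k) = 2" using k 2 by (simp add: d_def ip_lin)
 hence dk: "d = sr k" using rt_ip_bou(2)[OF d(1) rt_sr[OF k(1)]] by blast
 hence c'i: "c' = sr i" using d(3) by (simp add: c'_def)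
 have "eps (sr k) (sr i) = - eps (sr i) (sr k)" using eps_swa[of "sr k" "sr i"] 2 ip_sym[of "sr i" "sr k"] by simp
 thus ?thesis unfolding Ec d_def[symmetric] dk c'i using Es[OF i(1)] Es[OF k(1)] br_ant[of "g i" "g k"] by simp
 qed
 qed
 thus ?thesis using A by blast
 qed
 qed
 thus ?thesis using Es by (intro exI[of _ E]) blast
qed

text \<open>\<open>d - sr i - sr i\<close> has norm 6 and is no root, so \<open>f\<close> kills
  \<open>u\<close>. As \<open>Hl (sr i)\<close> acts on \<open>u\<close> by -1, \<open>f e\<close>
  acts on it as the identity.\<close>

lemma low_sim:
 assumes i: "i : {1..8}" and e: "e : RS (sr i)" and f: "f : RS (- sr i)" and ef: "br e f = Hl (sr i)"
 and d: "rt d" "ip d (sr i) = 1" and u: "u : RS (d - sr i)"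
 shows "br f (br e u) = u"
proof -
 have "br f u : RS (d - sr i - sr i)" using RS_br[OF f u] by simp
 moreover have "ip (d - sr i - sr i) (d - sr i - sr i) = 6" using d ip_sr_sel[OF i] ip_sym[of d "sr i"] by (simp add: rt_def ip_lin)
 hence "~ rt (d - sr i - sr i)" "d - sr i - sr i ~= 0" by (auto simp: rt_def)
 ultimately have "br f u = 0" using RS_tri by blast
 moreover have "br f e = - Hl (sr i)" using br_ant[of f e] ef by simp
 moreover have "br (Hl (sr i)) u = - u" using RS_h[OF u Hl_h] d(2) ip_sr_sel[OF i] by (simp add: ip_lin)
 ultimately show ?thesis using jac_rig[of f e u] by (simp add: br_min_lef)
qed

text \<open>One row of the multiplication table, isolated so that the table can be proved by
  induction on \<open>a\<close>. The sign in \<open>- Hl a\<close> fits the cocycle: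
  \<open>eps a (- a)\<close> is -1 for a root.\<close>

definition str_row :: "(lat => 'g) => lat => bool" where
 "str_row e a = ((ALL b. rt b --> br (e a) (e b) =
 (if rt (a + b) then sc (of_int (eps a b)) (e (a + b)) else if a + b = 0 then - Hl a else 0)))"

text \<open>The Jacobi identity expresses the bracket with \<open>e (a + d)\<close> through the rows
  of \<open>a\<close> and \<open>d\<close>. When \<open>a + d + b\<close> is a root, the products of
  \<open>a\<close> and \<open>d\<close> with \<open>b\<close> add up to -1, which leaves four cases;
  bimultiplicativity of \<open>eps\<close> settles the signs.\<close>

lemma str_row_add:
 assumes e: "!!c. rt c ==> e c : RS c" and a: "rt a" "rt d" "ip a d = - 1" "str_row e a" "str_row e d"
 and ead: "e (a + d) = sc (of_int (eps a d)) (br (e a) (e d))"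
 shows "str_row e (a + d)" unfolding str_row_def
proof (intro allI impI)
 fix b assume b: "rt b"
 have ad: "rt (a + d)" using rt_add a by blast
 let ?p = "ip a b" and ?q = "ip d b"
 have pq: "ip (a + d) b = ?p + ?q" by (simp add: ip_lin)
 have sw: "eps d a = - eps a d" using eps_swa[of d a] a(3) ip_sym[of a d] by simp
 have exp: "br (e (a + d)) (e b) = sc (of_int (eps a d)) (br (e a) (br (e d) (e b)) - br (e d) (br (e a) (e b)))"
 unfolding ead br_scale_left jac_lef ..
 have ra: "br (e a) (e c) = (if rt (a + c) then sc (of_int (eps a c)) (e (a + c)) else if a + c = 0 then - Hl a else 0)"
 if "rt c" for c using a(4) that unfolding str_row_def by blast
 have rd: "br (e d) (e c) = (if rt (d + c) then sc (of_int (eps d c)) (e (d + c)) else if d + c = 0 then - Hl d else 0)"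
 if "rt c" for c using a(5) that unfolding str_row_def by blast
 note ba = rt_ip_bou[OF a(1) b] and bd = rt_ip_bou[OF a(2) b]
 have za: "(a + b = 0) = (?p = - 2)" and zd: "(d + b = 0) = (?q = - 2)"
 using ba(3) bd(3) by (simp_all add: add_eq_0_iff2)
 have Ea: "br (e a) (e b) = (if ?p = - 1 then sc (of_int (eps a b)) (e (a + b)) else if ?p = - 2 then - Hl a else 0)"
 using ra[OF b] rt_add[OF a(1) b] za by simp
 have Ed: "br (e d) (e b) = (if ?q = - 1 then sc (of_int (eps d b)) (e (d + b)) else if ?q = - 2 then - Hl d else 0)"
 using rd[OF b] rt_add[OF a(2) b] zd by simp
 show "br (e (a + d)) (e b) = (if rt (a + d + b) then sc (of_int (eps (a + d) b)) (e (a + d + b))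
 else if a + d + b = 0 then - Hl (a + d) else 0)" using ad b
 proof (cases rule: rt_add_cas[of "a + d" b])
 case 1
 have "(?p = - 1 & ?q = 0) | (?p = 0 & ?q = - 1) | (?p = - 2 & ?q = 1) | (?p = 1 & ?q = - 2)"
 using 1(1) pq ba(1) bd(1) by (simp add: abs_le_iff) presburger
 then consider "?p = - 1" "?q = 0" | "?p = 0" "?q = - 1" | "?p = - 2" "?q = 1" | "?p = 1" "?q = - 2" by blast
 hence "br (e (a + d)) (e b) = sc (of_int (eps (a + d) b)) (e (a + d + b))"
 proof cases
 case c: 1
 have "rt (a + b)" using rt_add[OF a(1) b] c(1) by simp
 moreover have "rt (d + (a + b))" using 1(2) by (simp add: add_ac)
 ultimately have "br (e d) (e (a + b)) = sc (of_int (eps d (a + b))) (e (a + d + b))" using rd[of "a + b"] by (simp add: add_ac)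
 thus ?thesis unfolding exp Ea Ed using c sw
 by (simp add: br_scale_right eps_lin mult_ac) (simp add: mult.assoc[symmetric] of_int_mult[symmetric] del: of_int_mult)
 next
 case c: 2
 have "rt (d + b)" using rt_add[OF a(2) b] c(2) by simp
 moreover have "rt (a + (d + b))" using 1(2) by (simp add: add_ac)
 ultimately have "br (e a) (e (d + b)) = sc (of_int (eps a (d + b))) (e (a + d + b))" using ra[of "d + b"] by (simp add: add_ac)
 thus ?thesis unfolding exp Ea Ed using c sw
 by (simp add: br_scale_right eps_lin mult_ac) (simp add: mult.assoc[symmetric] of_int_mult[symmetric] del: of_int_mult)
 next
 case c: 3
 have "b = - a" using c(1) ba(3) by simp
 have "br (Hl a) (e d) = - e d" using RS_h[OF e[OF a(2)] Hl_h, of a] a(3) ip_sym[of a d] by simp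
 hence "br (e d) (Hl a) = e d" using br_ant[of "e d" "Hl a"] by simp
 thus ?thesis unfolding exp Ea Ed using c sw \<open>b = - a\<close> eps_sel[OF a(1)] by (simp add: br_min_rig eps_lin)
 next
 case c: 4
 have "b = - d" using c(2) bd(3) by simp
 have "br (Hl d) (e a) = - e a" using RS_h[OF e[OF a(1)] Hl_h, of d] a(3) by simp
 hence "br (e a) (Hl d) = e a" using br_ant[of "e a" "Hl d"] by simp
 thus ?thesis unfolding exp Ea Ed using c sw \<open>b = - d\<close> eps_sel[OF a(2)] by (simp add: br_min_rig eps_lin)
 qed
 thus ?thesis using 1 by simp
 next
 case 2
 have bb: "b = - (a + d)" using 2(2) by (simp only: add_eq_0_iff)
 have ip: "?p = - 1" "?q = - 1" unfolding bb using a(1-3) ip_sym[of a d] by (simp_all add: ip_lin rt_def)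
 have "br (e a) (e (d + b)) = - Hl a" "br (e d) (e (a + b)) = - Hl d" using ra[of "- a"] rd[of "- d"] a(1,2) unfolding bb by simp_all
 moreover have "eps a d * eps d b = 1" "eps a d * eps a b = - 1"
 unfolding bb using eps_sel[OF a(1)] eps_sel[OF a(2)] sw by (simp_all add: eps_lin mult.assoc[symmetric])
 hence "(of_int (eps a d) * of_int (eps d b) :: complex) = 1" "(of_int (eps a d) * of_int (eps a b) :: complex) = - 1"
 by (simp_all add: of_int_mult[symmetric] del: of_int_mult)
 ultimately have "br (e (a + d)) (e b) = - Hl (a + d)" unfolding exp Ea Ed Hl_add using ip by (simp add: br_scale_right scale_right_diff_distrib)
 thus ?thesis using 2 by simp
 next
 case 3
 have "br (e (a + d)) (e b) : RS (a + d + b)" using RS_br e ad b by blast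
 thus ?thesis using 3 RS_tri[of "a + d + b"] by simp
 qed
qed

end

lemma eps_com_sq [simp]: "(of_int (eps a b) :: complex) * of_int (eps a b) = 1" by (simp add: of_int_mult[symmetric] del: of_int_mult)

context e8
begin

lemma sim_tri_Hl:
 obtains e f where "!!i. i : {1..8} ==> e i : RS (sr i)" "!!i. i : {1..8} ==> f i : RS (- sr i)"
 "!!i. i : {1..8} ==> br (e i) (f i) = Hl (sr i)"
proof -
 obtain e f where ef: "!!i. i : {1..8} ==> e i : RS (sr i)" "!!i. i : {1..8} ==> f i : RS (- sr i)"
 "!!i. i : {1..8} ==> br (e i) (f i) : h"
 "!!i c. i : {1..8} ==> wt c (br (e i) (f i)) = of_int (ip c (sr i))" using sim_tri by blast
 thus ?thesis using that[of e f] Hl_uni by blast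
qed

lemma opp_Hl: "e8.Hl h (%i H. - al i H) c = - Hl c"
proof -
 interpret O: e8 sc br h "%i H. - al i H" by (rule oppo)
 show ?thesis by (rule O.Hl_uni[symmetric]) (simp_all add: h_neg opp_wt wt_h_min)
qed

text \<open>The positive half comes from \<open>pos_bas\<close>, the negative half from
  \<open>pos_bas\<close> for the opposite simple roots. The rows of plus and minus a simple root
  hold by construction in one half and by \<open>low_sim\<close> in the other;
  \<open>str_row_add\<close> carries them to all heights.\<close>

lemma che_bas_ex:
 "EX e. (ALL c. rt c --> e c : RS c & e c ~= 0) & (ALL a. rt a --> str_row e a)"
proof -
 obtain e f where ef: "!!i. i : {1..8} ==> e i : RS (sr i)" "!!i. i : {1..8} ==> f i : RS (- sr i)"
 "!!i. i : {1..8} ==> br (e i) (f i) = Hl (sr i)" using sim_tri_Hl by blast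
 \<comment> \<open>The sign makes \<open>br (e i) (g i)\<close> equal to \<open>- Hl (sr i)\<close>,
   as \<open>str_row\<close> demands.\<close>
 define g where "g i = - f i" for i
 have H0: "Hl (sr i) ~= 0" if "i : {1..8}" for i
 using wt_Hl[of "sr i" "sr i"] ip_sr_sel[OF that] wt_h_zer[of "sr i"] by (metis of_int_eq_0_iff zero_neq_numeral)
 have e0: "e i ~= 0" and f0: "f i ~= 0" if "i : {1..8}" for i using H0[OF that] ef(3)[OF that] by auto
 interpret O: e8 sc br h "%i H. - al i H" by (rule oppo)
 have ORS: "O.RS c = RS (- c)" for c by (rule opp_RS)
 have OHl: "O.Hl c = - Hl c" for c by (rule opp_Hl)
 have g: "g i : RS (- sr i)" "g i ~= 0" "br (g i) (e i) = Hl (sr i)" "br (e i) (g i) = - Hl (sr i)" if "i : {1..8}" for i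
 using ef[OF that] f0[OF that] RS_neg br_ant[of "f i" "e i"] by (simp_all add: g_def br_min_lef br_min_rig)
 obtain P where P: "!!c. rt c ==> npos c ==> P c : RS c & P c ~= 0" "!!i. i : {1..8} ==> P (sr i) = e i"
 "!!i c. i : {1..8} ==> rt c ==> npos c ==> ip c (sr i) = 1 ==>
 P c = sc (of_int (eps (sr i) (c - sr i))) (br (e i) (P (c - sr i)))"
 using pos_bas[of e] ef(1) e0 by metis
 obtain N where N: "!!c. rt c ==> npos c ==> N c : RS (- c) & N c ~= 0" "!!i. i : {1..8} ==> N (sr i) = g i"
 "!!i c. i : {1..8} ==> rt c ==> npos c ==> ip c (sr i) = 1 ==>
 N c = sc (of_int (eps (sr i) (c - sr i))) (br (g i) (N (c - sr i)))"
 using O.pos_bas[of g] g(1,2) unfolding ORS by metis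
 define b where "b c = (if npos c then P c else N (- c))" for c
 have nneg: "~ npos c" if "rt c" "npos (- c)" for c using npo_ant[of c] rt_nz that by blast
 have bneg: "b c = N (- c)" if "rt c" "npos (- c)" for c using nneg[OF that] by (simp add: b_def)
 have b: "b c : RS c & b c ~= 0" if "rt c" for c using rt_sig[OF that] P(1)[of c] N(1)[of "- c"] that bneg[of c] by (auto simp: b_def)
 have be: "b (sr i) = e i" if "i : {1..8}" for i using P(2)[OF that] npo_sr[OF that] by (simp add: b_def)
 have bg: "b (- sr i) = g i" if "i : {1..8}" for i using N(2)[OF that] bneg[of "- sr i"] npo_sr[OF that] rt_sr[OF that] by simp
 have triv: "br (b a) (b c) = 0" if "rt a" "rt c" "~ rt (a + c)" "a + c ~= 0" for a c
 using RS_br[of "b a" a "b c" c] b that RS_tri[of "a + c"] by auto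
 have up: "br (b (sr i)) (b c) = sc (of_int (eps (sr i) c)) (b (sr i + c))" if i: "i : {1..8}" and c: "rt c" "ip (sr i) c = - 1" for i c
 using rt_sig[OF c(1)]
 proof
 assume n: "npos c"
 have cs: "rt (sr i + c)" "npos (sr i + c)" "ip (sr i + c) (sr i) = 1"
 using rt_add[OF rt_sr[OF i] c(1)] c n npo_add[OF npo_sr[OF i]] ip_sr_sel[OF i] ip_sym[of c "sr i"] by (simp_all add: ip_lin)
 show ?thesis using P(3)[OF i cs] n cs(2) P(2)[OF i] npo_sr[OF i] by (simp add: b_def)
 next
 assume n: "npos (- c)"
 have c1: "rt (- c)" "ip (- c) (sr i) = 1" using c ip_sym[of c "sr i"] by simp_all
 have lo: "rt (- c - sr i)" "npos (- c - sr i)" using npo_low[OF c1(1) n i c1(2)] .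
 have "N (- c) = sc (of_int (eps (sr i) (- c - sr i))) (br (g i) (N (- c - sr i)))" by (rule N(3)[OF i c1(1) n c1(2)])
 moreover have "br (e i) (br (g i) (N (- c - sr i))) = - N (- c - sr i)"
 proof -
 have "br (- e i) (br (g i) (N (- c - sr i))) = N (- c - sr i)" by (rule O.low_sim[OF i _ _ _ c1])
 (use g[OF i] RS_neg[OF ef(1)[OF i]] N(1)[OF lo] in "simp_all add: ORS OHl br_min_rig")
 thus ?thesis by (simp add: br_min_lef) (metis minus_minus)
 qed
 moreover have "b (sr i + c) = N (- c - sr i)"
 proof -
 have e: "- (sr i + c) = - c - sr i" by simp
 have "rt (sr i + c)" using lo(1) e rt_umi by metis
 thus ?thesis using bneg[of "sr i + c"] lo(2) unfolding e by blast
 qed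
 moreover have "eps (sr i) (- c - sr i) = - eps (sr i) c" using eps_sel[OF rt_sr[OF i]] by (simp add: eps_lin)
 ultimately show ?thesis using bneg[OF c(1) n] be[OF i] by (simp add: br_scale_right br_min_rig)
 qed
 have down: "br (b (- sr i)) (b c) = sc (of_int (eps (- sr i) c)) (b (- sr i + c))" if i: "i : {1..8}" and c: "rt c" "ip (sr i) c = 1" for i c
 using rt_sig[OF c(1)]
 proof
 assume n: "npos c"
 have c1: "ip c (sr i) = 1" using c ip_sym[of c "sr i"] by simp
 have lo: "rt (c - sr i)" "npos (c - sr i)" using npo_low[OF c(1) n i c1] .
 have "P c = sc (of_int (eps (sr i) (c - sr i))) (br (e i) (P (c - sr i)))" by (rule P(3)[OF i c(1) n c1])
 moreover have "br (g i) (br (e i) (P (c - sr i))) = - P (c - sr i)"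
 proof -
 have "br (f i) (br (e i) (P (c - sr i))) = P (c - sr i)" by (rule low_sim[OF i ef(1,2,3)[OF i] c(1) c1]) (use P(1)[OF lo] in simp)
 thus ?thesis by (simp add: g_def br_min_lef)
 qed
 moreover have "b (- sr i + c) = P (c - sr i)" using lo by (simp add: b_def)
 moreover have "eps (sr i) (c - sr i) = - eps (sr i) c" using eps_sel[OF rt_sr[OF i]] by (simp add: eps_lin)
 ultimately show ?thesis using n bg[OF i] by (simp add: b_def br_scale_right br_min_rig)
 next
 assume n: "npos (- c)"
 have cs: "rt (sr i - c)" "npos (sr i - c)" "ip (sr i - c) (sr i) = 1"
 using rt_dif[OF rt_sr[OF i] c(1)] c npo_add[OF npo_sr[OF i] n] ip_sr_sel[OF i] ip_sym[of c "sr i"] by (simp_all add: ip_lin)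
 have "b (- sr i + c) = N (sr i - c)" using bneg[of "- sr i + c"] cs rt_umi[of "sr i - c"] by simp
 thus ?thesis using N(3)[OF i cs] bneg[OF c(1) n] bg[OF i] by simp
 qed
 have row1: "str_row b (sr i)" "str_row b (- sr i)" if i: "i : {1..8}" for i
 proof -
 note r = rt_sr[OF i]
 show "str_row b (sr i)" unfolding str_row_def
 proof (intro allI impI)
 fix c assume c: "rt c"
 show "br (b (sr i)) (b c) = (if rt (sr i + c) then sc (of_int (eps (sr i) c)) (b (sr i + c))
 else if sr i + c = 0 then - Hl (sr i) else 0)" using r c
 proof (cases rule: rt_add_cas)
 case 1
 thus ?thesis using up[OF i c] by simp
 next
 case 2
 hence "c = - sr i" by (simp only: add_eq_0_iff)
 thus ?thesis using be[OF i] bg[OF i] g[OF i] by simp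
 qed (use triv[OF r c] in simp)
 qed
 show "str_row b (- sr i)" unfolding str_row_def
 proof (intro allI impI)
 fix c assume c: "rt c"
 have r': "rt (- sr i)" using r by simp
 show "br (b (- sr i)) (b c) = (if rt (- sr i + c) then sc (of_int (eps (- sr i) c)) (b (- sr i + c))
 else if - sr i + c = 0 then - Hl (- sr i) else 0)" using r' c
 proof (cases rule: rt_add_cas)
 case 1
 thus ?thesis using down[OF i c] by simp
 next
 case 2
 hence "c = sr i" by (simp add: neg_eq_iff_add_eq_0[symmetric])
 thus ?thesis using be[OF i] bg[OF i] g[OF i] by (simp add: Hl_min)
 qed (use triv[OF r' c] in simp)
 qed
 qed
 have rows: "str_row b c & str_row b (- c)" if "npos c" "rt c" for c using that
 proof (induction c rule: npo_ht_ind)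
 case (less c)
 consider i where "i : {1..8}" "c = sr i"
 | i where "i : {1..8}" "ip c (sr i) = 1" "rt (c - sr i)" "npos (c - sr i)" using rt_des[OF less(3,1)] by blast
 thus ?case
 proof cases
 case 1
 thus ?thesis using row1 by blast
 next
 case 2
 define d where "d = c - sr i"
 have d: "rt d" "npos d" "ip (sr i) d = - 1" "c = sr i + d" "ht d < ht c" using 2 ip_sr_sel[OF 2(1)] ip_sym[of "sr i" c] ht_sr[OF 2(1)]
 by (simp_all add: d_def ip_lin ht_dif)
 have IH: "str_row b d" "str_row b (- d)" using less(2)[OF d(2,5,1)] by blast+
 note r = rt_sr[OF 2(1)]
 have "str_row b (sr i + d)" by (rule str_row_add[OF _ r d(1,3) row1(1)[OF 2(1)] IH(1)])
 (use b up[OF 2(1) d(1,3)] in simp_all)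
 moreover have "str_row b (- sr i + - d)" by (rule str_row_add[OF _ _ _ _ row1(2)[OF 2(1)] IH(2)])
 (use b r d down[OF 2(1), of "- d"] in simp_all)
 ultimately show ?thesis using d(4) by simp
 qed
 qed
 have "str_row b c" if "rt c" for c using rt_sig[OF that] rows[of c] rows[of "- c"] that by auto
 thus ?thesis using b by blast
qed

definition ev :: "lat => 'g" where
 "ev = (SOME e. (ALL c. rt c --> e c : RS c & e c ~= 0) & (ALL a. rt a --> str_row e a))"

lemma ev_RS: "rt c ==> ev c : RS c" and ev_nz: "rt c ==> ev c ~= 0" and str_row_ev: "rt c ==> str_row ev c"
 using someI_ex[OF che_bas_ex, folded ev_def] by blast+

lemma br_ev:
 assumes "rt a" "rt b"
 shows "br (ev a) (ev b) = (if rt (a + b) then sc (of_int (eps a b)) (ev (a + b)) else if a + b = 0 then - Hl a else 0)"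
 using str_row_ev[OF assms(1)] assms(2) unfolding str_row_def by blast

lemma br_h_ev: "H : h ==> rt c ==> br H (ev c) = sc (wt c H) (ev c)" by (rule RS_h[OF ev_RS])

lemma br_ev_h: "H : h ==> rt c ==> br (ev c) H = - sc (wt c H) (ev c)" using br_ant[of "ev c" H] br_h_ev by simp

end

lemma (in complex_lie_algebra) br_span_closed:
 assumes "!!x y. x : S ==> y : T ==> br x y : U" "subspace U" "x : span S" "y : span T"
 shows "br x y : U"
proof -
 have 1: "br x y : U" if "x : S" "y : span T" for x y using that(2)
 proof (induction rule: span_induct_alt)
 case (step c a b)
 thus ?case using assms(1,2) that(1) by (simp add: br_add_right br_scale_right subspace_add subspace_scale)
 qed (use assms(2) subspace_0 in simp)
 show ?thesis using assms(3)
 proof (induction rule: span_induct_alt)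
 case (step c a b)
 thus ?case using 1 assms(2,4) by (simp add: br_add_left br_scale_left subspace_add subspace_scale)
 qed (use assms(2) subspace_0 in simp)
qed

context e8
begin

section \<open>Coordinates\<close>

abbreviation roots :: "lat set" where "roots \<equiv> {c. rt c}"

lemma fin_roo: "finite roots"
proof -
 have "roots <= {c. RS c ~= {0}}" using roo_spa_ex RS_non by blast
 thus ?thesis using fin_wei finite_subset by blast
qed

definition expa :: "'g => (lat => complex) => 'g" where
 "expa H k = H + (SUM c:roots. sc (k c) (ev c))"

lemma exp_ex: "EX H k. H : h & x = expa H k"
proof -
 have "x : span (\<Union>c. RS c)" using RS_spa by simp
 thus ?thesis
 proof (induction rule: span_induct_alt)
 case base
 show ?case by (rule exI[of _ 0], rule exI[of _ "%_. 0"]) (simp add: expa_def h_0)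
 next
 case (step a x y)
 then obtain H k where Hk: "H : h" "y = expa H k" by blast
 obtain c where c: "x : RS c" using step by blast
 show ?case
 proof (cases "rt c")
 case True
 obtain t where t: "x = sc t (ev c)" using roo_spa_dim[OF True ev_RS[OF True] c ev_nz[OF True]] by blast
 have "sc a x + y = expa H (%d. k d + (if d = c then a * t else 0))"
 proof -
 have "(SUM d:roots. sc (if d = c then a * t else 0) (ev d)) = (SUM d:roots. if d = c then sc (a * t) (ev d) else 0)" by (rule sum.cong) auto
 also have "... = sc (a * t) (ev c)" using fin_roo True by (simp add: sum.delta)
 finally show ?thesis unfolding Hk(2) t by (simp add: expa_def scale_left_distrib sum.distrib)
 qed
 thus ?thesis using Hk(1) by blast
 next
 case False
 have "x : h" using c RS_zer RS_tri[OF False] h_0 by (cases "c = 0") auto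
 hence "sc a x + H : h" using Hk(1) h_add h_sca by blast
 moreover have "sc a x + y = expa (sc a x + H) k" unfolding Hk(2) by (simp add: expa_def)
 ultimately show ?thesis by blast
 qed
 qed
qed

lemma exp_uni:
 assumes "H : h" "H' : h" "expa H k = expa H' k'"
 shows "H = H'" "rt c ==> k c = k' c"
proof -
 define u where "u c = (if c = 0 then H - H' else sc (k c - k' c) (ev c))" for c
 have u: "u c : RS c" if "c : insert 0 roots" for c using that assms RS_zer h_diff ev_RS RS_scale by (auto simp: u_def)
 have "(SUM c:insert 0 roots. u c) = (H - H') + (SUM c:roots. sc (k c - k' c) (ev c))"
 proof -
 have "(SUM c:roots. u c) = (SUM c:roots. sc (k c - k' c) (ev c))" by (rule sum.cong) (auto simp: u_def)
 thus ?thesis using fin_roo by (simp add: u_def)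
 qed
 also have "... = 0" using assms(3) by (simp add: expa_def scale_left_diff_distrib sum_subtractf algebra_simps)
 finally have 0: "u c = 0" if "c : insert 0 roots" for c using RS_ind[of "insert 0 roots" u c] u fin_roo that by simp
 show "H = H'" using 0[of 0] by (simp add: u_def)
 show "k c = k' c" if "rt c" using 0[of c] that rt_nz ev_nz by (auto simp: u_def)
qed

definition hp :: "'g => 'g" where
 "hp x = (SOME H. H : h & (EX k. x = expa H k))"

text \<open>Outside the roots the coefficients are arbitrary, hence the hypothesis
  \<open>rt c\<close> in the rules for \<open>cf\<close>.\<close>

definition cf :: "'g => lat => complex" where
 "cf x = (SOME k. x = expa (hp x) k)"

lemma hp_h [simp]: "hp x : h" and expa: "expa (hp x) (cf x) = x"
proof -
 have "hp x : h & (EX k. x = expa (hp x) k)" unfolding hp_def by (rule someI_ex) (use exp_ex in blast)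
 thus "hp x : h" "expa (hp x) (cf x) = x" using someI_ex[of "%k. x = expa (hp x) k"] unfolding cf_def by auto
qed

lemma hp_cfI:
 assumes "H : h" "x = expa H k"
 shows "hp x = H" "rt c ==> cf x c = k c" using exp_uni[OF hp_h assms(1)] expa[of x] assms(2) by metis+

lemma exp_add: "expa H k + expa H' k' = expa (H + H') (%c. k c + k' c)"
 by (simp add: expa_def scale_left_distrib sum.distrib algebra_simps)

lemma exp_sca: "sc a (expa H k) = expa (sc a H) (%c. a * k c)" by (simp add: expa_def scale_right_distrib scale_sum_right)

lemma hp_add: "hp (x + y) = hp x + hp y" and cf_add: "rt c ==> cf (x + y) c = cf x c + cf y c"
proof -
 have "x + y = expa (hp x + hp y) (%c. cf x c + cf y c)" unfolding exp_add[symmetric] expa ..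
 from hp_cfI[OF h_add[OF hp_h hp_h] this]
 show "hp (x + y) = hp x + hp y" "rt c ==> cf (x + y) c = cf x c + cf y c" by blast+
qed

lemma hp_sca: "hp (sc a x) = sc a (hp x)" and cf_sca: "rt c ==> cf (sc a x) c = a * cf x c"
proof -
 have "sc a x = expa (sc a (hp x)) (%c. a * cf x c)" unfolding exp_sca[symmetric] expa ..
 from hp_cfI[OF h_sca[OF hp_h] this]
 show "hp (sc a x) = sc a (hp x)" "rt c ==> cf (sc a x) c = a * cf x c" by blast+
qed

lemma hp_zer [simp]: "hp 0 = 0" using hp_sca[of 0 0] by simp
lemma cf_zer [simp]: "rt c ==> cf 0 c = 0" using cf_sca[of c 0 0] by simp
lemma hp_min: "hp (- x) = - hp x" using hp_sca[of "-1" x] by simp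
lemma cf_min: "rt c ==> cf (- x) c = - cf x c" using cf_sca[of c "-1" x] by simp
lemma hp_dif: "hp (x - y) = hp x - hp y" using hp_add[of x "- y"] by (simp add: hp_min)
lemma cf_dif: "rt c ==> cf (x - y) c = cf x c - cf y c" using cf_add[of c x "- y"] by (simp add: cf_min)
lemma cf_sum: "rt c ==> cf (SUM i:I. u i) c = (SUM i:I. cf (u i) c)" by (induction I rule: infinite_finite_induct) (simp_all add: cf_add)
lemma hp_sum: "hp (SUM i:I. u i) = (SUM i:I. hp (u i))" by (induction I rule: infinite_finite_induct) (simp_all add: hp_add)

lemma hp_on_h: "H : h ==> hp H = H" and cf_on_h: "H : h ==> rt c ==> cf H c = 0"
proof -
 assume H: "H : h"
 have e: "H = expa H (%_. 0)" by (simp add: expa_def)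
 show "hp H = H" "rt c ==> cf H c = 0" using hp_cfI[OF H e] by blast+
qed

lemma hp_ev: "rt d ==> hp (ev d) = 0" and cf_ev: "rt d ==> rt c ==> cf (ev d) c = (if c = d then 1 else 0)"
proof -
 assume d: "rt d"
 have "(SUM c:roots. sc (if c = d then 1 else 0) (ev c)) = (SUM c:roots. if c = d then sc 1 (ev c) else 0)" by (rule sum.cong) auto
 hence e: "ev d = expa 0 (%c. if c = d then 1 else 0)" using fin_roo d by (simp add: expa_def sum.delta)
 show "hp (ev d) = 0" "rt c ==> cf (ev d) c = (if c = d then 1 else 0)" using hp_cfI[OF h_0 e] by blast+
qed

lemma hp_cf_eqI: "hp x = hp y ==> (!!c. rt c ==> cf x c = cf y c) ==> x = y" using expa[of x] expa[of y] unfolding expa_def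
 by (metis (mono_tags, lifting) mem_Collect_eq sum.cong)

lemma br_ev_exp:
 assumes n: "rt n"
 shows "br x (ev n) = sc (wt n (hp x)) (ev n) +
 (SUM c:roots. sc (cf x c) (if rt (c + n) then sc (of_int (eps c n)) (ev (c + n)) else if c + n = 0 then - Hl c else 0))"
proof -
 have "br x (ev n) = br (expa (hp x) (cf x)) (ev n)" unfolding expa ..
 also have "... = sc (wt n (hp x)) (ev n) + (SUM c:roots. sc (cf x c) (br (ev c) (ev n)))"
 unfolding expa_def br_add_left br_sum_lef br_scale_left br_h_ev[OF hp_h n] ..
 finally show ?thesis using br_ev[OF _ n] by simp
qed

lemma cf_br_ev:
 assumes n: "rt n" and b: "rt b"
 shows "cf (br x (ev n)) b = (if b = n then wt n (hp x) else if rt (b - n) then of_int (eps (b - n) n) * cf x (b - n) else 0)"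
proof -
 have t: "cf (sc (cf x c) (if rt (c + n) then sc (of_int (eps c n)) (ev (c + n)) else if c + n = 0 then - Hl c else 0)) b
 = (if c = b - n then of_int (eps (b - n) n) * cf x (b - n) else 0)" if "c : roots" for c
 using b cf_on_h[OF h_neg[OF Hl_h] b] by (auto simp: cf_sca cf_ev eq_diff_eq)
 have "cf (br x (ev n)) b = wt n (hp x) * (if b = n then 1 else 0)
 + (SUM c:roots. if c = b - n then of_int (eps (b - n) n) * cf x (b - n) else 0)"
 unfolding br_ev_exp[OF n] cf_add[OF b] cf_sca[OF b] cf_ev[OF n b] cf_sum[OF b]
 using t by (intro arg_cong2[where f = "(+)"] refl sum.cong) (auto simp: cf_sca[OF b])
 thus ?thesis using fin_roo by (auto simp: sum.delta)
qed

lemma hp_br_ev: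
 assumes n: "rt n"
 shows "hp (br x (ev n)) = sc (cf x (- n)) (Hl n)"
proof -
 have t: "hp (sc (cf x c) (if rt (c + n) then sc (of_int (eps c n)) (ev (c + n)) else if c + n = 0 then - Hl c else 0))
 = (if c = - n then sc (cf x (- n)) (Hl n) else 0)" if "c : roots" for c using hp_ev[of "c + n"] hp_on_h[OF Hl_h, of n] n
 by (auto simp: hp_sca hp_min Hl_min add_eq_0_iff2 hp_on_h)
 have "hp (br x (ev n)) = (SUM c:roots. if c = - n then sc (cf x (- n)) (Hl n) else 0)"
 unfolding br_ev_exp[OF n] hp_add hp_sum using t by (simp add: hp_sca hp_ev[OF n])
 thus ?thesis using fin_roo n by (simp add: sum.delta)
qed

lemma br_exp_h: "H : h ==> br x H = expa 0 (%c. - (wt c H * cf x c))"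
proof -
 assume H: "H : h"
 have "br x H = br (expa (hp x) (cf x)) H" unfolding expa ..
 also have "... = (SUM c:roots. sc (cf x c) (br (ev c) H))" unfolding expa_def br_add_left br_sum_lef br_scale_left h_com[OF hp_h H] by simp
 also have "... = (SUM c:roots. sc (- (wt c H * cf x c)) (ev c))" by (rule sum.cong) (simp_all add: br_ev_h[OF H] mult.commute)
 finally show ?thesis by (simp add: expa_def)
qed

lemma hp_br_h: "H : h ==> hp (br x H) = 0" and cf_br_h: "H : h ==> rt c ==> cf (br x H) c = - (wt c H * cf x c)"
 using hp_cfI[OF h_0 br_exp_h] by blast+

section \<open>Parabolic and Levi subalgebras\<close>

text \<open>The span of \<open>h\<close> and the root vectors at roots in \<open>A\<close>,
  described by the vanishing of the other coordinates. \<open>A\<close> may contain points that are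
  no roots, so it can be cut out by conditions on lattice coordinates.\<close>

definition PS :: "lat set => 'g set" where
 "PS A = {x. ALL c. rt c --> c ~: A --> cf x c = 0}"

lemma PS_subs: "subspace (PS A)" by (rule subspaceI) (simp_all add: PS_def cf_add cf_sca)

lemma PS_h: "H : h ==> H : PS A" by (simp add: PS_def cf_on_h)
lemma PS_ev: "rt c ==> c : A ==> ev c : PS A" by (auto simp: PS_def cf_ev)
lemma PS_spa: "PS A = span (h \<union> ev ` (A \<inter> roots))"
proof
 show "span (h \<union> ev ` (A \<inter> roots)) <= PS A" by (rule span_minimal) (auto simp: PS_subs PS_h PS_ev)
 show "PS A <= span (h \<union> ev ` (A \<inter> roots))"
 proof
 fix x assume x: "x : PS A"
 have "sc (cf x c) (ev c) : span (h \<union> ev ` (A \<inter> roots))" if "c : roots" for c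
 proof (cases "c : A")
 case True
 thus ?thesis using that by (intro span_scale span_base) blast
 next
 case False
 hence "cf x c = 0" using x that by (simp add: PS_def)
 thus ?thesis by (simp add: span_zero)
 qed
 hence "expa (hp x) (cf x) : span (h \<union> ev ` (A \<inter> roots))"
 unfolding expa_def by (intro span_add span_sum span_base[of "hp x"]) simp_all
 thus "x : span (h \<union> ev ` (A \<inter> roots))" by (simp add: expa)
 qed
qed

definition closed_roots :: "lat set => bool" where
 "closed_roots A = ((ALL a:A. ALL b:A. rt a --> rt b --> rt (a + b) --> a + b : A))"

lemma PS_sub:
 assumes "closed_roots A" shows "lie_subalgebra sc br (PS A)" unfolding lie_subalgebra_def
proof (intro conjI ballI)
 show "subspace (PS A)" by (rule PS_subs)
 fix x y assume xy: "x : PS A" "y : PS A"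
 show "br x y : PS A"
 proof (rule br_span_closed[OF _ PS_subs xy[unfolded PS_spa]])
 fix x y assume "x : h \<union> ev ` (A \<inter> roots)" "y : h \<union> ev ` (A \<inter> roots)"
 then consider "x : h" "y : h" | c where "x : h" "y = ev c" "c : A" "rt c"
 | c where "y : h" "x = ev c" "c : A" "rt c"
 | c d where "x = ev c" "c : A" "rt c" "y = ev d" "d : A" "rt d" by blast
 thus "br x y : PS A"
 proof cases
 case 1
 thus ?thesis using PS_h[OF h_0] by (simp add: h_com)
 next
 case 2
 thus ?thesis using PS_ev subspace_scale[OF PS_subs] by (simp add: br_h_ev)
 next
 case 3
 thus ?thesis using PS_ev subspace_scale[OF PS_subs] subspace_neg[OF PS_subs] by (simp add: br_ev_h)
 next
 case 4
 thus ?thesis using assms PS_ev PS_h[OF h_neg[OF Hl_h]] PS_h[OF h_0] subspace_scale[OF PS_subs] unfolding closed_roots_def by (simp add: br_ev)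
 qed
 qed
qed

definition para :: "nat set => lat set" where
 "para pp = {c. ALL i:{1..8} - pp. 0 <= lc c i}"

definition levi :: "nat set => lat set" where
 "levi pp = {c. ALL i:{1..8} - pp. lc c i = 0}"

lemma clo_par: "closed_roots (para pp)" and clo_lev: "closed_roots (levi pp)" by (auto simp: closed_roots_def para_def levi_def)

lemma RS_PS: "rt c ==> c : A ==> RS c <= PS A"
proof
 fix x assume c: "rt c" "c : A" and "x : RS c"
 then obtain t where "x = sc t (ev c)" using roo_spa_dim[OF c(1) ev_RS _ ev_nz] by blast
 thus "x : PS A" using PS_ev[OF c] subspace_scale[OF PS_subs] by simp
qed

lemma roo_spa_sim:
 assumes "i : {1..8}"
 shows "root_space sc br h (al i) = RS (sr i)" "root_space sc br h (%H. - al i H) = RS (- sr i)"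
 by (simp_all add: root_space_def RS_def wt_min wt_sr[OF assms])

lemma pos_roo_wt: "rt c ==> npos c ==> positive_root sc br h {1..8} al (wt c)" unfolding positive_root_def
 by (intro conjI is_roo_wt exI[of _ "%i. nat (lc c i)"]) (auto simp: wt_def npos_def intro!: sum.cong)

lemma pos_roo_RS:
 assumes "positive_root sc br h {1..8} al be"
 shows "EX c. rt c & npos c & root_space sc br h be = RS c"
proof -
 have r: "is_root sc br h be" using assms unfolding positive_root_def by blast
 then obtain c where c: "rt c" "ALL H:h. be H = wt c H" using is_roo_ex by blast
 obtain n where n: "ALL H:h. be H = (SUM i:{1..8}. of_nat (n i) * al i H)" using assms unfolding positive_root_def by (elim conjE exE)
 define d where "d = L (n 1) (n 2) (n 3) (n 4) (n 5) (n 6) (n 7) (n 8)"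
 have lc: "lc d i = int (n i)" if "i : {1..8}" for i using that unfolding I8 d_def by auto
 have "wt c H = wt d H" if "H : h" for H
 proof -
 have "wt d H = (SUM i:{1..8}. of_nat (n i) * al i H)" unfolding wt_def by (intro sum.cong refl) (simp add: lc)
 thus ?thesis using c n that by simp
 qed
 hence "c = d" by (rule wt_inj)
 hence "npos c" by (simp add: npos_def lc)
 moreover have "root_space sc br h be = RS c" using c(2) by (auto simp: root_space_def RS_def)
 ultimately show ?thesis using c(1) by blast
qed

lemma sub_ev_clo:
 assumes T: "lie_subalgebra sc br T" and "rt a" "rt b" "ev a : T" "ev b : T" "ip a b = - 1"
 shows "ev (a + b) : T"
proof -
 have s: "subspace T" and m: "br (ev a) (ev b) : T" using assms unfolding lie_subalgebra_def by blast+
 have "br (ev a) (ev b) = sc (of_int (eps a b)) (ev (a + b))" using br_ev[OF assms(2,3)] rt_add[OF assms(2,3)] assms(6) by simp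
 hence "ev (a + b) = sc (of_int (eps a b)) (br (ev a) (ev b))" by simp
 thus ?thesis using subspace_scale[OF s m] by metis
qed

text \<open>The descent of \<open>rt_des\<close> removes only simple roots with positive coordinate
  in \<open>c\<close>; these belong to \<open>pp\<close>, because the others do not occur in
  \<open>c\<close>. The sign \<open>s\<close> treats positive and negative roots at once.\<close>

lemma sub_lev_ev:
 assumes T: "lie_subalgebra sc br T" and "npos c" "rt c" "c : levi pp" and "s = 1 | s = - 1"
 and "!!i. i : pp \<inter> {1..8} ==> ev (if s = (1::int) then sr i else - sr i) : T"
 shows "ev (if s = 1 then c else - c) : T" using assms(2-4)
proof (induction c rule: npo_ht_ind)
 case (less c)
 have lv: "i : pp" if "i : {1..8}" "0 < lc c i" for i using less(4) that by (force simp: levi_def)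
 consider i where "i : {1..8}" "c = sr i"
 | i where "i : {1..8}" "0 < lc c i" "ip c (sr i) = 1" "rt (c - sr i)" "npos (c - sr i)" using rt_des[OF less(3,1)] by blast
 thus ?case
 proof cases
 case 1
 thus ?thesis using assms(6)[of i] lv[of i] lc_sr[of i i] by (simp split: if_splits)
 next
 case 2
 note i = lv[OF 2(1,2)]
 have "c - sr i : levi pp" using less(4) i by (auto simp: levi_def lc_sr)
 hence IH: "ev (if s = 1 then c - sr i else - (c - sr i)) : T" using less(2)[OF 2(5) _ 2(4)] ht_sr[OF 2(1)] by (simp add: ht_dif)
 have ip: "ip (sr i) (c - sr i) = - 1" using 2(3) ip_sr_sel[OF 2(1)] ip_sym[of c "sr i"] by (simp add: ip_lin)
 have g: "ev (if s = 1 then sr i else - sr i) : T" using assms(6)[of i] i 2(1) by blast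
 show ?thesis
 proof (cases "s = 1")
 case True
 thus ?thesis using sub_ev_clo[OF T rt_sr[OF 2(1)] 2(4) _ _ ip] g IH by simp
 next
 case False
 have "ev (- sr i + - (c - sr i)) : T" using sub_ev_clo[OF T, of "- sr i" "- (c - sr i)"] rt_sr[OF 2(1)] 2(4) g IH ip False
 by (simp del: minus_diff_eq)
 thus ?thesis using False by simp
 qed
 qed
qed

lemma PS_lea:
 assumes T: "lie_subalgebra sc br T" and "h <= T" "!!c. rt c ==> c : A ==> ev c : T"
 shows "PS A <= T" unfolding PS_spa using T assms(2,3) unfolding lie_subalgebra_def by (intro span_minimal) auto

abbreviation "parab \<equiv> standard_parabolic sc br h {1..8} al"
abbreviation "slevi \<equiv> standard_levi sc br h al"

text \<open>Positive root vectors lie in the Borel subalgebra. A negative root in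
  \<open>para pp\<close> has coordinate 0 outside \<open>pp\<close>, so it is a root of the Levi
  subalgebra and is reached from the \<open>- sr i\<close>.\<close>

lemma sta_par_eq:
 assumes "pp <= {1..8}"
 shows "parab pp = PS (para pp)"
proof
 let ?S = "borel sc br h {1..8} al \<union> (UN i:pp. root_space sc br h (%H. - al i H))"
 have bo: "borel sc br h {1..8} al <= PS (para pp)" unfolding borel_def
 proof (rule span_minimal[OF _ PS_subs], intro Un_least UN_least)
 show "h <= PS (para pp)" using PS_h by blast
 fix be assume "be : {be. positive_root sc br h {1..8} al be}"
 then obtain c where "rt c" "npos c" "root_space sc br h be = RS c" using pos_roo_RS by blast
 thus "root_space sc br h be <= PS (para pp)" using RS_PS[of c "para pp"] by (auto simp: para_def npos_def)
 qed
 have "root_space sc br h (%H. - al i H) <= PS (para pp)" if "i : pp" for i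
 proof -
 have i: "i : {1..8}" using that assms by blast
 have "- sr i : para pp" using that by (auto simp: para_def lc_sr)
 thus ?thesis using RS_PS[of "- sr i" "para pp"] rt_sr[OF i] by (simp add: roo_spa_sim[OF i])
 qed
 hence "?S <= PS (para pp)" using bo by blast
 thus "parab pp <= PS (para pp)" unfolding standard_parabolic_def lie_generated_def using PS_sub[OF clo_par] by blast
 show "PS (para pp) <= parab pp" unfolding standard_parabolic_def lie_generated_def
 proof (rule Inter_greatest)
 fix T assume "T : {T. lie_subalgebra sc br T & ?S <= T}"
 hence T: "lie_subalgebra sc br T" and S: "?S <= T" by blast+
 show "PS (para pp) <= T"
 proof (rule PS_lea[OF T])
 show "h <= T" using S unfolding borel_def using span_superset by blast
 fix c assume c: "rt c" "c : para pp"
 show "ev c : T" using rt_sig[OF c(1)]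
 proof
 assume n: "npos c"
 have "ev c : root_space sc br h (wt c)" using ev_RS[OF c(1)] by (simp add: RS_def root_space_def)
 hence "ev c : borel sc br h {1..8} al" unfolding borel_def using pos_roo_wt[OF c(1) n] by (intro span_base) blast
 thus ?thesis using S by blast
 next
 assume n: "npos (- c)"
 have "- c : levi pp" using c(2) n by (force simp: levi_def para_def npos_def)
 moreover have "ev (- sr i) : T" if "i : pp \<inter> {1..8}" for i
 proof -
 have "ev (- sr i) : root_space sc br h (%H. - al i H)" using that ev_RS[of "- sr i"] rt_sr[of i] by (simp add: roo_spa_sim)
 thus ?thesis using S that by blast
 qed
 ultimately show ?thesis using sub_lev_ev[OF T n, of pp "- 1"] c(1) by simp
 qed
 qed
 qed
qed

lemma sta_lev_eq:
 assumes "pp <= {1..8}"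
 shows "slevi pp = PS (levi pp)"
proof
 let ?S = "h \<union> (UN i:pp. root_space sc br h (al i) \<union> root_space sc br h (%H. - al i H))"
 have "root_space sc br h (al i) \<union> root_space sc br h (%H. - al i H) <= PS (levi pp)" if "i : pp" for i
 proof -
 have i: "i : {1..8}" using that assms by blast
 have "sr i : levi pp" "- sr i : levi pp" using that by (auto simp: levi_def lc_sr)
 thus ?thesis using RS_PS[of "- sr i" "levi pp"] RS_PS[of "sr i" "levi pp"] rt_sr[OF i] by (simp add: roo_spa_sim[OF i])
 qed
 hence "?S <= PS (levi pp)" using PS_h by blast
 thus "slevi pp <= PS (levi pp)" unfolding standard_levi_def lie_generated_def using PS_sub[OF clo_lev] by blast
 show "PS (levi pp) <= slevi pp" unfolding standard_levi_def lie_generated_def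
 proof (rule Inter_greatest)
 fix T assume "T : {T. lie_subalgebra sc br T & ?S <= T}"
 hence T: "lie_subalgebra sc br T" and S: "?S <= T" by blast+
 have sT: "ev (sr i) : T" "ev (- sr i) : T" if "i : pp \<inter> {1..8}" for i
 proof -
 have "ev (sr i) : root_space sc br h (al i)" "ev (- sr i) : root_space sc br h (%H. - al i H)"
 using that ev_RS[of "sr i"] ev_RS[of "- sr i"] rt_sr[of i] by (simp_all add: roo_spa_sim)
 thus "ev (sr i) : T" "ev (- sr i) : T" using S that by blast+
 qed
 show "PS (levi pp) <= T"
 proof (rule PS_lea[OF T])
 show "h <= T" using S by blast
 fix c assume c: "rt c" "c : levi pp"
 show "ev c : T" using rt_sig[OF c(1)]
 proof
 assume "npos c"
 thus ?thesis using sub_lev_ev[OF T, of c pp 1] c sT by simp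
 next
 assume n: "npos (- c)"
 have "- c : levi pp" using c(2) by (simp add: levi_def)
 thus ?thesis using sub_lev_ev[OF T n, of pp "- 1"] c sT by simp
 qed
 qed
 qed
qed

text \<open>The derived algebra of the Levi subalgebra, by \<open>der_lev_eq\<close>: passing to
  brackets only cuts the Cartan part down to the span of the coroots of \<open>pp\<close>.\<close>

definition levd :: "nat set => 'g set" where
 "levd pp = {x : PS (levi pp). hp x : span ((%i. Hl (sr i)) ` pp)}"

lemma Hl_lev:
 assumes "pp <= {1..8}" "c : levi pp"
 shows "Hl c : span ((%i. Hl (sr i)) ` pp)"
proof -
 have "Hl c = (SUM i:{1..8}. sc (of_int (lc c i)) (Hl (sr i)))"
 proof (rule Hl_uni[symmetric])
 show "(SUM i:{1..8}. sc (of_int (lc c i)) (Hl (sr i))) : h" by (intro h_sum h_sca Hl_h)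
 fix d
 have "wt d (SUM i:{1..8}. sc (of_int (lc c i)) (Hl (sr i))) = (SUM i:{1..8}. of_int (lc c i * ip (sr i) d))"
 by (subst wt_h_sum) (simp_all add: h_sca wt_h_sca ip_sym[of d])
 also have "... = of_int (ip d c)" unfolding ip_sym[of d c] ip_exp[of c d] by (rule of_int_sum[symmetric])
 finally show "wt d (SUM i:{1..8}. sc (of_int (lc c i)) (Hl (sr i))) = of_int (ip d c)" .
 qed
 also have "... = (SUM i:pp. sc (of_int (lc c i)) (Hl (sr i)))" by (rule sum.mono_neutral_right) (use assms in "auto simp: levi_def")
 also have "... : span ((%i. Hl (sr i)) ` pp)" by (intro span_sum span_scale span_base) blast
 finally show ?thesis .
qed

lemma lev_der_sub: "subspace (levd pp)" unfolding levd_def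
 using PS_subs[of "levi pp"] subspace_span[of "(%i. Hl (sr i)) ` pp"]
 by (auto intro!: subspaceI simp: hp_add hp_sca subspace_add subspace_scale subspace_0)

lemma der_lev_eq:
 assumes pp: "pp <= {1..8}"
 shows "derived_algebra sc br (PS (levi pp)) = levd pp"
proof
 have evd: "sc t (ev c) : levd pp" if "rt c" "c : levi pp" for c t
 using PS_ev[OF that] subspace_scale[OF PS_subs] that(1) by (simp add: levd_def hp_sca hp_ev span_zero)
 have 0: "0 : levd pp" using lev_der_sub by (rule subspace_0)
 have "br x y : levd pp" if "x : PS (levi pp)" "y : PS (levi pp)" for x y
 proof (rule br_span_closed[OF _ lev_der_sub that[unfolded PS_spa]])
 fix x y assume "x : h \<union> ev ` (levi pp \<inter> roots)" "y : h \<union> ev ` (levi pp \<inter> roots)"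
 then consider "x : h" "y : h" | c where "x : h" "y = ev c" "c : levi pp" "rt c"
 | c where "y : h" "x = ev c" "c : levi pp" "rt c"
 | c d where "x = ev c" "c : levi pp" "rt c" "y = ev d" "d : levi pp" "rt d" by blast
 thus "br x y : levd pp"
 proof cases
 case 1
 thus ?thesis using 0 by (simp add: h_com)
 next
 case 2
 thus ?thesis using evd by (simp add: br_h_ev)
 next
 case 3
 thus ?thesis using evd[of c "- wt c y"] by (simp add: br_ev_h)
 next
 case 4
 have "- Hl c : levd pp" using Hl_lev[OF pp 4(2)] PS_h[OF Hl_h] hp_on_h[OF Hl_h] subspace_neg[OF PS_subs]
 by (simp add: levd_def hp_min span_neg)
 thus ?thesis using 4 0 evd clo_lev[of pp] unfolding closed_roots_def by (simp add: br_ev)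
 qed
 qed
 thus "derived_algebra sc br (PS (levi pp)) <= levd pp"
 unfolding derived_algebra_def by (intro span_minimal[OF _ lev_der_sub]) blast
 let ?D = "derived_algebra sc br (PS (levi pp))"
 have sD: "subspace ?D" unfolding derived_algebra_def by (rule subspace_span)
 have brD: "br x y : ?D" if "x : PS (levi pp)" "y : PS (levi pp)" for x y
 unfolding derived_algebra_def using that by (intro span_base) blast
 show "levd pp <= ?D"
 proof
 fix x assume x: "x : levd pp"
 have evD: "ev c : ?D" if "rt c" "c : levi pp" for c
 proof -
 have "br (Hl c) (ev c) = sc 2 (ev c)" using that(1) by (simp add: br_h_ev rt_def)
 hence "ev c = sc (1/2) (br (Hl c) (ev c))" by simp
 thus ?thesis using brD[OF PS_h[OF Hl_h] PS_ev[OF that]] subspace_scale[OF sD] by metis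
 qed
 have "Hl (sr i) : ?D" if "i : pp" for i
 proof -
 have i: "i : {1..8}" using that pp by blast
 have l: "sr i : levi pp" "- sr i : levi pp" using that by (auto simp: levi_def lc_sr)
 have "br (ev (sr i)) (ev (- sr i)) = - Hl (sr i)" using rt_sr[OF i] by (simp add: br_ev)
 moreover have "br (ev (sr i)) (ev (- sr i)) : ?D" using l rt_sr[OF i] by (intro brD PS_ev) simp_all
 ultimately show ?thesis using subspace_neg[OF sD] by (metis minus_minus)
 qed
 hence "hp x : ?D" using x sD span_minimal[of "(%i. Hl (sr i)) ` pp" ?D] by (auto simp: levd_def)
 moreover have "sc (cf x c) (ev c) : ?D" if "c : roots" for c
 proof (cases "c : levi pp")
 case False
 hence "cf x c = 0" using x that by (simp add: levd_def PS_def)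
 thus ?thesis using subspace_0[OF sD] by simp
 qed (use evD that subspace_scale[OF sD] in simp)
 ultimately have "expa (hp x) (cf x) : ?D" unfolding expa_def by (intro subspace_add[OF sD] subspace_sum[OF sD])
 thus "x : ?D" by (simp add: expa)
 qed
qed

end

text \<open>The basis of the lattice dual to the simple roots, i.e. the rows of the inverse of the
 (unimodular) Cartan matrix.\<close>

definition fw :: "nat => lat" where
 "fw i = (if i = 1 then L 2 3 4 5 6 4 2 3
 else if i = 2 then L 3 6 8 10 12 8 4 6
 else if i = 3 then L 4 8 12 15 18 12 6 9
 else if i = 4 then L 5 10 15 20 24 16 8 12
 else if i = 5 then L 6 12 18 24 30 20 10 15
 else if i = 6 then L 4 8 12 16 20 14 7 10
 else if i = 7 then L 2 4 6 8 10 7 4 5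
 else if i = 8 then L 3 6 9 12 15 10 5 8
 else 0)"

lemma ip_fw: "i : {1..8} ==> j : {1..8} ==> ip (sr j) (fw i) = (if i = j then 1 else 0)"
 unfolding I8 by (elim insertE emptyE; hypsubst; unfold ip_sr_row fw_def; simp)

context e8
begin

lemma h_pre: "EX H:h. ALL i:{1..8}. wt (sr i) H = t i"
proof -
 define H where "H = (SUM i:{1..8}. sc (t i) (Hl (fw i)))"
 have "H : h" unfolding H_def by (intro h_sum h_sca Hl_h)
 moreover have "wt (sr j) H = t j" if "j : {1..8}" for j
 proof -
 have "wt (sr j) H = (SUM i:{1..8}. t i * of_int (ip (sr j) (fw i)))" unfolding H_def by (subst wt_h_sum) (simp_all add: h_sca wt_h_sca)
 also have "... = (SUM i:{1..8}. if i = j then t i else 0)" by (rule sum.cong) (use that ip_fw in auto)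
 finally show ?thesis using that by simp
 qed
 ultimately show ?thesis by blast
qed

section \<open>Derivations and the centre of a parabolic subalgebra\<close>

lemma PS_ind [consumes 1, case_names h ev add]:
 assumes "x : PS A" "!!H. H : h ==> P H" "!!c. rt c ==> c : A ==> P (ev c)"
 "!!a x y. x : PS A ==> y : PS A ==> P x ==> P y ==> P (sc a x + y)"
 shows "P x"
proof -
 have "x : PS A & P x" using assms(1)[unfolded PS_spa]
 proof (induction rule: span_induct_alt)
 case base
 show ?case using assms(2)[OF h_0] PS_h[OF h_0] by blast
 next
 case (step a x y)
 hence "x : PS A & P x" using assms(2,3) PS_h PS_ev by blast
 thus ?case using step assms(4) PS_subs[of A] by (simp add: subspace_add subspace_scale)
 qed
 thus ?thesis ..
qed

lemma PS_cen:
 assumes A: "!!c. rt c ==> npos c ==> c : A" and "!!y. y : PS A ==> br x y = 0"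
 shows "x = 0"
proof -
 have c0: "cf x c = 0" if "rt c" for c
 proof -
 have "br x (Hl c) = 0" using assms(2) PS_h[OF Hl_h] by blast
 hence "wt c (Hl c) * cf x c = 0" using cf_br_h[OF Hl_h that, of x c] that by simp
 thus ?thesis using that by (simp add: rt_def)
 qed
 have xh: "x = hp x" by (rule hp_cf_eqI) (simp_all add: hp_on_h c0 cf_on_h)
 have "wt (sr i) (hp x) = 0" if i: "i : {1..8}" for i
 proof -
 have "br (hp x) (ev (sr i)) = 0" using assms(2)[OF PS_ev] A rt_sr[OF i] npo_sr[OF i] xh by metis
 thus ?thesis using br_h_ev[OF hp_h rt_sr[OF i], of x] ev_nz[OF rt_sr[OF i]] by simp
 qed
 hence "hp x = 0" by (intro h_eqI) (simp_all add: h_0 wt_h_zer)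
 thus ?thesis using xh by simp
qed

lemma Hl_nz: "rt c ==> Hl c ~= 0" using wt_Hl[of c c] wt_h_zer[of c] by (auto simp: rt_def simp del: wt_Hl)

text \<open>Subtracting inner derivations, \<open>D\<close> first maps \<open>h\<close> to itself, then kills \<open>h\<close> and acts by scalars
 on the root vectors; these scalars are additive, hence given by an element of \<open>h\<close>.\<close>

lemma PS_inn_der:
 assumes A: "closed_roots A" "!!c. rt c ==> npos c ==> c : A" and lin: "linear_on sc sc (PS A) D" and Dp: "!!x. x : PS A ==> D x : PS A"
 and der: "!!x y. x : PS A ==> y : PS A ==> D (br x y) = br (D x) y + br x (D y)"
 shows "EX z:PS A. ALL x:PS A. D x = br z x"
proof -
 have Dadd: "D (x + y) = D x + D y" and Dsc: "D (sc a x) = sc a (D x)" if "x : PS A" "y : PS A" for x y a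
 using lin that unfolding linear_on_def by blast+
 note ps = subspace_scale[OF PS_subs[of A]] subspace_add[OF PS_subs[of A]]
 have D0: "D 0 = 0" using Dsc[of 0 0 0] PS_h[OF h_0] by simp
 have brp: "br x y : PS A" if "x : PS A" "y : PS A" for x y using PS_sub[OF A(1)] that unfolding lie_subalgebra_def by blast
 \<comment> \<open>Applying \<open>D\<close> to \<open>br H (Hl c) = 0\<close> shows that the
   coordinate of \<open>D H\<close> at \<open>c\<close> is proportional to \<open>wt c H\<close>;
   the factor is read off at \<open>Hl c\<close>, where the weight is 2.\<close>
 define bb where "bb c = cf (D (Hl c)) c / 2" for c
 have DH: "cf (D H) c = wt c H * bb c" if H: "H : h" and c: "rt c" for H c
 proof -
 have "D (br H (Hl c)) = 0" using D0 h_com[OF H Hl_h] by simp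
 hence "br (D H) (Hl c) + br H (D (Hl c)) = 0" using der[OF PS_h[OF H] PS_h[OF Hl_h]] by simp
 hence "br (D H) (Hl c) - br (D (Hl c)) H = 0" using br_ant[of H "D (Hl c)"] by simp
 hence "cf (br (D H) (Hl c) - br (D (Hl c)) H) c = 0" using c by simp
 thus ?thesis using c H by (simp add: cf_dif cf_br_h bb_def rt_def)
 qed
 \<comment> \<open>With this sign \<open>br z1 H\<close> has the same root coordinates as
   \<open>D H\<close>.\<close>
 define z1 where "z1 = expa 0 (%c. - bb c)"
 have hz1: "hp z1 = 0" and cz1: "rt c ==> cf z1 c = - bb c" for c using hp_cfI[OF h_0 z1_def] by blast+
 have z1: "z1 : PS A" unfolding PS_def using Dp[OF PS_h[OF Hl_h]] by (auto simp: cz1 bb_def PS_def)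
 define D1 where "D1 x = D x - br z1 x" for x
 have D1p: "D1 x : PS A" if "x : PS A" for x unfolding D1_def using Dp[OF that] brp[OF z1 that] subspace_diff[OF PS_subs] by blast
 have D1add: "D1 (x + y) = D1 x + D1 y" and D1sc: "D1 (sc a x) = sc a (D1 x)" if "x : PS A" "y : PS A" for x y a
 unfolding D1_def using that by (simp_all add: Dadd Dsc br_add_right br_scale_right scale_right_diff_distrib)
 have D1der: "D1 (br x y) = br (D1 x) y + br x (D1 y)" if "x : PS A" "y : PS A" for x y
 unfolding D1_def der[OF that] br_dif_lef br_dif_rig using jac_rig[of z1 x y] by simp
 have D1h: "D1 H : h" if H: "H : h" for H
 proof -
 have "D1 H = hp (D1 H)" by (rule hp_cf_eqI)
 (simp_all add: D1_def hp_on_h cf_on_h hp_dif cf_dif hp_br_h cf_br_h DH cz1 H)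
 thus ?thesis using hp_h by metis
 qed
 have ev1: "hp (D1 (ev c)) = 0 & (ALL d. rt d --> d ~= c --> cf (D1 (ev c)) d = 0) & (ALL H:h. wt c (D1 H) = 0)" if c: "rt c" "c : A" for c
 proof -
 let ?y = "D1 (ev c)"
 have e: "br H ?y = sc (wt c H) ?y - sc (wt c (D1 H)) (ev c)" if H: "H : h" for H
 using D1der[OF PS_h[OF H] PS_ev[OF c]] br_h_ev[OF H c(1)] br_h_ev[OF D1h[OF H] c(1)]
 D1sc[OF PS_ev[OF c] PS_ev[OF c]] by (simp add: algebra_simps)
 have hpe: "hp (br H ?y) = 0" if "H : h" for H using hp_br_h[OF that, of ?y] br_ant[of H ?y] by (simp add: hp_min)
 have cfe: "cf (br H ?y) d = wt d H * cf ?y d" if "H : h" "rt d" for H d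
 using cf_br_h[OF that, of ?y] br_ant[of H ?y] that by (simp add: cf_min)
 have "sc (wt c (Hl c)) (hp ?y) = 0" using hpe[OF Hl_h, of c] unfolding e[OF Hl_h] by (simp add: hp_dif hp_sca hp_ev[OF c(1)])
 hence 1: "hp ?y = 0" using c(1) by (simp add: rt_def)
 have 2: "cf ?y d = 0" if d: "rt d" "d ~= c" for d
 proof -
 obtain H where H: "H : h" "wt d H ~= wt c H" using wt_inj[of d c] d(2) by blast
 have "wt d H * cf ?y d = wt c H * cf ?y d" using cfe[OF H(1) d(1)] unfolding e[OF H(1)] using d c by (auto simp: cf_dif cf_sca cf_ev)
 thus ?thesis using H(2) by auto
 qed
 have 3: "wt c (D1 H) = 0" if H: "H : h" for H using cfe[OF H c(1)] unfolding e[OF H] using c by (simp add: cf_dif cf_sca cf_ev)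
 show ?thesis using 1 2 3 by blast
 qed
 have D1h0: "D1 H = 0" if H: "H : h" for H using D1h[OF H] ev1 A(2) rt_sr npo_sr H by (intro h_eqI) (auto simp: h_0 wt_h_zer)
 define lm where "lm c = cf (D1 (ev c)) c" for c
 have D1ev: "D1 (ev c) = sc (lm c) (ev c)" if c: "rt c" "c : A" for c
 proof (rule hp_cf_eqI)
 show "hp (D1 (ev c)) = hp (sc (lm c) (ev c))" using ev1[OF c] c(1) by (simp add: hp_sca hp_ev)
 show "cf (D1 (ev c)) d = cf (sc (lm c) (ev c)) d" if "rt d" for d using ev1[OF c] c(1) that by (cases "d = c") (simp_all add: cf_sca cf_ev lm_def)
 qed
 have lm_add: "lm (c + d) = lm c + lm d" if "rt c" "c : A" "rt d" "d : A" "rt (c + d)" for c d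
 proof -
 have cd: "c + d : A" using A(1) that unfolding closed_roots_def by blast
 let ?e = "of_int (eps c d) :: complex"
 have "sc (?e * lm (c + d)) (ev (c + d)) = D1 (br (ev c) (ev d))" using that cd D1sc[OF PS_ev PS_ev, of "c + d" "c + d" ?e] by (simp add: br_ev D1ev)
 also have "... = sc (?e * (lm c + lm d)) (ev (c + d))" using that D1der[OF PS_ev PS_ev, of c d]
 by (simp add: D1ev br_scale_left br_scale_right br_ev distrib_left scale_left_distrib mult.commute)
 finally show ?thesis using ev_nz[OF that(5)] by simp
 qed
 have lm_neg: "lm c + lm (- c) = 0" if "rt c" "c : A" "- c : A" for c
 proof -
 have "br (ev c) (ev (- c)) = - Hl c" using that by (simp add: br_ev)
 hence "0 = D1 (br (ev c) (ev (- c)))" using D1h0 h_neg Hl_h by metis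
 also have "... = sc (lm c + lm (- c)) (- Hl c)" using that D1der[OF PS_ev PS_ev, of c "- c"]
 by (simp add: D1ev br_scale_left br_scale_right br_ev scale_left_distrib)
 finally show ?thesis using Hl_nz[OF that(1)] by auto
 qed
 obtain H1 where H1: "H1 : h" "!!i. i : {1..8} ==> wt (sr i) H1 = lm (sr i)" using h_pre[of "%i. lm (sr i)"] by blast
 have lmp: "lm c = wt c H1" if "npos c" "rt c" for c using that
 proof (induction c rule: npo_ht_ind)
 case (less c)
 consider i where "i : {1..8}" "c = sr i"
 | i where "i : {1..8}" "ip c (sr i) = 1" "rt (c - sr i)" "npos (c - sr i)" using rt_des[OF less(3,1)] by blast
 thus ?case
 proof cases
 case 1
 thus ?thesis using H1(2) by simp
 next
 case 2
 have "lm (c - sr i) = wt (c - sr i) H1" using less(2)[OF 2(4) _ 2(3)] ht_sr[OF 2(1)] by (simp add: ht_dif)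
 moreover have "lm (c - sr i + sr i) = lm (c - sr i) + lm (sr i)" using 2 less(3) by (intro lm_add A(2) rt_sr npo_sr) simp_all
 ultimately show ?thesis using H1(2)[OF 2(1)] by (simp add: wt_dif)
 qed
 qed
 have lmw: "lm c = wt c H1" if c: "rt c" "c : A" for c using rt_sig[OF c(1)]
 proof
 assume n: "npos (- c)"
 have "lm (- c) = - wt c H1" using lmp[OF n] c(1) by (simp add: wt_min)
 moreover have "- c : A" using A(2) n c(1) by simp
 ultimately have "lm c + - wt c H1 = 0" using lm_neg[OF c] by simp
 thus ?thesis by simp
 qed (use lmp c in blast)
 have zp: "z1 + H1 : PS A" using z1 PS_h[OF H1(1)] ps by blast
 have "D x = br (z1 + H1) x" if "x : PS A" for x using that
 proof (induction rule: PS_ind)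
 case (h H)
 thus ?case using D1h0[OF h] h_com[OF H1(1) h] by (simp add: D1_def br_add_left)
 next
 case (ev c)
 thus ?case using D1ev[OF ev] lmw[OF ev] br_h_ev[OF H1(1) ev(1)] by (simp add: D1_def br_add_left algebra_simps)
 next
 case (add a x y)
 thus ?case using ps by (simp add: Dadd Dsc br_add_right br_scale_right)
 qed
 thus ?thesis using zp by blast
qed

end

section \<open>Polynomial functions and Zariski closed subgroups\<close>

lemma pol_con:
 assumes "polyfun sc W f" "!!w. w : W ==> S w = T w"
 shows "f S = f T" using assms by (induction rule: polyfun.induct) auto

lemma zar_top: "topspace (zariski sc W) = GL sc W"
proof -
 have "polyfun sc W (%T. 1)" by (rule polyfun.const)
 hence "GL sc W : {{T : GL sc W. f T ~= 0} | f. polyfun sc W f}" by (intro CollectI exI[of _ "%T. 1"]) auto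
 thus ?thesis unfolding zariski_def by auto
qed

lemma zar_ope_nbh:
 assumes "openin (zariski sc W) O'" "T : O'"
 shows "EX f. polyfun sc W f & f T ~= 0 & {S : GL sc W. f S ~= 0} <= O'"
proof -
 have "generate_topology_on {{T : GL sc W. f T ~= 0} | f. polyfun sc W f} O'"
 using assms(1) unfolding zariski_def openin_topology_generated_by_iff .
 thus ?thesis using assms(2)
 proof (induction rule: generate_topology_on.induct)
 case (Int a b)
 then obtain f g where "polyfun sc W f" "f T ~= 0" "{S : GL sc W. f S ~= 0} <= a"
 "polyfun sc W g" "g T ~= 0" "{S : GL sc W. g S ~= 0} <= b" by blast
 thus ?case by (intro exI[of _ "%T. f T * g T"]) (auto intro: polyfun.mult)
 next
 case (UN K)
 then obtain k where "k : K" "T : k" by blast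
 thus ?case using UN.IH by blast
 next
 case (Basis s)
 thus ?case by auto
 qed simp
qed

lemma zar_clo:
 assumes "closedin (zariski sc W) U" "T : GL sc W" and "!!f. polyfun sc W f ==> (!!u. u : U ==> f u = 0) ==> f T = 0"
 shows "T : U"
proof (rule ccontr)
 assume "T ~: U"
 have "openin (zariski sc W) (GL sc W - U)" using assms(1) unfolding closedin_def zar_top by blast
 then obtain f where f: "polyfun sc W f" "f T ~= 0" "{S : GL sc W. f S ~= 0} <= GL sc W - U"
 using zar_ope_nbh[of sc W "GL sc W - U" T] assms(2) \<open>T ~: U\<close> by blast
 have "U <= GL sc W" using assms(1) unfolding closedin_def zar_top by blast
 hence "f u = 0" if "u : U" for u using f(3) that by blast
 thus False using assms(3)[OF f(1)] f(2) by blast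
qed

text \<open>The condition of \<open>group_lie_algebra\<close> for an arbitrary space
  \<open>W\<close>, so that it also serves subgroups of the adjoint image acting on
  \<open>q\<close>.\<close>

definition tangent :: "(complex => 'v::ab_group_add => 'v) => 'v set => ('v => 'v) set => ('v => 'v) => bool" where
 "tangent sc W U D = ((ALL f. polyfun sc W f & (ALL u:U. f u = 0) -->
 ((%t. f (%v. v + sc t (D v))) has_field_derivative 0) (at 0)))"

text \<open>Along a curve with velocity A D, polynomials are differentiated by the left-invariant
  vector field of \<open>D\<close>, which maps polynomial functions to polynomial functions. Hence
  one \<open>f'\<close> serves all curves.\<close>

lemma pol_der:
 assumes "polyfun sc W f" "D ` W <= W"
 shows "EX f'. polyfun sc W f' & (ALL A t. (ALL w:W. ALL l. linear_on sc (*) W l -->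
 ((%t. l (A t w)) has_field_derivative l (A t (D w))) (at t)) -->
 ((%t. f (A t)) has_field_derivative f' (A t)) (at t))"
 using assms(1)
proof (induction rule: polyfun.induct)
 case (const c)
 show ?case by (rule exI[of _ "%T. 0"]) (auto intro: polyfun.const)
next
 case (coeff w l)
 thus ?case using assms(2) by (intro exI[of _ "%T. l (T (D w))"]) (auto intro: polyfun.coeff)
next
 case (add f g)
 then obtain f' g' where fg: "polyfun sc W f'" "polyfun sc W g'" and f: "!!A t. (ALL w:W. ALL l. linear_on sc (*) W l -->
 ((%t. l (A t w)) has_field_derivative l (A t (D w))) (at t)) ==>
 ((%t. f (A t)) has_field_derivative f' (A t)) (at t)"
 and g: "!!A t. (ALL w:W. ALL l. linear_on sc (*) W l -->
 ((%t. l (A t w)) has_field_derivative l (A t (D w))) (at t)) ==>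
 ((%t. g (A t)) has_field_derivative g' (A t)) (at t)" by metis
 show ?case by (rule exI[of _ "%T. f' T + g' T"]) (use fg f g in "auto intro!: polyfun.add DERIV_add")
next
 case (mult f g)
 then obtain f' g' where fg: "polyfun sc W f'" "polyfun sc W g'" and f: "!!A t. (ALL w:W. ALL l. linear_on sc (*) W l -->
 ((%t. l (A t w)) has_field_derivative l (A t (D w))) (at t)) ==>
 ((%t. f (A t)) has_field_derivative f' (A t)) (at t)"
 and g: "!!A t. (ALL w:W. ALL l. linear_on sc (*) W l -->
 ((%t. l (A t w)) has_field_derivative l (A t (D w))) (at t)) ==>
 ((%t. g (A t)) has_field_derivative g' (A t)) (at t)" by metis
 show ?case by (rule exI[of _ "%T. f' T * g T + g' T * f T"])
 (use fg f g mult in "auto intro!: polyfun.add polyfun.mult DERIV_mult")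
qed

lemma pol_com_lef:
 assumes "polyfun sc W f" and u: "linear_on sc sc W u" "u ` W <= W"
 shows "polyfun sc W (%T. f (compose W u T))" using assms(1)
proof (induction rule: polyfun.induct)
 case (coeff w l)
 have "linear_on sc (*) W (%x. l (u x))" using coeff(2) u unfolding linear_on_def by (auto simp: image_subset_iff)
 hence "polyfun sc W (%T. (%x. l (u x)) (T w))" using coeff(1) by (intro polyfun.coeff)
 thus ?case using coeff(1) by (simp add: compose_def)
qed (auto intro: polyfun.intros)

lemma pol_com_rig:
 assumes "polyfun sc W f" and u: "u ` W <= W"
 shows "polyfun sc W (%T. f (compose W T u))" using assms(1)
proof (induction rule: polyfun.induct)
 case (coeff w l)
 hence "polyfun sc W (%T. l (T (u w)))" using u by (intro polyfun.coeff) auto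
 thus ?case using coeff(1) by (simp add: compose_def)
qed (auto intro: polyfun.intros)

text \<open>All derivatives at \<open>0\<close> of an equa along the curve vanish.\<close>

lemma tan_cur_in_clo:
 assumes U: "closedin (zariski sc W) U" "(\<lambda>w\<in>W. w) : U" and D: "tangent sc W U D" "linear_on sc sc W D" "D ` W <= W"
 and V: "vector_space sc" and W: "module.subspace sc W" and A: "!!t. A t : GL sc W" "A 0 = (\<lambda>w\<in>W. w)"
 and A': "!!t w l. w : W ==> linear_on sc (*) W l ==>
 ((%t. l (A t w)) has_field_derivative l (A t (D w))) (at t)"
 and mult: "!!u v. u : U ==> v : U ==> compose W u v : U"
 shows "A t : U"
proof (rule zar_clo[OF U(1) A(1)])
 interpret V: vector_space sc by (rule V)
 fix f assume f: "polyfun sc W f" "!!u. u : U ==> f u = 0"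
 have UG: "u : GL sc W" if "u : U" for u using U(1) that unfolding closedin_def zar_top by blast
 define I where "I f = (polyfun sc W f & (ALL u:U. f u = 0))" for f
 have ex: "EX f'. I f' & (ALL t. ((%t. f (A t)) has_field_derivative f' (A t)) (at t))" if I: "I f" for f
 proof -
 obtain f' where f': "polyfun sc W f'"
 "!!A t. (ALL w:W. ALL l. linear_on sc (*) W l -->
 ((%t. l (A t w)) has_field_derivative l (A t (D w))) (at t)) ==>
 ((%t. f (A t)) has_field_derivative f' (A t)) (at t)" using pol_der[of sc W f D] I D(3) unfolding I_def by metis
 \<comment> \<open>\<open>f' u\<close> is the derivative of \<open>f\<close> along the curve u (1 +
   t D). Left translation by \<open>u\<close> maps \<open>U\<close> into itself, so the tangency of
   \<open>D\<close> at the identity makes it vanish.\<close>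
 have "f' u = 0" if u: "u : U" for u
 proof -
 have ul: "linear_on sc sc W u" "u ` W <= W" "u : extensional W" using UG[OF u] unfolding GL_def Bij_def by (auto simp: bij_betw_def)
 let ?B = "%t. compose W u (%v. v + sc t (D v))"
 have "((%t. f (?B t)) has_field_derivative 0) (at 0)"
 proof -
 have "polyfun sc W (%T. f (compose W u T))" using pol_com_lef I ul unfolding I_def by blast
 moreover have "f (compose W u v) = 0" if "v : U" for v using mult[OF u that] I unfolding I_def by blast
 ultimately show ?thesis using D(1) unfolding tangent_def by blast
 qed
 moreover have "((%t. f (?B t)) has_field_derivative f' (?B 0)) (at 0)"
 proof (rule f'(2), intro ballI allI impI)
 fix w l assume w: "w : W" and l: "linear_on sc (*) W l"
 have Dw: "D w : W" "D (D w) : W" using D(3) w by auto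
 have z: "sc t x : W" if "x : W" for t x using V.subspace_scale[OF W that] .
 have uD: "u w : W" "u (D w) : W" "u (D (D w)) : W" using ul(2) w Dw by auto
 have "l (?B t w) = l (u w) + t * l (u (D w))" for t
 proof -
 have "u (w + sc t (D w)) = u w + sc t (u (D w))" using ul(1) w Dw z[OF Dw(1)] unfolding linear_on_def by simp
 thus ?thesis using l w uD z[OF uD(2)] unfolding linear_on_def compose_def by simp
 qed
 moreover have "l (?B 0 (D w)) = l (u (D w))" using Dw by (simp add: compose_def)
 ultimately show "((%t. l (?B t w)) has_field_derivative l (?B 0 (D w))) (at 0)" by (auto intro!: derivative_eq_intros)
 qed
 ultimately have "f' (?B 0) = 0" by (rule DERIV_unique[symmetric])
 moreover have "f' (?B 0) = f' u"
 proof (rule pol_con[OF f'(1)])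
 fix w assume "w : W"
 thus "?B 0 w = u w" by (simp add: compose_def)
 qed
 ultimately show ?thesis by simp
 qed
 hence "I f'" using f'(1) unfolding I_def by blast
 moreover have "((%t. f (A t)) has_field_derivative f' (A t)) (at t)" for t using f'(2)[of A t] A' by blast
 ultimately show ?thesis by blast
 qed
 obtain d where d: "!!f. I f ==> I (d f)" "!!f t. I f ==> ((%t. f (A t)) has_field_derivative d f (A t)) (at t)" using ex by metis
 have If: "I f" using f unfolding I_def by blast
 have Id: "I ((d ^^ n) f)" for n by (induction n) (simp_all add: If d(1))
 have der: "(deriv ^^ n) (%t. f (A t)) = (%t. (d ^^ n) f (A t))" for n
 proof (induction n)
 case (Suc n)
 have "deriv (%t. (d ^^ n) f (A t)) = (%t. d ((d ^^ n) f) (A t))" using DERIV_imp_deriv[OF d(2)[OF Id]] by (intro ext)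
 thus ?case using Suc by simp
 qed simp
 have "(deriv ^^ n) (%t. f (A t)) 0 = 0" for n using Id[of n] U(2) unfolding der A(2) I_def by blast
 moreover have "(%t. f (A t)) holomorphic_on UNIV" using d(2)[OF If] unfolding holomorphic_on_def field_differentiable_def by blast
 ultimately show "f (A t) = 0" using holomorphic_fun_eq_0_on_connected[of "%t. f (A t)" UNIV 0 t] connected_UNIV by simp
qed

section \<open>One-parameter groups\<close>

lemma lin_on_exp:
 fixes l :: "complex ^ 'n => complex"
 assumes "linear_on (*s) (*) UNIV l"
 shows "l v = (SUM i:UNIV. v $ i * l (axis i 1))"
proof -
 have add: "l (x + y) = l x + l y" and sc: "l (c *s x) = c * l x" for x y c using assms unfolding linear_on_def by blast+
 have l0: "l 0 = 0" using sc[of 0 0] by simp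
 have "l (SUM i:I. v $ i *s axis i 1) = (SUM i:I. v $ i * l (axis i 1))" for I by (induction I rule: infinite_finite_induct) (simp_all add: l0 add sc)
 thus ?thesis using basis_expansion[of v] by metis
qed

lemma lin_on_com:
 "linear_on a b UNIV f ==> linear_on b c UNIV g ==> linear_on a c UNIV (%x. g (f x))" unfolding linear_on_def by simp

lemma lin_on_dif:
 assumes "linear_on a b UNIV f" shows "f (x - y) = f x - f y"
proof -
 have "f (x - y + y) = f (x - y) + f y" using assms unfolding linear_on_def by blast
 thus ?thesis by simp
qed

lemma lin_on_nth: "linear_on (*s) (*) UNIV (%v. v $ i)" by (simp add: linear_on_def)

lemma lin_on_exp_vec:
 fixes X :: "complex ^ 'n => complex ^ 'n"
 assumes "linear_on (*s) (*s) UNIV X"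
 shows "X v $ i = (SUM j:UNIV. v $ j * X (axis j 1) $ i)"
proof -
 have "linear_on (*s) (*) UNIV (%v. X v $ i)" using assms unfolding linear_on_def by simp
 thus ?thesis by (rule lin_on_exp)
qed

definition exp_coeff :: "(complex ^ 'n => complex ^ 'n) => nat => complex ^ 'n => 'n => complex" where
 "exp_coeff X n v i = (X ^^ n) v $ i / fact n"

text \<open>The exponential of t X, entry by entry a power series in the scalar \<open>t\<close>, so
  that termwise differentiation of complex power series applies.\<close>

definition expc :: "(complex ^ 'n => complex ^ 'n) => complex => complex ^ 'n => complex ^ 'n" where
 "expc X t v = (\<chi> i. \<Sum>n. exp_coeff X n v i * t ^ n)"

context
 fixes X :: "complex ^ 'n => complex ^ 'n"
 assumes X: "linear_on (*s) (*s) UNIV X"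
begin

lemma X_add: "X (x + y) = X x + X y" and X_sca: "X (c *s x) = c *s X x" using X unfolding linear_on_def by blast+

lemma Xn_add: "(X ^^ n) (x + y) = (X ^^ n) x + (X ^^ n) y" by (induction n) (simp_all add: X_add)
lemma Xn_sca: "(X ^^ n) (c *s x) = c *s (X ^^ n) x" by (induction n) (simp_all add: X_sca)

lemma exp_coe_add: "exp_coeff X n (x + y) i = exp_coeff X n x i + exp_coeff X n y i" by (simp add: exp_coeff_def Xn_add add_divide_distrib)
lemma exp_coe_sca: "exp_coeff X n (c *s x) i = c * exp_coeff X n x i" by (simp add: exp_coeff_def Xn_sca)

lemma exp_sum: "summable (%n. exp_coeff X n v i * t ^ n)"
proof -
 have "linear X"
 proof (rule linearI)
 have sR: "r *\<^sub>R x = complex_of_real r *s x" for r :: real and x :: "complex ^ 'n"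
 unfolding vec_eq_iff vector_scaleR_component vector_smult_component by (simp add: scaleR_conv_of_real)
 show "X (r *\<^sub>R x) = r *\<^sub>R X x" for r x unfolding sR by (rule X_sca)
 qed (rule X_add)
 then obtain K where K: "K > 0" "!!v. norm (X v) <= K * norm v"
 using linear_conv_bounded_linear bounded_linear.pos_bounded[of X] by (metis mult.commute)
 have b: "norm ((X ^^ n) v) <= K ^ n * norm v" for n
 proof (induction n)
 case (Suc n)
 have "norm ((X ^^ Suc n) v) <= K * norm ((X ^^ n) v)" using K(2) by simp
 also have "... <= K * (K ^ n * norm v)" using Suc K(1) by simp
 finally show ?case by (simp add: mult.assoc)
 qed simp
 show ?thesis
 proof (rule summable_comparison_test)
 show "summable (%n. norm v * (inverse (fact n) * (K * norm t) ^ n))" using summable_exp[of "K * norm t"] by (rule summable_mult)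
 have "norm (exp_coeff X n v i * t ^ n) <= norm v * (inverse (fact n) * (K * norm t) ^ n)" for n
 proof -
 have "norm ((X ^^ n) v $ i) <= K ^ n * norm v" using b[of n] Finite_Cartesian_Product.norm_nth_le[of "(X ^^ n) v" i] by linarith
 hence "norm ((X ^^ n) v $ i) * (inverse (fact n) * norm t ^ n) <= K ^ n * norm v * (inverse (fact n) * norm t ^ n)" by (intro mult_right_mono) auto
 moreover have "norm (exp_coeff X n v i * t ^ n) = norm ((X ^^ n) v $ i) * (inverse (fact n) * norm t ^ n)"
 by (simp add: exp_coeff_def norm_mult norm_divide norm_power divide_inverse norm_inverse)
 ultimately show ?thesis by (simp add: power_mult_distrib mult_ac)
 qed
 thus "EX N. \<forall>n\<ge>N. norm (exp_coeff X n v i * t ^ n) <= norm v * (inverse (fact n) * (K * norm t) ^ n)" by blast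
 qed
qed

lemma exp_der_com: "((%t. expc X t v $ i) has_field_derivative expc X t (X v) $ i) (at t)"
proof -
 have "((%t. \<Sum>n. exp_coeff X n v i * t ^ n) has_field_derivative
 (\<Sum>n. diffs (%n. exp_coeff X n v i) n * t ^ n)) (at t)"
 by (rule termdiffs_strong_converges_everywhere) (rule exp_sum)
 moreover have "diffs (%n. exp_coeff X n v i) n = exp_coeff X n (X v) i" for n
 by (simp add: diffs_def exp_coeff_def funpow_swap1 field_simps del: of_nat_Suc)
 ultimately show ?thesis by (simp add: expc_def)
qed

lemma expc_0: "expc X 0 v = v"
proof -
 have "(\<Sum>n. exp_coeff X n v i * 0 ^ n) = v $ i" for i using powser_zero[of "%n. exp_coeff X n v i"] by (simp add: exp_coeff_def)
 thus ?thesis by (simp add: expc_def vec_eq_iff)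
qed

lemma exp_lin: "linear_on (*s) (*s) UNIV (expc X t)" unfolding linear_on_def
proof (intro conjI ballI allI)
 show "expc X t (x + y) = expc X t x + expc X t y" for x y unfolding expc_def vec_eq_iff
 by (simp add: exp_coe_add distrib_right suminf_add[OF exp_sum exp_sum])
 show "expc X t (c *s x) = c *s expc X t x" for c x unfolding expc_def vec_eq_iff
 using suminf_mult[OF exp_sum, of c x _ t] by (simp add: exp_coe_sca mult.assoc)
qed

lemma exp_com: "X (expc X t v) = expc X t (X v)"
proof -
 have "X (expc X t v) $ i = expc X t (X v) $ i" for i
 proof -
 have "X (expc X t v) $ i = (SUM j:UNIV. expc X t v $ j * X (axis j 1) $ i)" by (rule lin_on_exp_vec[OF X])
 also have "... = (SUM j:UNIV. \<Sum>n. exp_coeff X n v j * t ^ n * X (axis j 1) $ i)"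
 unfolding expc_def by (simp add: suminf_mult2[OF exp_sum])
 also have "... = (\<Sum>n. SUM j:UNIV. exp_coeff X n v j * t ^ n * X (axis j 1) $ i)"
 by (rule suminf_sum[symmetric]) (rule summable_mult2[OF exp_sum])
 also have "... = (\<Sum>n. exp_coeff X n (X v) i * t ^ n)"
 proof (rule arg_cong[where f = suminf], rule ext)
 fix n
 have "(X ^^ n) (X v) $ i = X ((X ^^ n) v) $ i" by (simp add: funpow_swap1)
 also have "... = (SUM j:UNIV. (X ^^ n) v $ j * X (axis j 1) $ i)" by (rule lin_on_exp_vec[OF X])
 finally have "exp_coeff X n (X v) i = (SUM j:UNIV. exp_coeff X n v j * X (axis j 1) $ i)" by (simp add: exp_coeff_def sum_divide_distrib)
 thus "(SUM j:UNIV. exp_coeff X n v j * t ^ n * X (axis j 1) $ i) = exp_coeff X n (X v) i * t ^ n" by (simp add: sum_distrib_left mult_ac)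
 qed
 finally show ?thesis by (simp add: expc_def)
 qed
 thus ?thesis by (simp add: vec_eq_iff)
qed

lemma exp_der:
 assumes "linear_on (*s) (*) UNIV l"
 shows "((%t. l (expc X t v)) has_field_derivative l (expc X t (X v))) (at t)"
proof -
 have "((%t. SUM i:UNIV. expc X t v $ i * l (axis i 1)) has_field_derivative
 (SUM i:UNIV. expc X t (X v) $ i * l (axis i 1))) (at t)"
 by (intro DERIV_sum DERIV_cmult_right exp_der_com)
 thus ?thesis unfolding lin_on_exp[OF assms, symmetric] .
qed

text \<open>The Leibniz rule for exp(tX) Y exp(-tX), carried out on products of scalar functions
  after expansion in the standard basis. For Y the identity it gives \<open>exp_inv\<close>, for Y
  in the Lie algebra the derivative of the adjoint action.\<close>

lemma exp_con_der:
 assumes Y: "linear_on (*s) (*s) UNIV Y"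
 shows "((%t. expc X t (Y (expc X (- t) v)) $ i) has_field_derivative
 expc X t (X (Y (expc X (- t) v)) - Y (X (expc X (- t) v))) $ i) (at t)"
proof -
 have e: "expc X t (Y u) $ i = (SUM j:UNIV. u $ j * expc X t (Y (axis j 1)) $ i)" for t u
 proof -
 have "linear_on (*s) (*) UNIV (%u. expc X t (Y u) $ i)" by (rule lin_on_com[OF lin_on_com[OF Y exp_lin[of t]] lin_on_nth[of i]])
 thus ?thesis by (rule lin_on_exp)
 qed
 have m: "((%t. expc X (- t) v $ j) has_field_derivative - (expc X (- t) (X v) $ j)) (at t)" for j
 proof -
 have "((%t. expc X (- t) v $ j) has_field_derivative expc X (- t) (X v) $ j * (- 1)) (at t)"
 by (rule DERIV_chain2[OF exp_der_com DERIV_minus[OF DERIV_ident]])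
 thus ?thesis by simp
 qed
 have "((%t. SUM j:UNIV. expc X (- t) v $ j * expc X t (Y (axis j 1)) $ i) has_field_derivative
 (SUM j:UNIV. - (expc X (- t) (X v) $ j) * expc X t (Y (axis j 1)) $ i
 + expc X t (X (Y (axis j 1))) $ i * expc X (- t) v $ j)) (at t)"
 by (intro DERIV_sum DERIV_mult m exp_der_com)
 also have "(SUM j:UNIV. - (expc X (- t) (X v) $ j) * expc X t (Y (axis j 1)) $ i
 + expc X t (X (Y (axis j 1))) $ i * expc X (- t) v $ j)
 = - (SUM j:UNIV. expc X (- t) (X v) $ j * expc X t (Y (axis j 1)) $ i)
 + (SUM j:UNIV. expc X (- t) v $ j * expc X t (X (Y (axis j 1))) $ i)"
 by (simp add: sum_subtractf mult.commute)
 also have "(SUM j:UNIV. expc X (- t) (X v) $ j * expc X t (Y (axis j 1)) $ i) = expc X t (Y (expc X (- t) (X v))) $ i" by (rule e[symmetric])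
 also have "(SUM j:UNIV. expc X (- t) v $ j * expc X t (X (Y (axis j 1))) $ i) = expc X t (X (Y (expc X (- t) v))) $ i"
 by (rule lin_on_exp[symmetric],
 rule lin_on_com[OF lin_on_com[OF lin_on_com[OF Y X] exp_lin[of t]] lin_on_nth[of i]])
 also have "(%t. SUM j:UNIV. expc X (- t) v $ j * expc X t (Y (axis j 1)) $ i) = (%t. expc X t (Y (expc X (- t) v)) $ i)" by (intro ext e[symmetric])
 also have "- (expc X t (Y (expc X (- t) (X v))) $ i) + expc X t (X (Y (expc X (- t) v))) $ i
 = expc X t (X (Y (expc X (- t) v)) - Y (X (expc X (- t) v))) $ i"
 by (simp add: lin_on_dif[OF exp_lin] exp_com)
 finally show ?thesis .
qed

lemma exp_inv: "expc X t (expc X (- t) v) = v"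
proof -
 have id: "linear_on (*s) (*s) UNIV (%v::complex^'n. v)" by (simp add: linear_on_def)
 have z: "expc X t 0 = 0" for t using exp_lin[of t] unfolding linear_on_def by (metis UNIV_I vector_smult_lzero)
 have d: "((%t. expc X t (expc X (- t) v) $ i) has_field_derivative 0) (at t)" for i t using exp_con_der[OF id, of v i t] by (simp add: z)
 have "expc X t (expc X (- t) v) $ i = v $ i" for i
 proof -
 have "EX c. ALL t:UNIV. expc X t (expc X (- t) v) $ i = c"
 using has_field_derivative_zero_constant[of UNIV "%t. expc X t (expc X (- t) v) $ i"] d by simp
 thus ?thesis using expc_0 by (metis UNIV_I minus_zero)
 qed
 thus ?thesis by (simp add: vec_eq_iff)
qed

lemma exp_GL: "expc X t : GL (*s) UNIV"
proof -
 have "bij (expc X t)" by (rule o_bij[of "expc X (- t)"]) (auto simp: exp_inv exp_inv[of "- t", simplified])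
 thus ?thesis using exp_lin by (simp add: GL_def Bij_def)
qed

lemma inv_exp: "inv_into UNIV (expc X t) = expc X (- t)" by (rule inv_equality) (auto simp: exp_inv exp_inv[of "- t", simplified])

end

section \<open>The adjoint action\<close>

locale lie_group = complex_lie_algebra sc br for sc :: "complex => 'g::ab_group_add => 'g" and br :: "'g => 'g => 'g" +
 fixes q :: "'g set" and Q :: "(complex ^ 'n => complex ^ 'n) set" and ph :: "'g => complex ^ 'n => complex ^ 'n"
 assumes q: "lie_subalgebra sc br q" and fin: "EX B. finite B & q <= module.span sc B" and Qph: "has_lie_algebra sc br q Q ph"
begin

lemma q_sub: "subspace q" and q_br: "x : q ==> y : q ==> br x y : q" using q unfolding lie_subalgebra_def by blast+

lemmas q_0 = subspace_0[OF q_sub] and q_add = subspace_add[OF q_sub]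
 and q_scale = subspace_scale[OF q_sub] and q_sum = subspace_sum[OF q_sub] and q_diff = subspace_diff[OF q_sub]

lemma Q_sub: "subgroup Q (BijGroup UNIV)" and Q_closed: "closedin (zariski (*s) UNIV) Q"
 and Q_GL: "g : Q ==> linear_on (*s) (*s) UNIV g" and Q_bij: "g : Q ==> bij g"
 using Qph unfolding has_lie_algebra_def connected_linear_algebraic_group_def GL_def Bij_def by auto

lemma Q_comp: assumes "g : Q" "k : Q" shows "g \<circ> k : Q"
proof -
 have B: "g : Bij UNIV" "k : Bij UNIV" using Q_bij assms by (auto simp: Bij_def)
 have "g \<otimes>\<^bsub>BijGroup UNIV\<^esub> k : Q" using subgroup.m_closed[OF Q_sub assms] .
 moreover have "g \<otimes>\<^bsub>BijGroup UNIV\<^esub> k = g \<circ> k" using B by (auto simp: BijGroup_def compose_def fun_eq_iff)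
 ultimately show ?thesis by simp
qed

lemma Q_id: "(%x. x) : Q" using subgroup.one_closed[OF Q_sub] by (simp add: BijGroup_def restrict_UNIV)

lemma Q_inv: assumes "g : Q" shows "inv_into UNIV g : Q"
proof -
 have "g : Bij UNIV" using Q_bij assms by (auto simp: Bij_def)
 thus ?thesis using subgroup.m_inv_closed[OF Q_sub assms] inv_BijGroup[of g UNIV] by (simp add: restrict_UNIV)
qed

lemma inv_Q [simp]: "g : Q ==> inv_into UNIV g (g v) = v" "g : Q ==> g (inv_into UNIV g v) = v"
 by (simp_all add: inv_f_f[OF bij_is_inj[OF Q_bij]] surj_f_inv_f[OF bij_is_surj[OF Q_bij]])

lemma ph_bij: "bij_betw ph q (group_lie_algebra Q)" and ph_add: "x : q ==> y : q ==> ph (x + y) v = ph x v + ph y v"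
 and ph_sca: "x : q ==> ph (sc c x) v = c *s ph x v"
 and ph_br: "x : q ==> y : q ==> ph (br x y) v = ph x (ph y v) - ph y (ph x v)"
 using Qph unfolding has_lie_algebra_def by simp_all

lemma ph_in: "x : q ==> ph x : group_lie_algebra Q" and ph_inj: "x : q ==> y : q ==> ph x = ph y ==> x = y"
 using ph_bij unfolding bij_betw_def by (auto dest: inj_onD)

lemma ph_sur: "X : group_lie_algebra Q ==> EX x:q. ph x = X" using ph_bij unfolding bij_betw_def by (metis imageE)

lemma ph_lin: "x : q ==> linear_on (*s) (*s) UNIV (ph x)" using ph_in unfolding group_lie_algebra_def by blast

lemma ph_tan: "x : q ==> tangent (*s) UNIV Q (ph x)" using ph_in unfolding group_lie_algebra_def tangent_def by blast

lemma lie_alg_con: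
 assumes g: "g : Q" and X: "X : group_lie_algebra Q"
 shows "g \<circ> X \<circ> inv_into UNIV g : group_lie_algebra Q" unfolding group_lie_algebra_def
proof (intro CollectI conjI allI impI)
 let ?i = "inv_into UNIV g"
 have Xl: "linear_on (*s) (*s) UNIV X" using X unfolding group_lie_algebra_def by blast
 show "linear_on (*s) (*s) UNIV (g \<circ> X \<circ> ?i)"
 using lin_on_com[OF lin_on_com[OF Q_GL[OF Q_inv[OF g]] Xl] Q_GL[OF g]] by (simp add: o_def)
 fix f assume f: "polyfun (*s) UNIV f & (ALL g:Q. f g = 0)"
 define f' where "f' T = f (compose UNIV g (compose UNIV T ?i))" for T
 have "polyfun (*s) UNIV f'" unfolding f'_def using pol_com_rig[OF pol_com_lef, of "(*s)" UNIV f g ?i] f Q_GL[OF g] by simp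
 moreover have "f' u = 0" if "u : Q" for u using f Q_comp[OF g Q_comp[OF that Q_inv[OF g]]] by (simp add: f'_def compose_def o_def restrict_UNIV)
 ultimately have "((%t. f' (%v. v + t *s X v)) has_field_derivative 0) (at 0)" using X unfolding group_lie_algebra_def by blast
 moreover have "f' (%v. v + t *s X v) = f (%v. v + t *s (g \<circ> X \<circ> ?i) v)" for t
 proof -
 have "g (x + t *s y) = g x + t *s g y" for x y using Q_GL[OF g] unfolding linear_on_def by simp
 thus ?thesis using g by (simp add: f'_def compose_def restrict_UNIV)
 qed
 ultimately show "((%t. f (%v. v + t *s (g \<circ> X \<circ> ?i) v)) has_field_derivative 0) (at 0)" by simp
qed

lemma Ad_clo: "g : Q ==> x : q ==> Ad q ph g x : q"
 and ph_Ad: "g : Q ==> x : q ==> ph (Ad q ph g x) v = g (ph x (inv_into UNIV g v))"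
proof -
 assume gx: "g : Q" "x : q"
 have "g \<circ> ph x \<circ> inv_into UNIV g : ph ` q"
 using lie_alg_con[OF gx(1) ph_in[OF gx(2)]] ph_bij by (simp add: bij_betw_def)
 thus "Ad q ph g x : q" "ph (Ad q ph g x) v = g (ph x (inv_into UNIV g v))"
 using gx(2) by (simp_all add: Ad_def inv_into_into f_inv_into_f)
qed

text \<open>\<open>ph\<close> is injective and turns \<open>Ad\<close> into conjugation, so
  identities for \<open>Ad\<close> can be verified on endomorphisms.\<close>

lemma Ad_eqI:
 assumes "g : Q" "x : q" "y : q" "!!v. ph y v = g (ph x (inv_into UNIV g v))"
 shows "Ad q ph g x = y" using assms ph_Ad[OF assms(1,2)] by (intro ph_inj Ad_clo) auto

lemma Ad_comp:
 assumes "g : Q" "k : Q" "x : q"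
 shows "Ad q ph (g \<circ> k) x = Ad q ph g (Ad q ph k x)"
proof (rule Ad_eqI)
 have "inv_into UNIV (g \<circ> k) v = inv_into UNIV k (inv_into UNIV g v)" for v
 using o_inv_distrib[of g k] Q_bij assms(1,2) by (simp add: fun_eq_iff)
 thus "ph (Ad q ph g (Ad q ph k x)) v = (g \<circ> k) (ph x (inv_into UNIV (g \<circ> k) v))" for v
 using assms by (simp add: ph_Ad Ad_clo)
qed (use assms in "simp_all add: Q_comp Ad_clo")

lemma Ad_id: "x : q ==> Ad q ph (%x. x) x = x" using Q_id by (intro Ad_eqI) (auto simp: inv_id[unfolded id_def])

lemma Ad_inv: assumes "g : Q" "x : q"
 shows "Ad q ph (inv_into UNIV g) (Ad q ph g x) = x" "Ad q ph g (Ad q ph (inv_into UNIV g) x) = x"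
proof -
 have "inv_into UNIV g \<circ> g = (%x. x)" "g \<circ> inv_into UNIV g = (%x. x)" using assms(1) by (auto simp: fun_eq_iff)
 thus "Ad q ph (inv_into UNIV g) (Ad q ph g x) = x" "Ad q ph g (Ad q ph (inv_into UNIV g) x) = x"
 using Ad_comp[OF Q_inv[OF assms(1)] assms(1,2)] Ad_comp[OF assms(1) Q_inv[OF assms(1)] assms(2)]
 Ad_id[OF assms(2)] by simp_all
qed

lemma Q_lin: "g : Q ==> g (x + y) = g x + g y" "g : Q ==> g (c *s x) = c *s g x" "g : Q ==> g (x - y) = g x - g y"
 using Q_GL lin_on_dif[OF Q_GL] unfolding linear_on_def by blast+

lemma Ad_add: "g : Q ==> x : q ==> y : q ==> Ad q ph g (x + y) = Ad q ph g x + Ad q ph g y"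
 by (rule Ad_eqI) (simp_all add: q_add Ad_clo ph_add ph_Ad Q_lin)

lemma Ad_sca: "g : Q ==> x : q ==> Ad q ph g (sc c x) = sc c (Ad q ph g x)"
 by (rule Ad_eqI) (simp_all add: q_scale Ad_clo ph_sca ph_Ad Q_lin)

lemma Ad_br: "g : Q ==> x : q ==> y : q ==> Ad q ph g (br x y) = br (Ad q ph g x) (Ad q ph g y)"
 by (rule Ad_eqI) (simp_all add: q_br Ad_clo ph_br ph_Ad Q_lin)

lemma Ad_lin: "g : Q ==> linear_on sc sc q (Ad q ph g)" by (simp add: linear_on_def Ad_add Ad_sca)

lemma Ad_bij: "g : Q ==> bij_betw (Ad q ph g) q q" by (rule bij_betw_byWitness[where f' = "Ad q ph (inv_into UNIV g)"])
 (auto simp: Ad_inv Ad_clo Q_inv)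

lemma Ad_Bij: "g : Q ==> Ad q ph g : Bij q" using Ad_bij by (simp add: Bij_def Ad_def)

lemma Ad_GL: "g : Q ==> Ad q ph g : GL sc q" using Ad_Bij Ad_lin by (simp add: GL_def)

lemma Ad_com: "g : Q ==> k : Q ==> compose q (Ad q ph g) (Ad q ph k) = Ad q ph (g \<circ> k)"
 by (rule ext) (auto simp: compose_def Ad_comp Ad_clo, auto simp: Ad_def)

lemma Ad_one: "Ad q ph (%x. x) = (\<lambda>x\<in>q. x)" by (rule ext) (auto simp: Ad_id, auto simp: Ad_def)

section \<open>Differentiating the adjoint action\<close>

text \<open>\<open>ph\<close> embeds \<open>q\<close> into the matrices, where a functional given on
  a subspace extends. Derivatives of functionals along the adjoint action thereby reduce to
  derivatives of matrix entries.\<close>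

lemma fun_mat:
 assumes l: "linear_on sc (*) q l"
 shows "EX c. ALL z:q. l z = (SUM i:UNIV. SUM j:UNIV. c i j * ph z (axis j 1) $ i)"
proof -
 define P :: "'g => complex ^ ('n \<times> 'n)" where "P z = (\<chi> p. ph z (axis (snd p) 1) $ fst p)" for z
 have P_add: "P (x + y) = P x + P y" and P_scale: "P (sc c x) = c *s P x" if "x : q" "y : q" for x y c
 using that by (simp_all add: P_def vec_eq_iff ph_add ph_sca)
 have P_inj: "x = y" if "x : q" "y : q" "P x = P y" for x y
 proof (rule ph_inj[OF that(1,2)], rule ext)
 fix v
 have e: "ph x (axis j 1) $ i = ph y (axis j 1) $ i" for i j
 proof -
 have "P x $ (i, j) = P y $ (i, j)" using that(3) by simp
 thus ?thesis by (simp add: P_def)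
 qed
 have "ph x v $ i = ph y v $ i" for i
 proof -
 have "ph x v $ i = (SUM j:UNIV. v $ j * ph x (axis j 1) $ i)" by (rule lin_on_exp_vec[OF ph_lin[OF that(1)]])
 also have "... = (SUM j:UNIV. v $ j * ph y (axis j 1) $ i)" using e by simp
 also have "... = ph y v $ i" by (rule lin_on_exp_vec[OF ph_lin[OF that(2)], symmetric])
 finally show ?thesis .
 qed
 thus "ph x v = ph y v" by (simp add: vec_eq_iff)
 qed
 have P0: "P 0 = 0" using P_scale[OF q_0 q_0, of 0] by simp
 have P_sum: "P (SUM i:I. u i) = (SUM i:I. P (u i))" if "finite I" "!!i. i : I ==> u i : q" for I and u :: "'g => 'g"
 using that by (induction I rule: finite_induct) (simp_all add: P0 P_add q_sum)
 obtain B where B: "B <= q" "independent B" "q <= span B" using maximal_independent_subset[of q] by blast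
 have "finite B"
 proof -
 obtain B' where "finite B'" "q <= span B'" using fin by blast
 thus ?thesis using independent_span_bound[of B' B] B by blast
 qed
 have inj: "inj_on P B" using P_inj B(1) by (auto intro: inj_onI)
 have ind: "vec.independent (P ` B)"
 proof (rule vec.independent_if_scalars_zero)
 fix f x assume f: "(SUM x:P ` B. f x *s x) = 0" and "x : P ` B"
 then obtain b where b: "b : B" "x = P b" by blast
 have "P (SUM b:B. sc (f (P b)) b) = (SUM b:B. P (sc (f (P b)) b))" using \<open>finite B\<close> B(1) q_scale by (intro P_sum) auto
 also have "... = (SUM b:B. f (P b) *s P b)" using B(1) by (intro sum.cong refl P_scale) auto
 also have "... = 0" using f inj by (simp add: sum.reindex)
 finally have "(SUM b:B. sc (f (P b)) b) = 0" using P_inj[OF _ q_0] P0 B(1) q_scale by (intro P_inj[OF _ q_0]) (auto intro!: q_sum)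
 thus "f x = 0" using independentD[OF B(2) \<open>finite B\<close> subset_refl, of "%b. f (P b)" b] b by simp
 qed (use \<open>finite B\<close> in simp)
 have cv: "vector_space ((*) :: complex => complex => complex)" by unfold_locales (simp_all add: algebra_simps)
 interpret vp: vector_space_pair "(*s) :: complex => complex ^ ('n \<times> 'n) => _" "(*) :: complex => complex => complex"
 unfolding vector_space_pair_def using cv vec.vector_space_axioms by blast
 obtain F where F: "Vector_Spaces.linear (*s) (*) F" "!!x. x : P ` B ==> F x = l (inv_into B P x)"
 using vp.linear_independent_extend[OF ind, of "%x. l (inv_into B P x)"] by blast
 have Fl: "linear_on (*s) (*) UNIV F" using F(1) by (simp add: Vector_Spaces.linear_iff linear_on_def)
 have l0: "l 0 = 0" using l q_0 unfolding linear_on_def by (metis scale_zero_left mult_zero_left)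
 have "z : q & l z = F (P z)" if "z : span B" for z using that
 proof (induction rule: span_induct_alt)
 case base
 show ?case using l0 P0 Fl q_0 unfolding linear_on_def by (metis UNIV_I mult_zero_left vector_smult_lzero)
 next
 case (step a b y)
 hence b: "b : q" "l b = F (P b)" using B(1) F(2)[of "P b"] inj by auto
 thus ?case using step l Fl q_scale[OF b(1)] q_add unfolding linear_on_def by (simp add: P_add P_scale)
 qed
 hence lF: "l z = F (P z)" if "z : q" for z using B(3) that by blast
 show ?thesis
 proof (intro exI[of _ "%i j. F (axis (i, j) 1)"] ballI)
 fix z assume z: "z : q"
 have "l z = (SUM p:UNIV. P z $ p * F (axis p 1))" unfolding lF[OF z] by (rule lin_on_exp[OF Fl])
 also have "... = (SUM i:UNIV. SUM j:UNIV. P z $ (i, j) * F (axis (i, j) 1))"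
 unfolding UNIV_Times_UNIV[symmetric] by (simp add: sum.cartesian_product del: UNIV_Times_UNIV)
 finally show "l z = (SUM i:UNIV. SUM j:UNIV. F (axis (i, j) 1) * ph z (axis j 1) $ i)" by (simp add: P_def mult.commute)
 qed
qed

lemma exp_in_Q: assumes "x : q" shows "expc (ph x) t : Q"
proof (rule tan_cur_in_clo[OF Q_closed _ ph_tan[OF assms] ph_lin[OF assms] _ vec.vector_space_axioms])
 note X = ph_lin[OF assms]
 show "(\<lambda>w\<in>UNIV. w) : Q" using Q_id by (simp add: restrict_UNIV)
 show "expc (ph x) 0 = (\<lambda>w\<in>UNIV. w)" by (simp add: expc_0[OF X] fun_eq_iff)
 show "expc (ph x) t : GL (*s) UNIV" for t by (rule exp_GL[OF X])
 show "((%t. l (expc (ph x) t w)) has_field_derivative l (expc (ph x) t (ph x w))) (at t)"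
 if "linear_on (*s) (*) UNIV l" for t w l by (rule exp_der[OF X that])
 show "compose UNIV u v : Q" if "u : Q" "v : Q" for u v using Q_comp[OF that] by (simp add: compose_def o_def restrict_UNIV)
qed auto

abbreviation Adx :: "'g => complex => 'g => 'g" where
 "Adx x t \<equiv> Ad q ph (expc (ph x) t)"

lemma Adx_der:
 assumes x: "x : q" and y: "y : q" and l: "linear_on sc (*) q l"
 shows "((%t. l (Adx x t y)) has_field_derivative l (Adx x t (br x y))) (at t)"
proof -
 note X = ph_lin[OF x] and E = exp_in_Q[OF x]
 obtain c where c: "!!z. z : q ==> l z = (SUM i:UNIV. SUM j:UNIV. c i j * ph z (axis j 1) $ i)" using fun_mat[OF l] by blast
 have A: "ph (Adx x t z) v = expc (ph x) t (ph z (expc (ph x) (- t) v))" if "z : q" for t z v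
 using ph_Ad[OF E that] inv_exp[OF X] by simp
 have "((%t. SUM i:UNIV. SUM j:UNIV. c i j * expc (ph x) t (ph y (expc (ph x) (- t) (axis j 1))) $ i) has_field_derivative
 (SUM i:UNIV. SUM j:UNIV. c i j * expc (ph x) t (ph x (ph y (expc (ph x) (- t) (axis j 1))) - ph y (ph x (expc (ph x) (- t) (axis j 1)))) $ i)) (at t)"
 by (intro DERIV_sum DERIV_cmult exp_con_der[OF X ph_lin[OF y]])
 thus ?thesis using c Ad_clo[OF E] y q_br[OF x y] A ph_br[OF x y] by simp
qed

lemma Adx_0: "x : q ==> Adx x 0 = (\<lambda>y\<in>q. y)"
proof -
 assume x: "x : q"
 have "expc (ph x) 0 = (%x. x)" using expc_0[OF ph_lin[OF x]] by (intro ext)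
 thus ?thesis using Ad_one by simp
qed

lemma Adx_fix: assumes x: "x : q" shows "Adx x t x = x"
 using exp_inv[OF ph_lin[OF x]] exp_com[OF ph_lin[OF x]] inv_exp[OF ph_lin[OF x]] x by (intro Ad_eqI exp_in_Q) auto

end

section \<open>Unipotent radicals of stabilisers\<close>

definition curve_velocity :: "(complex => 'v::ab_group_add => 'v) => 'v set => (complex => 'v => 'v) => ('v => 'v) => bool" where
 "curve_velocity sc W A D = ((ALL w:W. A 0 w = w) &
 (ALL w:W. ALL l. linear_on sc (*) W l --> ((%t. l (A t w)) has_field_derivative l (D w)) (at 0)))"

text \<open>The differential of \<open>f\<close> at the identity, recorded as a finite list of
  functionals and vectors: its value at a velocity \<open>D\<close> is the sum of
  \<open>l (D w)\<close>. In this form tangency can be tested along curves that are not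
  lines.\<close>

definition diffl :: "(complex => 'v::ab_group_add => 'v) => 'v set => (('v => 'v) => complex) => (('v => complex) \<times> 'v) list => bool" where
 "diffl sc W f S = ((ALL (l, w):set S. linear_on sc (*) W l & w : W) &
 (ALL A D. curve_velocity sc W A D -->
 ((%t. f (A t)) has_field_derivative (SUM (l, w)<-S. l (D w))) (at 0)))"

lemma diffe:
 assumes "diffl sc W f S"
 shows "(l, w) : set S ==> linear_on sc (*) W l" "(l, w) : set S ==> w : W"
 "curve_velocity sc W A D ==> ((%t. f (A t)) has_field_derivative (SUM (l, w)<-S. l (D w))) (at 0)"
 using assms unfolding diffl_def by auto

lemma pol_dif:
 assumes "polyfun sc W f"
 shows "EX S. diffl sc W f S" using assms
proof (induction rule: polyfun.induct)
 case (const c)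
 show ?case by (rule exI[of _ "[]"]) (auto simp: diffl_def)
next
 case (coeff w l)
 show ?case by (rule exI[of _ "[(l, w)]"]) (use coeff in "auto simp: diffl_def curve_velocity_def")
next
 case (add f g)
 then obtain S T where S: "diffl sc W f S" and T: "diffl sc W g T" by blast
 have "diffl sc W (%T. f T + g T) (S @ T)" unfolding diffl_def
 proof (intro conjI allI impI)
 show "ALL (l, w):set (S @ T). linear_on sc (*) W l & w : W" using diffe(1,2)[OF S] diffe(1,2)[OF T] by auto
 fix A D assume A: "curve_velocity sc W A D"
 show "((%t. f (A t) + g (A t)) has_field_derivative (SUM (l, w)<-S @ T. l (D w))) (at 0)"
 using DERIV_add[OF diffe(3)[OF S A] diffe(3)[OF T A]] by simp
 qed
 thus ?case by blast
next
 case (mult f g)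
 then obtain S T where S: "diffl sc W f S" and T: "diffl sc W g T" by blast
 define f1 g1 where "f1 = f (%w. w)" and "g1 = g (%w. w)"
 let ?S = "map (%(l, w). (%x. g1 * l x, w)) S @ map (%(l, w). (%x. f1 * l x, w)) T"
 have "diffl sc W (%T. f T * g T) ?S" unfolding diffl_def
 proof (intro conjI allI impI)
 have "linear_on sc (*) W (%x. a * l x)" if "linear_on sc (*) W l" for a l
 using that unfolding linear_on_def by (simp add: distrib_left mult.left_commute)
 thus "ALL (l, w):set ?S. linear_on sc (*) W l & w : W" using diffe(1,2)[OF S] diffe(1,2)[OF T] by auto
 fix A D assume A: "curve_velocity sc W A D"
 hence A0: "!!w. w : W ==> A 0 w = w" unfolding curve_velocity_def by blast
 have 1: "f (A 0) = f1" "g (A 0) = g1"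
 unfolding f1_def g1_def by (rule pol_con[OF mult.hyps(1) A0] pol_con[OF mult.hyps(2) A0], assumption)+
 have s: "(SUM (l, w)<-map (%(l, w). (%x. a * l x, w)) S. l (D w)) = a * (SUM (l, w)<-S. l (D w))" for a :: complex and S
 by (induction S) (auto simp: distrib_left)
 have "((%t. f (A t) * g (A t)) has_field_derivative (SUM (l, w)<-S. l (D w)) * g (A 0) + (SUM (l, w)<-T. l (D w)) * f (A 0)) (at 0)"
 by (rule DERIV_mult[OF diffe(3)[OF S A] diffe(3)[OF T A]])
 thus "((%t. f (A t) * g (A t)) has_field_derivative (SUM (l, w)<-?S. l (D w))) (at 0)"
 unfolding 1 sum_list_append map_append s by (simp add: mult.commute)
 qed
 thus ?case by blast
qed

section \<open>Polynomial dependence on a complex exponent\<close>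

definition poly_fun :: "(complex => complex) => bool" where
 "poly_fun g = ((EX p. ALL t. g t = poly p t))"

lemma pol_fun_con: "poly_fun (%t. c)" unfolding poly_fun_def by (rule exI[of _ "[:c:]"]) simp
lemma pol_fun_add: "poly_fun f ==> poly_fun g ==> poly_fun (%t. f t + g t)" unfolding poly_fun_def by (metis poly_add)
lemma pol_fun_dif: "poly_fun f ==> poly_fun g ==> poly_fun (%t. f t - g t)" unfolding poly_fun_def by (metis poly_diff)
lemma pol_fun_mul: "poly_fun f ==> poly_fun g ==> poly_fun (%t. f t * g t)" unfolding poly_fun_def by (metis poly_mult)
lemma pol_fun_sum: "(!!i. i : I ==> poly_fun (f i)) ==> poly_fun (%t. SUM i:I. f i t)"
 by (induction I rule: infinite_finite_induct) (simp_all add: pol_fun_con pol_fun_add)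

lemma pol_fun_gbi: "poly_fun (%t. t gchoose j)" unfolding poly_fun_def by (rule exI[of _ "smult (1 / fact j) (PROD i<j. [:- of_nat i, 1:])"])
 (simp add: gbinomial_prod_rev poly_prod atLeast0LessThan)

text \<open>A non-zero polynomial has finitely many roots. Identities for natural powers of a
  unipotent map extend in this way to complex exponents.\<close>

lemma pol_fun_zer:
 assumes "poly_fun g" "!!n::nat. g (of_nat n) = 0" shows "g t = 0"
proof -
 obtain p where p: "!!t. g t = poly p t" using assms(1) unfolding poly_fun_def by blast
 have "p = 0"
 proof (rule ccontr)
 assume "p ~= 0"
 hence "finite {t. poly p t = 0}" by (rule poly_roots_finite)
 moreover have "range (of_nat :: nat => complex) <= {t. poly p t = 0}" using assms(2) p by auto
 ultimately have "finite (range (of_nat :: nat => complex))" by (rule rev_finite_subset)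
 thus False using range_inj_infinite[OF inj_of_nat] by blast
 qed
 thus ?thesis using p by simp
qed

lemma pol_fun_der: "poly_fun g ==> (g has_field_derivative deriv g t) (at t)"
proof -
 assume "poly_fun g"
 then obtain p where "g = poly p" unfolding poly_fun_def by blast
 hence "(g has_field_derivative poly (pderiv p) t) (at t)" using poly_DERIV by blast
 thus ?thesis by (simp add: DERIV_imp_deriv)
qed

text \<open>The coefficients of log (1 + N), obtained as the velocity at t = 0 of the binomial
  series of (1 + N)^t.\<close>

definition logc :: "nat => complex" where
 "logc j = deriv (%t. t gchoose j) 0"

lemma log_der: "((%t. t gchoose j) has_field_derivative logc j) (at 0)"
 unfolding logc_def by (rule pol_fun_der[OF pol_fun_gbi])

lemma logc_0: "logc 0 = 0" and logc_1: "logc (Suc 0) = 1" by (simp_all add: logc_def)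

context lie_group
begin

lemma fin_bas:
 obtains B where "finite B" "B <= q" "independent B" "q <= span B" "span B = q"
proof -
 obtain B where B: "B <= q" "independent B" "q <= span B" using maximal_independent_subset[of q] by blast
 have "finite B"
 proof -
 obtain B' where "finite B'" "q <= span B'" using fin by blast
 thus ?thesis using independent_span_bound[of B' B] B by blast
 qed
 moreover have "span B = q" using B span_minimal[OF B(1) q_sub] by blast
 ultimately show ?thesis using that B by blast
qed

lemma lin_on_sum:
 assumes "linear_on sc (*) q l" "finite I" "!!i. i : I ==> u i : q"
 shows "l (SUM i:I. sc (c i) (u i)) = (SUM i:I. c i * l (u i))"
proof -
 have l: "x : q ==> y : q ==> l (x + y) = l x + l y" "x : q ==> l (sc a x) = a * l x" for x y a
 using assms(1) unfolding linear_on_def by blast+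
 have l0: "l 0 = 0" using l(2)[OF q_0, of 0] by simp
 have "(SUM i:I. sc (c i) (u i)) : q & l (SUM i:I. sc (c i) (u i)) = (SUM i:I. c i * l (u i))" using assms(2,3)
 by (induction I rule: finite_induct) (simp_all add: l0 q_0 l q_scale q_add)
 thus ?thesis ..
qed

lemma bas_fun:
 assumes B: "B <= q" "independent B" "span B = q"
 shows "linear_on sc (*) q (%x. representation B x b)" unfolding linear_on_def using B(2,3) by (auto simp: representation_add representation_scale)

lemma fun_sep:
 assumes z: "z : q" "!!l. linear_on sc (*) q l ==> l z = 0"
 shows "z = 0"
proof -
 obtain B where B: "finite B" "B <= q" "independent B" "q <= span B" "span B = q" using fin_bas .
 have "representation B z b = 0" for b using z(2)[OF bas_fun[OF B(2,3,5)]] .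
 thus ?thesis using sum_representation_eq[OF B(3), of z B] z(1) B(1,5) by simp
qed

text \<open>If k is least with T^k w = 0, the vectors w, T w, ..., T^(k-1) w are independent, so k
  is at most the number of generators. The bound is uniform in \<open>T\<close>, as the limit in
  \<open>ad_nil\<close> requires.\<close>

lemma nil_bou:
 "EX d. ALL T n. linear_on sc sc q T --> T ` q <= q --> (ALL w:q. (T ^^ n) w = 0) --> (ALL w:q. (T ^^ d) w = 0)"
proof -
 obtain B where B: "finite B" "q <= span B" using fin by blast
 have "(T ^^ card B) w = 0" if T: "linear_on sc sc q T" "T ` q <= q" and n: "ALL w:q. (T ^^ n) w = 0" and w: "w : q" for T n w
 proof (rule ccontr)
 assume nz: "(T ^^ card B) w ~= 0"
 have Tq: "(T ^^ k) v : q" if "v : q" for k v using T(2) that by (induction k) auto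
 have Tadd: "x : q ==> y : q ==> T (x + y) = T x + T y" "x : q ==> T (sc a x) = sc a (T x)" for x y a
 using T(1) unfolding linear_on_def by blast+
 have T0: "(T ^^ k) 0 = 0" for k using Tadd(2)[OF q_0, of 0] by (induction k) simp_all
 define k where "k = (LEAST k. (T ^^ k) w = 0)"
 have k0: "(T ^^ k) w = 0" unfolding k_def using n w by (intro LeastI[of "%k. (T ^^ k) w = 0" n]) blast
 have below: "(T ^^ j) w ~= 0" if "j < k" for j using not_less_Least that unfolding k_def by blast
 have above: "(T ^^ j) w = 0" if "k <= j" for j
 proof -
 have "(T ^^ j) w = (T ^^ (j - k)) ((T ^^ k) w)" using that by (simp add: funpow_add[symmetric, THEN fun_cong, unfolded o_def])
 thus ?thesis using k0 T0 by simp
 qed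
 have kB: "card B < k" using above nz by (meson not_le)
 have Tsum: "(T ^^ m) (SUM i:I. sc (c i) ((T ^^ i) w)) = (SUM i:I. sc (c i) ((T ^^ (m + i)) w))" if "finite I" for m I c
 proof (induction m)
 case (Suc m)
 have "T (SUM i:I. sc (c i) (u i)) = (SUM i:I. sc (c i) (T (u i)))" if "!!i. u i : q" for u using \<open>finite I\<close> T0[of 1] that
 by (induction I rule: finite_induct) (simp_all add: Tadd q_scale q_sum)
 thus ?case using Suc Tq[OF w] by simp
 qed simp
 have inj: "inj_on (%j. (T ^^ j) w) {..<k}"
 proof (rule linorder_inj_onI)
 fix i j assume ij: "i < j" "i : {..<k}" "j : {..<k}"
 show "(T ^^ i) w ~= (T ^^ j) w"
 proof
 assume "(T ^^ i) w = (T ^^ j) w"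
 hence "(T ^^ (k - j)) ((T ^^ i) w) = (T ^^ (k - j)) ((T ^^ j) w)" by simp
 hence "(T ^^ (k - j + i)) w = (T ^^ k) w" using ij(3) by (simp add: funpow_add[symmetric, THEN fun_cong, unfolded o_def])
 moreover have "k - j + i < k" using ij by auto
 ultimately show False using below k0 by metis
 qed
 qed auto
 have "independent ((%j. (T ^^ j) w) ` {..<k})"
 proof (rule independent_if_scalars_zero)
 fix f x assume f: "(SUM x:(%j. (T ^^ j) w) ` {..<k}. sc (f x) x) = 0" and "x : (%j. (T ^^ j) w) ` {..<k}"
 define c where "c j = f ((T ^^ j) w)" for j
 have s: "(SUM j<k. sc (c j) ((T ^^ j) w)) = 0" using f inj by (simp add: sum.reindex c_def)
 have "c j = 0" if "j < k" for j using that
 proof (induction j rule: less_induct)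
 case (less j)
 have "0 = (T ^^ (k - 1 - j)) (SUM j<k. sc (c j) ((T ^^ j) w))" unfolding s T0 ..
 also have "... = (SUM i<k. sc (c i) ((T ^^ (k - 1 - j + i)) w))" by (rule Tsum) simp
 also have "... = (SUM i<k. if i = j then sc (c j) ((T ^^ (k - 1)) w) else 0)"
 proof (rule sum.cong)
 fix i assume "i : {..<k}"
 thus "sc (c i) ((T ^^ (k - 1 - j + i)) w) = (if i = j then sc (c j) ((T ^^ (k - 1)) w) else 0)"
 using less above[of "k - 1 - j + i"] by (cases i j rule: linorder_cases) auto
 qed simp
 finally have "sc (c j) ((T ^^ (k - 1)) w) = 0" using less.prems by (simp add: sum.delta)
 thus ?case using below[of "k - 1"] less.prems by simp
 qed
 thus "f x = 0" using \<open>x : (%j. (T ^^ j) w) ` {..<k}\<close> by (auto simp: c_def)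
 qed simp
 moreover have "(%j. (T ^^ j) w) ` {..<k} <= span B" using Tq[OF w] B(2) by blast
 ultimately have "card ((%j. (T ^^ j) w) ` {..<k}) <= card B" using independent_span_bound[OF B(1)] by blast
 thus False using kB by (simp add: card_image[OF inj])
 qed
 thus ?thesis by blast
qed

text \<open>The limit \<open>t \<rightarrow> 0\<close> in \<open>((exp (t ad x) - 1) / t)\<^sup>d = 0\<close>.\<close>

lemma ad_nil:
 assumes x: "x : q" and u: "!!t. unipotent_on q (Adx x t)"
 shows "EX d. ALL w:q. ((br x) ^^ d) w = 0"
proof -
 obtain d where d: "!!T n. linear_on sc sc q T ==> T ` q <= q ==> (ALL w:q. (T ^^ n) w = 0) ==> (ALL w:q. (T ^^ d) w = 0)"
 using nil_bou by blast
 define N where "N t v = Adx x t v - v" for t v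
 note E = exp_in_Q[OF x]
 have Nq: "N t v : q" if "v : q" for t v using Ad_clo[OF E that] that q_diff by (simp add: N_def)
 have Nlin: "linear_on sc sc q (N t)" for t unfolding linear_on_def N_def by (auto simp: Ad_add[OF E] Ad_sca[OF E] scale_right_diff_distrib)
 have Nd: "(N t ^^ d) w = 0" if "w : q" for t w
 proof -
 obtain n where "ALL w:q. (N t ^^ n) w = 0" using u[of t] unfolding unipotent_on_def N_def[abs_def] by blast
 thus ?thesis using d[OF Nlin, of t n] Nq that by blast
 qed
 obtain B where B: "finite B" "B <= q" "independent B" "q <= span B" "span B = q" using fin_bas .
 define r where "r b z = representation B z b" for b z
 have r_lin: "linear_on sc (*) q (r b)" for b unfolding r_def by (rule bas_fun[OF B(2,3,5)])
 have r_exp: "z = (SUM b:B. sc (r b z) b)" if "z : q" for z unfolding r_def using sum_representation_eq[OF B(3), of z B] that B(1,5) by simp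
 have brq: "((br x) ^^ k) z : q" if "z : q" for k z using that q_br[OF x] by (induction k) auto
 have lim1: "((%t. l (N t w) / t) \<longlongrightarrow> l (br x w)) (at 0)" if w: "w : q" and l: "linear_on sc (*) q l" for w l
 proof -
 have "((%t. l (Adx x t w)) has_field_derivative l (Adx x 0 (br x w))) (at 0)" by (rule Adx_der[OF x w l])
 hence "((%t. (l (Adx x t w) - l (Adx x 0 w)) / (t - 0)) \<longlongrightarrow> l (Adx x 0 (br x w))) (at 0)"
 unfolding has_field_derivative_iff by simp
 moreover have "l (N t w) = l (Adx x t w) - l (Adx x 0 w)" for t
 proof -
 have "l (N t w + w) = l (N t w) + l w" using l Nq[OF w] w unfolding linear_on_def by blast
 thus ?thesis using w by (simp add: N_def Adx_0[OF x])
 qed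
 ultimately show ?thesis using w q_br[OF x w] by (simp add: Adx_0[OF x])
 qed
 \<comment> \<open>Induction on \<open>k\<close>: expanding the innermost factor
   \<open>N t w\<close> in the basis \<open>B\<close> reduces the claim to finitely many scalar
   limits.\<close>
 have lim: "((%t. l ((N t ^^ k) w) / t ^ k) \<longlongrightarrow> l (((br x) ^^ k) w)) (at 0)" if "w : q" "linear_on sc (*) q l" for w l k
 using that
 proof (induction k arbitrary: w)
 case (Suc k)
 have lk: "linear_on sc (*) q (%z. l ((N t ^^ k) z))" for t
 proof -
 have "linear_on sc sc q (N t ^^ k) & (N t ^^ k) ` q <= q"
 proof (induction k)
 case (Suc k)
 thus ?case using Nlin[of t] Nq unfolding linear_on_def by (auto simp: image_subset_iff)
 qed (simp add: linear_on_def)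
 thus ?thesis using Suc.prems(2) unfolding linear_on_def by (auto simp: image_subset_iff)
 qed
 have lb: "linear_on sc (*) q (%z. l (((br x) ^^ k) z))"
 proof -
 have "((br x) ^^ k) (y + z) = ((br x) ^^ k) y + ((br x) ^^ k) z" "((br x) ^^ k) (sc c y) = sc c (((br x) ^^ k) y)" for y z c
 by (induction k) (simp_all add: br_add_right br_scale_right)
 thus ?thesis using Suc.prems(2) brq unfolding linear_on_def by auto
 qed
 have "((%t. SUM b:B. (r b (N t w) / t) * (l ((N t ^^ k) b) / t ^ k)) \<longlongrightarrow>
 (SUM b:B. r b (br x w) * l (((br x) ^^ k) b))) (at 0)"
 using B(2) by (intro tendsto_sum tendsto_mult lim1[OF Suc.prems(1) r_lin] Suc.IH[OF _ Suc.prems(2)]) auto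
 moreover have "(SUM b:B. (r b (N t w) / t) * (l ((N t ^^ k) b) / t ^ k)) = l ((N t ^^ Suc k) w) / t ^ Suc k" for t
 proof -
 have "l ((N t ^^ k) (N t w)) = l ((N t ^^ k) (SUM b:B. sc (r b (N t w)) b))" using r_exp[OF Nq[OF Suc.prems(1)], of t] by simp
 also have "... = (SUM b:B. r b (N t w) * l ((N t ^^ k) b))"
 using lin_on_sum[OF lk[of t], where I = B and u = id and c = "%b. r b (N t w)"] B(1,2) by auto
 finally show ?thesis by (simp add: funpow_swap1 sum_divide_distrib)
 qed
 moreover have "(SUM b:B. r b (br x w) * l (((br x) ^^ k) b)) = l (((br x) ^^ Suc k) w)"
 proof -
 have "l (((br x) ^^ k) (br x w)) = l (((br x) ^^ k) (SUM b:B. sc (r b (br x w)) b))" using r_exp[OF q_br[OF x Suc.prems(1)]] by simp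
 also have "... = (SUM b:B. r b (br x w) * l (((br x) ^^ k) b))"
 using lin_on_sum[OF lb, where I = B and u = id and c = "%b. r b (br x w)"] B(1,2) by auto
 finally show ?thesis by (simp add: funpow_swap1)
 qed
 ultimately show ?case by simp
 qed simp
 have "((br x) ^^ d) w = 0" if w: "w : q" for w
 proof (rule fun_sep[OF brq[OF w]])
 fix l assume l: "linear_on sc (*) q l"
 have "l 0 = 0" using l q_0 unfolding linear_on_def by (metis scale_zero_left mult_zero_left)
 hence "((%t. 0) \<longlongrightarrow> l (((br x) ^^ d) w)) (at (0::complex))" using lim[OF w l, of d] Nd[OF w] by simp
 thus "l (((br x) ^^ d) w) = 0" by (simp add: tendsto_const_iff)
 qed
 thus ?thesis by blast
qed

end

section \<open>Normal nilpotent matrices\<close>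

definition adjm :: "complex ^ 'e ^ 'e => complex ^ 'e ^ 'e" where
 "adjm X = (\<chi> i j. cnj (X $ j $ i))"

text \<open>Let A be the adjoint of X and w = X u with X w = 0. Normality gives (A w, A w) = (w, X A
  w) = (w, A X w) = 0, and then (w, w) = (u, A w) = 0. So X (X u) = 0 already implies X u = 0, and
  nilpotency descends to X = 0.\<close>

lemma nor_nil:
 fixes X :: "complex ^ 'e ^ 'e"
 assumes n: "X ** adjm X = adjm X ** X" and d: "!!v. (((*v) X) ^^ d) v = 0"
 shows "X = 0"
proof -
 define ci where "ci u v = (SUM i:UNIV. cnj (u $ i) * v $ i)" for u v :: "complex ^ 'e"
 have ci0: "u = 0" if "ci u u = 0" for u
 proof -
 have "ci u u = of_real (SUM i:UNIV. (cmod (u $ i))\<^sup>2)"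
 unfolding ci_def of_real_sum by (rule sum.cong) (simp_all only: complex_norm_square mult.commute)
 hence "(SUM i:UNIV. (cmod (u $ i))\<^sup>2) = 0" using that by (metis of_real_eq_0_iff)
 thus ?thesis by (simp add: sum_nonneg_eq_0_iff vec_eq_iff)
 qed
 have adj: "ci (adjm X *v u) v = ci u (X *v v)" "ci (X *v u) v = ci u (adjm X *v v)" for u v
 proof -
 have "ci (adjm X *v u) v = (SUM i:UNIV. SUM j:UNIV. X $ j $ i * cnj (u $ j) * v $ i)"
 by (simp add: ci_def adjm_def matrix_vector_mult_def sum_distrib_right)
 also have "... = (SUM j:UNIV. SUM i:UNIV. X $ j $ i * cnj (u $ j) * v $ i)" by (rule sum.swap)
 also have "... = ci u (X *v v)" by (simp add: ci_def matrix_vector_mult_def sum_distrib_left mult_ac)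
 finally show "ci (adjm X *v u) v = ci u (X *v v)" .
 have "ci (X *v u) v = (SUM i:UNIV. SUM j:UNIV. cnj (X $ i $ j) * cnj (u $ j) * v $ i)"
 by (simp add: ci_def matrix_vector_mult_def sum_distrib_right)
 also have "... = (SUM j:UNIV. SUM i:UNIV. cnj (X $ i $ j) * cnj (u $ j) * v $ i)" by (rule sum.swap)
 also have "... = ci u (adjm X *v v)" by (simp add: ci_def adjm_def matrix_vector_mult_def sum_distrib_left mult_ac)
 finally show "ci (X *v u) v = ci u (adjm X *v v)" .
 qed
 have sq: "X *v u = 0" if "X *v (X *v u) = 0" for u
 proof -
 let ?w = "X *v u"
 have "ci (adjm X *v ?w) (adjm X *v ?w) = ci ?w (X *v (adjm X *v ?w))" by (rule adj)
 also have "X *v (adjm X *v ?w) = adjm X *v (X *v ?w)" by (simp only: matrix_vector_mul_assoc matrix_mul_assoc n)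
 also have "... = 0" using that by simp
 finally have "adjm X *v ?w = 0" by (intro ci0) (simp add: ci_def)
 hence "ci ?w ?w = 0" unfolding adj(2)[of u ?w] by (simp add: ci_def)
 thus ?thesis by (rule ci0)
 qed
 have "ALL v. (((*v) X) ^^ Suc k) v = 0 ==> ALL v. X *v v = 0" for k
 proof (induction k)
 case (Suc k)
 have "(((*v) X) ^^ Suc k) v = 0" for v using sq[of "(((*v) X) ^^ k) v"] Suc.prems by simp
 thus ?case using Suc.IH by blast
 qed simp
 moreover have "ALL v. (((*v) X) ^^ Suc d) v = 0" using d by simp
 ultimately have "ALL v. X *v v = 0" by blast
 thus ?thesis by (simp add: matrix_eq)
qed

lemma Bij_mul: "g : Bij S ==> f : Bij S ==> g \<otimes>\<^bsub>BijGroup S\<^esub> f = compose S g f" by (simp add: BijGroup_def)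

section \<open>Group stabilisers and the tangent vectors of their normal subgroups\<close>

context lie_group
begin

lemma gro_sta_iff:
 assumes ga: "ga : dual_space sc q"
 shows "(g : group_stabiliser q Q ph ga) = (g : Q & (ALL x:q. ga (Ad q ph g x) = ga x))"
proof -
 have ext: "ga : extensional q" using ga unfolding dual_space_def by blast
 have "(coadjoint q ph g ga = ga) = ((ALL x:q. ga (Ad q ph (inv_into UNIV g) x) = ga x))" if "g : Q"
 proof -
 have "(coadjoint q ph g ga = ga) = ((ALL x:q. coadjoint q ph g ga x = ga x))"
 using ext extensionalityI[of "coadjoint q ph g ga" q ga] restrict_extensional unfolding coadjoint_def by metis
 thus ?thesis by (simp add: coadjoint_def)
 qed
 moreover have "((ALL x:q. ga (Ad q ph (inv_into UNIV g) x) = ga x)) = ((ALL x:q. ga (Ad q ph g x) = ga x))" if g: "g : Q"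
 proof
 assume a: "ALL x:q. ga (Ad q ph (inv_into UNIV g) x) = ga x"
 show "ALL x:q. ga (Ad q ph g x) = ga x" using a Ad_inv(1)[OF g] Ad_clo[OF g] by metis
 next
 assume a: "ALL x:q. ga (Ad q ph g x) = ga x"
 show "ALL x:q. ga (Ad q ph (inv_into UNIV g) x) = ga x" using a Ad_inv(2)[OF g] Ad_clo[OF Q_inv[OF g]] by metis
 qed
 ultimately show ?thesis unfolding group_stabiliser_def by blast
qed

lemma Adx_sta:
 assumes ga: "ga : dual_space sc q" and x: "x : lie_stabiliser br q ga"
 shows "expc (ph x) t : group_stabiliser q Q ph ga" unfolding gro_sta_iff[OF ga]
proof (intro conjI ballI)
 have xq: "x : q" and xs: "!!y. y : q ==> ga (br x y) = 0" using x unfolding lie_stabiliser_def by blast+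
 show "expc (ph x) t : Q" by (rule exp_in_Q[OF xq])
 fix y assume y: "y : q"
 have l: "linear_on sc (*) q ga" using ga unfolding dual_space_def by blast
 have "((%t. ga (Adx x t y)) has_field_derivative 0) (at t)" for t
 proof -
 have "Adx x t (br x y) = br x (Adx x t y)" using Ad_br[OF exp_in_Q[OF xq] xq y] Adx_fix[OF xq] by simp
 hence "ga (Adx x t (br x y)) = 0" using xs Ad_clo[OF exp_in_Q[OF xq] y] by simp
 thus ?thesis using Adx_der[OF xq y l, of t] by simp
 qed
 hence "EX c. ALL t:UNIV. ga (Adx x t y) = c" using has_field_derivative_zero_constant[of UNIV "%t. ga (Adx x t y)"] by simp
 hence "ga (Adx x t y) = ga (Adx x 0 y)" by (metis UNIV_I)
 thus "ga (Adx x t y) = ga y" using y by (simp add: Adx_0[OF xq])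
qed

lemma Ad_sta_sub:
 assumes ga: "ga : dual_space sc q"
 shows "subgroup (Ad q ph ` group_stabiliser q Q ph ga) (BijGroup q)"
proof
 let ?G = "group_stabiliser q Q ph ga"
 note iff = gro_sta_iff[OF ga]
 have GQ: "g : Q" if "g : ?G" for g using that iff by blast
 show "Ad q ph ` ?G <= carrier (BijGroup q)" using Ad_Bij GQ by (auto simp: BijGroup_def)
 show "\<one>\<^bsub>BijGroup q\<^esub> : Ad q ph ` ?G"
 proof -
 have "(%x. x) : ?G" unfolding iff using Q_id Ad_id by simp
 thus ?thesis using Ad_one by (force simp: BijGroup_def)
 qed
 fix a b assume "a : Ad q ph ` ?G" "b : Ad q ph ` ?G"
 then obtain g k where gk: "g : ?G" "a = Ad q ph g" "k : ?G" "b = Ad q ph k" by blast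
 have "g \<circ> k : ?G" using gk(1,3) Q_comp Ad_comp Ad_clo unfolding iff by simp
 moreover have "a \<otimes>\<^bsub>BijGroup q\<^esub> b = Ad q ph (g \<circ> k)" using gk GQ Ad_Bij Ad_com by (simp add: BijGroup_def)
 ultimately show "a \<otimes>\<^bsub>BijGroup q\<^esub> b : Ad q ph ` ?G" by blast
next
 let ?G = "group_stabiliser q Q ph ga"
 note iff = gro_sta_iff[OF ga]
 fix a assume "a : Ad q ph ` ?G"
 then obtain g where g: "g : ?G" "a = Ad q ph g" by blast
 hence gQ: "g : Q" using iff by blast
 have "inv_into UNIV g : ?G" unfolding iff
 proof (intro conjI ballI Q_inv[OF gQ])
 fix x assume x: "x : q"
 have "ga (Ad q ph g (Ad q ph (inv_into UNIV g) x)) = ga (Ad q ph (inv_into UNIV g) x)"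
 using g(1) Ad_clo[OF Q_inv[OF gQ] x] unfolding iff by blast
 thus "ga (Ad q ph (inv_into UNIV g) x) = ga x" using Ad_inv(2)[OF gQ x] by simp
 qed
 moreover have "inv\<^bsub>BijGroup q\<^esub> a = Ad q ph (inv_into UNIV g)"
 proof -
 have "inv\<^bsub>BijGroup q\<^esub> a = (\<lambda>x\<in>q. inv_into q (Ad q ph g) x)" unfolding g(2) by (rule inv_BijGroup[OF Ad_Bij[OF gQ]])
 also have "... = Ad q ph (inv_into UNIV g)"
 proof (rule ext)
 fix x
 show "(\<lambda>x\<in>q. inv_into q (Ad q ph g) x) x = Ad q ph (inv_into UNIV g) x"
 proof (cases "x : q")
 case True
 have "inv_into q (Ad q ph g) (Ad q ph g (Ad q ph (inv_into UNIV g) x)) = Ad q ph (inv_into UNIV g) x"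
 using Ad_bij[OF gQ] Ad_clo[OF Q_inv[OF gQ] True] by (intro inv_into_f_f) (auto simp: bij_betw_def)
 thus ?thesis using Ad_inv(2)[OF gQ True] True by simp
 qed (simp add: Ad_def)
 qed
 finally show ?thesis .
 qed
 ultimately show "inv\<^bsub>BijGroup q\<^esub> a : Ad q ph ` ?G" by blast
qed

lemma lin_cur_vel:
 assumes "D ` q <= q" shows "curve_velocity sc q (%t v. v + sc t (D v)) D" unfolding curve_velocity_def
proof (intro conjI ballI allI impI)
 fix w l assume w: "w : q" and l: "linear_on sc (*) q l"
 have Dw: "D w : q" using w assms by blast
 have "l (w + sc t (D w)) = l w + t * l (D w)" for t using l w Dw q_scale[OF Dw, of t] unfolding linear_on_def by simp
 thus "((%t. l (w + sc t (D w))) has_field_derivative l (D w)) (at 0)" by (auto intro!: derivative_eq_intros)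
qed simp

text \<open>All curves with velocity \<open>D\<close> at the identity give the same derivative, that
  of the list \<open>S\<close>. Tangency becomes a system of linear equations in \<open>D\<close>,
  which may be differentiated along families of tangent vectors.\<close>

lemma tan_iff:
 assumes D: "D ` q <= q"
 shows "tangent sc q U D \<longleftrightarrow>
 (ALL f S. polyfun sc q f & (ALL u:U. f u = 0) & diffl sc q f S --> (SUM (l, w)<-S. l (D w)) = 0)"
proof
 assume t: "tangent sc q U D"
 show "ALL f S. polyfun sc q f & (ALL u:U. f u = 0) & diffl sc q f S --> (SUM (l, w)<-S. l (D w)) = 0"
 proof (intro allI impI, elim conjE)
 fix f S assume f: "polyfun sc q f" "ALL u:U. f u = 0" and S: "diffl sc q f S"
 have "((%t. f (%v. v + sc t (D v))) has_field_derivative 0) (at 0)" using t f unfolding tangent_def by blast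
 thus "(SUM (l, w)<-S. l (D w)) = 0" using DERIV_unique diffe(3)[OF S lin_cur_vel[OF D]] by blast
 qed
next
 assume a: "ALL f S. polyfun sc q f & (ALL u:U. f u = 0) & diffl sc q f S --> (SUM (l, w)<-S. l (D w)) = 0"
 show "tangent sc q U D" unfolding tangent_def
 proof (intro allI impI)
 fix f assume f: "polyfun sc q f & (ALL u:U. f u = 0)"
 obtain S where S: "diffl sc q f S" using pol_dif f by blast
 thus "((%t. f (%v. v + sc t (D v))) has_field_derivative 0) (at 0)" using diffe(3)[OF S lin_cur_vel[OF D]] a f by metis
 qed
qed

lemma dif_fun:
 assumes S: "diffl sc q f S"
 shows "linear_on sc (*) q (%z. SUM (l, w)<-S. l (br z w))"
proof -
 have "linear_on sc (*) q (%z. SUM (l, w)<-S. l (br z w))"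
 if "!!l w. (l, w) : set S ==> linear_on sc (*) q l & w : q" for S :: "(('g => complex) \<times> 'g) list" using that
 proof (induction S)
 case (Cons p S)
 obtain l w where p: "p = (l, w)" by (cases p)
 have l: "linear_on sc (*) q l" "w : q" using Cons.prems[of l w] p by simp_all
 have "linear_on sc (*) q (%z. SUM (l, w)<-S. l (br z w))" by (rule Cons.IH) (use Cons.prems in auto)
 thus ?case using l q_br unfolding p linear_on_def by (simp add: br_add_left br_scale_left distrib_left)
 qed (simp add: linear_on_def)
 thus ?thesis using diffe(1,2)[OF S] by blast
qed

text \<open>Conjugation by \<open>Ad q ph g\<close> is polynomial and maps the normal subgroup
  \<open>U\<close> to itself; at the identity it carries \<open>br x\<close> to the bracket with
  \<open>Ad q ph g x\<close>.\<close>

lemma tan_con: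
 assumes ga: "ga : dual_space sc q" and H: "H = Ad q ph ` group_stabiliser q Q ph ga"
 and U: "U \<lhd> (BijGroup q\<lparr>carrier := H\<rparr>)" and g: "g : group_stabiliser q Q ph ga"
 and x: "x : q" and t: "tangent sc q U (br x)"
 shows "tangent sc q U (br (Ad q ph g x))"
proof -
 have gQ: "g : Q" using g gro_sta_iff[OF ga] by blast
 let ?a = "Ad q ph g" and ?b = "Ad q ph (inv_into UNIV g)"
 have sub: "subgroup H (BijGroup q)" unfolding H by (rule Ad_sta_sub[OF ga])
 have aH: "?a : H" using g H by blast
 have ab: "inv\<^bsub>BijGroup q\<^esub> ?a = ?b"
 proof -
 have "compose q ?b ?a = \<one>\<^bsub>BijGroup q\<^esub>" using Ad_inv(1)[OF gQ] by (auto simp: compose_def BijGroup_def fun_eq_iff)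
 hence "?b \<otimes>\<^bsub>BijGroup q\<^esub> ?a = \<one>\<^bsub>BijGroup q\<^esub>"
 using Bij_mul[OF Ad_Bij[OF Q_inv[OF gQ]] Ad_Bij[OF gQ]] by simp
 moreover have "?a : carrier (BijGroup q)" "?b : carrier (BijGroup q)"
 using Ad_Bij[OF gQ] Ad_Bij[OF Q_inv[OF gQ]] by (simp_all add: BijGroup_def)
 ultimately show ?thesis by (rule group.inv_equality[OF group_BijGroup])
 qed
 have UB: "u : Bij q" if "u : U" for u
 proof -
 have "u : H" using normal_imp_subgroup[OF U] that subgroup.subset by fastforce
 thus ?thesis using sub subgroup.subset by (fastforce simp: BijGroup_def)
 qed
 have conjU: "compose q ?a (compose q u ?b) : U" if u: "u : U" for u
 proof -
 have "?a \<otimes>\<^bsub>BijGroup q\<lparr>carrier := H\<rparr>\<^esub> u \<otimes>\<^bsub>BijGroup q\<lparr>carrier := H\<rparr>\<^esub> inv\<^bsub>BijGroup q\<lparr>carrier := H\<rparr>\<^esub> ?a : U"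
 using normal.inv_op_closed2[OF U _ u] aH by simp
 moreover have "inv\<^bsub>BijGroup q\<lparr>carrier := H\<rparr>\<^esub> ?a = ?b" using group.m_inv_consistent[OF group_BijGroup sub aH] ab by simp
 ultimately have "compose q (compose q ?a u) ?b : U"
 using Bij_mul[OF Ad_Bij[OF gQ] UB[OF u]] Bij_mul[OF compose_Bij[OF Ad_Bij[OF gQ] UB[OF u]] Ad_Bij[OF Q_inv[OF gQ]]] by simp
 moreover have "compose q (compose q ?a u) ?b = compose q ?a (compose q u ?b)"
 using Ad_clo[OF Q_inv[OF gQ]] by (auto simp: compose_def fun_eq_iff)
 ultimately show ?thesis by simp
 qed
 have brq: "br x ` q <= q" "br (?a x) ` q <= q" using q_br x Ad_clo[OF gQ] by blast+
 show ?thesis unfolding tangent_def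
 proof (intro allI impI)
 fix f assume f: "polyfun sc q f & (ALL u:U. f u = 0)"
 define f' where "f' T = f (compose q ?a (compose q T ?b))" for T
 have pf': "polyfun sc q f'" unfolding f'_def using pol_com_rig[OF pol_com_lef, of sc q f ?a ?b] f Ad_lin[OF gQ]
 Ad_clo[OF gQ] Ad_clo[OF Q_inv[OF gQ]] by blast
 moreover have "f' u = 0" if "u : U" for u unfolding f'_def using conjU[OF that] f by blast
 ultimately have "((%t. f' (%v. v + sc t (br x v))) has_field_derivative 0) (at 0)" using t unfolding tangent_def by blast
 moreover have "f' (%v. v + sc t (br x v)) = f (%v. v + sc t (br (?a x) v))" for t unfolding f'_def
 proof (rule pol_con[of sc q f])
 fix w assume w: "w : q"
 note bw = Ad_clo[OF Q_inv[OF gQ] w]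
 show "compose q ?a (compose q (%v. v + sc t (br x v)) ?b) w = w + sc t (br (?a x) w)" using w bw Ad_inv(2)[OF gQ w] q_br[OF x bw] q_scale
 by (simp add: compose_def Ad_add[OF gQ] Ad_sca[OF gQ] Ad_br[OF gQ x bw])
 qed (use f in blast)
 ultimately show "((%t. f (%v. v + sc t (br (?a x) v))) has_field_derivative 0) (at 0)" by simp
 qed
qed

end

context lie_group
begin

lemma lin_q_dif:
 assumes "linear_on sc (*) q l" "x : q" "y : q" shows "l (x - y) = l x - l y"
proof -
 have "l (x - y + y) = l (x - y) + l y" using assms(1) q_diff[OF assms(2,3)] assms(3) unfolding linear_on_def by blast
 thus ?thesis by simp
qed

text \<open>This is the ideal property of the tangent vectors of \<open>U\<close>: by
  \<open>tan_con\<close> all \<open>Adx m t x\<close> are tangent, and the linear equations of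
  \<open>tan_iff\<close> are differentiated at t = 0.\<close>

lemma tan_ide:
 assumes ga: "ga : dual_space sc q" and U: "U \<lhd> (BijGroup q\<lparr>carrier := Ad q ph ` group_stabiliser q Q ph ga\<rparr>)"
 and m: "m : lie_stabiliser br q ga" and x: "x : q" "tangent sc q U (br x)"
 shows "tangent sc q U (br (br m x))"
proof -
 have mq: "m : q" using m unfolding lie_stabiliser_def by blast
 have bq: "br z ` q <= q" if "z : q" for z using q_br that by blast
 have "(SUM (l, w)<-S. l (br (br m x) w)) = 0" if f: "polyfun sc q f" "ALL u:U. f u = 0" and S: "diffl sc q f S" for f S
 proof -
 define L where "L z = (SUM (l, w)<-S. l (br z w))" for z
 have L: "linear_on sc (*) q L" unfolding L_def by (rule dif_fun[OF S])
 have "L (Adx m t x) = 0" for t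
 proof -
 have "tangent sc q U (br (Adx m t x))" by (rule tan_con[OF ga refl U Adx_sta[OF ga m] x])
 thus ?thesis unfolding L_def using f S tan_iff[OF bq[OF Ad_clo[OF exp_in_Q[OF mq] x(1)]]] by blast
 qed
 hence "((%t. 0) has_field_derivative L (Adx m 0 (br m x))) (at 0)" using Adx_der[OF mq x(1) L, of 0] by simp
 hence "L (Adx m 0 (br m x)) = 0" using DERIV_const DERIV_unique by blast
 thus ?thesis using q_br[OF mq x(1)] by (simp add: Adx_0[OF mq] L_def)
 qed
 thus ?thesis unfolding tan_iff[OF bq[OF q_br[OF mq x(1)]]] by blast
qed

lemma tan_Adx_in:
 assumes ga: "ga : dual_space sc q" and U: "U \<lhd> (BijGroup q\<lparr>carrier := Ad q ph ` group_stabiliser q Q ph ga\<rparr>)"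
 and cl: "closedin (zariski sc q) U" and x: "x : q" "tangent sc q U (br x)"
 shows "Adx x t : U"
proof (rule tan_cur_in_clo[OF cl _ x(2)])
 have sub: "subgroup U (BijGroup q\<lparr>carrier := Ad q ph ` group_stabiliser q Q ph ga\<rparr>)"
 using U by (rule normal_imp_subgroup)
 show "(\<lambda>w\<in>q. w) : U" using subgroup.one_closed[OF sub] by (simp add: BijGroup_def)
 show "linear_on sc sc q (br x)" by (simp add: linear_on_def br_add_right br_scale_right)
 show "br x ` q <= q" using q_br x by blast
 show "vector_space sc" by (rule vector_space_axioms)
 show "subspace q" by (rule q_sub)
 show "Adx x t : GL sc q" for t by (rule Ad_GL[OF exp_in_Q[OF x(1)]])
 show "Adx x 0 = (\<lambda>w\<in>q. w)" by (rule Adx_0[OF x(1)])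
 show "((%t. l (Adx x t w)) has_field_derivative l (Adx x t (br x w))) (at t)"
 if "w : q" "linear_on sc (*) q l" for t w l by (rule Adx_der[OF x(1) that])
 show "compose q u v : U" if "u : U" "v : U" for u v
 proof -
 have "U <= Bij q" using cl by (auto simp: closedin_def zar_top GL_def)
 moreover have "u \<otimes>\<^bsub>BijGroup q\<^esub> v : U" using subgroup.m_closed[OF sub that] by simp
 ultimately show ?thesis using Bij_mul that by (metis subsetD)
 qed
qed

text \<open>For a unipotent \<open>u\<close> in a closed subgroup \<open>U\<close> of automorphisms fixing \<open>ga\<close>, the power \<open>u\<^sup>t\<close> is
 polynomial in \<open>t\<close>; its velocity \<open>log u\<close> is a derivation tangent to \<open>U\<close>.\<close>

lemma uni_log:
 assumes ga: "ga : dual_space sc q" and U: "U \<lhd> (BijGroup q\<lparr>carrier := Ad q ph ` group_stabiliser q Q ph ga\<rparr>)"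
 and u: "u : U" "unipotent_on q u"
 obtains D where "linear_on sc sc q D" "!!x. x : q ==> D x : q"
 "!!x y. x : q ==> y : q ==> D (br x y) = br (D x) y + br x (D y)"
 "!!x. x : q ==> ga (D x) = 0" "tangent sc q U D"
 "ALL x:q. D x = 0 ==> ALL x:q. u x = x"
proof -
 have sub: "subgroup U (BijGroup q\<lparr>carrier := Ad q ph ` group_stabiliser q Q ph ga\<rparr>)"
 using U by (rule normal_imp_subgroup)
 obtain g where g: "g : group_stabiliser q Q ph ga" "u = Ad q ph g" using subgroup.subset[OF sub] u(1) by auto
 have gQ: "g : Q" and gga: "!!x. x : q ==> ga (u x) = ga x"
 using g(1) unfolding gro_sta_iff[OF ga] g(2) by blast+
 have uq: "u x : q" and uadd: "y : q ==> u (x + y) = u x + u y" and usc: "u (sc c x) = sc c (u x)"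
 and ubr: "y : q ==> u (br x y) = br (u x) (u y)" if "x : q" for x y c
 unfolding g(2) using Ad_clo[OF gQ] Ad_add[OF gQ] Ad_sca[OF gQ] Ad_br[OF gQ] that by blast+
 define N where "N v = u v - v" for v
 obtain n where n: "!!w. w : q ==> (N ^^ n) w = 0" using u(2) unfolding unipotent_on_def N_def[abs_def] by blast
 have Nq: "(N ^^ j) x : q" if "x : q" for x j using that uq q_diff by (induction j) (auto simp: N_def)
 have Nadd: "(N ^^ j) (x + y) = (N ^^ j) x + (N ^^ j) y" and Nsc: "(N ^^ j) (sc c x) = sc c ((N ^^ j) x)" if "x : q" "y : q" for x y c j
 using that Nq by (induction j) (simp_all add: N_def uadd usc scale_right_diff_distrib)
 have Nhigh: "(N ^^ j) x = 0" if "n <= j" "x : q" for j x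
 proof -
 have "(N ^^ j) x = (N ^^ n) ((N ^^ (j - n)) x)" using that(1) by (simp add: funpow_add[symmetric, THEN fun_cong, unfolded o_def])
 thus ?thesis using n[OF Nq[OF that(2)]] by simp
 qed
 \<comment> \<open>\<open>V t\<close> is the binomial series of u^t, finite because
   \<open>N ^^ n\<close> vanishes on \<open>q\<close>; \<open>D\<close> is its velocity at 0, the
   logarithm of \<open>u\<close>.\<close>
 define V where "V t x = (SUM j<Suc n. sc (t gchoose j) ((N ^^ j) x))" for t x
 define D where "D x = (SUM j<Suc n. sc (logc j) ((N ^^ j) x))" for x
 have Vq: "V t x : q" and Dq: "D x : q" if "x : q" for t x
 unfolding V_def D_def using Nq[OF that] by (auto intro!: q_sum q_scale simp del: sum.lessThan_Suc)
 have V0: "V 0 x = x" for x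
 proof -
 have "V 0 x = (SUM j<Suc n. if j = 0 then x else 0)" unfolding V_def by (rule sum.cong) (auto simp: gbinomial_0_left)
 thus ?thesis by (simp add: sum.delta)
 qed
 have upow: "(u ^^ m) x = V (of_nat m) x" if x: "x : q" for m x
 proof (induction m)
 case (Suc m)
 have "N (V (of_nat m) x) = (SUM j<Suc n. sc (of_nat m gchoose j) ((N ^^ Suc j) x))"
 proof -
 have "(SUM j:I. sc (c j) ((N ^^ j) x)) : q & N (SUM j:I. sc (c j) ((N ^^ j) x)) = (SUM j:I. sc (c j) ((N ^^ Suc j) x))" if "finite I" for I c
 using that
 proof (induction I rule: finite_induct)
 case empty
 show ?case using Nsc[OF q_0 q_0, of 1 0] q_0 by simp
 next
 case (insert j I)
 thus ?case using Nadd[of "sc (c j) ((N ^^ j) x)" "SUM j:I. sc (c j) ((N ^^ j) x)" 1]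
 Nsc[OF Nq[OF x] Nq[OF x], of 1 "c j" j] Nq[OF x] q_scale q_add by simp
 qed
 thus ?thesis unfolding V_def by blast
 qed
 also have "... = (SUM j<n. sc (of_nat m gchoose j) ((N ^^ Suc j) x))" using Nhigh[of "Suc n" x] x by simp
 finally have NV: "N (V (of_nat m) x) = ..." .
 have VS: "V t x = x + (SUM j<n. sc (t gchoose Suc j) ((N ^^ Suc j) x))" for t unfolding V_def sum.lessThan_Suc_shift by simp
 have "u (V (of_nat m) x) = V (of_nat m) x + N (V (of_nat m) x)" by (simp add: N_def)
 also have "... = x + (SUM j<n. sc (of_nat m gchoose Suc j) ((N ^^ Suc j) x)) + (SUM j<n. sc (of_nat m gchoose j) ((N ^^ Suc j) x))"
 by (rule arg_cong2[where f = "(+)", OF VS NV])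
 also have "... = x + (SUM j<n. sc ((of_nat m gchoose Suc j) + (of_nat m gchoose j)) ((N ^^ Suc j) x))"
 by (simp only: scale_left_distrib sum.distrib add.assoc)
 also have "... = V (of_nat (Suc m)) x"
 proof -
 have "(of_nat m gchoose Suc j) + (of_nat m gchoose j) = (of_nat (Suc m) gchoose Suc j :: complex)" for j
 using gbinomial_Suc_Suc[of "of_nat m :: complex" j] by (simp add: add.commute)
 thus ?thesis unfolding VS by simp
 qed
 finally show ?case using Suc by simp
 qed (simp add: V0)
 have upq: "(u ^^ m) x : q" if "x : q" for m x using that uq by (induction m) auto
 have lV: "l (V t x) = (SUM j<Suc n. (t gchoose j) * l ((N ^^ j) x))" and lD: "l (D x) = (SUM j<Suc n. logc j * l ((N ^^ j) x))"
 if l: "linear_on sc (*) q l" and x: "x : q" for l t x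
 unfolding V_def D_def using lin_on_sum[OF l, of "{..<Suc n}" "%j. (N ^^ j) x"] Nq[OF x] by blast+
 have pV: "poly_fun (%t. l (V t x))" if "linear_on sc (*) q l" "x : q" for l x
 unfolding lV[OF that] by (intro pol_fun_sum pol_fun_mul pol_fun_gbi pol_fun_con)
 have vel: "curve_velocity sc q V D" unfolding curve_velocity_def
 proof (intro conjI ballI allI impI)
 fix w l assume w: "w : q" and l: "linear_on sc (*) q l"
 show "((%t. l (V t w)) has_field_derivative l (D w)) (at 0)" unfolding lV[OF l w] lD[OF l w] by (intro DERIV_sum DERIV_cmult_right log_der)
 qed (rule V0)
 have Dlin: "linear_on sc sc q D" unfolding linear_on_def D_def by (auto simp: Nadd Nsc scale_right_distrib sum.distrib scale_sum_right mult.commute)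
 moreover have "D (br x y) = br (D x) y + br x (D y)" if x: "x : q" and y: "y : q" for x y
 proof -
 have "D (br x y) - (br (D x) y + br x (D y)) = 0"
 proof (rule fun_sep)
 show "D (br x y) - (br (D x) y + br x (D y)) : q" by (intro q_diff q_add q_br Dq x y)
 fix l assume l: "linear_on sc (*) q l"
 have bil: "l (br (SUM i<Suc n. sc (a i) ((N ^^ i) x)) (SUM j<Suc n. sc (b j) ((N ^^ j) y)))
 = (SUM i<Suc n. SUM j<Suc n. a i * b j * l (br ((N ^^ i) x) ((N ^^ j) y)))" for a b
 proof -
 have "br (SUM i<Suc n. sc (a i) ((N ^^ i) x)) (SUM j<Suc n. sc (b j) ((N ^^ j) y))
 = (SUM i<Suc n. sc (a i) (SUM j<Suc n. sc (b j) (br ((N ^^ i) x) ((N ^^ j) y))))"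
 by (simp only: br_sum_lef br_scale_left, simp only: br_sum_rig br_scale_right)
 moreover have "(SUM j<Suc n. sc (b j) (br ((N ^^ i) x) ((N ^^ j) y))) : q" for i using Nq[OF x] Nq[OF y] by (intro q_sum q_scale q_br)
 ultimately have "l (br (SUM i<Suc n. sc (a i) ((N ^^ i) x)) (SUM j<Suc n. sc (b j) ((N ^^ j) y)))
 = (SUM i<Suc n. a i * l (SUM j<Suc n. sc (b j) (br ((N ^^ i) x) ((N ^^ j) y))))"
 using lin_on_sum[OF l, of "{..<Suc n}"] by (simp del: sum.lessThan_Suc)
 also have "... = (SUM i<Suc n. a i * (SUM j<Suc n. b j * l (br ((N ^^ i) x) ((N ^^ j) y))))"
 using lin_on_sum[OF l, of "{..<Suc n}"] q_br[OF Nq[OF x] Nq[OF y]] by (simp del: sum.lessThan_Suc)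
 finally show ?thesis by (simp only: sum_distrib_left mult.assoc)
 qed
 let ?c = "%i j. l (br ((N ^^ i) x) ((N ^^ j) y))"
 \<comment> \<open>\<open>l (V t (br x y))\<close> and \<open>F t\<close> are polynomials in
   \<open>t\<close> that agree at natural numbers, where u^m is an automorphism. Comparing
   velocities at 0 gives the Leibniz rule for \<open>D\<close>.\<close>
 define F where "F t = (SUM i<Suc n. SUM j<Suc n. (t gchoose i) * (t gchoose j) * ?c i j)" for t
 have F: "F t = l (br (V t x) (V t y))" for t unfolding F_def V_def bil ..
 have "poly_fun (%t. l (V t (br x y)) - F t)"
 unfolding F_def by (intro pol_fun_dif pV[OF l q_br[OF x y]] pol_fun_sum pol_fun_mul pol_fun_gbi pol_fun_con)
 moreover have "l (V (of_nat m) (br x y)) - F (of_nat m) = 0" for m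
 proof -
 have "(u ^^ m) (br x y) = br ((u ^^ m) x) ((u ^^ m) y)" by (induction m) (simp_all add: ubr upq x y)
 thus ?thesis unfolding F upow[OF x, symmetric] upow[OF y, symmetric] upow[OF q_br[OF x y], symmetric] by simp
 qed
 ultimately have "l (V t (br x y)) - F t = 0" for t by (rule pol_fun_zer)
 hence VF: "(%t. l (V t (br x y))) = F" by (simp add: fun_eq_iff)
 have "(F has_field_derivative
 (SUM i<Suc n. SUM j<Suc n. (logc i * (0 gchoose j) + logc j * (0 gchoose i)) * ?c i j)) (at 0)"
 unfolding F_def by (intro DERIV_sum DERIV_cmult_right DERIV_mult log_der)
 moreover have "(F has_field_derivative l (D (br x y))) (at 0)" using vel l q_br[OF x y] unfolding curve_velocity_def VF[symmetric] by blast
 ultimately have "l (D (br x y)) = (SUM i<Suc n. SUM j<Suc n. (logc i * (0 gchoose j) + logc j * (0 gchoose i)) * ?c i j)"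
 by (rule DERIV_unique[rotated])
 also have "... = (SUM i<Suc n. SUM j<Suc n. logc i * (0 gchoose j) * ?c i j) + (SUM i<Suc n. SUM j<Suc n. (0 gchoose i) * logc j * ?c i j)"
 by (simp add: distrib_left sum.distrib mult_ac del: sum.lessThan_Suc)
 also have "(SUM i<Suc n. SUM j<Suc n. logc i * (0 gchoose j) * ?c i j) = l (br (D x) (V 0 y))" unfolding D_def V_def bil ..
 also have "(SUM i<Suc n. SUM j<Suc n. (0 gchoose i) * logc j * ?c i j) = l (br (V 0 x) (D y))" unfolding D_def V_def bil ..
 finally have "l (D (br x y)) = l (br (D x) y + br x (D y))" using l q_br[OF x Dq[OF y]] q_br[OF Dq[OF x] y] unfolding V0 linear_on_def by simp
 moreover have "l (D (br x y) - (br (D x) y + br x (D y))) = l (D (br x y)) - l (br (D x) y + br x (D y))"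
 by (intro lin_q_dif[OF l] q_add q_br Dq x y)
 ultimately show "l (D (br x y) - (br (D x) y + br x (D y))) = 0" by simp
 qed
 thus ?thesis by simp
 qed
 moreover have "ga (D x) = 0" if x: "x : q" for x
 proof -
 have l: "linear_on sc (*) q ga" using ga unfolding dual_space_def by blast
 have "ga ((u ^^ m) x) = ga x" for m by (induction m) (simp_all add: gga upq x)
 hence "ga (V (of_nat m) x) - ga x = 0" for m using upow[OF x] by simp
 hence "ga (V t x) - ga x = 0" for t using pol_fun_zer[OF pol_fun_dif[OF pV[OF l x] pol_fun_con]] by blast
 hence "ga (V t x) = ga x" for t by simp
 moreover have "((%t. ga (V t x)) has_field_derivative ga (D x)) (at 0)" using vel l x unfolding curve_velocity_def by blast
 ultimately show ?thesis using DERIV_unique[OF DERIV_const] by simp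
 qed
 moreover have Dsub: "D ` q <= q" using Dq by blast
 have "tangent sc q U D" unfolding tan_iff[OF Dsub]
 proof (intro allI impI, elim conjE)
 fix f S assume f: "polyfun sc q f" "ALL u:U. f u = 0" and S: "diffl sc q f S"
 have "poly_fun (%t. f (V t))" using f(1)
 proof (induction rule: polyfun.induct)
 case (coeff w l)
 thus ?case by (intro pV)
 qed (auto intro: pol_fun_con pol_fun_add pol_fun_mul)
 moreover have "f (V (of_nat m)) = 0" for m
 proof -
 have "(\<lambda>w\<in>q. (u ^^ m) w) : U"
 proof (induction m)
 case 0
 thus ?case using subgroup.one_closed[OF sub] by (simp add: BijGroup_def restrict_def)
 next
 case (Suc m)
 have "U <= Bij q" using subgroup.subset[OF sub] Ad_Bij gro_sta_iff[OF ga] by auto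
 hence "compose q u (\<lambda>w\<in>q. (u ^^ m) w) : U"
 using subgroup.m_closed[OF sub u(1) Suc] Bij_mul[OF subsetD subsetD, OF \<open>U <= Bij q\<close> u(1) \<open>U <= Bij q\<close> Suc] by (simp add: restrict_def)
 moreover have "compose q u (\<lambda>w\<in>q. (u ^^ m) w) = (\<lambda>w\<in>q. (u ^^ Suc m) w)" by (auto simp: compose_def fun_eq_iff)
 ultimately show ?case by (simp only:)
 qed
 hence "f (\<lambda>w\<in>q. (u ^^ m) w) = 0" using f(2) by blast
 moreover have "f (\<lambda>w\<in>q. (u ^^ m) w) = f (V (of_nat m))" by (rule pol_con[OF f(1)]) (simp add: upow)
 ultimately show ?thesis by simp
 qed
 ultimately have "f (V t) = 0" for t by (rule pol_fun_zer)
 thus "(SUM (l, w)<-S. l (D w)) = 0" using DERIV_unique[OF DERIV_const] diffe(3)[OF S vel] by simp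
 qed
 \<comment> \<open>If \<open>u\<close> moved \<open>x\<close>, let N^(j+1) x be the last non-zero
   power. As the linear coefficient of the logarithm is 1, \<open>D\<close> maps N^j x to N^(j+1) x,
   against \<open>D = 0\<close>.\<close>
 moreover have "u x = x" if D0: "ALL x:q. D x = 0" and x: "x : q" for x
 proof (rule ccontr)
 assume "u x ~= x"
 hence N1: "(N ^^ 1) x ~= 0" by (simp add: N_def)
 define k where "k = (LEAST k. (N ^^ k) x = 0)"
 have k0: "(N ^^ k) x = 0" unfolding k_def using n[OF x] by (rule LeastI)
 have below: "(N ^^ j) x ~= 0" if "j < k" for j using not_less_Least that unfolding k_def by blast
 have "N 0 = 0" using Nsc[OF q_0 q_0, of 1 0] by simp
 hence "x ~= 0" using N1 by auto
 hence "k ~= 0" "k ~= 1" using k0 N1 by (auto intro: ccontr)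
 then obtain j where j: "k = Suc (Suc j)" by (metis One_nat_def not0_implies_Suc)
 let ?w = "(N ^^ j) x"
 have "D ?w = (SUM i<Suc n. if i = 1 then (N ^^ Suc j) x else 0)" unfolding D_def
 proof (rule sum.cong)
 fix i
 have high: "(N ^^ (Suc (Suc i) + j)) x = 0" for i
 proof (induction i)
 case (Suc i)
 thus ?case using Nsc[OF q_0 q_0, of 1 0] by simp
 qed (use k0 j in simp)
 show "sc (logc i) ((N ^^ i) ?w) = (if i = 1 then (N ^^ Suc j) x else 0)"
 proof -
 consider "i = 0" | "i = 1" | k where "i = Suc (Suc k)" by (metis One_nat_def not0_implies_Suc)
 thus ?thesis
 proof cases
 case 3
 have "(N ^^ i) ?w = (N ^^ (i + j)) x" by (simp add: funpow_add)
 thus ?thesis using 3 high[of k] by simp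
 qed (simp_all add: logc_0 logc_1)
 qed
 qed simp
 moreover have "1 < Suc n"
 proof -
 have "n ~= 0" using n[OF x] N1 \<open>k ~= 0\<close> below[of 0] by (metis not_gr_zero)
 thus ?thesis by simp
 qed
 ultimately have "D ?w = (N ^^ Suc j) x" by (simp add: sum.delta)
 thus False using D0 Nq[OF x] below[of "Suc j"] j by simp
 qed
 ultimately show ?thesis by (intro that[of D]) (use Dq in blast)+
qed

text \<open>\<open>inner\<close> turns the logarithm of a unipotent element into some
  \<open>z\<close> in \<open>q\<close>, which lies in \<open>M\<close> because \<open>ga\<close>
  vanishes on the image of the logarithm. \<open>w\<close> converts ad-nilpotency on
  \<open>q\<close> into nilpotency of the matrix \<open>tt x\<close>, \<open>star\<close> supplies
  adjoints within \<open>M\<close>, and \<open>tt0\<close> leads back from matrices to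
  \<open>M\<close>.\<close>

theorem red_typ:
 fixes tt :: "'g => complex ^ 'e ^ 'e" and w :: "complex ^ 'e => 'g"
 assumes ga: "ga : dual_space sc q" and M: "M = lie_stabiliser br q ga"
 and inner: "!!D. linear_on sc sc q D ==> (!!x. x : q ==> D x : q) ==>
 (!!x y. x : q ==> y : q ==> D (br x y) = br (D x) y + br x (D y)) ==> EX z:q. ALL x:q. D x = br z x"
 and tt0: "!!x. x : M ==> tt x = 0 ==> x = 0"
 and ttbr: "!!x y. x : M ==> y : M ==> tt (br x y) = tt x ** tt y - tt y ** tt x"
 and star: "!!x. x : M ==> EX y:M. tt y = adjm (tt x)"
 and w: "!!v. w v : q" "!!v. w v = 0 ==> v = 0" "!!x v. x : M ==> br x (w v) = w (tt x *v v)"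
 shows "reductive_type sc q Q ph ga" unfolding reductive_type_def reductive_group_def
proof (intro conjI allI impI)
 let ?H = "Ad q ph ` group_stabiliser q Q ph ga"
 show "subgroup ?H (BijGroup q)" by (rule Ad_sta_sub[OF ga])
 show "?H <= GL sc q" using Ad_GL gro_sta_iff[OF ga] by blast
 fix U assume "U \<lhd> (BijGroup q\<lparr>carrier := ?H\<rparr>) & closedin (zariski sc q) U &
 connectedin (zariski sc q) U & (ALL u:U. unipotent_on q u)"
 hence U: "U \<lhd> (BijGroup q\<lparr>carrier := ?H\<rparr>)" and cl: "closedin (zariski sc q) U"
 and uni: "!!u. u : U ==> unipotent_on q u" by blast+
 have Mq: "x : q" if "x : M" for x using that unfolding M lie_stabiliser_def by blast
 have nil: "EX d. ALL v. (((*v) (tt x)) ^^ d) v = 0" if x: "x : M" "tangent sc q U (br x)" for x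
 proof -
 obtain d where d: "!!y. y : q ==> ((br x) ^^ d) y = 0"
 using ad_nil[OF Mq[OF x(1)]] uni tan_Adx_in[OF ga U cl Mq[OF x(1)] x(2)] by blast
 have "((br x) ^^ k) (w v) = w ((((*v) (tt x)) ^^ k) v)" for k v by (induction k) (simp_all add: w(3)[OF x(1)])
 hence "w ((((*v) (tt x)) ^^ d) v) = 0" for v using d[OF w(1)] by simp
 thus ?thesis using w(2) by blast
 qed
 have zero: "x = 0" if x: "x : M" "tangent sc q U (br x)" for x
 proof -
 obtain y where y: "y : M" "tt y = adjm (tt x)" using star[OF x(1)] by blast
 let ?X = "tt x" and ?A = "adjm (tt x)"
 have Mbr: "br a b : M" if "a : M" "b : M" for a b
 proof -
 have "ga (br (br a b) z) = 0" if z: "z : q" for z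
 proof -
 have "br (br a b) z = br a (br b z) - br b (br a z)" by (rule jac_lef)
 moreover have "ga (br a (br b z)) = 0" "ga (br b (br a z)) = 0"
 using \<open>a : M\<close> \<open>b : M\<close> q_br[OF Mq[OF \<open>a : M\<close>] z] q_br[OF Mq[OF \<open>b : M\<close>] z] unfolding M lie_stabiliser_def by blast+
 moreover have "linear_on sc (*) q ga" using ga unfolding dual_space_def by blast
 ultimately show ?thesis
 using lin_q_dif[of ga] q_br[OF Mq[OF \<open>a : M\<close>] q_br[OF Mq[OF \<open>b : M\<close>] z]] q_br[OF Mq[OF \<open>b : M\<close>] q_br[OF Mq[OF \<open>a : M\<close>] z]] by simp
 qed
 thus ?thesis using that Mq q_br unfolding M lie_stabiliser_def by blast
 qed
 \<comment> \<open>The ideal contains \<open>br y x\<close>, whose matrix is the commutator of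
   \<open>?A\<close> and \<open>?X\<close>. It is self-adjoint and nilpotent, hence 0; so
   \<open>?X\<close> is normal and nilpotent, hence 0 as well.\<close>
 have c: "br y x : M" "tangent sc q U (br (br y x))"
 using Mbr[OF y(1) x(1)] tan_ide[OF ga U _ Mq[OF x(1)] x(2), of y] y(1) M by blast+
 have adj_mult: "adjm (A ** B) = adjm B ** adjm A" for A B :: "complex ^ 'e ^ 'e"
 by (simp add: adjm_def matrix_matrix_mult_def vec_eq_iff mult.commute)
 have adj_adj: "adjm (adjm A) = A" for A :: "complex ^ 'e ^ 'e" by (simp add: adjm_def vec_eq_iff)
 have adj_diff: "adjm (A - B) = adjm A - adjm B" for A B :: "complex ^ 'e ^ 'e"
 by (simp add: adjm_def vec_eq_iff)
 have tc: "tt (br y x) = ?A ** ?X - ?X ** ?A" using ttbr[OF y(1) x(1)] y(2) by simp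
 have "adjm (tt (br y x)) = tt (br y x)" unfolding tc adj_diff adj_mult adj_adj ..
 moreover obtain d where "!!v. (((*v) (tt (br y x))) ^^ d) v = 0" using nil[OF c] by blast
 ultimately have "tt (br y x) = 0" using nor_nil[of "tt (br y x)" d] by simp
 hence "?X ** ?A = ?A ** ?X" using tc by simp
 moreover obtain d' where "!!v. (((*v) ?X) ^^ d') v = 0" using nil[OF x] by blast
 ultimately have "?X = 0" by (rule nor_nil)
 thus "x = 0" using tt0[OF x(1)] by blast
 qed
 have triv: "u = (\<lambda>x\<in>q. x)" if u: "u : U" for u
 proof -
 obtain D where D: "linear_on sc sc q D" "!!x. x : q ==> D x : q"
 "!!x y. x : q ==> y : q ==> D (br x y) = br (D x) y + br x (D y)"
 "!!x. x : q ==> ga (D x) = 0" "tangent sc q U D"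
 "ALL x:q. D x = 0 ==> ALL x:q. u x = x" using uni_log[OF ga U u uni[OF u]] by blast
 obtain z where z: "z : q" "!!x. x : q ==> D x = br z x" using inner[OF D(1-3)] by blast
 have zM: "z : M" using z D(4) unfolding M lie_stabiliser_def by auto
 have "tangent sc q U (br z)"
 proof -
 have Ds: "D ` q <= q" "br z ` q <= q" using D(2) q_br[OF z(1)] by blast+
 have "(SUM (l, w)<-S. l (br z w)) = 0" if f: "polyfun sc q f" "ALL u:U. f u = 0" "diffl sc q f S" for f S
 proof -
 have "(SUM (l, w)<-S. l (br z w)) = (SUM (l, w)<-S. l (D w))"
 using diffe(2)[OF f(3)] z(2) by (intro arg_cong[where f = sum_list] map_cong) auto
 also have "... = 0" using D(5) f unfolding tan_iff[OF Ds(1)] by blast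
 finally show ?thesis .
 qed
 thus ?thesis unfolding tan_iff[OF Ds(2)] by blast
 qed
 hence "z = 0" by (rule zero[OF zM])
 hence "ALL x:q. u x = x" using D(6) z(2) by simp
 moreover have "u : extensional q" using cl u by (auto simp: closedin_def zar_top GL_def Bij_def)
 ultimately show ?thesis by (auto intro!: extensionalityI)
 qed
 have one: "\<one>\<^bsub>BijGroup q\<^esub> = (\<lambda>x\<in>q. x)" by (simp add: BijGroup_def)
 have "\<one>\<^bsub>BijGroup q\<^esub> : U" using subgroup.one_closed[OF normal_imp_subgroup[OF U]] by simp
 hence "(\<lambda>x\<in>q. x) : U" unfolding one .
 moreover have "U <= {\<lambda>x\<in>q. x}" using triv by (intro subsetI singletonI) (simp only: singleton_iff)
 ultimately show "U = {\<one>\<^bsub>BijGroup q\<^esub>}" unfolding one by (intro equalityI) simp_all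
qed

text \<open>The entries of a commutator with a fixed matrix are polynomial functions. Those for
  \<open>g\<close> in \<open>Q\<close> vanish on the centre, so \<open>X\<close> commutes with
  \<open>Q\<close>; those for \<open>X\<close> then vanish on \<open>Q\<close>, so \<open>X\<close>
  commutes with the Lie algebra. The trivial centre of \<open>q\<close> leaves only
  \<open>X = 0\<close>.\<close>

lemma cen_lie_alg:
 assumes c: "!!x. x : q ==> (!!y. y : q ==> br x y = 0) ==> x = 0" and X: "X : group_lie_algebra (group_centre Q)"
 shows "diagonalisable (*s) X"
proof -
 have sub: "group_centre Q <= Q" unfolding group_centre_def by blast
 have Xl: "linear_on (*s) (*s) UNIV X" using X unfolding group_lie_algebra_def by blast
 have Xd: "((%t. f (%v. v + t *s X v)) has_field_derivative 0) (at 0)" if "polyfun (*s) UNIV f" "!!g. g : group_centre Q ==> f g = 0" for f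
 using X that unfolding group_lie_algebra_def by blast
 have commute_pf: "polyfun (*s) UNIV (%T. (T (A w) - A (T w)) $ i)" if A: "linear_on (*s) (*s) UNIV A" for A :: "complex ^ 'n => complex ^ 'n" and w i
 proof -
 have "polyfun (*s) UNIV (%T. (%v. v $ i) (T (A w)))" by (rule polyfun.coeff[OF _ lin_on_nth]) simp
 moreover have "polyfun (*s) UNIV (%T. (%v. (- 1) * (A v $ i)) (T w))"
 proof (rule polyfun.coeff)
 show "linear_on (*s) (*) UNIV (%v. (- 1) * (A v $ i))" using lin_on_com[OF A lin_on_nth[of i]] by (simp add: linear_on_def)
 qed simp
 ultimately show ?thesis using polyfun.add by fastforce
 qed
 have der: "((%t. ((A w + t *s Y (A w)) - A (w + t *s Y w)) $ i) has_field_derivative (Y (A w) - A (Y w)) $ i) (at 0)"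
 if A: "linear_on (*s) (*s) UNIV A" for A Y :: "complex ^ 'n => complex ^ 'n" and w i
 proof -
 have "A (w + t *s Y w) = A w + t *s A (Y w)" for t using A unfolding linear_on_def by simp
 hence "(%t. ((A w + t *s Y (A w)) - A (w + t *s Y w)) $ i) = (%t. t * (Y (A w) - A (Y w)) $ i)" by (simp add: fun_eq_iff algebra_simps)
 thus ?thesis by (auto intro!: derivative_eq_intros)
 qed
 have XQ: "X (g w) = g (X w)" if g: "g : Q" for g w
 proof -
 have "(X (g w) - g (X w)) $ i = 0" for i
 proof (rule DERIV_unique)
 show "((%t. ((g w + t *s X (g w)) - g (w + t *s X w)) $ i) has_field_derivative (X (g w) - g (X w)) $ i) (at 0)" by (rule der[OF Q_GL[OF g]])
 show "((%t. ((g w + t *s X (g w)) - g (w + t *s X w)) $ i) has_field_derivative 0) (at 0)"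
 proof (rule Xd[OF commute_pf[OF Q_GL[OF g]]])
 fix z assume "z : group_centre Q"
 hence "g \<circ> z = z \<circ> g" using g unfolding group_centre_def by blast
 hence "z (g w) = g (z w)" by (metis o_apply)
 thus "(z (g w) - g (z w)) $ i = 0" by simp
 qed
 qed
 thus ?thesis by (simp add: vec_eq_iff)
 qed
 have "X : group_lie_algebra Q" unfolding group_lie_algebra_def using Xl Xd sub by blast
 then obtain x where x: "x : q" "ph x = X" using ph_sur by blast
 have "br x y = 0" if y: "y : q" for y
 proof -
 note Yl = ph_lin[OF y]
 have "(ph y (X w) - X (ph y w)) $ i = 0" for w i
 proof (rule DERIV_unique)
 show "((%t. ((X w + t *s ph y (X w)) - X (w + t *s ph y w)) $ i) has_field_derivative (ph y (X w) - X (ph y w)) $ i) (at 0)"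
 by (rule der[OF Xl])
 have "ALL g:Q. (g (X w) - X (g w)) $ i = 0" by (simp add: XQ)
 thus "((%t. ((X w + t *s ph y (X w)) - X (w + t *s ph y w)) $ i) has_field_derivative 0) (at 0)"
 using ph_tan[OF y, unfolded tangent_def] commute_pf[OF Xl, of w i] by blast
 qed
 hence e: "ph y (X w) = X (ph y w)" for w by (simp add: vec_eq_iff)
 have "ph (br x y) = ph 0"
 proof (rule ext)
 fix v
 have "ph (sc 0 0) v = 0 *s ph 0 v" by (rule ph_sca[OF q_0])
 thus "ph (br x y) v = ph 0 v" unfolding ph_br[OF x(1) y] x(2) e by simp
 qed
 thus ?thesis using ph_inj[OF q_br[OF x(1) y] q_0] by blast
 qed
 hence "x = 0" using c[OF x(1)] by blast
 have "X v = 0" for v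
 proof -
 have "ph (sc 0 0) v = 0 *s ph 0 v" by (rule ph_sca[OF q_0])
 thus ?thesis using x(2) \<open>x = 0\<close> by simp
 qed
 hence "{v. EX c. X v = c *s v} = UNIV" by (auto intro: exI[of _ 0])
 thus ?thesis unfolding diagonalisable_def by simp
qed

end

section \<open>The index of a Lie algebra with a toral stabiliser\<close>

text \<open>The Leibniz formula over a finite index set, because the size of the minors varies with
  the form, and over a commutative ring, because the entries will be polynomials.\<close>

definition det_on :: "'i set => ('i => 'i => 'r::comm_ring_1) => 'r" where
 "det_on J A = (\<Sum>p | p permutes J. of_int (sign p) * (PROD i:J. A i (p i)))"

lemma det_on_row_exp:
 assumes J: "finite J" "m : J"
 shows "det_on J (A(m := r)) = (\<Sum>p | p permutes J. of_int (sign p) * (r (p m) * (PROD i:J - {m}. A i (p i))))" unfolding det_on_def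
proof (rule sum.cong)
 fix p
 have "(PROD i:J. (A(m := r)) i (p i)) = r (p m) * (PROD i:J - {m}. (A(m := r)) i (p i))" by (simp add: prod.remove[OF J])
 also have "(PROD i:J - {m}. (A(m := r)) i (p i)) = (PROD i:J - {m}. A i (p i))" by (rule prod.cong) auto
 finally show "of_int (sign p) * (PROD i:J. (A(m := r)) i (p i)) = of_int (sign p) * (r (p m) * (PROD i:J - {m}. A i (p i)))" by simp
qed simp

lemma det_on_col_exp:
 assumes J: "finite J" "k : J"
 shows "det_on J (%i j. if j = k then c i else A i j) =
 (\<Sum>p | p permutes J. of_int (sign p) * (c (inv_into UNIV p k) * (PROD i:J - {inv_into UNIV p k}. A i (p i))))"
 unfolding det_on_def
proof (rule sum.cong)
 fix p assume "p : {p. p permutes J}"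
 hence p: "p permutes J" by simp
 let ?m = "inv_into UNIV p k"
 have m: "?m : J" "p ?m = k" "!!i. p i = k \<longleftrightarrow> i = ?m"
 using permutes_in_image[OF permutes_inv[OF p]] J permutes_inverses[OF p] by auto
 have "(PROD i:J. if p i = k then c i else A i (p i)) = c ?m * (PROD i:J - {?m}. if p i = k then c i else A i (p i))"
 by (simp add: prod.remove[OF J(1) m(1)] m(2))
 also have "(PROD i:J - {?m}. if p i = k then c i else A i (p i)) = (PROD i:J - {?m}. A i (p i))" by (rule prod.cong) (auto simp: m(3))
 finally show "of_int (sign p) * (PROD i:J. if p i = k then c i else A i (p i)) =
 of_int (sign p) * (c ?m * (PROD i:J - {?m}. A i (p i)))" by simp
qed simp

lemma det_on_equ_row:
 fixes A :: "'i => 'i => complex"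
 assumes J: "finite J" and m: "m : J" "n : J" "m ~= n" and eq: "A m = A n"
 shows "det_on J A = 0"
proof -
 let ?t = "Transposition.transpose m n"
 have t: "?t permutes J" by (rule permutes_swap_id[OF m(1,2)])
 have "det_on J A = (\<Sum>p | p permutes J. of_int (sign (p \<circ> ?t)) * (PROD i:J. A i ((p \<circ> ?t) i)))"
 unfolding det_on_def by (rule sum_permutations_compose_right[OF t])
 also have "... = (\<Sum>p | p permutes J. - (of_int (sign p) * (PROD i:J. A i (p i))))"
 proof (rule sum.cong)
 fix p assume "p : {p. p permutes J}"
 hence p: "p permutes J" by simp
 have "permutation p" "permutation ?t" unfolding permutation_permutes using p t J by blast+
 hence "sign (p \<circ> ?t) = - sign p" using sign_compose[of p ?t] sign_swap_id[of m n] m(3) by simp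
 moreover have "(PROD i:J. A i ((p \<circ> ?t) i)) = (PROD i:J. A (?t i) (p (?t i)))"
 proof (rule prod.cong)
 fix i
 have "A (?t i) = A i" using eq by (simp add: Transposition.transpose_def)
 thus "A i ((p \<circ> ?t) i) = A (?t i) (p (?t i))" by simp
 qed simp
 moreover have "... = (PROD i:J. A i (p i))" by (rule prod.reindex_bij_betw[OF permutes_imp_bij[OF t]])
 ultimately show "of_int (sign (p \<circ> ?t)) * (PROD i:J. A i ((p \<circ> ?t) i)) = - (of_int (sign p) * (PROD i:J. A i (p i)))" by simp
 qed simp
 also have "... = - det_on J A" unfolding det_on_def by (rule sum_negf)
 finally show ?thesis by simp
qed

text \<open>Replacing row \<open>m\<close> by the vanishing combination gives 0; by linearity the
  only term without two equal rows is \<open>c m\<close> times the determinant.\<close>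

lemma det_on_dep_row:
 fixes A :: "'i => 'i => complex"
 assumes J: "finite J" and dep: "!!j. j : J ==> (SUM i:J. c i * A i j) = 0" and m: "m : J" "c m ~= 0"
 shows "det_on J A = 0"
proof -
 let ?P = "{p. p permutes J}"
 have "0 = (SUM p:?P. of_int (sign p) * ((SUM i:J. c i * A i (p m)) * (PROD i:J - {m}. A i (p i))))"
 by (rule sum.neutral[symmetric]) (use dep m in "auto simp: permutes_in_image")
 also have "... = (SUM p:?P. SUM n:J. c n * (of_int (sign p) * (A n (p m) * (PROD i:J - {m}. A i (p i)))))"
 by (simp add: sum_distrib_left sum_distrib_right mult_ac)
 also have "... = (SUM n:J. c n * det_on J (A(m := A n)))" unfolding det_on_row_exp[OF J m(1)] by (subst sum.swap) (simp add: sum_distrib_left)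
 also have "... = c m * det_on J (A(m := A m)) + (SUM n:J - {m}. c n * det_on J (A(m := A n)))" by (rule sum.remove[OF J m(1)])
 also have "(SUM n:J - {m}. c n * det_on J (A(m := A n))) = 0"
 proof (rule sum.neutral, rule ballI)
 fix n assume n: "n : J - {m}"
 have "det_on J (A(m := A n)) = 0" by (rule det_on_equ_row[OF J m(1), of n]) (use n in auto)
 thus "c n * det_on J (A(m := A n)) = 0" by simp
 qed
 finally show ?thesis using m by simp
qed

lemma det_on_ide:
 assumes J: "finite J" and A: "!!i j. i : J ==> j : J ==> A i j = (if i = j then 1 else 0)"
 shows "det_on J A = 1"
proof -
 have "(PROD i:J. A i (p i)) = (if p = id then 1 else 0)" if p: "p permutes J" for p
 proof (cases "p = id")
 case True
 thus ?thesis using A by (auto intro: prod.neutral)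
 next
 case False
 then obtain i where i: "p i ~= i" by (auto simp: fun_eq_iff)
 hence "i : J" "p i : J" using p permutes_not_in permutes_in_image by metis+
 hence "A i (p i) = 0" using A i by auto
 hence "EX i:J. A i (p i) = 0" using \<open>i : J\<close> by blast
 thus ?thesis using False prod_zero[OF J, of "%i. A i (p i)"] by simp
 qed
 hence "det_on J A = (\<Sum>p | p permutes J. if p = id then 1 else 0)" unfolding det_on_def by (intro sum.cong) auto
 also have "... = 1" using finite_permutations[OF J] permutes_id[of J] by (simp add: sum.delta)
 finally show ?thesis .
qed

text \<open>Two parameters are in play: the polynomial variable is the deformation parameter t,
  while \<open>s\<close> moves the direction of the deformation.\<close>

definition coeff_der :: "(complex => complex poly) => complex poly => complex => bool" where
 "coeff_der P P' s = ((ALL n. ((%s. coeff (P s) n) has_field_derivative coeff P' n) (at s)))"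

lemma coe_der_con: "coeff_der (%s. p) 0 s" unfolding coeff_der_def by simp

lemma coe_der_mul:
 assumes "coeff_der P P' s" "coeff_der R R' s"
 shows "coeff_der (%s. P s * R s) (P' * R s + P s * R') s" unfolding coeff_der_def
proof
 fix n
 have "((%s. SUM i<=n. coeff (P s) i * coeff (R s) (n - i)) has_field_derivative
 (SUM i<=n. coeff (P s) i * coeff R' (n - i) + coeff P' i * coeff (R s) (n - i))) (at s)"
 using assms unfolding coeff_der_def by (intro DERIV_sum DERIV_mult') auto
 thus "((%s. coeff (P s * R s) n) has_field_derivative coeff (P' * R s + P s * R') n) (at s)" by (simp add: coeff_mult sum.distrib add.commute)
qed

lemma coe_der_sum:
 assumes "!!i. i : I ==> coeff_der (P i) (P' i) s"
 shows "coeff_der (%s. SUM i:I. P i s) (SUM i:I. P' i) s" using assms unfolding coeff_der_def by (simp add: coeff_sum DERIV_sum)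

lemma coe_der_pro:
 assumes "finite I" "!!i. i : I ==> coeff_der (P i) (P' i) s"
 shows "coeff_der (%s. PROD i:I. P i s) (SUM m:I. P' m * (PROD i:I - {m}. P i s)) s" using assms
proof (induction I rule: finite_induct)
 case (insert a I)
 have "coeff_der (%s. P a s * (PROD i:I. P i s))
 (P' a * (PROD i:I. P i s) + P a s * (SUM m:I. P' m * (PROD i:I - {m}. P i s))) s"
 using insert by (intro coe_der_mul) auto
 moreover have "(SUM m:insert a I. P' m * (PROD i:insert a I - {m}. P i s)) =
 P' a * (PROD i:I. P i s) + P a s * (SUM m:I. P' m * (PROD i:I - {m}. P i s))"
 proof -
 have "(PROD i:insert a I - {m}. P i s) = P a s * (PROD i:I - {m}. P i s)" if m: "m : I" for m
 proof -
 have "insert a I - {m} = insert a (I - {m})" using m insert by auto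
 thus ?thesis using insert by simp
 qed
 moreover have "insert a I - {a} = I" using insert by auto
 ultimately show ?thesis using insert(1,2) by (simp add: sum_distrib_left mult_ac)
 qed
 ultimately show ?case using insert by simp
qed (simp add: coe_der_con)

lemma coe_der_zer:
 assumes "!!s. coeff_der P (P' s) s" "!!s. coeff (P' s) n = 0"
 shows "coeff (P 1) n = coeff (P 0) n"
proof -
 have "EX c. ALL x:UNIV. (%s. coeff (P s) n) x = c"
 by (rule has_field_derivative_zero_constant) (use assms in "simp_all add: coeff_der_def, metis")
 thus ?thesis by auto
qed

context complex_lie_algebra
begin

lemma dua_vec:
 assumes q: "subspace q" and I: "finite I" and f: "!!i. i : I ==> linear_on sc (*) q (f i)"
 and ind: "!!c. (!!z. z : q ==> (SUM i:I. c i * f i z) = 0) ==> ALL i:I. c i = 0"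
 shows "EX y. (ALL i:I. y i : q) & (ALL i:I. ALL j:I. f i (y j) = (if i = j then 1 else 0))" using I f ind
proof (induction I rule: finite_induct)
 case (insert a I)
 have "EX y. (ALL i:I. y i : q) & (ALL i:I. ALL j:I. f i (y j) = (if i = j then 1 else 0))"
 proof (rule insert.IH)
 fix c assume c: "!!z. z : q ==> (SUM i:I. c i * f i z) = 0"
 have "(SUM i:insert a I. (c(a := 0)) i * f i z) = (SUM i:I. c i * f i z)" for z using insert(1,2) by (auto intro!: sum.cong)
 hence z: "ALL i:insert a I. (c(a := 0)) i = 0" using c by (intro insert.prems(2)) simp
 show "ALL i:I. c i = 0"
 proof
 fix i assume "i : I"
 thus "c i = 0" using z[rule_format, of i] insert(2) by (cases "i = a") auto
 qed
 qed (rule insert.prems(1), simp)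
 then obtain y where y0: "(ALL i:I. y i : q) & (ALL i:I. ALL j:I. f i (y j) = (if i = j then 1 else 0))" by (elim exE)
 have y: "i : I ==> y i : q" "i : I ==> j : I ==> f i (y j) = (if i = j then 1 else 0)" for i j using y0 by auto
 have add: "f i (u + v) = f i u + f i v" and scale: "f i (sc c u) = c * f i u" if "i : insert a I" "u : q" "v : q" for i u v c
 using insert.prems(1)[OF that(1)] that(2,3) unfolding linear_on_def by blast+
 have diff: "f i (u - v) = f i u - f i v" if "i : insert a I" "u : q" "v : q" for i u v
 using add[OF that(1) subspace_diff[OF q that(2,3)] that(3)] by simp
 have z0: "0 : q" using q by (rule subspace_0)
 have fsum: "f i (SUM j:K. sc (c j) (y j)) = (SUM j:K. c j * f i (y j))" if i: "i : insert a I" and K: "K <= I" for i c K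
 using finite_subset[OF K insert(1)] K
 proof (induction K rule: finite_induct)
 case empty
 thus ?case using scale[OF i z0 z0, of 0] by simp
 next
 case (insert k K)
 have "(SUM j:K. sc (c j) (y j)) : q" by (rule subspace_sum[OF q]) (use insert y(1) subspace_scale[OF q] in auto)
 moreover have "y k : q" using insert y(1) by auto
 ultimately show ?case using insert add[OF i subspace_scale[OF q, of "y k" "c k"]] scale[OF i, of "y k" "y k" "c k"] by simp
 qed
 define r where "r z = z - (SUM j:I. sc (f j z) (y j))" for z
 have sq: "(SUM j:I. sc (c j) (y j)) : q" for c by (rule subspace_sum[OF q]) (use y(1) subspace_scale[OF q] in auto)
 have rq: "r z : q" if "z : q" for z unfolding r_def by (intro subspace_diff[OF q] that sq)
 have fr: "f i (r z) = f i z - (SUM j:I. f j z * f i (y j))" if "i : insert a I" "z : q" for i z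
 unfolding r_def using diff[OF that sq] fsum[OF that(1) order.refl] by simp
 have fr0: "f i (r z) = 0" if "i : I" "z : q" for i z
 proof -
 have "(SUM j:I. f j z * f i (y j)) = (SUM j:I. if j = i then f j z else 0)" by (rule sum.cong) (use that y(2) in auto)
 thus ?thesis using fr[of i z] that insert(1) by (simp add: sum.delta)
 qed
 have "EX z. z : q & f a (r z) ~= 0"
 proof (rule ccontr)
 assume "~ ?thesis"
 hence none: "f a (r z) = 0" if "z : q" for z using that by blast
 let ?c = "%i. if i = a then 1 else - f a (y i)"
 have "(SUM i:insert a I. ?c i * f i z) = 0" if "z : q" for z
 proof -
 have "(SUM i:I. ?c i * f i z) = - (SUM i:I. f i z * f a (y i))" unfolding sum_negf[symmetric] by (rule sum.cong) (use insert(2) in auto)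
 thus ?thesis using fr[of a z] none that insert(1,2) by simp
 qed
 hence "?c a = 0" using insert.prems(2)[of ?c] by blast
 thus False by simp
 qed
 then obtain z where z: "z : q" "f a (r z) ~= 0" by (elim exE conjE)
 define w where "w = sc (inverse (f a (r z))) (r z)"
 have w: "w : q" "f a w = 1" "!!i. i : I ==> f i w = 0"
 unfolding w_def using scale[OF _ rq[OF z(1)] z0] rq[OF z(1)] z fr0 subspace_scale[OF q] by auto
 define y' where "y' j = (if j = a then w else y j - sc (f a (y j)) w)" for j
 have "y' i : q" if "i : insert a I" for i using that w(1) y(1) by (auto simp: y'_def intro!: subspace_diff[OF q] subspace_scale[OF q])
 moreover have "f i (y' j) = (if i = j then 1 else 0)" if "i : insert a I" "j : insert a I" for i j
 proof (cases "j = a")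
 case True
 thus ?thesis using that w by (auto simp: y'_def)
 next
 case False
 hence j: "j : I" using that by simp
 have "f i (y' j) = f i (y j) - f a (y j) * f i w"
 unfolding y'_def using False diff[OF that(1) y(1)[OF j] subspace_scale[OF q w(1)]] scale[OF that(1) w(1) w(1)] by simp
 thus ?thesis using that w y(2)[OF _ j] False by auto
 qed
 ultimately have "(ALL i:insert a I. y' i : q) &
 (ALL i:insert a I. ALL j:insert a I. f i (y' j) = (if i = j then 1 else 0))" by simp
 thus ?case by (intro exI[of _ y'])
qed simp

section \<open>Minors of a form deformed along its coadjoint orbit\<close>

context
 fixes q :: "'g set" and ga1 :: "'g => complex" and J :: "nat set"
 assumes q: "lie_subalgebra sc br q" and ga1: "linear_on sc (*) q ga1" and J: "finite J"
begin

text \<open>The Gram matrix of the alternating form of ga1 + t et on two families of vectors.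
  \<open>pdet\<close> is its determinant, \<open>dpdet\<close> the derivative of the latter when the
  entries move with velocity \<open>B\<close>.\<close>

private definition pmat where
 "pmat et x y = (%i j. [:ga1 (br (x i) (y j)), et (br (x i) (y j)) :: complex:])"

private definition pdet where "pdet et x y = det_on J (pmat et x y)"

private definition dpdet where
 "dpdet et x y B = (\<Sum>p | p permutes J. of_int (sign p) * (SUM m:J. B m (p m) * (PROD i:J - {m}. pmat et x y i (p i))))"

private lemma pde_der:
 "coeff_der (%s. pdet (%z. et z + s * ze z) x y)
 (dpdet (%z. et z + s * ze z) x y (%i j. [:0, ze (br (x i) (y j)):])) s"
proof -
 have "coeff_der (%s. pmat (%z. et z + s * ze z) x y i j) [:0, ze (br (x i) (y j)):] s" for i j
 unfolding coeff_der_def pmat_def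
 proof
 fix n
 show "((%s. coeff [:ga1 (br (x i) (y j)), et (br (x i) (y j)) + s * ze (br (x i) (y j)):] n)
 has_field_derivative coeff [:0, ze (br (x i) (y j)):] n) (at s)"
 proof (cases n)
 case (Suc k)
 thus ?thesis by (cases k) (auto intro!: derivative_eq_intros)
 qed simp
 qed
 hence "coeff_der (%s. of_int (sign p) * (PROD i:J. pmat (%z. et z + s * ze z) x y i (p i)))
 (0 * (PROD i:J. pmat (%z. et z + s * ze z) x y i (p i)) + of_int (sign p) *
 (SUM m:J. [:0, ze (br (x m) (y (p m))):] * (PROD i:J - {m}. pmat (%z. et z + s * ze z) x y i (p i)))) s" for p
 by (intro coe_der_mul coe_der_pro[OF J] coe_der_con)
 thus ?thesis unfolding pdet_def det_on_def dpdet_def by (intro coe_der_sum) simp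
qed

text \<open>By the Jacobi identity, composing the form with \<open>br u\<close> amounts to moving
  one argument of the bracket by \<open>u\<close>. Expanded along rows and columns, the derivative
  of the minor is a sum of minors of the same deformed form.\<close>

private lemma dpd_equ:
 assumes x: "!!i. i : J ==> x i : q" "!!i. i : J ==> y i : q" and u: "u : q" and et: "linear_on sc (*) q et"
 shows "dpdet et x y (%i j. [:ga1 (br u (br (x i) (y j))), et (br u (br (x i) (y j))):]) =
 (SUM m:J. pdet et (x(m := br u (x m))) y) + (SUM k:J. pdet et x (y(k := br u (y k))))"
proof -
 let ?P = "{p. p permutes J}"
 let ?R = "%m p. PROD i:J - {m}. pmat et x y i (p i)"
 have q_br: "br v w : q" if "v : q" "w : q" for v w using q that unfolding lie_subalgebra_def by blast
 have split: "[:ga1 (br u (br a b)), et (br u (br a b)):] =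
 [:ga1 (br (br u a) b), et (br (br u a) b):] + [:ga1 (br a (br u b)), et (br a (br u b)):]"
 if "a : q" "b : q" for a b
 proof -
 have "br u (br a b) = br (br u a) b + br a (br u b)" using jac_lef[of u a b] by simp
 moreover have "l (br (br u a) b + br a (br u b)) = l (br (br u a) b) + l (br a (br u b))" if "linear_on sc (*) q l" for l
 using that q_br[OF q_br[OF u \<open>a : q\<close>] \<open>b : q\<close>] q_br[OF \<open>a : q\<close> q_br[OF u \<open>b : q\<close>]] unfolding linear_on_def by blast
 ultimately show ?thesis using ga1 et by simp
 qed
 have "dpdet et x y (%i j. [:ga1 (br u (br (x i) (y j))), et (br u (br (x i) (y j))):]) =
 (SUM p:?P. of_int (sign p) * (SUM m:J. [:ga1 (br (br u (x m)) (y (p m))), et (br (br u (x m)) (y (p m))):] * ?R m p)) +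
 (SUM p:?P. of_int (sign p) * (SUM m:J. [:ga1 (br (x m) (br u (y (p m)))), et (br (x m) (br u (y (p m)))):] * ?R m p))"
 unfolding dpdet_def sum.distrib[symmetric] distrib_left[symmetric] distrib_right[symmetric]
 by (intro sum.cong refl arg_cong2[where f = "(*)"] split x) (auto simp: permutes_in_image)
 also have "(SUM p:?P. of_int (sign p) * (SUM m:J. [:ga1 (br (br u (x m)) (y (p m))), et (br (br u (x m)) (y (p m))):] * ?R m p)) =
 (SUM m:J. pdet et (x(m := br u (x m))) y)"
 proof -
 have "pdet et (x(m := br u (x m))) y = (SUM p:?P. of_int (sign p) *
 ([:ga1 (br (br u (x m)) (y (p m))), et (br (br u (x m)) (y (p m))):] * ?R m p))" if m: "m : J" for m
 proof -
 have "pmat et (x(m := br u (x m))) y = (pmat et x y)(m := %j. [:ga1 (br (br u (x m)) (y j)), et (br (br u (x m)) (y j)):])"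
 by (auto simp: pmat_def fun_eq_iff)
 thus ?thesis unfolding pdet_def by (simp add: det_on_row_exp[OF J m])
 qed
 thus ?thesis by (simp add: sum_distrib_left sum.swap[of _ J])
 qed
 also have "(SUM p:?P. of_int (sign p) * (SUM m:J. [:ga1 (br (x m) (br u (y (p m)))), et (br (x m) (br u (y (p m)))):] * ?R m p)) =
 (SUM k:J. pdet et x (y(k := br u (y k))))"
 proof -
 let ?c = "%k i. [:ga1 (br (x i) (br u (y k))), et (br (x i) (br u (y k))):]"
 have "pdet et x (y(k := br u (y k))) = (SUM p:?P. of_int (sign p) *
 (?c k (inv_into UNIV p k) * ?R (inv_into UNIV p k) p))" if k: "k : J" for k
 proof -
 have "pmat et x (y(k := br u (y k))) = (%i j. if j = k then ?c k i else pmat et x y i j)" by (auto simp: pmat_def fun_eq_iff)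
 thus ?thesis unfolding pdet_def using det_on_col_exp[OF J k, of "?c k" "pmat et x y"] by simp
 qed
 hence "(SUM k:J. pdet et x (y(k := br u (y k)))) = (SUM p:?P. of_int (sign p) *
 (SUM k:J. ?c k (inv_into UNIV p k) * ?R (inv_into UNIV p k) p))"
 by (simp add: sum_distrib_left sum.swap[of _ J])
 also have "... = (SUM p:?P. of_int (sign p) * (SUM m:J. ?c (p m) m * ?R m p))"
 proof (rule sum.cong)
 fix p assume "p : ?P"
 hence p: "p permutes J" by simp
 have "(SUM m:J. ?c (p m) m * ?R m p) = (SUM k:J. ?c (p (inv_into UNIV p k)) (inv_into UNIV p k) * ?R (inv_into UNIV p k) p)"
 by (rule sum.reindex_bij_betw[OF permutes_imp_bij[OF permutes_inv[OF p]], symmetric])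
 thus "of_int (sign p) * (SUM k:J. ?c k (inv_into UNIV p k) * ?R (inv_into UNIV p k) p) =
 of_int (sign p) * (SUM m:J. ?c (p m) m * ?R m p)"
 by (simp only: permutes_inverses(1)[OF p])
 qed simp
 finally show ?thesis ..
 qed
 finally show ?thesis .
qed

text \<open>The lowest order coefficient of the minors of \<open>ga1 + t et\<close>, as a function of \<open>et\<close>, does not change
 when \<open>et\<close> moves along the orbit of \<open>ga1\<close>.\<close>

private lemma low_coe_inv:
 assumes low: "!!et x y i. linear_on sc (*) q et ==> (!!i. i : J ==> x i : q) ==> (!!i. i : J ==> y i : q) ==>
 i < d ==> coeff (pdet et x y) i = 0"
 and x: "!!i. i : J ==> x i : q" "!!i. i : J ==> y i : q" and u: "u : q" and et: "linear_on sc (*) q et"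
 shows "coeff (pdet (%z. et z + ga1 (br u z)) x y) d = coeff (pdet et x y) d"
proof -
 have q_br: "br v w : q" if "v : q" "w : q" for v w using q that unfolding lie_subalgebra_def by blast
 have sub: "subspace q" using q unfolding lie_subalgebra_def by blast
 have lin: "linear_on sc (*) q (%z. et z + s * l (br u z))" if "linear_on sc (*) q et" "linear_on sc (*) q l" for et l s
 using that q_br[OF u] unfolding linear_on_def by (simp add: br_add_right br_scale_right algebra_simps)
 have deriv: "coeff (dpdet et x y (%i j. [:0, ga1 (br u (br (x i) (y j))):])) d = 0" if et: "linear_on sc (*) q et" for et
 proof -
 let ?B1 = "%i j. [:ga1 (br u (br (x i) (y j))):]" and ?B2 = "%i j. [:0, et (br u (br (x i) (y j))):]"
 have eq: "dpdet et x y ?B1 + dpdet et x y ?B2 =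
 (SUM m:J. pdet et (x(m := br u (x m))) y) + (SUM k:J. pdet et x (y(k := br u (y k))))"
 proof -
 have "dpdet et x y ?B1 + dpdet et x y ?B2 = dpdet et x y (%i j. ?B1 i j + ?B2 i j)"
 unfolding dpdet_def sum.distrib[symmetric] distrib_left[symmetric] distrib_right[symmetric] ..
 thus ?thesis using dpd_equ[OF x u et] by simp
 qed
 \<comment> \<open>The velocity along the orbit is t times \<open>?B1\<close>, so coefficient
   \<open>d\<close> of the derivative is coefficient d - 1 of the \<open>?B1\<close> part. The parts
   of \<open>?B1\<close> and \<open>?B2\<close> add up to minors whose low coefficients vanish, and
   the \<open>?B2\<close> part is a derivative of such minors.\<close>
 have B1: "coeff (dpdet et x y ?B1) n = 0" if n: "n < d" for n
 proof -
 have "((%s. coeff (pdet (%z. et z + s * et (br u z)) x y) n) has_field_derivative coeff (dpdet et x y ?B2) n) (at 0)"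
 using pde_der[of et "%z. et (br u z)" x y 0] unfolding coeff_der_def by simp
 moreover have "coeff (pdet (%z. et z + s * et (br u z)) x y) n = 0" for s by (rule low[OF lin[OF et et] x n])
 ultimately have "coeff (dpdet et x y ?B2) n = 0" using DERIV_unique[OF DERIV_const[of 0]] by simp
 moreover have "coeff (pdet et (x(m := br u (x m))) y) n = 0" "coeff (pdet et x (y(m := br u (y m)))) n = 0" if "m : J" for m
 by (rule low[OF et _ _ n]; use x q_br[OF u] that in auto)+
 moreover have "coeff (dpdet et x y ?B1) n + coeff (dpdet et x y ?B2) n =
 (SUM m:J. coeff (pdet et (x(m := br u (x m))) y) n) + (SUM k:J. coeff (pdet et x (y(k := br u (y k)))) n)"
 using arg_cong[OF eq, of "%p. coeff p n"] by (simp add: coeff_sum)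
 ultimately show ?thesis by simp
 qed
 have "dpdet et x y (%i j. [:0, ga1 (br u (br (x i) (y j))):]) = [:0, 1:] * dpdet et x y ?B1" unfolding dpdet_def sum_distrib_left
 by (intro sum.cong refl) (simp add: mult.left_commute mult.assoc smult_add_right)
 thus ?thesis using B1 by (cases d) auto
 qed
 have "coeff (pdet (%z. et z + 1 * ga1 (br u z)) x y) d = coeff (pdet (%z. et z + 0 * ga1 (br u z)) x y) d"
 by (rule coe_der_zer[where P = "%s. pdet (%z. et z + s * ga1 (br u z)) x y", OF pde_der deriv[OF lin[OF et ga1]]])
 thus ?thesis by simp
qed

text \<open>Induction on the degree in t. By \<open>orbit\<close>, \<open>et\<close> differs from
  its composite with \<open>ta\<close> by an orbit direction, which does not change the lowest
  coefficient, and for the composite the minors vanish. So all coefficients are 0, and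
  \<open>ga\<close> is reached at t = 1 in direction \<open>ga - ga1\<close>.\<close>

lemma min_van:
 assumes ta: "!!x. x : q ==> ta x : q" "linear_on sc sc q ta"
 and orbit: "!!et. linear_on sc (*) q et ==> EX u:q. ALL z:q. et z - et (ta z) = ga1 (br u z)"
 and vanish: "!!et x y. linear_on sc (*) q et ==> (!!i. i : J ==> x i : q) ==> (!!i. i : J ==> y i : q) ==>
 det_on J (%i j. ga1 (br (x i) (y j)) + et (ta (br (x i) (y j)))) = 0"
 and ga: "linear_on sc (*) q ga" and x: "!!i. i : J ==> x i : q" "!!i. i : J ==> y i : q"
 shows "det_on J (%i j. ga (br (x i) (y j))) = 0"
proof -
 have q_br: "br v w : q" if "v : q" "w : q" for v w using q that unfolding lie_subalgebra_def by blast
 have ev: "poly (pdet et x y) t = det_on J (%i j. ga1 (br (x i) (y j)) + t * et (br (x i) (y j)))" for et x y t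
 unfolding pdet_def det_on_def pmat_def by (simp add: poly_sum poly_prod)
 have low: "coeff (pdet et x y) d = 0"
 if "linear_on sc (*) q et" "!!i. i : J ==> x i : q" "!!i. i : J ==> y i : q" for et x y d using that
 proof (induction d arbitrary: et x y rule: less_induct)
 case (less d)
 obtain u where u: "u : q" "!!z. z : q ==> et z - et (ta z) = ga1 (br u z)" using orbit[OF less.prems(1)] by blast
 have lin: "linear_on sc (*) q (%z. t * et (ta z))" for t using less.prems(1) ta unfolding linear_on_def by (simp add: distrib_left)
 have "coeff (pdet (%z. et (ta z) + ga1 (br u z)) x y) d = coeff (pdet (%z. et (ta z)) x y) d"
 by (rule low_coe_inv) (use less u(1) lin[of 1] in simp_all)
 moreover have "poly (pdet (%z. et (ta z)) x y) t = 0" for t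
 unfolding ev using vanish[of "%z. t * et z" x y] less.prems by (simp add: linear_on_def distrib_left)
 hence "pdet (%z. et (ta z)) x y = 0" using poly_all_0_iff_0 by blast
 moreover have "pdet (%z. et (ta z) + ga1 (br u z)) x y = pdet et x y"
 proof -
 have "et (ta (br (x i) (y j))) + ga1 (br u (br (x i) (y j))) = et (br (x i) (y j))" if "i : J" "j : J" for i j
 using u(2)[OF q_br[OF less.prems(2)[OF that(1)] less.prems(3)[OF that(2)]]] by (simp add: algebra_simps)
 thus ?thesis unfolding pdet_def det_on_def pmat_def by (intro sum.cong refl arg_cong2[where f = "(*)"] prod.cong) (auto simp: permutes_in_image)
 qed
 ultimately show ?case by simp
 qed
 have "linear_on sc (*) q (%z. ga z - ga1 z)" using ga ga1 unfolding linear_on_def by (simp add: algebra_simps)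
 hence "pdet (%z. ga z - ga1 z) x y = 0" using low x by (intro poly_eqI) simp
 hence "poly (pdet (%z. ga z - ga1 z) x y) 1 = 0" by simp
 thus ?thesis unfolding ev by simp
qed

end

text \<open>\<open>ga1\<close> bounds the index from above. If some \<open>ga\<close> had a smaller
  stabiliser, its alternating form would have a non-zero minor larger than the codimension of
  \<open>T\<close>. Minors of that size vanish for all sums of \<open>ga1\<close> and a form
  composed with \<open>ta\<close>, whose stabilisers contain \<open>T\<close>, and then by
  \<open>min_van\<close> for every form.\<close>

lemma lie_ind_tor:
 assumes q: "lie_subalgebra sc br q" and fin: "finite B0" "q <= span B0"
 and ga1: "ga1 : dual_space sc q" and T: "lie_stabiliser br q ga1 = T"
 and ta: "linear_on sc sc q ta" "!!x. x : q ==> ta x : q" "!!t. t : T ==> ta t = t"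
 "!!t x. t : T ==> x : q ==> ta (br t x) = 0"
 shows "lie_index sc br q = dim T"
proof -
 have sub: "subspace q" and q_br: "br v w : q" if "v : q" "w : q" for v w using q that unfolding lie_subalgebra_def by blast+
 have sub: "subspace q" using q unfolding lie_subalgebra_def by blast
 have stab: "subspace (lie_stabiliser br q ga)" "lie_stabiliser br q ga <= q" if "linear_on sc (*) q ga" for ga
 proof -
 have z: "ga 0 = 0" using that subspace_0[OF sub] unfolding linear_on_def by (metis mult_zero_left scale_zero_left)
 show "subspace (lie_stabiliser br q ga)" unfolding subspace_def lie_stabiliser_def
 using that q_br subspace_0[OF sub] subspace_add[OF sub] subspace_scale[OF sub] z
 by (auto simp: linear_on_def br_add_left br_scale_left br_zer_lef)
 show "lie_stabiliser br q ga <= q" unfolding lie_stabiliser_def by blast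
 qed
 have ga1l: "linear_on sc (*) q ga1" using ga1 unfolding dual_space_def by blast
 have Tq: "subspace T" "T <= q" using stab[OF ga1l] T by simp_all
 have ker: "((ALL z:q. ga (br x z) = 0)) = (x : lie_stabiliser br q ga)" if "x : q" for x ga
 using that unfolding lie_stabiliser_def by blast
 have sum_lin: "ga (br (SUM i:I. sc (c i) (x i)) z) = (SUM i:I. c i * ga (br (x i) z))"
 if ga: "linear_on sc (*) q ga" and I: "finite I" "!!i. i : I ==> x i : q" and z: "z : q"
 for ga I and c :: "'i => complex" and x :: "'i => 'g" and z using I
 proof (induction I rule: finite_induct)
 case empty
 have "ga (sc 0 0) = 0 * ga 0" using ga subspace_0[OF sub] unfolding linear_on_def by blast
 thus ?case by (simp add: br_zer_lef)
 next
 case (insert a I)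
 let ?s = "SUM i:I. sc (c i) (x i)"
 have s: "?s : q" by (rule subspace_sum[OF sub]) (use insert.prems subspace_scale[OF sub] in auto)
 have "ga (sc (c a) (br (x a) z) + br ?s z) = ga (sc (c a) (br (x a) z)) + ga (br ?s z)"
 using ga subspace_scale[OF sub q_br[OF insert.prems[OF insertI1] z]] q_br[OF s z] unfolding linear_on_def by blast
 moreover have "ga (sc (c a) (br (x a) z)) = c a * ga (br (x a) z)"
 using ga q_br[OF insert.prems[OF insertI1] z] unfolding linear_on_def by blast
 ultimately show ?case using insert by (simp add: br_add_left br_scale_left)
 qed
 have complement: "EX C. finite C & C <= q & card C + dim K = dim q & q <= {a + b | a b. a : K & b : span C} &
 (ALL c. (SUM v:C. sc (c v) v) : K --> (ALL v:C. c v = 0))"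
 if K: "subspace K" "K <= q" for K
 proof -
 obtain BK where BK: "BK <= K" "independent BK" "K <= span BK" "card BK = dim K" by (rule basis_exists)
 obtain B where B: "BK <= B" "B <= q" "independent B" "q <= span B"
 using maximal_independent_subset_extend[of BK q] BK(1,2) K(2) by (metis subset_trans)
 have fB: "finite B" using independent_span_bound[OF fin(1) B(3)] B(2) fin(2) by blast
 have sK: "span BK = K" using BK(1,3) K(1) span_minimal by blast
 let ?C = "B - BK"
 have "card ?C + dim K = dim q"
 using card_Diff_subset[OF finite_subset[OF B(1) fB] B(1)] card_mono[OF fB B(1)] BK(4) basis_card_eq_dim[OF B(2,4,3)] by simp
 moreover have "q <= {a + b | a b. a : K & b : span ?C}"
 proof -
 have "BK \<union> ?C = B" using B(1) by blast
 hence "span B = {a + b | a b. a : span BK & b : span ?C}" using span_Un[of BK ?C] by simp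
 thus ?thesis using B(4) sK by simp
 qed
 moreover have "ALL v:?C. c v = 0" if c: "(SUM v:?C. sc (c v) v) : K" for c
 proof -
 have "(SUM v:?C. sc (c v) v) : span BK" using c sK by simp
 then obtain u where u: "(SUM v:?C. sc (c v) v) = (SUM v:BK. sc (u v) v)" using span_finite[OF finite_subset[OF B(1) fB]] by auto
 let ?w = "%v. if v : BK then - u v else c v"
 have "(SUM v:B. sc (?w v) v) = (SUM v:?C. sc (?w v) v) + (SUM v:BK. sc (?w v) v)" by (rule sum.subset_diff[OF B(1) fB])
 also have "(SUM v:?C. sc (?w v) v) = (SUM v:?C. sc (c v) v)" by (rule sum.cong) auto
 also have "(SUM v:BK. sc (?w v) v) = - (SUM v:BK. sc (u v) v)" by (simp add: sum_negf)
 finally have w0: "(SUM v:B. sc (?w v) v) = 0" using u by simp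
 show ?thesis
 proof
 fix v assume v: "v : ?C"
 hence "?w v = 0" using independentD[OF B(3) fB order.refl w0, of v] by blast
 thus "c v = 0" using v by auto
 qed
 qed
 ultimately show ?thesis using fB B(2) by (intro exI[of _ ?C]) auto
 qed
 have dual: "EX y. (ALL i:I. y i : q) & (ALL i:I. ALL j:I. ga (br (x i) (y j)) = (if i = j then 1 else 0))"
 if ga: "linear_on sc (*) q ga" and I: "finite I" "!!i. i : I ==> x i : q"
 and ind: "!!c. (SUM i:I. sc (c i) (x i)) : lie_stabiliser br q ga ==> ALL i:I. c i = 0"
 for ga I and x :: "'i => 'g"
 proof (rule dua_vec[OF sub I(1)])
 show "linear_on sc (*) q (%z. ga (br (x i) z))" if "i : I" for i
 using ga q_br[OF I(2)[OF that]] unfolding linear_on_def by (simp add: br_add_right br_scale_right)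
 fix c assume c: "!!z. z : q ==> (SUM i:I. c i * ga (br (x i) z)) = 0"
 have "(SUM i:I. sc (c i) (x i)) : q" by (rule subspace_sum[OF sub]) (use I subspace_scale[OF sub] in auto)
 moreover have "ga (br (SUM i:I. sc (c i) (x i)) z) = (SUM i:I. c i * ga (br (x i) z))" if "z : q" for z
 by (rule sum_lin[OF ga I that])
 ultimately have "(SUM i:I. sc (c i) (x i)) : lie_stabiliser br q ga" using c unfolding lie_stabiliser_def by simp
 thus "ALL i:I. c i = 0" by (rule ind)
 qed
 \<comment> \<open>The alternating form of \<open>ga1\<close> is non-degenerate modulo
   \<open>T\<close>, so functionals vanishing on \<open>T\<close> are orbit directions;
   \<open>u\<close> is assembled from vectors dual to a complement \<open>C\<close> of
   \<open>T\<close>.\<close>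
 have orbit: "EX u:q. ALL z:q. ze z = ga1 (br u z)" if ze: "linear_on sc (*) q ze" "!!t. t : T ==> ze t = 0" for ze
 proof -
 obtain C where C: "finite C" "C <= q" "q <= {a + b | a b. a : T & b : span C}"
 "ALL c. (SUM v:C. sc (c v) v) : T --> (ALL v:C. c v = 0)" using complement[OF Tq] by (elim exE conjE)
 have "EX y. (ALL i:C. y i : q) & (ALL i:C. ALL j:C. ga1 (br i (y j)) = (if i = j then 1 else 0))"
 by (rule dual[OF ga1l C(1)]) (use C T in auto)
 then obtain y where y: "ALL i:C. y i : q" "ALL i:C. ALL j:C. ga1 (br i (y j)) = (if i = j then 1 else 0)" by (elim exE conjE)
 define u where "u = (SUM j:C. sc (- ze j) (y j))"
 have uq: "u : q" unfolding u_def using y by (intro subspace_sum[OF sub] subspace_scale[OF sub]) blast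
 have flip: "ga1 (br a b) = - ga1 (br b a)" if "a : q" "b : q" for a b
 proof -
 have "ga1 (sc (- 1) (br b a)) = - 1 * ga1 (br b a)" using ga1l q_br[OF that(2,1)] unfolding linear_on_def by blast
 thus ?thesis using br_ant[of a b] by simp
 qed
 have onC: "ga1 (br u v) = ze v" if v: "v : C" for v
 proof -
 have "ga1 (br u v) = (SUM j:C. - ze j * ga1 (br (y j) v))"
 unfolding u_def by (rule sum_lin[OF ga1l C(1)]) (use y v C in auto)
 also have "... = (SUM j:C. if j = v then ze v else 0)"
 proof (rule sum.cong)
 fix j assume j: "j : C"
 hence "ga1 (br (y j) v) = - (if v = j then 1 else 0)" using flip[of "y j" v] y v C by auto
 thus "- ze j * ga1 (br (y j) v) = (if j = v then ze v else 0)" by auto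
 qed simp
 finally show ?thesis using C(1) v by (simp add: sum.delta)
 qed
 have "ze z = ga1 (br u z)" if z: "z : q" for z
 proof -
 let ?E = "{z : q. ze z = ga1 (br u z)}"
 have E: "subspace ?E" unfolding subspace_def
 using ze(1) ga1l subspace_0[OF sub] subspace_add[OF sub] subspace_scale[OF sub] q_br[OF uq] ze(2)[OF subspace_0[OF Tq(1)]]
 flip[OF uq subspace_0[OF sub]]
 by (auto simp: linear_on_def br_add_right br_scale_right br_zer_rig)
 have "T <= ?E"
 proof
 fix t assume t: "t : T"
 hence "ga1 (br t u) = 0" using uq T unfolding lie_stabiliser_def by blast
 thus "t : ?E" using t Tq ze(2)[OF t] flip[of u t] uq by auto
 qed
 moreover have "span C <= ?E" by (rule span_minimal[OF _ E]) (use onC C(2) in auto)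
 moreover obtain a b where "z = a + b" "a : T" "b : span C" using C(3) z by blast
 ultimately have "z : ?E" using subspace_add[OF E] by blast
 thus ?thesis by blast
 qed
 thus ?thesis using uq by blast
 qed
 have lower: "dim T <= dim (lie_stabiliser br q ga)" if ga: "linear_on sc (*) q ga" for ga
 proof (rule ccontr)
 assume small: "~ dim T <= dim (lie_stabiliser br q ga)"
 obtain C where C: "finite C" "C <= q" "card C + dim (lie_stabiliser br q ga) = dim q"
 "ALL c. (SUM v:C. sc (c v) v) : lie_stabiliser br q ga --> (ALL v:C. c v = 0)" using complement[OF stab[OF ga]] by (elim exE conjE)
 obtain e where e: "bij_betw e {..<card C} C" using ex_bij_betw_nat_finite[OF C(1)] by (auto simp: atLeast0LessThan)
 define J where "J = {..<card C}"
 have J: "finite J" "bij_betw e J C" using e by (simp_all add: J_def)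
 have eq: "e i : q" if "i : J" for i using J(2) that C(2) bij_betwE by blast
 have "EX y. (ALL i:J. y i : q) & (ALL i:J. ALL j:J. ga (br (e i) (y j)) = (if i = j then 1 else 0))"
 proof (rule dual[OF ga J(1) eq])
 fix c assume c: "(SUM i:J. sc (c i) (e i)) : lie_stabiliser br q ga"
 have inv: "inv_into J e (e i) = i" if "i : J" for i using J(2) that by (simp add: bij_betw_def)
 have "(SUM v:C. sc (c (inv_into J e v)) v) = (SUM i:J. sc (c (inv_into J e (e i))) (e i))" by (rule sum.reindex_bij_betw[OF J(2), symmetric])
 also have "... = (SUM i:J. sc (c i) (e i))" by (rule sum.cong) (simp_all add: inv)
 finally have z: "ALL v:C. c (inv_into J e v) = 0" using C(4)[THEN spec, of "%v. c (inv_into J e v)"] c by simp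
 show "ALL i:J. c i = 0"
 proof
 fix i assume i: "i : J"
 hence "e i : C" using J(2) bij_betwE by blast
 thus "c i = 0" using z inv[OF i] by force
 qed
 qed
 then obtain y where y: "ALL i:J. y i : q" "ALL i:J. ALL j:J. ga (br (e i) (y j)) = (if i = j then 1 else 0)" by (elim exE conjE)
 have "det_on J (%i j. ga (br (e i) (y j))) = 1" by (rule det_on_ide[OF J(1)]) (use y in simp)
 moreover have "det_on J (%i j. ga (br (e i) (y j))) = 0"
 proof (rule min_van[OF q ga1l J(1) ta(2,1) _ _ ga eq])
 show "EX u:q. ALL z:q. et z - et (ta z) = ga1 (br u z)" if et: "linear_on sc (*) q et" for et
 proof (rule orbit)
 show "linear_on sc (*) q (%z. et z - et (ta z))" using et ta(1,2) unfolding linear_on_def by (simp add: right_diff_distrib)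
 qed (use ta(3) in simp)
 show "y i : q" if "i : J" for i using y that by blast
 next
 fix et and x y :: "nat => 'g"
 assume et: "linear_on sc (*) q et" and x: "!!i. i : J ==> x i : q" and y: "!!i. i : J ==> y i : q"
 define ga' where "ga' z = ga1 z + et (ta z)" for z
 have ga': "linear_on sc (*) q ga'" using ga1l et ta(1,2) unfolding linear_on_def ga'_def by (simp add: distrib_left)
 have "et 0 = 0" using et subspace_0[OF sub] unfolding linear_on_def by (metis mult_zero_left scale_zero_left)
 hence T': "T <= lie_stabiliser br q ga'" using ta(4) T Tq unfolding ga'_def lie_stabiliser_def by auto
 \<comment> \<open>Dimension count: otherwise the \<open>x i\<close> and a basis of \<open>T\<close>
   would be independent in \<open>q\<close>, but they are \<open>card C + dim T\<close> in number,
   more than \<open>dim q\<close>.\<close>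
 have "EX c. (SUM i:J. sc (c i) (x i)) : lie_stabiliser br q ga' & (EX i:J. c i ~= 0)"
 proof (rule ccontr)
 assume "~ ?thesis"
 hence ind: "!!c. (SUM i:J. sc (c i) (x i)) : lie_stabiliser br q ga' ==> ALL i:J. c i = 0" by blast
 obtain B where B: "B <= T" "independent B" "T <= span B" "card B = dim T" by (rule basis_exists)
 have fB: "finite B" using independent_span_bound[OF fin(1) B(2)] B(1) Tq(2) fin(2) by blast
 have span0: "(SUM v:B. sc (c v) v) : lie_stabiliser br q ga'" for c
 using T' B(1) by (intro subspace_sum[OF stab(1)[OF ga']] subspace_scale[OF stab(1)[OF ga']]) blast
 have inj: "inj_on x J"
 proof (rule inj_onI, rule ccontr)
 fix i j assume ij: "i : J" "j : J" "x i = x j" "i ~= j"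
 let ?c = "%k. if k = i then 1 else if k = j then - 1 else (0 :: complex)"
 have "(SUM k:J. sc (?c k) (x k)) = (SUM k:J. (if k = i then x i else 0) + (if k = j then - x j else 0))" using ij(4) by (intro sum.cong) auto
 also have "... = 0" using J(1) ij by (simp add: sum.distrib sum.delta)
 finally have "ALL k:J. ?c k = 0" using ind[of ?c] subspace_0[OF stab(1)[OF ga']] by simp
 thus False using ij(1) by auto
 qed
 have xT: "x ` J \<inter> B = {}"
 proof (rule ccontr)
 assume "x ` J \<inter> B ~= {}"
 then obtain i where i: "i : J" "x i : B" by blast
 have "(SUM k:J. sc (if k = i then 1 else 0) (x k)) = (SUM k:J. if k = i then x i else 0)" by (intro sum.cong) auto
 also have "... = x i" using J(1) i by (simp add: sum.delta)
 finally have e: "(SUM k:J. sc (if k = i then 1 else 0) (x k)) = x i" .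
 have "(SUM k:J. sc (if k = i then 1 else 0) (x k)) : lie_stabiliser br q ga'" unfolding e using i(2) B(1) T' by blast
 hence "ALL k:J. (if k = i then 1 else 0 :: complex) = 0" by (rule ind)
 thus False using i(1) by auto
 qed
 have "independent (x ` J \<union> B)"
 proof (rule independent_if_scalars_zero)
 show "finite (x ` J \<union> B)" using J(1) fB by simp
 fix f v assume f: "(SUM v:x ` J \<union> B. sc (f v) v) = 0" and v: "v : x ` J \<union> B"
 have s: "(SUM i:J. sc (f (x i)) (x i)) + (SUM v:B. sc (f v) v) = 0"
 using f sum.union_disjoint[OF finite_imageI[OF J(1), of x] fB xT, of "%v. sc (f v) v"]
 sum.reindex[OF inj, of "%v. sc (f v) v"] by simp
 hence "(SUM i:J. sc (f (x i)) (x i)) = - (SUM v:B. sc (f v) v)" using eq_neg_iff_add_eq_0 by blast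
 hence "(SUM i:J. sc (f (x i)) (x i)) : lie_stabiliser br q ga'" using subspace_neg[OF stab(1)[OF ga'] span0] by simp
 hence fx: "ALL i:J. f (x i) = 0" by (rule ind)
 hence "(SUM i:J. sc (f (x i)) (x i)) = 0" by (intro sum.neutral) auto
 hence "(SUM v:B. sc (f v) v) = 0" using s by simp
 hence "ALL v:B. f v = 0" using independentD[OF B(2) fB order.refl] by blast
 thus "f v = 0" using fx v by auto
 qed
 moreover obtain Bq where Bq: "Bq <= q" "independent Bq" "q <= span Bq" "card Bq = dim q" by (rule basis_exists)
 moreover have "finite Bq" using independent_span_bound[OF fin(1) Bq(2)] Bq(1) fin(2) by blast
 moreover have "x ` J \<union> B <= span Bq" using x B(1) Tq(2) Bq(3) by blast
 ultimately have "card (x ` J \<union> B) <= dim q" using independent_span_bound[of Bq "x ` J \<union> B"] by simp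
 moreover have "card (x ` J \<union> B) = card C + dim T"
 using card_Un_disjoint[OF finite_imageI[OF J(1)] fB xT] card_image[OF inj] B(4) by (simp add: J_def)
 ultimately show False using C(3) small by simp
 qed
 then obtain c i where c: "(SUM i:J. sc (c i) (x i)) : lie_stabiliser br q ga'" "i : J" "c i ~= 0" by (elim exE conjE bexE)
 have "(SUM i:J. c i * ga' (br (x i) (y j))) = 0" if "j : J" for j
 proof -
 have "ga' (br (SUM i:J. sc (c i) (x i)) (y j)) = (SUM i:J. c i * ga' (br (x i) (y j)))"
 by (rule sum_lin[OF ga' J(1) x y[OF that]])
 thus ?thesis using c(1) y[OF that] unfolding lie_stabiliser_def by simp
 qed
 hence "det_on J (%i j. ga' (br (x i) (y j))) = 0" by (intro det_on_dep_row[where c = c, OF J(1) _ c(2,3)])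
 thus "det_on J (%i j. ga1 (br (x i) (y j)) + et (ta (br (x i) (y j)))) = 0" by (simp only: ga'_def)
 qed
 ultimately show False by simp
 qed
 show ?thesis unfolding lie_index_def
 proof (rule antisym)
 show "(INF ga\<in>dual_space sc q. dim (lie_stabiliser br q ga)) <= dim T" using ga1 T by (intro cINF_lower2) auto
 show "dim T <= (INF ga\<in>dual_space sc q. dim (lie_stabiliser br q ga))"
 using ga1 lower by (intro cINF_greatest) (auto simp: dual_space_def)
 qed
qed

end

section \<open>Stabilisers of forms supported on orthogonal roots\<close>

text \<open>\<open>vec b\<close> lists the products of \<open>b\<close> with the simple roots.\<close>

fun vec :: "lat => lat" where
 "vec (L a1 a2 a3 a4 a5 a6 a7 a8) = L (2 * a1 - a2) (2 * a2 - a1 - a3) (2 * a3 - a2 - a4) (2 * a4 - a3 - a5)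
 (2 * a5 - a4 - a6 - a8) (2 * a6 - a5 - a7) (2 * a7 - a6) (2 * a8 - a5)"

fun dot :: "lat => lat => int" where
 "dot (L a1 a2 a3 a4 a5 a6 a7 a8) (L b1 b2 b3 b4 b5 b6 b7 b8) =
 a1 * b1 + a2 * b2 + a3 * b3 + a4 * b4 + a5 * b5 + a6 * b6 + a7 * b7 + a8 * b8"

lemma fm_dif_lef: "fm (a - b) c = fm a c - fm b c" and fm_dif_rig: "fm c (a - b) = fm c a - fm c b"
 using fm_add_lef[of a "- b" c] fm_add_rig[of c a "- b"] by (simp_all add: fm_umi_lef fm_umi_rig)

lemma eps_par: "of_int (eps a b) = (if even (fm a b) then 1 else - 1 :: complex)" by (simp add: eps_def)

lemma sig_pro:
 fixes a b c d e f :: int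
 shows "(if even a then 1 else - 1) * (if even b then 1 else - 1) * (if even c then 1 else - 1) * (if even d then 1 else - 1) *
 (if even e then 1 else - 1) * (if even f then 1 else - 1) = (if even (a + b + c + d + e + f) then 1 else - 1 :: complex)"
 by (cases "even a"; cases "even b"; cases "even c"; cases "even d"; cases "even e"; simp)

text \<open>Eliminating \<open>Y\<close> and \<open>Z\<close> leaves \<open>X\<close> times a sum of
  two coefficients. The product of all six signs being 1 makes these two equal, so the sum does not
  vanish.\<close>

lemma sig_sys:
 fixes X Y Z :: complex
 assumes "e * X + f * Y = 0" "e' * X + f' * Z = 0" "g * Z + k * Y = 0"
 and "e * e = 1" "f * f = 1" "f' * f' = 1" "k * k = 1" "e * f * e' * f' * g * k = 1"
 shows "X = 0"
proof -
 have Y: "Y = - (f * e * X)" and Z: "Z = - (f' * e' * X)" using assms by algebra+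
 have "g * f' * e' * X + k * f * e * X = 0" using assms(3) unfolding Y Z by algebra
 hence "2 * X = 0" using assms(4,5,7,8) by algebra
 thus ?thesis by simp
qed

lemma ip_dot: "ip b c = dot (vec b) c" by (cases b; cases c) (simp add: ip_def algebra_simps)

text \<open>Non-zero entries of the mask mark the simple roots outside pi. Together with
  \<open>zero_on\<close> this is an executable version of \<open>para\<close> and
  \<open>levi\<close>, see \<open>mas_par\<close>.\<close>

fun pos_on :: "lat => lat => bool" where
 "pos_on (L m1 m2 m3 m4 m5 m6 m7 m8) (L a1 a2 a3 a4 a5 a6 a7 a8) \<longleftrightarrow>
 (m1 = 0 | 0 <= a1) & (m2 = 0 | 0 <= a2) & (m3 = 0 | 0 <= a3) & (m4 = 0 | 0 <= a4) &
 (m5 = 0 | 0 <= a5) & (m6 = 0 | 0 <= a6) & (m7 = 0 | 0 <= a7) & (m8 = 0 | 0 <= a8)"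

fun zero_on :: "lat => lat => bool" where
 "zero_on (L m1 m2 m3 m4 m5 m6 m7 m8) (L a1 a2 a3 a4 a5 a6 a7 a8) \<longleftrightarrow>
 (m1 = 0 | a1 = 0) & (m2 = 0 | a2 = 0) & (m3 = 0 | a3 = 0) & (m4 = 0 | a4 = 0) &
 (m5 = 0 | a5 = 0) & (m6 = 0 | a6 = 0) & (m7 = 0 | a7 = 0) & (m8 = 0 | a8 = 0)"

lemma pos_on_iff: "pos_on m c = ((ALL i:{1..8}. lc m i = 0 | 0 <= lc c i))" unfolding I8 by (cases m; cases c) simp

lemma zer_on_iff: "zero_on m c = ((ALL i:{1..8}. lc m i = 0 | lc c i = 0))" unfolding I8 by (cases m; cases c) simp

text \<open>A search for a proof that the coefficient at \<open>c\<close> of an element of the stabiliser vanishes, using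
 \<open>dea_sin\<close>, \<open>dea_tri\<close>, \<open>dea_pai\<close> and \<open>dea_neg\<close> below; \<open>P\<close> and \<open>N\<close> are the roots of \<open>S\<close> with
 product \<open>1\<close> and \<open>-1\<close> with \<open>c\<close>.\<close>

primrec dead :: "lat => (lat \<times> lat) list => lat => nat => lat => bool" where
 "dead m S d 0 c = (~ pos_on m c)"
| "(dead m S d (Suc n) c) = ((if ~ pos_on m c then True else
 let ks = map (%(b, v). (b, dot v c)) S; t = dot d c;
 P = map fst (filter (%(b, k). k = 1) ks); N = map fst (filter (%(b, k). k = - 1) ks)
 in if EX (b, k):set ks. k = 2 then True
 else if (case (P, N) of ([p, q], [r]) => pos_on m (p - c) & pos_on m (q - c) & pos_on m (p + q - r - c) &
 (if t = 0 then True else dead m S d n (c - p) & dead m S d n (c - q) & dead m S d n (c - p - q + r))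
 | ([p], [r]) => (if t = 0 then False else
 pos_on m (p - c) & pos_on m (- c) & pos_on m (p - r - c) & dead m S d n (c - p))
 | _ => False) then True
 else if EX p:set P. (if pos_on m (p - c) then (ALL r:set N. dead m S d n (c - p + r)) &
 (if t = 0 then True else dead m S d n (c - p)) else False) then True
 else if t = 0 then False
 else if pos_on m (- c) then ALL r:set N. dead m S d n (c + r) else False))"

context e8
begin

definition cform :: "lat list => lat => 'g => complex" where
 "cform S d x = (SUM b<-S. cf x b) + wt d (hp x)"

end

locale e8_stabiliser = e8 sc br h al for sc :: "complex => 'g::ab_group_add => 'g" and br h al +
 fixes m :: lat and S :: "lat list" and d :: lat and x :: 'g
 assumes S: "distinct S" "!!b. b : set S ==> rt b" "!!b. b : set S ==> pos_on m b"
 "!!b b'. b : set S ==> b' : set S ==> b ~= b' ==> ip b b' = 0"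
 and d: "!!b. b : set S ==> ip d b = 0" and x: "x : PS {c. pos_on m c}" "!!y. y : PS {c. pos_on m c} ==> cform S d (br x y) = 0"
begin

lemma outs: "rt c ==> ~ pos_on m c ==> cf x c = 0" using x(1) unfolding PS_def by blast

text \<open>Bracketing with \<open>Hl b\<close> multiplies the coordinate at each member of
  \<open>S\<close> by its product with \<open>b\<close>, up to sign; orthogonality leaves only the
  one at \<open>b\<close>.\<close>

lemma supp: "b : set S ==> cf x b = 0"
proof -
 assume b: "b : set S"
 have "cform S d (br x (Hl b)) = (SUM b'<-S. - (of_int (ip b' b) * cf x b'))" unfolding cform_def using S(2) hp_br_h[OF Hl_h, of x b]
 by (simp add: cf_br_h[OF Hl_h] wt_h_zer cong: map_cong)
 also have "... = (SUM b'<-S. if b' = b then - 2 * cf x b else 0)" using S(2,4) b by (intro arg_cong[where f = sum_list] map_cong) (auto simp: rt_def)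
 also have "... = - 2 * cf x b" using S(1) b by (simp add: sum_list_distinct_conv_sum_set sum.delta)
 finally show "cf x b = 0" using x(2)[OF PS_h[OF Hl_h]] by simp
qed

text \<open>The stabiliser condition tested on \<open>ev n\<close>: the bracket moves the coordinate
  at \<open>b - n\<close> to a root \<open>b\<close> seen by the form, and the coordinate at
  \<open>- n\<close> into \<open>h\<close>, where \<open>d\<close> reads it.\<close>

lemma equa:
 assumes n: "rt n" "pos_on m n" "n ~: set S"
 shows "(SUM b<-S. if ip b n = 1 then of_int (eps (b - n) n) * cf x (b - n) else 0) + of_int (ip d n) * cf x (- n) = 0"
proof -
 have "cf (br x (ev n)) b = (if ip b n = 1 then of_int (eps (b - n) n) * cf x (b - n) else 0)" if "b : set S" for b
 proof -
 have "(rt (b - n)) = (ip b n = 1)" using S(2)[OF that] n(1) by (auto simp: rt_def ip_lin ip_sym[of n b])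
 moreover have "b ~= n" using that n(3) by auto
 ultimately show ?thesis using cf_br_ev[OF n(1) S(2)[OF that], of x] by simp
 qed
 hence "cform S d (br x (ev n)) =
 (SUM b<-S. if ip b n = 1 then of_int (eps (b - n) n) * cf x (b - n) else 0) + of_int (ip d n) * cf x (- n)"
 unfolding cform_def hp_br_ev[OF n(1)] using n(1) by (simp add: wt_h_sca[OF Hl_h] mult.commute cong: map_cong)
 thus ?thesis using x(2)[OF PS_ev[OF n(1)]] n(2) by simp
qed

lemma equ_res:
 assumes n: "rt n" "pos_on m n" "n ~: set S" and B: "distinct B" "set B <= set S" "!!b. b : set B ==> ip b n = 1"
 and z: "!!b. b : set S ==> b ~: set B ==> ip b n = 1 ==> cf x (b - n) = 0"
 shows "(SUM b<-B. of_int (eps (b - n) n) * cf x (b - n)) + of_int (ip d n) * cf x (- n) = 0"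
proof -
 have "(SUM b<-S. if ip b n = 1 then of_int (eps (b - n) n) * cf x (b - n) else 0) =
 (SUM b:set S. if ip b n = 1 then of_int (eps (b - n) n) * cf x (b - n) else 0)"
 using S(1) by (rule sum_list_distinct_conv_sum_set)
 also have "... = (SUM b:set B. of_int (eps (b - n) n) * cf x (b - n))" using B z by (intro sum.mono_neutral_cong_right) auto
 also have "... = (SUM b<-B. of_int (eps (b - n) n) * cf x (b - n))" using B(1) by (rule sum_list_distinct_conv_sum_set[symmetric])
 finally show ?thesis using equa[OF n] by simp
qed

lemma S_ip: "b : set S ==> b' : set S ==> ip b b' = (if b = b' then 2 else 0)" using S(2,4) by (auto simp: rt_def)

lemma not_S: "b : set S ==> ip b n = 1 ==> n ~: set S" using S_ip[of b n] by (auto split: if_splits)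

lemma sgn_nz: "of_int (eps a b) ~= (0 :: complex)" by (simp add: eps_def)

text \<open>The equation at \<open>n = p - c\<close> contains the coordinate at \<open>c\<close>
  through \<open>p\<close>. Its other terms sit at \<open>c - p + r\<close>, and at
  \<open>c - p\<close> unless \<open>d\<close> is orthogonal to \<open>c\<close>; all of them are
  assumed to vanish.\<close>

lemma dea_sin:
 assumes c: "rt c" and p: "p : set S" "ip p c = 1" "pos_on m (p - c)" and N: "!!r. r : set S ==> ip r c = - 1 ==> cf x (c - p + r) = 0"
 and t: "ip d c = 0 | cf x (c - p) = 0"
 shows "cf x c = 0"
proof -
 have n: "rt (p - c)" using rt_dif[OF S(2)[OF p(1)] c] p(2) by simp
 have ipn: "ip b (p - c) = (if b = p then 2 else 0) - ip b c" if "b : set S" for b using S_ip[OF that p(1)] by (simp add: ip_lin)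
 have "p - c ~: set S" by (rule not_S[OF p(1)]) (use ipn[OF p(1)] p(2) in simp)
 hence e: "(SUM b<-[p]. of_int (eps (b - (p - c)) (p - c)) * cf x (b - (p - c))) + of_int (ip d (p - c)) * cf x (- (p - c)) = 0"
 proof (rule equ_res[OF n p(3)])
 fix b assume b: "b : set S" "b ~: set [p]" "ip b (p - c) = 1"
 hence "ip b c = - 1" using ipn[OF b(1)] by simp
 hence "cf x (c - p + b) = 0" by (rule N[OF b(1)])
 moreover have "b - (p - c) = c - p + b" by (simp add: algebra_simps)
 ultimately show "cf x (b - (p - c)) = 0" by (simp only:)
 qed (use p ipn in auto)
 have d0: "of_int (ip d (p - c)) * cf x (- (p - c)) = 0" using t d[OF p(1)] by (auto simp: ip_lin)
 show ?thesis using e sgn_nz[of c "p - c"] unfolding d0 by simp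
qed

text \<open>In the equation at \<open>n = - c\<close> the coordinate at \<open>c\<close> enters
  through \<open>d\<close>; the other terms sit at \<open>c + r\<close>.\<close>

lemma dea_neg:
 assumes c: "rt c" and t: "ip d c ~= 0" "pos_on m (- c)" and N: "!!r. r : set S ==> ip r c = - 1 ==> cf x (c + r) = 0"
 shows "cf x c = 0"
proof -
 have "- c ~: set S" using t(1) d[of "- c"] by auto
 hence "(SUM b<-[]. of_int (eps (b - (- c)) (- c)) * cf x (b - (- c))) + of_int (ip d (- c)) * cf x (- (- c)) = 0"
 using c t(2) N by (intro equ_res) (auto simp: add.commute)
 thus ?thesis using t(1) by simp
qed

text \<open>The equations at \<open>p - c\<close>, \<open>q - c\<close> and
  \<open>p + q - r - c\<close> link the coordinates at \<open>c\<close>, \<open>c - p + r\<close>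
  and \<open>c - q + r\<close> pairwise, with six signs of product 1.\<close>

lemma dea_tri:
 assumes c: "rt c" and S3: "p : set S" "q : set S" "r : set S" "p ~= q"
 and i: "ip p c = 1" "ip q c = 1" "ip r c = - 1" and N: "!!b. b : set S ==> ip b c = - 1 ==> b = r"
 and pos: "pos_on m (p - c)" "pos_on m (q - c)" "pos_on m (p + q - r - c)"
 and t: "ip d c = 0 | (cf x (c - p) = 0 & cf x (c - q) = 0 & cf x (c - p - q + r) = 0)"
 shows "cf x c = 0"
proof -
 have ne: "p ~= r" "q ~= r" using i by auto
 let ?X = "cf x c" and ?Y = "cf x (c - p + r)" and ?Z = "cf x (c - q + r)"
 let ?l = "p + q - r - c"
 note ips = S_ip[OF S3(1,1)] S_ip[OF S3(2,2)] S_ip[OF S3(3,3)] S_ip[OF S3(1,2)] S_ip[OF S3(2,1)]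
 S_ip[OF S3(1,3)] S_ip[OF S3(3,1)] S_ip[OF S3(2,3)] S_ip[OF S3(3,2)]
 have two: "of_int (eps c (b - c)) * ?X + of_int (eps (c - b + r) (b - c)) * cf x (c - b + r) = 0" if b: "b : set S" "b = p | b = q" for b
 proof -
 have bc: "ip b c = 1" "pos_on m (b - c)" "b ~= r" "ip d c = 0 | cf x (c - b) = 0" using b i pos t ne by auto
 have n: "rt (b - c)" using rt_dif[OF S(2)[OF b(1)] c] bc(1) by simp
 have ipn: "ip b' (b - c) = (if b' = b then 2 else 0) - ip b' c" if "b' : set S" for b' using S_ip[OF that b(1)] by (simp add: ip_lin)
 have "b - c ~: set S" by (rule not_S[OF b(1)]) (use ipn[OF b(1)] bc(1) in simp)
 hence e: "(SUM b'<-[b, r]. of_int (eps (b' - (b - c)) (b - c)) * cf x (b' - (b - c))) + of_int (ip d (b - c)) * cf x (- (b - c)) = 0"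
 proof (rule equ_res[OF n bc(2)])
 fix b' assume b': "b' : set S" "b' ~: set [b, r]" "ip b' (b - c) = 1"
 hence "ip b' c = - 1" using ipn[OF b'(1)] by simp
 hence "b' = r" using N b'(1) by blast
 thus "cf x (b' - (b - c)) = 0" using b'(2) by simp
 qed (use b S3(3) bc ipn i in auto)
 have d0: "of_int (ip d (b - c)) * cf x (- (b - c)) = 0" using bc(4) d[OF b(1)] by (auto simp: ip_lin)
 have rbc: "r - (b - c) = c - b + r" by (simp add: algebra_simps)
 show ?thesis using e unfolding list.map sum_list.Cons sum_list.Nil d0 rbc by simp
 qed
 have l: "rt ?l" using c i ips ne S3(4) ip_sym[of c p] ip_sym[of c q] ip_sym[of c r] by (simp add: rt_def ip_lin)
 have ipl: "ip b ?l = (if b = p then 2 else 0) + (if b = q then 2 else 0) - (if b = r then 2 else 0) - ip b c" if "b : set S" for b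
 using S_ip[OF that S3(1)] S_ip[OF that S3(2)] S_ip[OF that S3(3)] by (simp add: ip_lin)
 have "?l ~: set S" by (rule not_S[OF S3(1)]) (use ipl[OF S3(1)] i S3(4) ne in simp)
 hence e: "(SUM b<-[p, q]. of_int (eps (b - ?l) ?l) * cf x (b - ?l)) + of_int (ip d ?l) * cf x (- ?l) = 0"
 proof (rule equ_res[OF l pos(3)])
 fix b assume b: "b : set S" "b ~: set [p, q]" "ip b ?l = 1"
 hence "ip b c = - 1 | ip b c = - 3" using ipl[OF b(1)] by (auto split: if_splits)
 hence "b = r" using N[OF b(1)] rt_ip_bou[OF S(2)[OF b(1)] c] by auto
 thus "cf x (b - ?l) = 0" using ipl[OF b(1)] b(3) i(3) ne by simp
 qed (use S3 ipl ne i in auto)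
 have d0: "of_int (ip d ?l) * cf x (- ?l) = 0"
 proof -
 have a: "- ?l = c - p - q + r" by (simp add: algebra_simps)
 have b: "ip d ?l = - ip d c" using d[OF S3(1)] d[OF S3(2)] d[OF S3(3)] by (simp add: ip_lin)
 show ?thesis unfolding a b using t by auto
 qed
 have pq: "p - ?l = c - q + r" "q - ?l = c - p + r" by (simp_all add: algebra_simps)
 have e3: "of_int (eps (c - q + r) ?l) * ?Z + of_int (eps (c - p + r) ?l) * ?Y = 0"
 using e unfolding list.map sum_list.Cons sum_list.Nil d0 pq by simp
 \<comment> \<open>Modulo 2 the sum reduces to the products of \<open>p\<close>, \<open>q\<close>
   and \<open>r\<close> with one another, which are 0.\<close>
 have par: "even (fm c (p - c) + fm (c - p + r) (p - c) + fm c (q - c) + fm (c - q + r) (q - c) + fm (c - q + r) ?l + fm (c - p + r) ?l)"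
 proof -
 have "even (ip p c)  = even (ip q c)" "even (ip p q)" "even (ip p r)" "even (ip q r)" "even (ip r r)" "even (ip r c) = even (ip q c)"
 using i ips S3(4) ne by auto
 thus ?thesis by (simp add: ip_def fm_add_lef fm_add_rig fm_dif_lef fm_dif_rig, argo)
 qed
 let ?e1 = "of_int (eps c (p - c)) :: complex" and ?f1 = "of_int (eps (c - p + r) (p - c)) :: complex"
 let ?e2 = "of_int (eps c (q - c)) :: complex" and ?f2 = "of_int (eps (c - q + r) (q - c)) :: complex"
 let ?g = "of_int (eps (c - q + r) ?l) :: complex" and ?k = "of_int (eps (c - p + r) ?l) :: complex"
 have "?e1 * ?f1 * ?e2 * ?f2 * ?g * ?k = 1" unfolding eps_par sig_pro if_P[OF par] ..
 moreover have "?e1 * ?X + ?f1 * ?Y = 0" "?e2 * ?X + ?f2 * ?Z = 0" "?g * ?Z + ?k * ?Y = 0" using two[OF S3(1)] two[OF S3(2)] e3 by blast+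
 moreover have "of_int (eps a b) * of_int (eps a b) = (1 :: complex)" for a b by (simp add: eps_def)
 ultimately show ?thesis using sig_sys by blast
qed

text \<open>The equations at \<open>- c\<close> and \<open>p - r - c\<close> express t X and t Y as
  signs times Z, where X, Y, Z are the coordinates at \<open>c\<close>, \<open>c - p + r\<close>,
  \<open>c + r\<close> and t is the product of \<open>d\<close> and \<open>c\<close>. Inserted into
  the equation at \<open>p - c\<close>, with the product of the signs equal to 1, they give Z =
  0.\<close>

lemma dea_pai:
 assumes c: "rt c" and S2: "p : set S" "r : set S" and i: "ip p c = 1" "ip r c = - 1" and N: "!!b. b : set S ==> ip b c = - 1 ==> b = r"
 and pos: "pos_on m (p - c)" "pos_on m (- c)" "pos_on m (p - r - c)" and t: "ip d c ~= 0" "cf x (c - p) = 0"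
 shows "cf x c = 0"
proof -
 have ne: "p ~= r" using i by auto
 let ?b = "c - p + r"
 let ?X = "cf x c" and ?Y = "cf x ?b" and ?Z = "cf x (c + r)"
 note ips = S_ip[OF S2(1,1)] S_ip[OF S2(2,2)] S_ip[OF S2(1,2)] S_ip[OF S2(2,1)]
 have rb: "rt ?b" using c i ips ne ip_sym[of c p] ip_sym[of c r] by (simp add: rt_def ip_lin)
 have ipb: "ip b ?b = ip b c - (if b = p then 2 else 0) + (if b = r then 2 else 0)" if "b : set S" for b
 using S_ip[OF that S2(1)] S_ip[OF that S2(2)] by (simp add: ip_lin)
 have db: "ip d (- ?b) = - ip d c" using d[OF S2(1)] d[OF S2(2)] by (simp add: ip_lin)
 have n: "rt (p - c)" using rt_dif[OF S(2)[OF S2(1)] c] i(1) by simp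
 have ipn: "ip b (p - c) = (if b = p then 2 else 0) - ip b c" if "b : set S" for b using S_ip[OF that S2(1)] by (simp add: ip_lin)
 have "p - c ~: set S" by (rule not_S[OF S2(1)]) (use ipn[OF S2(1)] i(1) in simp)
 hence e: "(SUM b<-[p, r]. of_int (eps (b - (p - c)) (p - c)) * cf x (b - (p - c))) + of_int (ip d (p - c)) * cf x (- (p - c)) = 0"
 proof (rule equ_res[OF n pos(1)])
 fix b assume b: "b : set S" "b ~: set [p, r]" "ip b (p - c) = 1"
 hence "ip b c = - 1" using ipn[OF b(1)] by simp
 hence "b = r" using N b(1) by blast
 thus "cf x (b - (p - c)) = 0" using b(2) by simp
 qed (use S2 ne ipn i in auto)
 have d0: "of_int (ip d (p - c)) * cf x (- (p - c)) = 0" using t(2) by simp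
 have rpc: "r - (p - c) = ?b" by (simp add: algebra_simps)
 have e1: "of_int (eps c (p - c)) * ?X + of_int (eps ?b (p - c)) * ?Y = 0" using e unfolding list.map sum_list.Cons sum_list.Nil d0 rpc by simp
 have neg: "of_int (eps (c + r) (- v)) * ?Z + of_int (ip d (- v)) * cf x v = 0"
 if v: "rt v" "s : set S" "ip s v = - 1" "pos_on m (- v)" "s + v = c + r" "!!b. b : set S ==> ip b v = - 1 ==> b = s" for v s
 proof -
 have rv: "rt (- v)" using v(1) by simp
 have "- v ~: set S" by (rule not_S[OF v(2)]) (use v(3) in simp)
 hence e: "(SUM b<-[s]. of_int (eps (b - (- v)) (- v)) * cf x (b - (- v))) + of_int (ip d (- v)) * cf x (- (- v)) = 0"
 proof (rule equ_res[OF rv v(4)])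
 fix b assume b: "b : set S" "b ~: set [s]" "ip b (- v) = 1"
 hence "ip b v = - 1" by simp
 hence "b = s" using v(6) b(1) by blast
 thus "cf x (b - (- v)) = 0" using b(2) by simp
 qed (use v(2,3) in auto)
 thus ?thesis using v(5) by simp
 qed
 have e2: "of_int (eps (c + r) (- c)) * ?Z + of_int (ip d (- c)) * ?X = 0" by (rule neg[OF c S2(2) i(2) pos(2)]) (rule add.commute, rule N)
 have e3: "of_int (eps (c + r) (- ?b)) * ?Z + of_int (ip d (- ?b)) * ?Y = 0"
 proof (rule neg[OF rb S2(1)])
 show "ip p ?b = - 1" using ipb[OF S2(1)] i(1) ne by simp
 have "- ?b = p - r - c" by (simp add: algebra_simps)
 thus "pos_on m (- ?b)" using pos(3) by (simp only:)
 show "p + ?b = c + r" by (simp add: algebra_simps)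
 show "b = p" if "b : set S" "ip b ?b = - 1" for b
 proof (rule ccontr)
 assume "b ~= p"
 hence "ip b c + (if b = r then 2 else 0) = - 1" using ipb[OF that(1)] that(2) by simp
 moreover have "b ~= r"
 proof
 assume "b = r"
 thus False using calculation i(2) by simp
 qed
 ultimately show False using N[OF that(1)] by simp
 qed
 qed
 have par: "even (fm c (p - c) + fm ?b (p - c) + fm (c + r) (- c) + fm (c + r) (- ?b))"
 proof -
 have "fm p r + fm r p = 0" "fm p c + fm c p = 1" "fm r c + fm c r = - 1" "fm p p = 1" "fm r r = 1"
 using ips(3) i S(2)[OF S2(1)] S(2)[OF S2(2)] ne by (auto simp: ip_def rt_def)
 hence "even (fm p r) = even (fm r p)" "fm p p = 1" "fm r r = 1" "odd (fm p c) = even (fm c p)" "odd (fm r c) = even (fm c r)" by presburger+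
 thus ?thesis by (auto simp: fm_add_lef fm_add_rig fm_dif_lef fm_dif_rig fm_umi_rig)
 qed
 let ?e = "of_int (eps c (p - c)) :: complex" and ?f = "of_int (eps ?b (p - c)) :: complex"
 let ?g = "of_int (eps (c + r) (- c)) :: complex" and ?k = "of_int (eps (c + r) (- ?b)) :: complex"
 let ?t = "of_int (ip d c) :: complex"
 have "?e * ?f * ?g * ?k = 1" using sig_pro[of "fm c (p - c)" "fm ?b (p - c)" "fm (c + r) (- c)" "fm (c + r) (- ?b)" 0 0] par
 unfolding eps_par by simp
 moreover have "?g * ?Z = ?t * ?X" using e2 by simp
 moreover have "?k * ?Z = ?t * ?Y" using e3 unfolding db of_int_minus by algebra
 moreover have "?f * ?f = 1" "?k * ?k = 1" by (simp_all add: eps_def)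
 ultimately have "2 * ?Z = 0" using e1 by algebra
 thus ?thesis using e2 t(1) by simp
qed

text \<open>Nested conditionals in \<open>dead\<close> let the evaluation stop at the first rule
  that succeeds; for the soundness proof they are flattened into a disjunction.\<close>

lemma sea_cas: "((if a then True else if b then True else if e then True else if f then True
 else if t then False else if u then v else False)) = (a | b | e | f | (~ t & u & v))"
 by simp

lemma pat_cas:
 assumes "case (P, N) of ([p, q], [r]) => A p q r | ([p], [r]) => B p r | _ => False"
 obtains p q r where "P = [p, q]" "N = [r]" "A p q r" | p r where "P = [p]" "N = [r]" "B p r" using assms by (auto split: list.splits)

theorem dea_sou:
 assumes "dead m (map (%b. (b, vec b)) S) (vec d) n c" "rt c"
 shows "cf x c = 0" using assms
proof (induction n arbitrary: c)
 case 0
 thus ?case using outs by simp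
next
 case (Suc n)
 let ?S = "map (%b. (b, vec b)) S"
 let ?D = "%c. dead m ?S (vec d) n c"
 let ?P = "filter (%b. ip b c = 1) S" and ?N = "filter (%b. ip b c = - 1) S"
 let ?ks = "map (%b. (b, ip b c)) S"
 have ks: "map (%(b, v). (b, dot v c)) ?S = ?ks" by (simp add: ip_dot)
 have P: "map fst (filter (%(b, k). k = 1) ?ks) = ?P" and N: "map fst (filter (%(b, k). k = - 1) ?ks) = ?N" by (simp_all add: filter_map o_def)
 have D: "cf x v = 0" if "?D v" "rt v" for v using Suc.IH that by blast
 have sub: "rt (c - p)" if "p : set S" "ip p c = 1" for p using rt_dif[OF Suc.prems(2) S(2)[OF that(1)]] that(2) ip_sym[of c p] by simp
 have sub2: "rt (c - p + r)" if "p : set S" "ip p c = 1" "r : set S" "ip r c = - 1" for p r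
 using that Suc.prems(2) S_ip[OF that(1,1)] S_ip[OF that(3,3)] S_ip[OF that(1,3)] S_ip[OF that(3,1)] ip_sym[of c p] ip_sym[of c r]
 by (auto simp: rt_def ip_lin)
 have sub3: "rt (c - p - q + r)" if "p : set S" "ip p c = 1" "r : set S" "ip r c = - 1" "q : set S" "ip q c = 1" "p ~= q" for p q r
 using that Suc.prems(2) S_ip[OF that(1,1)] S_ip[OF that(3,3)] S_ip[OF that(1,3)] S_ip[OF that(3,1)] ip_sym[of c p] ip_sym[of c r]
 S_ip[OF that(5,5)] S_ip[OF that(1,5)] S_ip[OF that(5,1)] S_ip[OF that(3,5)] S_ip[OF that(5,3)] ip_sym[of c q]
 by (auto simp: rt_def ip_lin)
 note search = Suc.prems(1)[unfolded dead.simps Let_def ks P N ip_dot[symmetric] sea_cas]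
 show ?case using search
 proof (elim disjE)
 assume "~ pos_on m c"
 thus ?thesis using outs Suc.prems(2) by blast
 next
 assume "EX (b, k):set ?ks. k = 2"
 then obtain b where b: "b : set S" "ip b c = 2" by auto
 have "ip (b - c) (b - c) = 0" using S(2)[OF b(1)] Suc.prems(2) b(2) ip_sym[of b c] by (simp add: rt_def ip_lin)
 hence "b = c" using ip_pos[of "b - c"] by auto
 thus ?thesis using supp b by auto
 next
 assume "case (?P, ?N) of ([p, q], [r]) => pos_on m (p - c) & pos_on m (q - c) & pos_on m (p + q - r - c) &
 (if ip d c = 0 then True else ?D (c - p) & ?D (c - q) & ?D (c - p - q + r))
 | ([p], [r]) => (if ip d c = 0 then False else
 pos_on m (p - c) & pos_on m (- c) & pos_on m (p - r - c) & ?D (c - p))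
 | _ => False"
 thus ?thesis
 proof (rule pat_cas)
 fix p q r assume PN: "?P = [p, q]" "?N = [r]" and A: "pos_on m (p - c) & pos_on m (q - c) & pos_on m (p + q - r - c) &
 (if ip d c = 0 then True else ?D (c - p) & ?D (c - q) & ?D (c - p - q + r))"
 have "distinct [p, q]" using distinct_filter[OF S(1), of "%b. ip b c = 1"] unfolding PN(1) .
 moreover have "set ?P = {p, q}" "set ?N = {r}" unfolding PN by simp_all
 ultimately have pq: "p : set S" "ip p c = 1" "q : set S" "ip q c = 1" "r : set S" "ip r c = - 1" "p ~= q"
 "!!b. b : set S ==> ip b c = - 1 ==> b = r" by auto
 have t: "ip d c = 0 | (cf x (c - p) = 0 & cf x (c - q) = 0 & cf x (c - p - q + r) = 0)"
 using A D[OF _ sub[OF pq(1,2)]] D[OF _ sub[OF pq(3,4)]] D[OF _ sub3[OF pq(1,2,5,6,3,4,7)]] by (simp split: if_splits)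
 show ?thesis by (rule dea_tri[OF Suc.prems(2) pq(1,3,5,7,2,4,6,8) _ _ _ t]) (use A in simp_all)
 next
 fix p r assume PN: "?P = [p]" "?N = [r]" and A: "if ip d c = 0 then False else
 pos_on m (p - c) & pos_on m (- c) & pos_on m (p - r - c) & ?D (c - p)"
 have A': "ip d c ~= 0" "pos_on m (p - c)" "pos_on m (- c)" "pos_on m (p - r - c)" "?D (c - p)" using A by (simp_all split: if_splits)
 have "set ?P = {p}" "set ?N = {r}" unfolding PN by simp_all
 hence pr: "p : set S" "ip p c = 1" "r : set S" "ip r c = - 1"
 "!!b. b : set S ==> ip b c = - 1 ==> b = r" by auto
 show ?thesis by (rule dea_pai[OF Suc.prems(2) pr(1,3,2,4,5) A'(2-4,1) D[OF A'(5) sub[OF pr(1,2)]]])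
 qed
 next
 assume "EX p:set ?P. (if pos_on m (p - c) then (ALL r:set ?N. ?D (c - p + r)) & (if ip d c = 0 then True else ?D (c - p)) else False)"
 then obtain p where p: "p : set S" "ip p c = 1" "pos_on m (p - c)" "ALL r:set ?N. ?D (c - p + r)" "ip d c = 0 | ?D (c - p)"
 by (auto split: if_splits)
 show ?thesis
 proof (rule dea_sin[OF Suc.prems(2) p(1-3)])
 show "cf x (c - p + r) = 0" if "r : set S" "ip r c = - 1" for r using p(4) that by (intro D sub2[OF p(1,2) that]) auto
 show "ip d c = 0 | cf x (c - p) = 0" using p(5) D sub[OF p(1,2)] by blast
 qed
 next
 assume t: "ip d c ~= 0 & pos_on m (- c) & (ALL r:set ?N. ?D (c + r))"
 show ?thesis
 proof (rule dea_neg[OF Suc.prems(2)])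
 show "cf x (c + r) = 0" if "r : set S" "ip r c = - 1" for r
 using t that rt_add[OF Suc.prems(2) S(2)[OF that(1)]] ip_sym[of c r] by (intro D) auto
 qed (use t in simp_all)
 qed
qed

end

text \<open>The roots \<open>c + sr i\<close> for a positive root \<open>c\<close>.\<close>

fun raise :: "lat => lat list" where
 "raise (L a1 a2 a3 a4 a5 a6 a7 a8) =
 (if 2 * a1 - a2 = - 1 then [L (a1 + 1) a2 a3 a4 a5 a6 a7 a8] else []) @
 (if 2 * a2 - a1 - a3 = - 1 then [L a1 (a2 + 1) a3 a4 a5 a6 a7 a8] else []) @
 (if 2 * a3 - a2 - a4 = - 1 then [L a1 a2 (a3 + 1) a4 a5 a6 a7 a8] else []) @
 (if 2 * a4 - a3 - a5 = - 1 then [L a1 a2 a3 (a4 + 1) a5 a6 a7 a8] else []) @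
 (if 2 * a5 - a4 - a6 - a8 = - 1 then [L a1 a2 a3 a4 (a5 + 1) a6 a7 a8] else []) @
 (if 2 * a6 - a5 - a7 = - 1 then [L a1 a2 a3 a4 a5 (a6 + 1) a7 a8] else []) @
 (if 2 * a7 - a6 = - 1 then [L a1 a2 a3 a4 a5 a6 (a7 + 1) a8] else []) @
 (if 2 * a8 - a5 = - 1 then [L a1 a2 a3 a4 a5 a6 a7 (a8 + 1)] else [])"

text \<open>Positive roots are visited height by height. The fuel \<open>n\<close> may run out only
  on an empty list, so success certifies that no root was missed.\<close>

primrec all_levels :: "(lat => bool) => nat => lat list => bool" where
 "all_levels Q 0 l = (l = [])"
| "(all_levels Q (Suc n) l) = ((if l = [] then True else list_all Q l & all_levels Q n (remdups (concat (map raise l)))))"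

definition simple_list :: "lat list" where
 "simple_list = [L 1 0 0 0 0 0 0 0, L 0 1 0 0 0 0 0 0, L 0 0 1 0 0 0 0 0, L 0 0 0 1 0 0 0 0,
 L 0 0 0 0 1 0 0 0, L 0 0 0 0 0 1 0 0, L 0 0 0 0 0 0 1 0, L 0 0 0 0 0 0 0 1]"

lemma rai_in: "i : {1..8} ==> ip c (sr i) = - 1 ==> c + sr i : set (raise c)"
 unfolding I8 by (cases c; elim insertE emptyE; hypsubst; simp add: ip_dot sr_def)

lemma sim_lis_in: "i : {1..8} ==> sr i : set simple_list"
 unfolding I8 by (elim insertE emptyE; hypsubst; simp add: sr_def simple_list_def)

lemma all_lev_pos:
 assumes "all_levels Q n simple_list" "rt c" "npos c" shows "Q c"
proof -
 define lev where "lev k = ((%l. remdups (concat (map raise l))) ^^ k) simple_list" for k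
 have "c : (\<Union>k. set (lev k))" using assms(3,2)
 proof (induction c rule: npo_ht_ind)
 case (less c)
 consider i where "i : {1..8}" "c = sr i"
 | i where "i : {1..8}" "ip c (sr i) = 1" "rt (c - sr i)" "npos (c - sr i)" using rt_des[OF less(3,1)] by blast
 thus ?case
 proof cases
 case 1
 hence "c : set (lev 0)" using sim_lis_in by (simp add: lev_def)
 thus ?thesis by blast
 next
 case (2 i)
 have "c - sr i : (\<Union>k. set (lev k))" using less(2)[OF 2(4) _ 2(3)] ht_sr[OF 2(1)] by (simp add: ht_dif)
 then obtain k where k: "c - sr i : set (lev k)" by blast
 have "ip (c - sr i) (sr i) = - 1" using 2(2) rt_sr[OF 2(1)] by (simp add: ip_lin rt_def)
 hence "c - sr i + sr i : set (raise (c - sr i))" by (rule rai_in[OF 2(1)])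
 hence "c : set (lev (Suc k))" using k by (auto simp: lev_def)
 thus ?thesis by blast
 qed
 qed
 moreover have "ALL c:set (((%l. remdups (concat (map raise l))) ^^ k) l). Q c" if "all_levels Q n l" for k n l using that
 proof (induction n arbitrary: l k)
 case 0
 hence "((%l. remdups (concat (map raise l))) ^^ k) l = []" by (induction k) auto
 thus ?case by simp
 next
 case (Suc n)
 show ?case
 proof (cases "l = []")
 case True
 hence "((%l. remdups (concat (map raise l))) ^^ k) l = []" by (induction k) auto
 thus ?thesis by simp
 next
 case False
 hence l: "list_all Q l" "all_levels Q n (remdups (concat (map raise l)))" using Suc.prems by auto
 show ?thesis
 proof (cases k)
 case 0
 thus ?thesis using l(1) by (simp add: list_all_iff)
 next
 case (Suc j)
 thus ?thesis using Suc.IH[OF l(2), of j] by (simp add: funpow_Suc_right del: funpow.simps)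
 qed
 qed
 qed
 ultimately show ?thesis using assms(1) unfolding lev_def by blast
qed

text \<open>The highest root has height 29, so there is nothing left at height 30 and the fuel
  suffices. Only positive roots are enumerated, each tested together with its negative.\<close>

definition for_roots :: "(lat => bool) => bool" where
 "for_roots Q = (all_levels (%c. Q c & Q (- c)) 30 simple_list)"

lemma all_roo:
 assumes "for_roots Q" "rt c" shows "Q c" using rt_sig[OF assms(2)] all_lev_pos[OF assms(1)[unfolded for_roots_def], of c]
 all_lev_pos[OF assms(1)[unfolded for_roots_def], of "- c"] assms(2) by auto

text \<open>With \<open>d = 0\<close> the roots outs \<open>{c. zero_on m' c}\<close> are excluded from the stabiliser, and with the
 given \<open>d\<close> all roots.\<close>

definition check :: "lat => lat => lat list => lat => lat => bool" where
 "check m m' S d c = ((if ~ pos_on m c then True else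
 (if zero_on m' c then True else dead m (map (%b. (b, vec b)) S) 0 1 c) &
 dead m (map (%b. (b, vec b)) S) (vec d) 3 c))"

definition form_data :: "lat => lat list => lat => bool" where
 "form_data m S d = (distinct S & list_all (%b. ip b b = 2 & pos_on m b & ip d b = 0 &
 list_all (%b'. b = b' | ip b b' = 0) S) S)"

text \<open>The last clause is completeness in coordinates: half the sum of
  \<open>ip b (sr j)\<close> times \<open>b\<close> over \<open>K\<close> is \<open>sr j\<close>. It
  allows an element of \<open>h\<close> to be rebuilt from its weights on \<open>K\<close>, see
  \<open>h_ort_exp\<close>.\<close>

definition orth_basis :: "lat list => bool" where
 "orth_basis K = (distinct K & list_all (%b. list_all (%b'. ip b b' = (if b = b' then 2 else 0)) K) K &
 list_all (%j. list_all (%i. (SUM b<-K. lc b i * ip b (sr j)) = (if i = j then 2 else 0)) [1,2,3,4,5,6,7,8]) [1,2,3,4,5,6,7,8])"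

lemma I8_lis: "set [1,2,3,4,5,6,7,8::nat] = {1..8}" by auto

section \<open>Stabilisers and the index from the checks\<close>

context e8
begin

definition fstab :: "lat => lat list => lat => 'g set" where
 "fstab m S d = {x : PS {c. pos_on m c}. ALL y:PS {c. pos_on m c}. cform S d (br x y) = 0}"

lemma clo_pos_on: "closed_roots {c. pos_on m c}" unfolding closed_roots_def
proof (intro ballI impI)
 fix a b assume ab: "a : {c. pos_on m c}" "b : {c. pos_on m c}"
 have "pos_on m (a + b)" unfolding pos_on_iff
 proof
 fix i assume "i : {1..8::nat}"
 hence "lc m i = 0 | 0 <= lc a i" "lc m i = 0 | 0 <= lc b i" using ab unfolding mem_Collect_eq pos_on_iff by blast+
 thus "lc m i = 0 | 0 <= lc (a + b) i" by auto
 qed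
 thus "a + b : {c. pos_on m c}" by simp
qed

lemma e8_sta:
 assumes "form_data m S d" "x : fstab m S d" shows "e8_stabiliser sc br h al m S d x" using assms
 by unfold_locales (auto simp: form_data_def fstab_def list_all_iff rt_def)

text \<open>Testing on \<open>ev b\<close> returns the weight \<open>b\<close> of the Cartan part:
  differences of distinct members of \<open>S\<close> are no roots, and the Cartan part of the
  bracket is a multiple of \<open>Hl b\<close>, which \<open>d\<close> kills.\<close>

lemma fst_hp:
 assumes S: "form_data m S d" and x: "x : fstab m S d" and b: "b : set S"
 shows "wt b (hp x) = 0"
proof -
 interpret e8_stabiliser sc br h al m S d x by (rule e8_sta[OF S x])
 have "cf (br x (ev b)) b' = (if b' = b then wt b (hp x) else 0)" if b': "b' : set S" for b'
 proof -
 have "~ rt (b' - b)" if "b' ~= b" using rt_dif[OF S(2)[OF b'] S(2)[OF b]] S_ip[OF b' b] that by simp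
 thus ?thesis using cf_br_ev[OF S(2)[OF b] S(2)[OF b'], of x] by simp
 qed
 hence "(SUM b'<-S. cf (br x (ev b)) b') = (SUM b'<-S. if b' = b then wt b (hp x) else 0)" by (intro arg_cong[where f = sum_list] map_cong) auto
 also have "... = wt b (hp x)" using S(1) b by (simp add: sum_list_distinct_conv_sum_set sum.delta)
 moreover have "wt d (hp (br x (ev b))) = 0" unfolding hp_br_ev[OF S(2)[OF b]] using d[OF b] by (simp add: wt_h_sca[OF Hl_h])
 ultimately have "cform S d (br x (ev b)) = wt b (hp x)" by (simp add: cform_def)
 moreover have "cform S d (br x (ev b)) = 0" by (rule x(2)[OF PS_ev[OF S(2)[OF b]]]) (use S(3)[OF b] in simp)
 ultimately show ?thesis by simp
qed

lemma che_zer: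
 assumes "for_roots (check m m' S d)" and S: "form_data m S d" "form_data m S 0" and c: "rt c"
 shows "x : fstab m S 0 ==> ~ zero_on m' c ==> cf x c = 0" "x : fstab m S d ==> cf x c = 0"
proof -
 have ck: "check m m' S d c" by (rule all_roo[OF assms(1) c])
 show "cf x c = 0" if x: "x : fstab m S 0" and z: "~ zero_on m' c"
 proof -
 interpret e8_stabiliser sc br h al m S 0 x by (rule e8_sta[OF S(2) x])
 have v0: "vec 0 = 0" by (simp add: zero_lat_def)
 show ?thesis
 proof (cases "pos_on m c")
 case True
 hence "dead m (map (%b. (b, vec b)) S) (vec 0) 1 c" using ck z v0 by (simp add: check_def del: dead.simps)
 thus ?thesis using c by (rule dea_sou)
 qed (use outs c in blast)
 qed
 show "cf x c = 0" if x: "x : fstab m S d"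
 proof -
 interpret e8_stabiliser sc br h al m S d x by (rule e8_sta[OF S(1) x])
 show ?thesis
 proof (cases "pos_on m c")
 case True
 hence "dead m (map (%b. (b, vec b)) S) (vec d) 3 c" using ck by (simp add: check_def del: dead.simps)
 thus ?thesis using c by (rule dea_sou)
 qed (use outs c in blast)
 qed
qed

lemma h_ort_exp:
 assumes K: "orth_basis K" and H: "H : h"
 shows "H = (SUM b<-K. sc (wt b H / 2) (Hl b))"
proof (rule h_eqI[OF H])
 have hs: "(SUM b<-L. sc (wt b H / 2) (Hl b)) : h & wt c (SUM b<-L. sc (wt b H / 2) (Hl b)) = (SUM b<-L. wt b H / 2 * of_int (ip c b))" for L c
 by (induction L) (auto simp: h_0 wt_h_zer h_add h_sca Hl_h wt_h_add wt_h_sca)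
 show "(SUM b<-K. sc (wt b H / 2) (Hl b)) : h" using hs by blast
 fix j assume j: "j : {1..8::nat}"
 have wl: "wt b H = (SUM i:{1..8}. of_int (lc b i) * al i H)" for b unfolding wt_def ..
 have "(SUM b<-K. wt b H / 2 * of_int (ip (sr j) b)) = (SUM b<-K. SUM i:{1..8}. al i H / 2 * of_int (lc b i * ip b (sr j)))"
 unfolding wl by (intro arg_cong[where f = sum_list] map_cong refl) (simp add: sum_divide_distrib sum_distrib_left sum_distrib_right ip_sym[of _ "sr j"] mult_ac)
 also have "... = (SUM i:{1..8}. SUM b<-K. al i H / 2 * of_int (lc b i * ip b (sr j)))" by (induction K) (simp_all add: sum.distrib)
 also have "... = (SUM i:{1..8}. al i H / 2 * of_int (SUM b<-K. lc b i * ip b (sr j)))"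
 proof (rule sum.cong)
 fix i
 show "(SUM b<-K. al i H / 2 * of_int (lc b i * ip b (sr j))) = al i H / 2 * of_int (SUM b<-K. lc b i * ip b (sr j))"
 by (induction K) (simp_all add: distrib_left)
 qed simp
 also have "... = (SUM i:{1..8}. if i = j then al i H else 0)"
 proof (rule sum.cong)
 fix i assume "i : {1..8::nat}"
 hence "(SUM b<-K. lc b i * ip b (sr j)) = (if i = j then 2 else 0)" using K j unfolding orth_basis_def list_all_iff I8_lis by blast
 thus "al i H / 2 * of_int (SUM b<-K. lc b i * ip b (sr j)) = (if i = j then al i H else 0)" by simp
 qed simp
 also have "... = wt (sr j) H" using j by (simp add: wt_sr)
 finally show "wt (sr j) H = wt (sr j) (SUM b<-K. sc (wt b H / 2) (Hl b))" using hs[of K "sr j"] by simp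
qed

lemma anni:
 assumes K: "orth_basis (S @ R)"
 shows "{H : h. ALL b:set S. wt b H = 0} = span (Hl ` set R)"
 "dim {H : h. ALL b:set S. wt b H = 0} = length R"
proof -
 let ?T = "{H : h. ALL b:set S. wt b H = 0}"
 have dR: "distinct R" and dSR: "set S \<inter> set R = {}" using K by (auto simp: orth_basis_def)
 have ips: "b : set (S @ R) ==> b' : set (S @ R) ==> ip b b' = (if b = b' then 2 else 0)" for b b'
 using K unfolding orth_basis_def list_all_iff by blast
 have subT: "subspace ?T" by (rule subspaceI) (auto simp: h_0 h_add h_sca wt_h_zer wt_h_add wt_h_sca)
 have RT: "Hl ` set R <= ?T" using ips dSR by (auto simp: Hl_h)
 have TR: "?T <= span (Hl ` set R)"
 proof
 fix H assume H: "H : ?T"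
 hence "H = (SUM b<-S @ R. sc (wt b H / 2) (Hl b))" using h_ort_exp[OF K] by blast
 also have "... = (SUM b<-S. sc (wt b H / 2) (Hl b)) + (SUM b<-R. sc (wt b H / 2) (Hl b))" by simp
 also have "(SUM b<-S. sc (wt b H / 2) (Hl b)) = (SUM b<-S. 0)" by (intro arg_cong[where f = sum_list] map_cong) (use H in auto)
 also have "... + (SUM b<-R. sc (wt b H / 2) (Hl b)) = (SUM b:set R. sc (wt b H / 2) (Hl b))" using dR by (simp add: sum_list_distinct_conv_sum_set)
 also have "... : span (Hl ` set R)" by (intro span_sum span_scale span_base) simp
 finally show "H : span (Hl ` set R)" .
 qed
 show eq: "?T = span (Hl ` set R)" using span_minimal[OF RT subT] TR by blast
 have inj: "inj_on Hl (set R)"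
 proof (rule inj_onI)
 fix a b assume ab: "a : set R" "b : set R" "Hl a = Hl b"
 hence "(of_int (ip a a) :: complex) = of_int (ip a b)" using wt_Hl[of a a] wt_Hl[of a b] by (simp del: wt_Hl)
 thus "a = b" using ips[of a a] ips[of a b] ab by (auto split: if_splits)
 qed
 have "independent (Hl ` set R)"
 proof (rule independent_if_scalars_zero)
 show "finite (Hl ` set R)" by simp
 fix f v assume f: "(SUM v:Hl ` set R. sc (f v) v) = 0" and v: "v : Hl ` set R"
 then obtain a where a: "a : set R" "v = Hl a" by blast
 have "(SUM b:set R. sc (f (Hl b)) (Hl b)) = 0" using f by (simp add: sum.reindex[OF inj])
 hence "0 = wt a (SUM b:set R. sc (f (Hl b)) (Hl b))" by (simp add: wt_h_zer)
 also have "... = (SUM b:set R. f (Hl b) * of_int (ip a b))" by (subst wt_h_sum) (simp_all add: h_sca Hl_h wt_h_sca)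
 also have "... = (SUM b:set R. if b = a then 2 * f (Hl b) else 0)" by (rule sum.cong) (use ips a in auto)
 also have "... = 2 * f v" using a by (simp add: sum.delta)
 finally show "f v = 0" by simp
 qed
 thus "dim ?T = length R" unfolding eq using dim_span_eq_card_independent[of "Hl ` set R"] card_image[OF inj] distinct_card[OF dR] by simp
qed

lemma cfo_lin: "cform S d (x + y) = cform S d x + cform S d y" "cform S d (sc a x) = a * cform S d x" if "!!b. b : set S ==> rt b"
proof -
 have "(SUM b<-L. cf (x + y) b) = (SUM b<-L. cf x b) + (SUM b<-L. cf y b)" if "!!b. b : set L ==> rt b" for L
 using that by (induction L) (simp_all add: cf_add)
 moreover have "(SUM b<-L. cf (sc a x) b) = a * (SUM b<-L. cf x b)" if "!!b. b : set L ==> rt b" for L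
 using that by (induction L) (simp_all add: cf_sca distrib_left)
 ultimately show "cform S d (x + y) = cform S d x + cform S d y" "cform S d (sc a x) = a * cform S d x"
 using that by (simp_all add: cform_def hp_add hp_sca wt_h_add wt_h_sca distrib_left)
qed

lemma res_cfo:
 assumes "form_data m S d"
 shows "restrict (cform S d) (PS {c. pos_on m c}) : dual_space sc (PS {c. pos_on m c})"
 "lie_stabiliser br (PS {c. pos_on m c}) (restrict (cform S d) (PS {c. pos_on m c})) = fstab m S d"
proof -
 let ?q = "PS {c. pos_on m c}"
 have rt: "!!b. b : set S ==> rt b" using assms by (auto simp: form_data_def list_all_iff rt_def)
 have ps: "x : ?q ==> y : ?q ==> x + y : ?q" "x : ?q ==> sc a x : ?q" for x y a
 using subspace_add[OF PS_subs] subspace_scale[OF PS_subs] by blast+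
 show "restrict (cform S d) ?q : dual_space sc ?q" unfolding dual_space_def linear_on_def using ps cfo_lin[OF rt] by simp
 have "br x y : ?q" if "x : ?q" "y : ?q" for x y using PS_sub[OF clo_pos_on] that unfolding lie_subalgebra_def by blast
 thus "lie_stabiliser br ?q (restrict (cform S d) ?q) = fstab m S d" unfolding lie_stabiliser_def fstab_def by auto
qed

lemma fst_tor:
 assumes S: "form_data m S d" and z: "!!x c. x : fstab m S d ==> rt c ==> cf x c = 0"
 shows "fstab m S d = {H : h. ALL b:set S. wt b H = 0}"
proof (intro equalityI subsetI)
 fix x assume x: "x : fstab m S d"
 have "x = hp x" by (rule hp_cf_eqI) (simp_all add: hp_on_h z[OF x] cf_on_h)
 thus "x : {H : h. ALL b:set S. wt b H = 0}" using fst_hp[OF S x] hp_h[of x] by simp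
next
 fix H assume H: "H : {H : h. ALL b:set S. wt b H = 0}"
 have rt: "!!b. b : set S ==> rt b" using S by (auto simp: form_data_def list_all_iff rt_def)
 have "cform S d (br H y) = 0" for y
 proof -
 have "br H y = - br y H" by (rule br_ant)
 moreover have "cf (br y H) b = 0" if "b : set S" for b using cf_br_h[of H b y] H rt[OF that] that by simp
 moreover have "hp (br y H) = 0" using hp_br_h H by blast
 ultimately show ?thesis using rt by (simp add: cform_def hp_min cf_min wt_h_zer cong: map_cong)
 qed
 thus "H : fstab m S d" using H PS_h by (auto simp: fstab_def)
qed

text \<open>With all root coordinates excluded, the stabiliser is the part of \<open>h\<close>
  annihilated by \<open>S\<close>. The projection \<open>hp\<close> fixes it and kills its brackets,
  as \<open>lie_ind_tor\<close> asks.\<close>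

theorem inde_of_chec:
 assumes ck: "for_roots (check m m' S d)" and S: "form_data m S d" "form_data m S 0" and K: "orth_basis (S @ R)"
 shows "lie_index sc br (PS {c. pos_on m c}) = length R"
proof -
 let ?q = "PS {c. pos_on m c}"
 obtain B where B: "finite B" "span B = UNIV" using fin_dim by blast
 have T: "fstab m S d = {H : h. ALL b:set S. wt b H = 0}" by (rule fst_tor[OF S(1) che_zer(2)[OF ck S]])
 have "lie_index sc br ?q = dim {H : h. ALL b:set S. wt b H = 0}"
 proof (rule lie_ind_tor[OF PS_sub[OF clo_pos_on] B(1) _ res_cfo(1)[OF S(1)], where ta = hp])
 show "?q <= span B" using B by simp
 show "lie_stabiliser br ?q (restrict (cform S d) ?q) = {H : h. ALL b:set S. wt b H = 0}" using res_cfo(2)[OF S(1)] T by simp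
 show "linear_on sc sc ?q hp" by (simp add: linear_on_def hp_add hp_sca)
 show "hp x : ?q" for x by (rule PS_h[OF hp_h])
 show "hp t = t" if "t : {H : h. ALL b:set S. wt b H = 0}" for t using that hp_on_h by blast
 show "hp (br t x) = 0" if "t : {H : h. ALL b:set S. wt b H = 0}" for t x using that hp_br_h[of t x] br_ant[of t x] by (simp add: hp_min)
 qed
 thus ?thesis using anni(2)[OF K] by simp
qed

end

section \<open>The defining representation of a Levi subalgebra\<close>

text \<open>The root vectors at the \<open>N i\<close> span a module of the Levi subalgebra, all of whose roots are
 differences of the weights \<open>N i\<close>.\<close>

locale w_module = e8 sc br h al for sc :: "complex => 'g::ab_group_add => 'g" and br h al +
 fixes pp :: "nat set" and N :: "'d::finite => lat"
 assumes pp: "pp <= {1..8}" and N: "!!i. rt (N i)" "!!i. N i ~: levi pp" "inj N"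
 and closed: "!!c j. rt c ==> c : levi pp ==> rt (c + N j) ==> c + N j : range N"
 and roots: "!!c. rt c ==> c : levi pp ==> EX a b. c = N a - N b" and levi: "!!a b. N a - N b : levi pp"
 and nondegenerate: "!!t :: 'd => complex. sum t UNIV = 0 ==>
 (!!i. (SUM j:UNIV. t j * of_int (ip (N i) (N j))) = 0) ==> (SUM j:UNIV. sc (t j) (Hl (N j))) = 0"
begin

definition rho :: "'g => complex ^ 'd ^ 'd" where
 "rho x = (\<chi> i j. cf (br x (ev (N j))) (N i))"

definition vect :: "complex ^ 'd => 'g" where
 "vect v = (SUM i:UNIV. sc (v $ i) (ev (N i)))"

lemma N_eq [simp]: "(N i = N j) = (i = j)" using N(3) by (auto dest: injD)

lemma rho_ent:
 "rho x $ i $ j = (if i = j then wt (N j) (hp x)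
 else if rt (N i - N j) then of_int (eps (N i - N j) (N j)) * cf x (N i - N j) else 0)"
 unfolding rho_def by (simp add: cf_br_ev[OF N(1) N(1)])

lemma cf_vec: "rt c ==> cf (vect v) c = (SUM i:UNIV. if c = N i then v $ i else 0)"
 unfolding vect_def cf_sum by (rule sum.cong) (simp_all add: cf_sca cf_ev N)

lemma cf_vec_N: "cf (vect v) (N j) = v $ j" by (simp add: cf_vec N sum.delta)

lemma hp_vec: "hp (vect v) = 0" unfolding vect_def by (simp add: hp_sum hp_sca hp_ev N)

lemma vec_inj: "vect v = 0 ==> v = 0" using cf_vec_N[of v] by (simp add: vec_eq_iff N)

lemma vec_dif: "vect (v - w) = vect v - vect w" unfolding vect_def by (simp add: scale_left_diff_distrib sum_subtractf)

lemma act_ev: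
 assumes x: "x : PS (levi pp)"
 shows "br x (ev (N j)) = vect (column j (rho x))"
proof (rule hp_cf_eqI)
 have "- N j ~: levi pp" using N(2)[of j] by (auto simp: levi_def)
 thus "hp (br x (ev (N j))) = hp (vect (column j (rho x)))" using x N(1)[of j] by (simp add: hp_br_ev[OF N(1)] hp_vec PS_def)
 fix c assume c: "rt c"
 show "cf (br x (ev (N j))) c = cf (vect (column j (rho x))) c"
 proof (cases "c : range N")
 case True
 then obtain i where "c = N i" by blast
 thus ?thesis by (simp add: cf_vec_N column_def rho_def)
 next
 case False
 hence "cf (vect (column j (rho x))) c = 0" using c by (auto simp: cf_vec intro!: sum.neutral)
 moreover have "cf (br x (ev (N j))) c = 0"
 proof (cases "rt (c - N j) & c - N j : levi pp")
 case True
 hence "c - N j + N j : range N" using closed[of "c - N j" j] c by simp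
 thus ?thesis using False by simp
 next
 case False
 thus ?thesis using x c \<open>c ~: range N\<close> by (auto simp: cf_br_ev[OF N(1) c] PS_def)
 qed
 ultimately show ?thesis by simp
 qed
qed

lemma action:
 assumes x: "x : PS (levi pp)" shows "br x (vect v) = vect (rho x *v v)"
proof -
 have "br x (vect v) = (SUM j:UNIV. sc (v $ j) (SUM i:UNIV. sc (rho x $ i $ j) (ev (N i))))"
 unfolding vect_def[of v] br_sum_rig br_scale_right act_ev[OF x] vect_def by (simp add: column_def)
 also have "... = (SUM j:UNIV. SUM i:UNIV. sc (rho x $ i $ j * v $ j) (ev (N i)))" by (simp add: scale_sum_right mult.commute)
 also have "... = vect (rho x *v v)" unfolding vect_def by (subst sum.swap) (simp add: matrix_vector_mult_def scale_sum_left)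
 finally show ?thesis .
qed

lemma rho_add: "rho (x + y) = rho x + rho y" by (simp add: rho_def vec_eq_iff br_add_left cf_add N)

lemma rho_sca: "rho (sc c x) = mat c ** rho x"
 by (simp add: rho_def vec_eq_iff br_scale_left cf_sca N matrix_matrix_mult_def mat_def if_distrib[of "%t. t * _"] sum.delta cong: if_cong)

lemma rho_br:
 assumes xy: "x : PS (levi pp)" "y : PS (levi pp)"
 shows "rho (br x y) = rho x ** rho y - rho y ** rho x"
proof -
 have "br x y : PS (levi pp)" using PS_sub[OF clo_lev] xy unfolding lie_subalgebra_def by blast
 have "rho (br x y) *v v = (rho x ** rho y - rho y ** rho x) *v v" for v
 proof -
 have "vect (rho (br x y) *v v) = br x (br y (vect v)) - br y (br x (vect v))"
 using action[OF \<open>br x y : PS (levi pp)\<close>, of v] jac_lef[of x y "vect v"] by simp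
 also have "... = vect ((rho x ** rho y - rho y ** rho x) *v v)"
 by (simp add: action xy vec_dif[symmetric] matrix_vector_mult_diff_rdistrib matrix_vector_mul_assoc)
 finally have "vect (rho (br x y) *v v - (rho x ** rho y - rho y ** rho x) *v v) = 0" by (simp add: vec_dif)
 hence "rho (br x y) *v v - (rho x ** rho y - rho y ** rho x) *v v = 0" by (rule vec_inj)
 thus ?thesis by simp
 qed
 thus ?thesis by (simp add: matrix_eq)
qed

text \<open>A simple root in \<open>pp\<close> is a difference of two weights, hence a combination
  of the \<open>N j\<close> with coefficient sum 0. Conversely, such a combination can be written in
  differences, which lie in the lattice of the Levi subalgebra.\<close>

lemma car_lev: "span ((%i. Hl (sr i)) ` pp) = {SUM j:UNIV. sc (t j) (Hl (N j)) | t. sum t UNIV = 0}" (is "_ = ?C")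
proof
 have "subspace ?C"
 proof (rule subspaceI)
 show "0 : ?C" by (intro CollectI exI[of _ "%_. 0"]) simp
 show "x + y : ?C" if xy: "x : ?C" "y : ?C" for x y
 proof -
 obtain t where "x = (SUM j:UNIV. sc (t j) (Hl (N j)))" "sum t UNIV = 0" using xy(1) by blast
 moreover obtain u where "y = (SUM j:UNIV. sc (u j) (Hl (N j)))" "sum u UNIV = 0" using xy(2) by blast
 ultimately show ?thesis by (intro CollectI exI[of _ "%j. t j + u j"]) (simp add: scale_left_distrib sum.distrib)
 qed
 show "sc a x : ?C" if x: "x : ?C" for x a
 proof -
 obtain t where "x = (SUM j:UNIV. sc (t j) (Hl (N j)))" "sum t UNIV = 0" using x by blast
 thus ?thesis by (intro CollectI exI[of _ "%j. a * t j"]) (simp add: scale_sum_right sum_distrib_left[symmetric])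
 qed
 qed
 moreover have "Hl (sr i) : ?C" if i: "i : pp" for i
 proof -
 have srl: "sr i : levi pp" using i by (auto simp: levi_def lc_sr)
 have "rt (sr i)" using i pp rt_sr by blast
 hence "EX a b. sr i = N a - N b" by (rule roots[OF _ srl])
 then obtain a b where ab: "sr i = N a - N b" by (elim exE)
 have "Hl (sr i) = Hl (N a) - Hl (N b)" using Hl_add[of "N a - N b" "N b"] ab by simp
 also have "... = (SUM j:UNIV. sc ((if j = a then 1 else 0) - (if j = b then 1 else 0)) (Hl (N j)))"
 proof -
 have "(SUM j:UNIV. sc ((if j = a then 1 else 0) - (if j = b then 1 else 0)) (Hl (N j))) =
 (SUM j:UNIV. (if j = a then Hl (N a) else 0) - (if j = b then Hl (N b) else 0))" by (rule sum.cong) (auto simp: scale_left_diff_distrib)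
 thus ?thesis by (simp add: sum_subtractf sum.delta)
 qed
 finally show ?thesis by (intro CollectI exI[of _ "%j. (if j = a then 1 else 0) - (if j = b then 1 else 0)"]) (simp add: sum_subtractf sum.delta)
 qed
 ultimately show "span ((%i. Hl (sr i)) ` pp) <= ?C" by (intro span_minimal) blast
next
 show "?C <= span ((%i. Hl (sr i)) ` pp)"
 proof
 fix x assume "x : ?C"
 then obtain t where t: "x = (SUM j:UNIV. sc (t j) (Hl (N j)))" "sum t UNIV = 0" by blast
 \<comment> \<open>An arbitrary base point: as the coefficients sum to 0, \<open>N z\<close> may be
   subtracted from every \<open>N j\<close>.\<close>
 define z where "z = (undefined :: 'd)"
 have "x = (SUM j:UNIV. sc (t j) (Hl (N j - N z)) + sc (t j) (Hl (N z)))" unfolding t(1)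
 proof (rule sum.cong)
 fix j
 have "Hl (N j) = Hl (N j - N z) + Hl (N z)" using Hl_add[of "N j - N z" "N z"] by simp
 thus "sc (t j) (Hl (N j)) = sc (t j) (Hl (N j - N z)) + sc (t j) (Hl (N z))" by (simp only: scale_right_distrib)
 qed simp
 also have "... = (SUM j:UNIV. sc (t j) (Hl (N j - N z)))" using t(2) by (simp add: sum.distrib scale_sum_left[symmetric])
 also have "... : span ((%i. Hl (sr i)) ` pp)" by (intro span_sum span_scale Hl_lev[OF pp] levi)
 finally show "x : span ((%i. Hl (sr i)) ` pp)" .
 qed
qed

lemma wt_sum_Hl: "wt c (SUM j:UNIV. sc (t j) (Hl (N j))) = (SUM j:UNIV. t j * of_int (ip c (N j)))"
 by (subst wt_h_sum) (simp_all add: h_sca Hl_h wt_h_sca)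

lemma rho_inj:
 assumes x: "x : levd pp" and 0: "rho x = 0"
 shows "x = 0"
proof -
 have xl: "x : PS (levi pp)" using x unfolding levd_def by blast
 have c0: "cf x c = 0" if c: "rt c" for c
 proof (cases "c : levi pp")
 case True
 then obtain a b where ab: "c = N a - N b" using roots c by blast
 hence "a ~= b" using c by (auto simp: rt_def)
 moreover have "rho x $ a $ b = 0" using 0 by simp
 ultimately show ?thesis using c unfolding rho_ent ab by (simp add: eps_def split: if_splits)
 qed (use xl c in "auto simp: PS_def")
 obtain t where t: "hp x = (SUM j:UNIV. sc (t j) (Hl (N j)))" "sum t UNIV = 0" using x unfolding levd_def car_lev by blast
 have "(SUM j:UNIV. t j * of_int (ip (N i) (N j))) = 0" for i
 proof -
 have "rho x $ i $ i = 0" using 0 by simp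
 hence "wt (N i) (hp x) = 0" unfolding rho_ent by simp
 thus ?thesis unfolding t(1) wt_sum_Hl .
 qed
 hence "hp x = 0" unfolding t(1) by (rule nondegenerate[OF t(2)])
 thus ?thesis using hp_cf_eqI[of x 0] c0 by simp
qed

text \<open>The preimage is assembled from a Cartan part and root coordinates. One root may be the
  difference of several pairs of weights, so \<open>cons\<close> makes the corresponding entries of
  \<open>X\<close> agree up to the cocycle.\<close>

lemma rho_sur:
 assumes t: "sum t UNIV = 0" "!!i. X $ i $ i = (SUM j:UNIV. t j * of_int (ip (N i) (N j)))"
 and z: "!!i j. i ~= j ==> ~ rt (N i - N j) ==> X $ i $ j = 0" and cons: "!!a b a' b'. rt (N a - N b) ==> N a - N b = N a' - N b' ==>
 of_int (eps (N a - N b) (N b)) * X $ a $ b = of_int (eps (N a - N b) (N b')) * X $ a' $ b'"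
 shows "EX x:levd pp. rho x = X"
proof -
 define H where "H = (SUM j:UNIV. sc (t j) (Hl (N j)))"
 define ab where "ab c = (SOME p. c = N (fst p) - N (snd p))" for c
 define k where "k c = (if EX a b. c = N a - N b then of_int (eps c (N (snd (ab c)))) * X $ fst (ab c) $ snd (ab c) else 0)" for c
 have kN: "k (N a - N b) = of_int (eps (N a - N b) (N b)) * X $ a $ b" if "rt (N a - N b)" for a b
 proof -
 have e: "N a - N b = N (fst (ab (N a - N b))) - N (snd (ab (N a - N b)))"
 unfolding ab_def by (rule someI_ex[of "%p. N a - N b = N (fst p) - N (snd p)"]) (auto intro: exI[of _ "(a, b)"])
 have "EX a' b'. N a - N b = N a' - N b'" by blast
 hence "k (N a - N b) = of_int (eps (N a - N b) (N (snd (ab (N a - N b))))) * X $ fst (ab (N a - N b)) $ snd (ab (N a - N b))"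
 unfolding k_def by (rule if_P)
 also have "... = of_int (eps (N a - N b) (N b)) * X $ a $ b" by (rule cons[OF that e, symmetric])
 finally show ?thesis .
 qed
 have Hs: "H : span ((%i. Hl (sr i)) ` pp)" unfolding car_lev H_def using t(1) by blast
 have Hh: "H : h" unfolding H_def by (intro h_sum h_sca Hl_h)
 define x where "x = expa H k"
 have x: "hp x = H" "rt c ==> cf x c = k c" for c using hp_cfI[OF Hh x_def] by blast+
 have "x : levd pp" unfolding levd_def PS_def using x Hs levi by (auto simp: k_def)
 moreover have "rho x $ i $ j = X $ i $ j" for i j
 proof (cases "i = j")
 case True
 thus ?thesis unfolding rho_ent x(1) H_def wt_sum_Hl using t(2) by simp
 next
 case False
 show ?thesis
 proof (cases "rt (N i - N j)")
 case True
 thus ?thesis unfolding rho_ent using False x(2)[OF True] kN[OF True] by (simp add: eps_def)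
 qed (simp add: rho_ent False z)
 qed
 ultimately show ?thesis by (auto simp: vec_eq_iff)
qed

end

text \<open>The products 2 and 1 make the differences of the \<open>N a\<close> a root system of
  type A, with the \<open>N a\<close> as the weights of its defining representation up to a common
  shift.\<close>

locale sl_module = e8 sc br h al for sc :: "complex => 'g::ab_group_add => 'g" and br h al +
 fixes pp :: "nat set" and N :: "'d::finite => lat"
 assumes sl_pp: "pp <= {1..8}" and N_ip: "!!a b. ip (N a) (N b) = (if a = b then 2 else 1)"
 and N_levi: "!!i. N i ~: levi pp" "!!a b. N a - N b : levi pp"
 and sl_roots: "!!c. rt c ==> c : levi pp ==> EX a b. c = N a - N b"

sublocale sl_module < w_module sc br h al pp N
proof
 show "pp <= {1..8}" by (rule sl_pp)
 show "rt (N i)" for i using N_ip[of i i] by (simp add: rt_def)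
 show "inj N"
 proof (rule injI)
 fix a b assume "N a = N b"
 thus "a = b" using N_ip[of a b] N_ip[of a a] by (auto split: if_splits)
 qed
 show "N i ~: levi pp" for i by (rule N_levi)
 show "N a - N b : levi pp" for a b by (rule N_levi)
 show "EX a b. c = N a - N b" if "rt c" "c : levi pp" for c by (rule sl_roots[OF that])
 show "c + N j : range N" if c: "rt c" "c : levi pp" "rt (c + N j)" for c j
 proof -
 obtain a b where ab: "c = N a - N b" using sl_roots[OF c(1,2)] by blast
 have "b = j"
 proof (rule ccontr)
 assume "b ~= j"
 moreover have "ip (c + N j) (c + N j) = 2" using c(3) by (simp add: rt_def)
 moreover have "a ~= b" using c(1) ab by (auto simp: rt_def)
 ultimately show False unfolding ab by (auto simp: ip_lin N_ip split: if_splits)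
 qed
 thus ?thesis using ab by simp
 qed
 show "(SUM j:UNIV. sc (t j) (Hl (N j))) = 0" if t: "sum t UNIV = 0" "!!i. (SUM j:UNIV. t j * of_int (ip (N i) (N j))) = 0" for t :: "'d => complex"
 proof -
 have "t i = 0" for i
 proof -
 have "(SUM j:UNIV. t j * of_int (ip (N i) (N j))) = (SUM j:UNIV. t j + (if j = i then t i else 0))" by (rule sum.cong) (auto simp: N_ip)
 thus ?thesis using t by (simp add: sum.distrib sum.delta)
 qed
 thus ?thesis by simp
 qed
qed

context sl_module
begin

lemma sl_sum: "(SUM j:UNIV. t j * of_int (ip (N i) (N j))) = sum t UNIV + t i" for t :: "'d => complex"
proof -
 have "(SUM j:UNIV. t j * of_int (ip (N i) (N j))) = (SUM j:UNIV. t j + (if j = i then t i else 0))" by (rule sum.cong) (auto simp: N_ip)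
 thus ?thesis by (simp add: sum.distrib sum.delta)
qed

lemma rt_dif_N: "(rt (N a - N b)) = (a ~= b)" by (auto simp: rt_def ip_lin N_ip)

theorem rho_iso: "matrix_lie_iso sc br (levd pp) rho sl" unfolding matrix_lie_iso_def
proof (intro conjI ballI allI)
 have PSl: "x : PS (levi pp)" if "x : levd pp" for x using that unfolding levd_def by blast
 show "rho (x + y) = rho x + rho y" for x y by (rule rho_add)
 show "rho (sc c x) = mat c ** rho x" for c x by (rule rho_sca)
 show "rho (br x y) = rho x ** rho y - rho y ** rho x" if "x : levd pp" "y : levd pp" for x y
 by (rule rho_br[OF PSl[OF that(1)] PSl[OF that(2)]])
 show "bij_betw rho (levd pp) sl" unfolding bij_betw_def
 proof
 show "inj_on rho (levd pp)"
 proof (rule inj_onI)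
 fix x y assume xy: "x : levd pp" "y : levd pp" "rho x = rho y"
 have "rho (x - y) + rho y = rho x" using rho_add[of "x - y" y] by simp
 hence "rho (x - y) = 0" using xy(3) by simp
 hence "x - y = 0" using rho_inj subspace_diff[OF lev_der_sub xy(1,2)] by blast
 thus "x = y" by simp
 qed
 show "rho ` levd pp = sl"
 proof (intro equalityI subsetI)
 fix X assume "X : rho ` levd pp"
 then obtain x where x: "x : levd pp" "X = rho x" by blast
 obtain t where t: "hp x = (SUM j:UNIV. sc (t j) (Hl (N j)))" "sum t UNIV = 0" using x(1) unfolding levd_def car_lev by blast
 have "trace (rho x) = (SUM i:UNIV. t i)" using t(2) unfolding trace_def rho_ent t(1) wt_sum_Hl sl_sum by simp
 thus "X : sl" using t(2) x(2) by (simp add: sl_def)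
 next
 fix X :: "complex ^ 'd ^ 'd" assume "X : sl"
 hence tr: "sum (%j. X $ j $ j) UNIV = 0" by (simp add: sl_def trace_def)
 have "EX x:levd pp. rho x = X"
 proof (rule rho_sur[OF tr])
 show "X $ i $ i = (SUM j:UNIV. X $ j $ j * of_int (ip (N i) (N j)))" for i unfolding sl_sum[of "%j. X $ j $ j"] tr by simp
 show "X $ i $ j = 0" if "i ~= j" "~ rt (N i - N j)" for i j using that rt_dif_N by blast
 fix a b a' b' assume r: "rt (N a - N b)" and e: "N a - N b = N a' - N b'"
 have "ip (N a - N b) (N a' - N b') = 2" using r unfolding e rt_def .
 hence "a = a' & b = b'" using r unfolding rt_dif_N by (auto simp: ip_lin N_ip split: if_splits)
 thus "of_int (eps (N a - N b) (N b)) * X $ a $ b = of_int (eps (N a - N b) (N b')) * X $ a' $ b'" by simp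
 qed
 thus "X : rho ` levd pp" by blast
 qed
 qed
qed

end

section \<open>Splitting a trivial line off the defining module\<close>

lemma mat_dis:
 fixes A :: "complex ^ 'b ^ 'a" and C :: "complex ^ 'c ^ 'b"
 shows "A ** (B - B') = A ** B - A ** B'" "(A - A') ** C = A ** C - A' ** C" "(A + A') ** C = A ** C + A' ** C"
 by (simp_all add: vec_eq_iff matrix_matrix_mult_def right_diff_distrib left_diff_distrib distrib_right sum_subtractf sum.distrib)

lemma bij_sum_opt:
 fixes g :: "'e::finite option => 'd::finite" and f :: "'d => complex"
 assumes "bij g" shows "(SUM d:UNIV. f d) = f (g None) + (SUM e:UNIV. f (g (Some e)))"
proof -
 have "(SUM d:UNIV. f d) = (SUM e:UNIV. f (g e))" using sum.reindex_bij_betw[OF assms, of f] by simp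
 also have "... = f (g None) + (SUM e:Some ` UNIV. f (g e))" unfolding UNIV_option_conv by (subst sum.insert) auto
 also have "(SUM e:Some ` UNIV. f (g e)) = (SUM e:UNIV. f (g (Some e)))" by (subst sum.reindex) auto
 finally show ?thesis .
qed

text \<open>The index \<open>g None\<close> carries the trivial line, and \<open>incl g s\<close>
  embeds the complement. The factors \<open>s e\<close> will be signs that bring an invariant form
  into a prescribed shape.\<close>

definition incl :: "('e::finite option => 'd::finite) => ('e => complex) => complex ^ 'e ^ 'd" where
 "incl g s = (\<chi> i e. if i = g (Some e) then s e else 0)"

context
 fixes g :: "'e::finite option => 'd::finite" and s :: "'e => complex"
 assumes g: "bij g" and s: "!!e. s e * s e = 1"
begin

lemma g_eq: "(g a = g b) = (a = b)" using bij_is_inj[OF g] by (auto dest: injD)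

lemma g_cas: obtains "i = g None" | e where "i = g (Some e)"
proof -
 obtain a where "i = g a" using bij_is_surj[OF g] by (elim surjE)
 thus ?thesis using that by (cases a) auto
qed

lemma inc_lef: "(transpose (incl g s) ** X) $ e $ j = s e * X $ g (Some e) $ j"
 by (simp add: matrix_matrix_mult_def transpose_def incl_def if_distrib[of "%t. t * _"] cong: if_cong)

lemma inc_rig: "(X ** incl g s) $ i $ e = X $ i $ g (Some e) * s e"
 by (simp add: matrix_matrix_mult_def incl_def if_distrib[of "%t. _ * t"] cong: if_cong)

lemma inc_iso: "transpose (incl g s) ** incl g s = mat 1" by (simp add: vec_eq_iff inc_lef mat_def) (auto simp: incl_def g_eq s)

lemma inc_vec: "(incl g s *v v) $ g None = 0" "(incl g s *v v) $ g (Some e) = s e * v $ e"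
 by (simp_all add: matrix_vector_mult_def incl_def g_eq if_distrib[of "%t. t * _"] cong: if_cong)

lemma inc_mul:
 "(incl g s ** Y) $ g None $ j = 0" "(incl g s ** Y) $ g (Some e) $ j = s e * Y $ e $ j"
 by (simp_all add: matrix_matrix_mult_def incl_def g_eq if_distrib[of "%t. t * _"] cong: if_cong)

lemma inc_pro:
 fixes X :: "complex ^ 'k ^ 'd"
 assumes "!!j. X $ g None $ j = 0" shows "incl g s ** (transpose (incl g s) ** X) = X"
proof -
 have "(incl g s ** (transpose (incl g s) ** X)) $ i $ j = X $ i $ j" for i j
 proof (cases rule: g_cas[of i])
 case 1
 thus ?thesis using assms by (simp add: inc_mul)
 next
 case (2 e)
 thus ?thesis using s[of e] by (simp add: inc_mul inc_lef mult.assoc[symmetric])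
 qed
 thus ?thesis by (simp add: vec_eq_iff)
qed

lemma inc_bij: "bij (%(w, c). incl g s *v w + c *s axis (g None) 1)"
proof (rule bij_betw_byWitness[where f' = "%u. (\<chi> e. s e * u $ g (Some e), u $ g None)"])
 show "ALL a:UNIV. (\<chi> e. s e * (case a of (w, c) => incl g s *v w + c *s axis (g None) 1) $ g (Some e),
 (case a of (w, c) => incl g s *v w + c *s axis (g None) 1) $ g None) = a"
 using s by (auto simp: inc_vec axis_def g_eq vec_eq_iff mult.assoc[symmetric])
 show "ALL a':UNIV. (case (\<chi> e. s e * a' $ g (Some e), a' $ g None) of (w, c) => incl g s *v w + c *s axis (g None) 1) = a'"
 proof
 fix u
 have "(incl g s *v (\<chi> e. s e * u $ g (Some e)) + u $ g None *s axis (g None) 1) $ i = u $ i" for i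
 proof (cases rule: g_cas[of i])
 case 1
 thus ?thesis by (simp add: inc_vec axis_def)
 next
 case (2 e)
 thus ?thesis using s[of e] by (simp add: inc_vec axis_def g_eq mult.assoc[symmetric])
 qed
 thus "(case (\<chi> e. s e * u $ g (Some e), u $ g None) of (w, c) => incl g s *v w + c *s axis (g None) 1) = u" by (simp add: vec_eq_iff)
 qed
qed auto

end

context e8
begin

abbreviation embeds :: "nat set => (complex ^ 'd ^ 'd) set => (complex ^ 'e ^ 'e) set =>
 (complex ^ 'n => complex ^ 'n) set => ('g => complex ^ 'n => complex ^ 'n) => bool" where
 "embeds pp D T Q ph \<equiv> quasi_reductive sc (parab pp) Q ph &
 (EX M. maximal_reductive_stabiliser_algebra sc br (parab pp) Q ph M &
 embedded_as_natural_plus_trivial sc br M (slevi pp) D T)"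

text \<open>The common end of all five cases. Row and column \<open>g None\<close> vanish on the
  stabiliser, so compression by \<open>incl g s\<close> is a faithful representation and the
  complement a submodule, as \<open>red_typ\<close> needs. The form is of nilpotent type because the
  stabiliser lies in the Levi subalgebra and no root of \<open>S\<close> does.\<close>

theorem emb_cas:
 fixes ro :: "'g => complex ^ 'd ^ 'd" and g :: "'e::finite option => 'd::finite" and s :: "'e => complex"
 and w :: "complex ^ 'd => 'g" and Q :: "(complex ^ 'n => complex ^ 'n) set"
 assumes pp: "pp <= {1..8}" and mask: "{c. pos_on m c} = para pp" and S: "form_data m S 0"
 and Sl: "!!b. b : set S ==> b ~: levi pp" and ro: "matrix_lie_iso sc br (levd pp) ro D"
 and w: "!!v. w v : PS (para pp)" "!!v. w v = 0 ==> v = 0"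
 "!!x v. x : levd pp ==> br x (w v) = w (ro x *v v)"
 and g: "bij g" and s: "!!e. s e * s e = 1" and M: "fstab m S 0 <= levd pp"
 "!!x j. x : fstab m S 0 ==> ro x $ g None $ j = 0" "!!x j. x : fstab m S 0 ==> ro x $ j $ g None = 0"
 and T: "(%x. transpose (incl g s) ** ro x ** incl g s) ` fstab m S 0 = T"
 "!!X. X : T ==> adjm X : T"
 and Q: "has_lie_algebra sc br (parab pp) Q ph"
 shows "embeds pp D T Q ph"
proof -
 let ?q = "PS (para pp)" and ?M = "fstab m S 0" and ?P = "incl g s"
 define tt where "tt x = transpose ?P ** ro x ** ?P" for x
 define ga where "ga = restrict (cform S 0) ?q"
 have qe: "parab pp = ?q" by (rule sta_par_eq[OF pp])
 have Qq: "has_lie_algebra sc br ?q Q ph" using Q unfolding qe .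
 have cl: "closed_roots (para pp)" by (rule clo_par)
 obtain B where B: "finite B" "span B = UNIV" using fin_dim by blast
 interpret G: lie_group sc br ?q Q ph by unfold_locales (use PS_sub[OF cl] B Qq in auto)
 have ga: "ga : dual_space sc ?q" "lie_stabiliser br ?q ga = ?M"
 using res_cfo[OF S] unfolding mask ga_def by blast+
 have roi: "bij_betw ro (levd pp) D" and roa: "!!x y. x : ?M ==> y : ?M ==> ro (x + y) = ro x + ro y"
 and ros: "!!c x. x : ?M ==> ro (sc c x) = mat c ** ro x"
 and rob: "!!x y. x : ?M ==> y : ?M ==> ro (br x y) = ro x ** ro y - ro y ** ro x"
 using ro M(1) unfolding matrix_lie_iso_def by blast+
 have subM: "subspace ?M"
 proof -
 have rt: "!!b. b : set S ==> rt b" using S by (auto simp: form_data_def list_all_iff rt_def)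
 have z: "cform S 0 0 = 0" using cfo_lin(2)[OF rt, of S 0 0 0] by simp
 show ?thesis unfolding fstab_def by (rule subspaceI)
 (use z cfo_lin[OF rt] subspace_add[OF PS_subs] subspace_scale[OF PS_subs] subspace_0[OF PS_subs] in
 \<open>auto simp: br_zer_lef br_add_left br_scale_left\<close>)
 qed
 have Ptt: "ro x ** ?P = ?P ** tt x" if x: "x : ?M" for x
 proof -
 have "(ro x ** ?P) $ g None $ j = 0" for j using M(2)[OF x] by (simp add: inc_rig[OF g s])
 hence "?P ** (transpose ?P ** (ro x ** ?P)) = ro x ** ?P" by (rule inc_pro[OF g s])
 thus ?thesis unfolding tt_def by (simp add: matrix_mul_assoc)
 qed
 have tte: "tt x $ e $ f = s e * ro x $ g (Some e) $ g (Some f) * s f" for x e f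
 unfolding tt_def inc_rig[OF g s] inc_lef[OF g s] ..
 have ttbr: "tt (br x y) = tt x ** tt y - tt y ** tt x" if xy: "x : ?M" "y : ?M" for x y
 proof -
 have m: "tt x ** tt y = transpose ?P ** (ro x ** ro y) ** ?P" if "x : ?M" "y : ?M" for x y
 proof -
 have "tt x ** tt y = transpose ?P ** (ro x ** ?P) ** tt y" by (simp add: tt_def matrix_mul_assoc)
 also have "... = transpose ?P ** ro x ** (?P ** tt y)" by (simp add: matrix_mul_assoc)
 also have "... = transpose ?P ** (ro x ** ro y) ** ?P" unfolding Ptt[OF that(2), symmetric] by (simp add: matrix_mul_assoc)
 finally show ?thesis .
 qed
 show ?thesis unfolding m[OF xy] m[OF xy(2,1)] tt_def[of "br x y"] rob[OF xy] by (simp only: mat_dis)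
 qed
 have tta: "tt (x + y) = tt x + tt y" if "x : ?M" "y : ?M" for x y
 unfolding tt_def roa[OF that] by (simp only: matrix_add_ldistrib mat_dis)
 have tts: "tt (sc c x) = mat c ** tt x" if "x : ?M" for c x
 proof -
 have m: "(mat c ** X) $ i $ j = c * X $ i $ j" for X :: "complex ^ 'a ^ 'b" and i j
 by (simp add: matrix_matrix_mult_def mat_def if_distrib[of "%t. t * _"] sum.delta cong: if_cong)
 show ?thesis by (simp add: vec_eq_iff m tte ros[OF that])
 qed
 have tt0: "x = 0" if x: "x : ?M" "tt x = 0" for x
 proof -
 have "ro x $ i $ j = 0" for i j
 proof (cases rule: g_cas[OF g s, of i])
 case 1
 thus ?thesis using M(2)[OF x(1)] by simp
 next
 case (2 e)
 show ?thesis
 proof (cases rule: g_cas[OF g s, of j])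
 case 1
 thus ?thesis using M(3)[OF x(1)] by simp
 next
 case (2 f)
 have "s e ~= 0" "s f ~= 0" using s[of e] s[of f] by auto
 moreover have "tt x $ e $ f = 0" using x(2) by simp
 ultimately show ?thesis unfolding tte \<open>i = g (Some e)\<close> 2 by simp
 qed
 qed
 hence "ro x = ro 0" using ros[OF x(1), of 0] by (simp add: vec_eq_iff mat_def matrix_matrix_mult_def)
 moreover have "0 : levd pp" by (rule subspace_0[OF lev_der_sub])
 ultimately show ?thesis using roi M(1) x(1) unfolding bij_betw_def inj_on_def by blast
 qed
 have npos_para: "c : para pp" if "npos c" for c using that by (auto simp: npos_def para_def)
 have inner: "EX z:?q. ALL x:?q. D x = br z x"
 if "linear_on sc sc ?q D" "!!x. x : ?q ==> D x : ?q" "!!x y. x : ?q ==> y : ?q ==> D (br x y) = br (D x) y + br x (D y)" for D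
 by (rule PS_inn_der[OF cl npos_para that])
 have red: "reductive_type sc ?q Q ph ga"
 proof (rule G.red_typ[OF ga(1) ga(2)[symmetric] inner tt0 ttbr, where w = "%v. w (?P *v v)"])
 show "EX y:?M. tt y = adjm (tt x)" if x: "x : ?M" for x
 proof -
 have "tt x : T" using x T(1) unfolding tt_def by blast
 hence "adjm (tt x) : tt ` ?M" using T unfolding tt_def by blast
 thus ?thesis by force
 qed
 show "w (?P *v v) : ?q" for v by (rule w(1))
 show "v = 0" if "w (?P *v v) = 0" for v
 proof -
 have "transpose ?P *v (?P *v v) = 0" using w(2)[OF that] by simp
 thus ?thesis by (simp add: matrix_vector_mul_assoc inc_iso[OF g s])
 qed
 show "br x (w (?P *v v)) = w (?P *v (tt x *v v))" if "x : ?M" for x v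
 using w(3) M(1) that Ptt[OF that] by (metis matrix_vector_mul_assoc subsetD)
 qed
 have nil: "nilpotent_type br ?q ga"
 proof -
 have "ga x = 0" if x: "x : ?M" for x
 proof -
 have "x : PS (levi pp)" using M(1) x unfolding levd_def by blast
 moreover have "!!b. b : set S ==> rt b" using S by (auto simp: form_data_def list_all_iff rt_def)
 ultimately have "cf x b = 0" if "b : set S" for b using Sl that by (auto simp: PS_def)
 moreover have "wt 0 (hp x) = 0" using wt_add[of 0 0] by simp
 ultimately have "cform S 0 x = 0" by (simp add: cform_def cong: map_cong)
 moreover have "x : ?q" using x unfolding fstab_def mask by blast
 ultimately show ?thesis unfolding ga_def by simp
 qed
 thus ?thesis unfolding nilpotent_type_def ga(2) by blast
 qed
 have quasi: "quasi_reductive sc ?q Q ph" unfolding quasi_reductive_def using ga(1) red by blast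
 have "diagonalisable (*s) X" if "X : group_lie_algebra (group_centre Q)" for X
 by (rule G.cen_lie_alg[OF _ that]) (rule PS_cen[of "para pp"], use npos_para in auto)
 hence "strongly_quasi_reductive sc ?q Q ph" unfolding strongly_quasi_reductive_def using quasi by blast
 hence max: "maximal_reductive_stabiliser_algebra sc br ?q Q ph ?M"
 unfolding maximal_reductive_stabiliser_algebra_def using ga red nil by blast
 have iso: "matrix_lie_iso sc br ?M tt T" unfolding matrix_lie_iso_def bij_betw_def
 proof (intro conjI ballI allI)
 show "inj_on tt ?M"
 proof (rule inj_onI)
 fix x y assume xy: "x : ?M" "y : ?M" "tt x = tt y"
 have d: "x - y : ?M" by (rule subspace_diff[OF subM xy(1,2)])
 have "tt (x - y) + tt y = tt x" using tta[OF d xy(2)] by simp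
 hence "x - y = 0" using tt0[OF d] xy(3) by simp
 thus "x = y" by simp
 qed
 show "tt ` ?M = T" using T(1) unfolding tt_def .
 qed (use tta tts ttbr in auto)
 have restr: "restricts_to_sum_with_trivial ?M ro tt" unfolding restricts_to_sum_with_trivial_def
 proof (intro exI conjI ballI)
 show "bij (%(w, c). ?P *v w + c *s axis (g None) 1)" by (rule inc_bij[OF g s])
 fix x assume x: "x : ?M"
 show "ro x ** ?P = ?P ** tt x" by (rule Ptt[OF x])
 show "ro x *v axis (g None) 1 = 0"
 using M(3)[OF x] by (simp add: vec_eq_iff matrix_vector_mult_def axis_def if_distrib[of "%t. _ * t"] sum.delta cong: if_cong)
 qed
 have "embedded_as_natural_plus_trivial sc br ?M (slevi pp) D T"
 unfolding embedded_as_natural_plus_trivial_def sta_lev_eq[OF pp] der_lev_eq[OF pp] using M(1) ro iso restr by blast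
 thus ?thesis unfolding qe using quasi max by blast
qed

end

section \<open>Symplectic stabilisers\<close>

text \<open>The weight \<open>th\<close> carries the trivial line. The other weights are paired by
  \<open>p\<close>, each pair summing to \<open>th + th'\<close> plus a root \<open>B e\<close> of
  \<open>S\<close>; this turns the equations of the stabiliser into invariance of a skew form.
  \<open>m'\<close> cuts out Levi roots that do not connect \<open>th\<close> with the other
  weights.\<close>

locale sp_data = sl_module sc br h al pp N
 for sc :: "complex => 'g::ab_group_add => 'g" and br h al pp and N :: "'d::finite => lat" +
 fixes g :: "'e::finite option => 'd" and p :: "'e => 'e" and B :: "'e => lat" and th th' m m' :: lat and S R :: "lat list"
 assumes g: "bij g" and p: "!!e. p (p e) = e" "!!e. p e ~= e" and mask: "{c. pos_on m c} = para pp"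
 and mask': "!!c. zero_on m' c ==> c : levi pp" "!!e. ~ zero_on m' (N (g (Some e)) - N (g None))"
 "!!e. ~ zero_on m' (N (g None) - N (g (Some e)))"
 and S: "form_data m S 0" "!!b. b : set S ==> b ~: levi pp" and R: "orth_basis (S @ R)" "set R <= levi pp"
 and th: "N (g None) = th" "th : set S" "th' : set S" "th ~= th'" and B: "!!e. B e : set S" "!!e. B e ~= th" "!!e. B e ~= th'"
 and pair: "!!e. N (g (Some e)) + N (g (Some (p e))) = th + th' + B e"
 and orth: "!!b e f. b : set S ==> b ~: range B ==> ip b (N (g (Some e))) = ip b (N (g (Some f)))"
 and zero: "!!x c. x : fstab m S 0 ==> rt c ==> ~ zero_on m' c ==> cf x c = 0"
begin

abbreviation n :: "'e => lat" where "n e \<equiv> N (g (Some e))"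

text \<open>The entry of the preserved skew form in row \<open>e\<close> and column
  \<open>p e\<close>, a product of cocycle values for which \<open>min_sig\<close> holds.\<close>

definition w :: "'e => complex" where
 "w e = of_int (eps (n e) (n e + n (p e))) * of_int (eps (B e) (th + th'))"

lemma S_rt: "b : set S ==> rt b" and S_pos: "b : set S ==> pos_on m b" and S_dis: "distinct S"
 using S(1) by (auto simp: form_data_def list_all_iff rt_def)

lemma S_prod: "b : set S ==> b' : set S ==> ip b b' = (if b = b' then 2 else 0)" using S(1) unfolding form_data_def list_all_iff by auto

lemma g_inj: "(g a = g b) = (a = b)" using bij_is_inj[OF g] by (auto dest: injD)

lemma ip_n: "ip (n e) (n f) = (if e = f then 2 else 1)" and ip_th: "ip th (n e) = 1"
 using N_ip[of "g None" "g (Some e)"] by (simp_all add: N_ip g_inj th(1)[symmetric])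

lemma B_p: "B (p e) = B e"
proof -
 have "th + th' + B (p e) = th + th' + B e" using pair[of e] pair[of "p e"] p(1)[of e] by (simp add: add.commute)
 thus ?thesis by simp
qed

lemma B_not: "th ~: range B" "th' ~: range B" using B(2,3) by (metis imageE)+

lemma ip_th': "ip th' (n e) = 1"
proof -
 have "ip th' (n e + n (p e)) = 2" unfolding pair using S_prod[OF th(3)] th B[of e] by (simp add: ip_lin)
 thus ?thesis using orth[OF th(3) B_not(2), of e "p e"] by (simp add: ip_lin)
qed

lemma B_eq: "B e = n e + n (p e) - th - th'" using pair[of e] by (simp add: algebra_simps)

lemma ip_B: "ip (B i) (n b) = (if b = i | b = p i then 1 else 0)" unfolding B_eq using p(2)[of i] by (auto simp: ip_lin ip_n ip_th ip_th')

lemma B_cla: "(B i = B j) = (j = i | j = p i)"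
proof
 assume "B i = B j"
 thus "j = i | j = p i" using ip_B[of i j] ip_B[of j j] by (auto split: if_splits)
qed (auto simp: B_p)

lemma ip_ext: "ip b (n e) + ip b (n f) = ip b th + ip b th'" if "b : set S" "b ~: range B"
proof -
 have "ip b (n e + n (p e)) = ip b th + ip b th'" unfolding pair using S_prod[OF that(1) B(1)[of e]] that(2) by (auto simp: ip_lin)
 thus ?thesis using orth[OF that, of e "p e"] orth[OF that, of e f] by (simp add: ip_lin)
qed

lemma w_sq: "w e * w e = 1" by (simp add: w_def eps_def)

text \<open>\<open>n e + n (p e)\<close> has norm 6, so \<open>fm\<close> takes the odd value 3 on
  it; this parity makes the form alternating.\<close>

lemma w_skew: "w (p e) = - w e"
proof -
 have "ip (n e + n (p e)) (n e + n (p e)) = 6" using p(2)[of e] by (simp add: ip_lin ip_n)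
 hence "fm (n e + n (p e)) (n e + n (p e)) = 3" using fm_sel[of "n e + n (p e)"] by simp
 hence "odd (fm (n e) (n e + n (p e)) + fm (n (p e)) (n e + n (p e)))" by (simp add: fm_add_lef)
 thus ?thesis unfolding w_def p(1) B_p by (auto simp: eps_def add.commute)
qed

text \<open>For \<open>b\<close> other than \<open>j\<close> and \<open>p j\<close>, the root whose
  equation is entry \<open>b\<close>, \<open>j\<close> of the invariance condition: within
  \<open>S\<close> only \<open>B j\<close> and \<open>B b\<close> have product 1 with it, and
  subtracting it from them leaves differences of weights.\<close>

definition nu :: "'e => 'e => lat" where "nu b j = n b + n j - th - th'"

lemma nu_B: "B j - nu b j = n (p j) - n b" and nu_B': "B b - nu b j = n (p b) - n j" unfolding nu_def B_eq by (simp_all add: algebra_simps)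

lemma ip_nu:
 assumes "b ~= j" "b ~= p j" "c : set S"
 shows "ip c (nu b j) = (if c = B j | c = B b then 1 else 0)"
proof (cases "c : range B")
 case True
 then obtain i where i: "c = B i" by blast
 have "ip (B i) th = 0" "ip (B i) th' = 0" using S_prod[OF B(1) th(2)] S_prod[OF B(1) th(3)] B(2,3) by auto
 hence "ip c (nu b j) = (if B i = B b then 1 else 0) + (if B i = B j then 1 else 0)" unfolding nu_def i by (simp add: ip_lin ip_B B_cla)
 moreover have "B b ~= B j" using assms(1,2) p(1)[of b] unfolding B_cla by auto
 ultimately show ?thesis using i by auto
next
 case False
 have "ip c (nu b j) = 0" using ip_ext[OF assms(3) False, of b j] by (simp add: nu_def ip_lin)
 thus ?thesis using False by auto
qed

lemma nu_roo:
 assumes "b ~= j" "b ~= p j" shows "rt (nu b j)" "pos_on m (nu b j)" "nu b j ~: set S"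
proof -
 show "rt (nu b j)"
 using assms S_prod[OF th(2,3)] S_prod[OF th(2,2)] S_prod[OF th(3,3)] S_prod[OF th(3,2)] th(4) ip_sym[of "n _" th] ip_sym[of "n _" th']
 by (simp add: rt_def nu_def ip_lin ip_n ip_th ip_th')
 have "B j : para pp" "n (p j) - n b : levi pp" using S_pos[OF B(1)] mask N_levi(2) by auto
 hence "B j - (n (p j) - n b) : para pp" by (auto simp: para_def levi_def)
 moreover have "B j - (n (p j) - n b) = nu b j" using nu_B[of j b] by (simp add: algebra_simps)
 ultimately show "pos_on m (nu b j)" using mask by auto
 show "nu b j ~: set S"
 proof
 assume "nu b j : set S"
 thus False using S_prod[OF B(1), of "nu b j" j] ip_nu[OF assms B(1)[of j]] by (auto split: if_splits)
 qed
qed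

lemma min_sum:
 assumes "b ~= j" "b ~= p j"
 shows "(SUM c<-S. if ip c (nu b j) = 1 then of_int (eps (c - nu b j) (nu b j)) * cf x (c - nu b j) else 0) =
 of_int (eps (n (p j) - n b) (nu b j)) * cf x (n (p j) - n b) + of_int (eps (n (p b) - n j) (nu b j)) * cf x (n (p b) - n j)"
proof -
 let ?f = "%c. of_int (eps (c - nu b j) (nu b j)) * cf x (c - nu b j)"
 have "B b ~= B j" using assms p(1)[of b] unfolding B_cla by auto
 have "(SUM c<-S. if ip c (nu b j) = 1 then ?f c else 0) = (SUM c:set S. if ip c (nu b j) = 1 then ?f c else 0)"
 using S_dis by (rule sum_list_distinct_conv_sum_set)
 also have "... = (SUM c:{B j, B b}. ?f c)" using B(1) ip_nu[OF assms] by (intro sum.mono_neutral_cong_right) auto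
 also have "... = ?f (B j) + ?f (B b)" using \<open>B b ~= B j\<close> by simp
 finally show ?thesis unfolding nu_B nu_B' .
qed

text \<open>Modulo 2 all terms with \<open>th\<close> and \<open>th'\<close> cancel, and four odd
  numbers remain: the products of \<open>n b\<close> with \<open>n j\<close> and
  \<open>n (p b)\<close>, and the values of \<open>fm\<close> on \<open>n b\<close> and on
  \<open>n (p j)\<close>.\<close>

lemma min_sig:
 assumes "b ~= j" "b ~= p j"
 shows "of_int (eps (n (p j) - n b) (nu b j)) * of_int (eps (n (p j) - n b) (n b)) * w (p j) =
 of_int (eps (n (p b) - n j) (nu b j)) * of_int (eps (n (p b) - n j) (n j)) * w b"
proof -
 let ?s = "%k::int. if even k then 1 else - 1 :: complex"
 have sm: "?s a * ?s b = ?s (a + b)" for a b by auto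
 have "fm (n b) (n j) + fm (n j) (n b) = 1" "fm (n (p j)) (n (p j)) = 1" "fm (n j) (n j) = 1" "fm (n b) (n b) = 1"
 "fm (n b) (n (p b)) + fm (n (p b)) (n b) = 1"
 using assms ip_n[of b j] ip_n[of j j] ip_n[of b b] ip_n[of "p j" "p j"] ip_n[of b "p b"] p(2)[of b] by (auto simp: ip_def)
 hence "odd (fm (n b) (n j) + fm (n j) (n b))" "odd (fm (n (p j)) (n (p j)))" "odd (fm (n j) (n j))" "odd (fm (n b) (n b))"
 "odd (fm (n b) (n (p b)) + fm (n (p b)) (n b))" by presburger+
 hence "even (fm (n (p j) - n b) (nu b j) + fm (n (p j) - n b) (n b) + (fm (n (p j)) (n (p j) + n j) + fm (B j) (th + th')) +
 (fm (n (p b) - n j) (nu b j) + fm (n (p b) - n j) (n j) + (fm (n b) (n b + n (p b)) + fm (B b) (th + th'))))"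
 unfolding nu_def B_eq fm_add_lef fm_add_rig fm_dif_lef fm_dif_rig even_add even_diff by argo
 hence "?s (fm (n (p j) - n b) (nu b j) + fm (n (p j) - n b) (n b) + (fm (n (p j)) (n (p j) + n j) + fm (B j) (th + th'))) =
 ?s (fm (n (p b) - n j) (nu b j) + fm (n (p b) - n j) (n j) + (fm (n b) (n b + n (p b)) + fm (B b) (th + th')))"
 unfolding even_add by (simp only:)
 thus ?thesis unfolding w_def p(1) B_p eps_par sm .
qed

lemma rho_n: "rho x $ g (Some i) $ g (Some j) =
 (if i = j then wt (n i) (hp x) else of_int (eps (n i - n j) (n j)) * cf x (n i - n j))" unfolding rho_ent by (simp add: g_inj rt_dif_N)

definition preserves :: "'g => bool" where
 "preserves x = ((ALL b j. rho x $ g (Some (p j)) $ g (Some b) * w (p j) + w b * rho x $ g (Some (p b)) $ g (Some j) = 0))"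

lemma min_rho:
 assumes "b ~= j" "b ~= p j"
 shows "(SUM c<-S. if ip c (nu b j) = 1 then of_int (eps (c - nu b j) (nu b j)) * cf x (c - nu b j) else 0) =
 of_int (eps (n (p j) - n b) (nu b j)) * of_int (eps (n (p j) - n b) (n b)) * w (p j) *
 (rho x $ g (Some (p j)) $ g (Some b) * w (p j) + w b * rho x $ g (Some (p b)) $ g (Some j))"
 (is "_ = ?e * ?e1 * w (p j) * _")
proof -
 let ?f = "of_int (eps (n (p b) - n j) (nu b j)) :: complex" and ?f1 = "of_int (eps (n (p b) - n j) (n j)) :: complex"
 have ne: "p j ~= b" "p b ~= j" using assms p(1)[of b] by auto
 have sq: "?e1 * ?e1 = 1" "?f1 * ?f1 = 1" "w (p j) * w (p j) = 1" "w b * w b = 1" by (simp_all add: eps_def w_sq)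
 have "?e * ?e1 * w (p j) * (?e1 * cf x (n (p j) - n b) * w (p j) + w b * (?f1 * cf x (n (p b) - n j))) =
 ?e * cf x (n (p j) - n b) + (?e * ?e1 * w (p j)) * w b * ?f1 * cf x (n (p b) - n j)"
 using sq by algebra
 also have "... = ?e * cf x (n (p j) - n b) + ?f * cf x (n (p b) - n j)" unfolding min_sig[OF assms] using sq by algebra
 finally show ?thesis unfolding min_sum[OF assms] rho_n using ne by simp
qed

lemma fst_lev:
 assumes x: "x : fstab m S 0" shows "x : levd pp"
proof -
 have "x : PS (levi pp)" using zero[OF x] mask'(1) by (auto simp: PS_def)
 moreover have "hp x : {H : h. ALL b:set S. wt b H = 0}" using fst_hp[OF S(1) x] by simp
 hence "hp x : span (Hl ` set R)" unfolding anni(1)[OF R(1)] .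
 moreover have "span (Hl ` set R) <= span ((%i. Hl (sr i)) ` pp)" using R(2) Hl_lev[OF sl_pp] by (intro span_minimal) auto
 ultimately show ?thesis unfolding levd_def by blast
qed

lemma fst_row:
 assumes x: "x : fstab m S 0" shows "rho x $ g None $ j = 0" "rho x $ j $ g None = 0"
proof -
 have d: "rho x $ g None $ g None = 0" unfolding rho_ent using fst_hp[OF S(1) x th(2)] th(1) by simp
 show "rho x $ g None $ j = 0"
 proof (cases rule: g_cas[OF g, of "%_. 1" j])
 case 3
 thus ?thesis using zero[OF x, of "N (g None) - N j"] mask'(3) by (auto simp: rho_ent g_inj)
 qed (use d in simp_all)
 show "rho x $ j $ g None = 0"
 proof (cases rule: g_cas[OF g, of "%_. 1" j])
 case 3
 thus ?thesis using zero[OF x, of "N j - N (g None)"] mask'(2) by (auto simp: rho_ent g_inj)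
 qed (use d in simp_all)
qed

lemma fst_pre:
 assumes x: "x : fstab m S 0" shows "preserves x" unfolding preserves_def
proof (intro allI)
 fix b j
 interpret F: e8_stabiliser sc br h al m S 0 x by (rule e8_sta[OF S(1) x])
 \<comment> \<open>The case \<open>b = j\<close> is the skewness of \<open>w\<close>;
   \<open>b = p j\<close> concerns the Cartan part, on which \<open>S\<close> vanishes; the other
   entries are the equations at \<open>nu b j\<close>.\<close>
 consider "b = j" | "b ~= j" "b = p j" | "b ~= j" "b ~= p j" by blast
 thus "rho x $ g (Some (p j)) $ g (Some b) * w (p j) + w b * rho x $ g (Some (p b)) $ g (Some j) = 0"
 proof cases
 case 1
 thus ?thesis using w_skew[of j] by (simp add: mult.commute)
 next
 case 2
 have "wt (n j + n (p j)) (hp x) = 0" unfolding pair using fst_hp[OF S(1) x] th B(1) by (simp add: wt_add)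
 hence "wt (n j) (hp x) + wt (n (p j)) (hp x) = 0" by (simp add: wt_add)
 thus ?thesis unfolding 2(2) p(1) rho_n by (simp add: mult.commute distrib_left[symmetric] add.commute)
 next
 case 3
 have "(SUM c<-S. if ip c (nu b j) = 1 then of_int (eps (c - nu b j) (nu b j)) * cf x (c - nu b j) else 0) = 0"
 using F.equa[OF nu_roo[OF 3]] by simp
 moreover have "w (p j) ~= 0" using w_sq[of "p j"] by auto
 moreover have "eps a c ~= 0" for a c by (simp add: eps_def)
 ultimately show ?thesis unfolding min_rho[OF 3] by simp
 qed
qed

lemma fstabI:
 assumes x: "x : levd pp" and row: "!!j. rho x $ g None $ j = 0" "!!j. rho x $ j $ g None = 0" and pr: "preserves x"
 shows "x : fstab m S 0"
proof -
 have xl: "x : PS (levi pp)" using x unfolding levd_def by blast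
 have "levi pp <= para pp" by (auto simp: levi_def para_def)
 hence xq: "x : PS {c. pos_on m c}" using xl unfolding mask by (auto simp: PS_def)
 have xS: "cf x b = 0" if "b : set S" for b using xl S(2)[OF that] S_rt[OF that] by (auto simp: PS_def)
 obtain t where t: "hp x = (SUM j:UNIV. sc (t j) (Hl (N j)))" "sum t UNIV = 0" using x unfolding levd_def car_lev by blast
 have tN: "wt (N i) (hp x) = t i" for i unfolding t(1) wt_sum_Hl sl_sum using t(2) by simp
 have t0: "t (g None) = 0" using row(1)[of "g None"] unfolding rho_ent tN by simp
 have S0: "wt b (hp x) = 0" if b: "b : set S" for b
 proof (cases "b : range B")
 case True
 then obtain e where e: "b = B e" by blast
 have "rho x $ g (Some (p e)) $ g (Some (p e)) * w (p e) + w (p e) * rho x $ g (Some (p (p e))) $ g (Some e) = 0"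
 using pr unfolding preserves_def by blast
 hence "w (p e) * (wt (n e) (hp x) + wt (n (p e)) (hp x)) = 0" unfolding p(1) rho_n by (simp add: distrib_left mult.commute add.commute)
 hence "wt (n e) (hp x) + wt (n (p e)) (hp x) = 0" using w_sq[of "p e"] by auto
 hence "wt (th + th' + B e) (hp x) = 0" unfolding pair[symmetric] by (simp add: wt_add)
 moreover have "wt th (hp x) = 0" using tN[of "g None"] t0 th(1) by simp
 moreover have "wt th' (hp x) = 0"
 proof -
 have "wt th' (hp x) = (SUM j:UNIV. t j * of_int (ip th' (N j)))" unfolding t(1) wt_sum_Hl ..
 also have "... = (SUM e:UNIV. t (g (Some e)))" unfolding bij_sum_opt[OF g] t0 ip_th' by simp
 also have "... = 0" using t(2) t0 unfolding bij_sum_opt[OF g] by simp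
 finally show ?thesis .
 qed
 ultimately show ?thesis using e by (simp add: wt_add)
 next
 case False
 define c where "c = ip b (n undefined)"
 have bc: "ip b (n e) = c" for e unfolding c_def by (rule orth[OF b False])
 have "wt b (hp x) = (SUM j:UNIV. t j * of_int (ip b (N j)))" unfolding t(1) wt_sum_Hl ..
 also have "... = (SUM e:UNIV. t (g (Some e)) * of_int c)" unfolding bij_sum_opt[OF g] t0 bc by simp
 also have "... = (SUM e:UNIV. t (g (Some e))) * of_int c" by (rule sum_distrib_right[symmetric])
 also have "(SUM e:UNIV. t (g (Some e))) = 0" using t(2) t0 unfolding bij_sum_opt[OF g] by simp
 finally show ?thesis by simp
 qed
 have w0: "wt 0 H = 0" for H using wt_add[of 0 0] by simp
 have ev0: "cform S 0 (br x (ev v)) = 0" if v: "rt v" for v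
 proof -
 have e: "cf (br x (ev v)) c = (if ip c v = 1 & c - v : levi pp then of_int (eps (c - v) v) * cf x (c - v) else 0)" if c: "c : set S" for c
 proof (cases "c = v")
 case True
 thus ?thesis using cf_br_ev[OF v S_rt[OF c], of x] S0[OF c] v by (simp add: rt_def)
 next
 case False
 have "(rt (c - v)) = (ip c v = 1)" using rt_dif[OF S_rt[OF c] v] .
 moreover have "rt (c - v) ==> c - v ~: levi pp ==> cf x (c - v) = 0" using xl by (auto simp: PS_def)
 ultimately show ?thesis using cf_br_ev[OF v S_rt[OF c], of x] False by auto
 qed
 have "(SUM c<-S. cf (br x (ev v)) c) = 0"
 proof (cases "EX c:set S. ip c v = 1 & c - v : levi pp & cf x (c - v) ~= 0")
 case False
 hence "(SUM c<-S. cf (br x (ev v)) c) = (SUM c<-S. 0)" by (intro arg_cong[where f = sum_list] map_cong) (auto simp: e)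
 thus ?thesis by simp
 next
 \<comment> \<open>A surviving term has \<open>c - v = n i - n b\<close>, because row and column
   \<open>g None\<close> vanish, and \<open>c = B k\<close>, because other members of
   \<open>S\<close> take one value on all \<open>n e\<close>. This forces \<open>v = nu b j\<close>,
   so the sum is an entry of the invariance condition.\<close>
 case True
 then obtain c where c: "c : set S" "ip c v = 1" "c - v : levi pp" "cf x (c - v) ~= 0" by (elim bexE conjE)
 have rc: "rt (c - v)" using rt_dif[OF S_rt[OF c(1)] v] c(2) by simp
 have "EX a b. c - v = N a - N b" by (rule sl_roots[OF rc c(3)])
 then obtain a a' where a: "c - v = N a - N a'" by (elim exE)
 have "a ~= a'" using rc a by (auto simp: rt_def)
 hence ra: "rho x $ a $ a' ~= 0" using c(4) rc unfolding rho_ent a by (simp add: eps_def)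
 have "a ~= g None" "a' ~= g None" using ra row by auto
 then obtain i b where ib: "a = g (Some i)" "a' = g (Some b)" using g_cas[OF g, of "%_. 1" a] g_cas[OF g, of "%_. 1" a'] by (metis mult_1)
 have cv: "c - v = n i - n b" using a ib by simp
 have "i ~= b" using \<open>a ~= a'\<close> ib by auto
 have ic: "ip c (n i) - ip c (n b) = 1"
 proof -
 have "ip c (c - v) = 1" using c(2) S_prod[OF c(1,1)] by (simp add: ip_lin)
 thus ?thesis unfolding cv by (simp add: ip_lin)
 qed
 hence "c : range B" using orth[OF c(1), of i b] by auto
 then obtain k where k: "c = B k" by blast
 have ki: "i = k | i = p k" "b ~= k" "b ~= p k" using ic unfolding k ip_B by (auto split: if_splits)
 define j where "j = p i"
 have j: "B j = c" "p j = i" "b ~= j" "b ~= p j" using ki B_p p(1) k unfolding j_def by auto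
 have "v = nu b j"
 proof -
 have "v = c - (n i - n b)" using cv by (simp add: algebra_simps)
 also have "... = nu b j" unfolding nu_def j(1)[symmetric] B_eq j(2) by (simp add: algebra_simps)
 finally show ?thesis .
 qed
 have lev: "c' - v : levi pp" if "c' : set S" "ip c' v = 1" for c'
 using ip_nu[OF j(3,4) that(1)] that(2) nu_B[of j b] nu_B'[of b j] N_levi(2) unfolding \<open>v = nu b j\<close> by (auto split: if_splits)
 have "(SUM c<-S. cf (br x (ev v)) c) = (SUM c<-S. if ip c v = 1 then of_int (eps (c - v) v) * cf x (c - v) else 0)"
 using lev by (intro arg_cong[where f = sum_list] map_cong) (auto simp: e)
 also have "... = 0" unfolding \<open>v = nu b j\<close> min_rho[OF j(3,4)] using pr unfolding preserves_def by simp
 finally show ?thesis .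
 qed
 thus ?thesis by (simp add: cform_def w0)
 qed
 have "cform S 0 (br x y) = 0" if "y : PS {c. pos_on m c}" for y using that
 proof (induction rule: PS_ind)
 case (h H)
 have "cf (br x H) b = 0" if "b : set S" for b using cf_br_h[OF h S_rt[OF that], of x] xS[OF that] by simp
 thus ?case by (simp add: cform_def w0 cong: map_cong)
 next
 case (ev c)
 thus ?case using ev0 by blast
 next
 case (add a y z)
 thus ?case using cfo_lin[OF S_rt, of S 0] by (simp add: br_add_right br_scale_right)
 qed
 thus ?thesis using xq unfolding fstab_def by blast
qed

theorem fst_ima:
 assumes s: "!!e. s e * s e = 1" and v: "!!e. v e = s e * s (p e) * w e"
 shows "(%x. transpose (incl g s) ** rho x ** incl g s) ` fstab m S 0 =
 {X. ALL b j. X $ p j $ b * v (p j) + v b * X $ p b $ j = 0}" (is "?tt ` _ = ?T")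
proof -
 have tte: "?tt x $ e $ f = s e * rho x $ g (Some e) $ g (Some f) * s f" for x e f unfolding inc_rig[OF g s] inc_lef[OF g s] ..
 have sv: "s (p j) * y * s b * v (p j) + v b * (s (p b) * z * s j) = s b * s j * (y * w (p j) + w b * z)" for y z b j
 unfolding v p(1) using s[of b] s[of j] s[of "p b"] s[of "p j"] by algebra
 have snz: "s e ~= 0" for e using s[of e] by auto
 show ?thesis
 proof (intro equalityI subsetI)
 fix X assume "X : ?tt ` fstab m S 0"
 then obtain x where x: "x : fstab m S 0" "X = ?tt x" by blast
 show "X : ?T" unfolding x(2) mem_Collect_eq tte sv using fst_pre[OF x(1)] unfolding preserves_def by simp
 next
 fix X assume X: "X : ?T"
 \<comment> \<open>\<open>X\<close> is extended by a zero row and column at \<open>g None\<close>.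
   Its trace is 0 because invariance makes the diagonal entries at \<open>e\<close> and
   \<open>p e\<close> opposite.\<close>
 define Y where "Y = incl g s ** X ** transpose (incl g s)"
 have Ye: "Y $ g (Some e) $ g (Some f) = s e * X $ e $ f * s f" for e f
 proof -
 have "Y $ i $ j = transpose Y $ j $ i" for i j by (simp add: transpose_def)
 hence "Y $ g (Some e) $ g (Some f) = (incl g s ** transpose (incl g s ** X)) $ g (Some f) $ g (Some e)" by (simp add: Y_def matrix_transpose_mul)
 also have "... = s f * transpose (incl g s ** X) $ f $ g (Some e)" by (rule inc_mul(2)[OF g s])
 also have "... = s f * (s e * X $ e $ f)" by (simp add: transpose_def inc_mul(2)[OF g s])
 finally show ?thesis by (simp add: mult_ac)
 qed
 have Y0: "Y $ g None $ j = 0" "Y $ j $ g None = 0" for j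
 proof -
 show "Y $ g None $ j = 0" unfolding Y_def matrix_mul_assoc[symmetric] by (rule inc_mul(1)[OF g s])
 have "Y $ j $ g None = (incl g s ** transpose (incl g s ** X)) $ g None $ j"
 by (simp add: Y_def matrix_transpose_mul[symmetric] transpose_def matrix_matrix_mult_def mult.commute)
 thus "Y $ j $ g None = 0" by (simp add: inc_mul(1)[OF g s])
 qed
 have "X $ e $ e + X $ p e $ p e = 0" for e
 proof -
 have "X $ p e $ p e * v (p e) + v (p e) * X $ p (p e) $ e = 0" using X by blast
 hence "v (p e) * (X $ e $ e + X $ p e $ p e) = 0" unfolding p(1) by (simp add: distrib_left mult.commute add.commute)
 moreover have "v (p e) ~= 0" using v[of "p e"] snz w_sq[of "p e"] by auto
 ultimately show ?thesis by simp
 qed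
 hence "(SUM e:UNIV. X $ e $ e) + (SUM e:UNIV. X $ p e $ p e) = 0" by (simp add: sum.distrib[symmetric])
 moreover have "(SUM e:UNIV. X $ p e $ p e) = (SUM e:UNIV. X $ e $ e)"
 by (rule sum.reindex_bij_betw) (rule bij_betw_byWitness[where f' = p], use p in auto)
 ultimately have "(SUM e:UNIV. X $ e $ e) = 0" by simp
 hence "trace Y = 0" unfolding trace_def bij_sum_opt[OF g] Ye Y0 using s by (simp add: mult.commute mult.assoc[symmetric])
 hence "Y : rho ` levd pp" using rho_iso unfolding matrix_lie_iso_def bij_betw_def sl_def by blast
 then obtain x where x: "x : levd pp" "Y = rho x" by blast
 have "preserves x" unfolding preserves_def
 proof (intro allI)
 fix b j
 have "s (p j) * (s (p j) * X $ p j $ b * s b) * s b * v (p j) + v b * (s (p b) * (s (p b) * X $ p b $ j * s j) * s j) = 0"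
 proof -
 have "X $ p j $ b * v (p j) + v b * X $ p b $ j = 0" using X by blast
 thus ?thesis using s[of b] s[of j] s[of "p b"] s[of "p j"] by algebra
 qed
 hence "s b * s j * (Y $ g (Some (p j)) $ g (Some b) * w (p j) + w b * Y $ g (Some (p b)) $ g (Some j)) = 0" unfolding sv Ye .
 thus "rho x $ g (Some (p j)) $ g (Some b) * w (p j) + w b * rho x $ g (Some (p b)) $ g (Some j) = 0" using snz unfolding x(2) by simp
 qed
 hence "x : fstab m S 0" using fstabI[OF x(1)] Y0 unfolding x(2) by blast
 moreover have "?tt x = X"
 proof -
 have "?tt x $ e $ f = X $ e $ f" for e f unfolding tte unfolding x(2)[symmetric] Ye using s[of e] s[of f] by algebra
 thus ?thesis by (simp add: vec_eq_iff)
 qed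
 ultimately show "X : ?tt ` fstab m S 0" by blast
 qed
qed

lemma vec_par: "vect u : PS (para pp)"
proof -
 have "N i : para pp" for i
 proof -
 have "th : para pp" using S_pos[OF th(2)] mask by auto
 moreover have "N i - th : levi pp" using N_levi(2)[of i "g None"] th(1) by simp
 ultimately have "th + (N i - th) : para pp" by (auto simp: para_def levi_def)
 thus ?thesis by simp
 qed
 thus ?thesis unfolding vect_def by (intro subspace_sum[OF PS_subs] subspace_scale[OF PS_subs] PS_ev N(1)) blast
qed

end

section \<open>Orthogonal stabilisers\<close>

lemma so_iff: "(X : so) = ((ALL i j. X $ j $ i = - X $ i $ j))"
proof -
 have "(transpose X = - X) = ((ALL i j. transpose X $ i $ j = (- X) $ i $ j))" unfolding vec_eq_iff ..
 also have "(...) = ((ALL i j. X $ j $ i = - X $ i $ j))" by (simp only: transpose_def vec_lambda_beta vector_uminus_component)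
 finally show ?thesis by (simp only: so_def mem_Collect_eq)
qed

lemma so_ent: "X : so ==> X $ j $ i = - X $ i $ j" unfolding so_iff by blast

text \<open>Up to the common shift by half of \<open>tau\<close>, a vector of norm 1, the
  \<open>N a\<close> are the weights of the vector representation of type D, and \<open>p\<close>
  exchanges opposite weights. This accounts for the products 2, 0 and 1.\<close>

locale so_module = e8 sc br h al for sc :: "complex => 'g::ab_group_add => 'g" and br h al +
 fixes pp :: "nat set" and N :: "'d::finite => lat" and p :: "'d => 'd" and tau :: lat
 assumes so_pp: "pp <= {1..8}" and p: "!!a. p (p a) = a" "!!a. p a ~= a"
 and N_ip: "!!a b. ip (N a) (N b) = (if a = b then 2 else if b = p a then 0 else 1)"
 and N_levi: "!!i. N i ~: levi pp" "!!a b. N a - N b : levi pp"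
 and so_roots: "!!c. rt c ==> c : levi pp ==> EX a b. c = N a - N b" and N_pair: "!!a. N a + N (p a) = tau"
begin

lemma p_eq: "(p a = b) = (a = p b)" using p(1) by metis

lemma rt_N: "rt (N i)" using N_ip[of i i] by (simp add: rt_def)

lemma rt_dif_N: "(rt (N a - N b)) = (a ~= b & b ~= p a)" using N_ip[of b a] p_eq[of b a] by (auto simp: rt_def ip_lin N_ip)

lemma inj_N: "inj N"
proof (rule injI)
 fix a b assume "N a = N b"
 thus "a = b" using N_ip[of a b] N_ip[of a a] by (auto split: if_splits)
qed

lemma so_sum: "(SUM j:UNIV. t j * of_int (ip (N i) (N j))) = sum t UNIV + t i - t (p i)" for t :: "'d => complex"
proof -
 have "(SUM j:UNIV. t j * of_int (ip (N i) (N j))) =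
 (SUM j:UNIV. t j + (if j = i then t i else 0) - (if j = p i then t (p i) else 0))"
 by (rule sum.cong) (use p(2)[of i] in "auto simp: N_ip")
 thus ?thesis by (simp add: sum.distrib sum_subtractf sum.delta)
qed

lemma sum_p: "(SUM j:UNIV. u (p j)) = (SUM j:UNIV. u j)" by (rule sum.reindex_bij_betw) (rule bij_betw_byWitness[where f' = p], use p in auto)

end

sublocale so_module < w_module sc br h al pp N
proof
 show "pp <= {1..8}" by (rule so_pp)
 show "rt (N i)" for i by (rule rt_N)
 show "inj N" by (rule inj_N)
 show "N i ~: levi pp" for i by (rule N_levi)
 show "N a - N b : levi pp" for a b by (rule N_levi)
 show "EX a b. c = N a - N b" if "rt c" "c : levi pp" for c by (rule so_roots[OF that])
 show "c + N j : range N" if c: "rt c" "c : levi pp" "rt (c + N j)" for c j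
 proof -
 have "EX a b. c = N a - N b" by (rule so_roots[OF c(1,2)])
 then obtain a b where ab: "c = N a - N b" by (elim exE)
 have "ip c (N j) = - 1" using rt_add[OF c(1) rt_N] c(3) by simp
 hence "ip (N a) (N j) - ip (N b) (N j) = - 1" unfolding ab by (simp add: ip_lin)
 then consider "b = j" | "j = p a" by (auto simp: N_ip split: if_splits)
 thus ?thesis
 proof cases
 case 2
 have "c + N j = N (p b)" using N_pair[of a] N_pair[of b] unfolding ab 2 by (simp add: algebra_simps)
 thus ?thesis by simp
 qed (simp add: ab)
 qed
 show "(SUM j:UNIV. sc (t j) (Hl (N j))) = 0" if t: "sum t UNIV = 0" "!!i. (SUM j:UNIV. t j * of_int (ip (N i) (N j))) = 0" for t :: "'d => complex"
 proof -
 \<comment> \<open>Both conditions together make \<open>t\<close> invariant under \<open>p\<close>,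
   so twice the sum is \<open>Hl tau\<close> with total coefficient \<open>sum t UNIV\<close>, which
   is 0.\<close>
 have tp: "t (p i) = t i" for i using t unfolding so_sum by simp
 let ?x = "SUM j:UNIV. sc (t j) (Hl (N j))"
 have "?x = (SUM j:UNIV. sc (t j) (Hl (N (p j))))" using sum_p[of "%j. sc (t j) (Hl (N j))"] by (simp add: tp)
 hence "?x + ?x = (SUM j:UNIV. sc (t j) (Hl (N j) + Hl (N (p j))))" by (simp add: scale_right_distrib sum.distrib)
 also have "... = sc (sum t UNIV) (Hl tau)" unfolding Hl_add[symmetric] N_pair by (simp add: scale_sum_left)
 finally have "?x + ?x = 0" using t(1) by simp
 hence "sc 2 ?x = 0" using scale_left_distrib[of 1 1 ?x] by simp
 thus ?thesis by simp
 qed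
qed

context so_module
begin

text \<open>The entry of the invariant form in row \<open>a\<close> and column \<open>p a\<close>.
  By \<open>f_p\<close> this form is symmetric, in contrast to the symplectic case.\<close>

definition f :: "'d => complex" where "f a = of_int (eps (N a) tau)"

definition F :: "complex ^ 'd ^ 'd" where "F = (\<chi> i j. if j = p i then f i else 0)"

lemma f_sq: "f a * f a = 1" by (simp add: f_def eps_def)

lemma ip_tau: "ip tau (N k) = 2" unfolding N_pair[of k, symmetric] using p(2)[of k] by (simp add: ip_lin N_ip p(1))

lemma f_p: "f (p a) = f a"
proof -
 have "ip tau tau = 4" using ip_tau[of a] ip_tau[of "p a"] ip_add_rig[of tau "N a" "N (p a)"] unfolding N_pair by simp
 hence "fm tau tau = 2" using fm_sel[of tau] by simp
 hence "even (fm (N a) tau + fm (N (p a)) tau)" unfolding N_pair[of a, symmetric] by (simp add: fm_add_lef[symmetric] N_pair)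
 thus ?thesis by (auto simp: f_def eps_def)
qed

definition so_F :: "(complex ^ 'd ^ 'd) set" where
 "so_F = {X. ALL i j. X $ p j $ i * f j + X $ p i $ j * f i = 0}"

lemma pai_sum_odd: "i ~= j ==> i ~= p j ==> odd (fm (N i + N j) (N i + N j))"
proof -
 assume ij: "i ~= j" "i ~= p j"
 hence "ip (N i + N j) (N i + N j) = 6" using p_eq[of i j] by (auto simp: ip_lin N_ip)
 thus ?thesis using fm_sel[of "N i + N j"] by presburger
qed

lemma rho_in: assumes x: "x : levd pp" shows "rho x : so_F" unfolding so_F_def
proof (intro CollectI allI)
 fix i j
 obtain t where t: "hp x = (SUM j:UNIV. sc (t j) (Hl (N j)))" "sum t UNIV = 0" using x unfolding levd_def car_lev by blast
 consider "i = j" | "i ~= j" "i = p j" | "i ~= j" "i ~= p j" by blast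
 thus "rho x $ p j $ i * f j + rho x $ p i $ j * f i = 0"
 proof cases
 case 1
 have "rho x $ p j $ j = 0" using p[of j] rt_dif_N[of "p j" j] by (simp add: rho_ent)
 thus ?thesis using 1 by simp
 next
 case 2
 have "wt tau (hp x) = 0" unfolding t(1) wt_sum_Hl ip_tau using t(2) by (simp add: sum_distrib_right[symmetric])
 hence "wt (N (p j)) (hp x) + wt (N j) (hp x) = 0" unfolding N_pair[of j, symmetric] by (simp add: wt_add add.commute)
 thus ?thesis unfolding 2(2) p(1) rho_ent f_p by (simp add: distrib_right[symmetric])
 next
 case 3
 let ?c = "N (p j) - N i"
 \<comment> \<open>One root sits at two places of the matrix, so the condition compares the two
   signs in front of a single coordinate.\<close>
 have c: "N (p i) - N j = ?c" using N_pair[of i] N_pair[of j] by (simp add: algebra_simps)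
 have ne: "p j ~= i" "p i ~= j" using 3 p_eq by metis+
 have r: "rt ?c" using rt_dif_N[of "p j" i] 3 ne p(1) by simp
 have c': "?c = tau - (N i + N j)" using N_pair[of j] by (simp add: algebra_simps)
 have "fm tau (N i + N j) + fm (N i + N j) tau = 4" using ip_tau[of i] ip_tau[of j] by (simp add: ip_def fm_add_lef fm_add_rig)
 hence "odd (fm ?c (N i) + fm (N j) tau + (fm ?c (N j) + fm (N i) tau))"
 using pai_sum_odd[OF 3] unfolding c' fm_dif_lef fm_dif_rig fm_add_lef fm_add_rig by presburger
 hence "of_int (eps ?c (N i)) * f j + of_int (eps ?c (N j)) * f i = 0" unfolding f_def eps_par by (auto split: if_splits)
 hence "(of_int (eps ?c (N i)) * f j + of_int (eps ?c (N j)) * f i) * cf x ?c = 0" by simp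
 hence "of_int (eps ?c (N i)) * cf x ?c * f j + of_int (eps ?c (N j)) * cf x ?c * f i = 0" by (simp only: ring_distribs mult_ac)
 thus ?thesis unfolding rho_ent using ne c r by simp
 qed
qed

lemma so_F_sur: assumes X: "X : so_F" shows "EX x:levd pp. rho x = X"
proof -
 have Xc: "X $ p j $ i * f j + X $ p i $ j * f i = 0" for i j using X unfolding so_F_def by blast
 have fnz: "f a ~= 0" for a using f_sq[of a] by auto
 have diag: "X $ p j $ p j = - X $ j $ j" for j
 proof -
 have "X $ p j $ p j * f j + X $ p (p j) $ j * f (p j) = 0" by (rule Xc)
 hence "(X $ p j $ p j + X $ j $ j) * f j = 0" unfolding p(1) f_p by (simp add: distrib_right)
 thus ?thesis using fnz by (simp add: eq_neg_iff_add_eq_0)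
 qed
 \<comment> \<open>The halves compensate a doubling in \<open>so_sum\<close>: for coefficients that
   change sign under \<open>p\<close>, \<open>t i - t (p i)\<close> is twice
   \<open>t i\<close>.\<close>
 have tr: "sum (%j. X $ j $ j / 2) UNIV = 0" using sum_p[of "%j. X $ j $ j / 2"] by (simp add: diag sum_negf)
 show ?thesis
 proof (rule rho_sur[OF tr])
 show "X $ i $ i = (SUM j:UNIV. X $ j $ j / 2 * of_int (ip (N i) (N j)))" for i unfolding so_sum[of "%j. X $ j $ j / 2"] tr by (simp add: diag)
 show "X $ i $ j = 0" if "i ~= j" "~ rt (N i - N j)" for i j
 proof -
 have "j = p i" using that rt_dif_N by blast
 hence "X $ i $ j * f j + X $ i $ j * f j = 0" using Xc[of j j] p(1)[of i] by simp
 hence "2 * (X $ i $ j * f j) = 0" by (simp only: mult_2)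
 thus ?thesis using fnz[of j] by simp
 qed
 fix a b a' b' assume r: "rt (N a - N b)" and e: "N a - N b = N a' - N b'"
 have "ip (N a - N b) (N a) = 1" using r p_eq[of b a] unfolding rt_dif_N by (auto simp: ip_lin N_ip)
 hence "ip (N a') (N a) - ip (N b') (N a) = 1" unfolding e by (simp add: ip_lin)
 hence "a' = a | b' = p a" using p_eq[of b' a] by (auto simp: N_ip split: if_splits)
 thus "of_int (eps (N a - N b) (N b)) * X $ a $ b = of_int (eps (N a - N b) (N b')) * X $ a' $ b'"
 proof
 assume "a' = a"
 hence "N b' = N b" using e by (simp add: algebra_simps)
 thus ?thesis using \<open>a' = a\<close> inj_N by (simp add: inj_def)
 next
 assume b': "b' = p a"
 have "N a' = N (p b)" using e N_pair[of a] N_pair[of b] unfolding b' by (simp add: algebra_simps)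
 hence a': "a' = p b" using inj_N by (simp add: inj_def)
 have "X $ a $ b * f a + X $ p b $ p a * f b = 0" using Xc[of b "p a"] unfolding p(1) f_p by (simp only: add.commute)
 moreover have "of_int (eps (N a - N b) (N b)) * f b = - (of_int (eps (N a - N b) (N (p a))) * f a)"
 proof -
 have pa: "N (p a) = tau - N a" using N_pair[of a] by (simp add: algebra_simps)
 have "a ~= b" "a ~= p b" using r p_eq[of b a] unfolding rt_dif_N by auto
 hence "odd (fm (N a + N b) (N a + N b))" by (rule pai_sum_odd)
 hence "odd (fm (N a - N b) (N b) + fm (N b) tau + (fm (N a - N b) (N (p a)) + fm (N a) tau))"
 unfolding pa fm_dif_lef fm_dif_rig fm_add_lef fm_add_rig by presburger
 thus ?thesis unfolding f_def eps_par by (auto split: if_splits)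
 qed
 ultimately show ?thesis unfolding a' b' using f_sq[of a] f_sq[of b] by algebra
 qed
 qed
qed

lemma F_sym: "transpose F = F" using p_eq by (auto simp: vec_eq_iff transpose_def F_def f_p)

lemma F_mult: "(F ** X) $ i $ j = f i * X $ p i $ j" "(X ** F) $ i $ j = X $ i $ p j * f j"
proof -
 show "(F ** X) $ i $ j = f i * X $ p i $ j" by (simp add: matrix_matrix_mult_def F_def if_distrib[of "%t. t * _"] cong: if_cong)
 have "(X ** F) $ i $ j = (SUM k:UNIV. X $ i $ k * (if j = p k then f k else 0))" by (simp add: matrix_matrix_mult_def F_def)
 also have "... = (SUM k:UNIV. if k = p j then X $ i $ p j * f j else 0)" by (rule sum.cong) (auto simp: p(1) f_p)
 finally have "(X ** F) $ i $ j = (SUM k:UNIV. if k = p j then X $ i $ p j * f j else 0)" .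
 thus "(X ** F) $ i $ j = X $ i $ p j * f j" by simp
qed

lemma so_F_iff: "(X : so_F) = (transpose X ** F + F ** X = 0)"
 unfolding so_F_def by (simp add: vec_eq_iff F_mult transpose_def mult.commute)

end

text \<open>\<open>q\<close> picks one index of each pair. The condition \<open>qz\<close> makes
  column \<open>z\<close> of \<open>C\<close> proportional to the sum of the basis vectors at
  \<open>z\<close> and \<open>p z\<close>, the two places where the form is supported.\<close>

locale so_data = so_module sc br h al pp N p tau
 for sc :: "complex => 'g::ab_group_add => 'g" and br h al pp and N :: "'d::finite => lat" and p tau +
 fixes q :: "'d => bool" and z :: 'd and m :: lat and R :: "lat list"
 assumes q: "!!a. q (p a) \<longleftrightarrow> ~ q a" and qz: "q z = (f z = 1)"
 and mask: "{c. pos_on m c} = para pp" and S: "form_data m [N z, N (p z)] 0" and R: "orth_basis ([N z, N (p z)] @ R)" "set R <= levi pp"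
 and zero: "!!x c. x : fstab m [N z, N (p z)] 0 ==> rt c ==> c ~: levi pp ==> cf x c = 0"
begin

text \<open>The columns of \<open>C\<close> are the orthonormal basis of vectors \<open>(e\<^sub>k + f e\<^sub>p\<^sub>k) / \<surd>2\<close> and
 \<open>\<i> (e\<^sub>p\<^sub>k - f e\<^sub>k) / \<surd>2\<close>.\<close>

definition ca :: "'d => complex" where "ca k = (if q k then 1 else - \<i> * f k) / of_real (sqrt 2)"
definition cb :: "'d => complex" where "cb k = (if q k then f k else \<i>) / of_real (sqrt 2)"
definition C :: "complex ^ 'd ^ 'd" where
 "C = (\<chi> i k. if i = k then ca k else if i = p k then cb k else 0)"

lemma sqrt2: "of_real (sqrt 2) * of_real (sqrt 2) = (2 :: complex)" unfolding of_real_mult[symmetric] by simp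

lemma C_mult:
 fixes Y :: "complex ^ 'd ^ 'd"
 shows "(transpose C ** Y) $ k $ l = ca k * Y $ k $ l + cb k * Y $ p k $ l"
proof -
 have "(transpose C ** Y) $ k $ l = (SUM i:UNIV. (if i = k then ca k * Y $ k $ l else 0) + (if i = p k then cb k * Y $ p k $ l else 0))"
 unfolding matrix_matrix_mult_def transpose_def C_def using p(2)[of k] by (auto intro!: sum.cong)
 thus ?thesis by (simp add: sum.distrib)
qed

lemma C_ort: "transpose C ** F ** C = mat 1"
proof -
 have s2: "of_real (sqrt 2) ~= (0 :: complex)" by simp
 have ab: "2 * f k * ca k * cb k = 1" for k unfolding ca_def cb_def using sqrt2 f_sq[of k] s2 by (auto simp: field_simps)
 have ab': "ca k * ca (p k) + cb k * cb (p k) = 0" for k unfolding ca_def cb_def q f_p using s2 by (auto simp: field_simps)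
 have "(transpose C ** F ** C) $ k $ l = (if k = l then 1 else 0)" for k l
 proof -
 have "(transpose C ** F ** C) $ k $ l = ca k * (f k * C $ p k $ l) + cb k * (f k * C $ k $ l)"
 unfolding matrix_mul_assoc[symmetric] C_mult F_mult p(1) f_p ..
 moreover have "... = (if k = l then 1 else 0)"
 proof -
 consider "l = k" | "l = p k" "l ~= k" | "l ~= k" "l ~= p k" by blast
 thus ?thesis
 proof cases
 case 1
 thus ?thesis using ab[of k] p(2)[of k] by (simp add: C_def mult_ac)
 next
 case 2
 have "ca k * (f k * ca (p k)) + cb k * (f k * cb (p k)) = 0" using ab'[of k] by algebra
 thus ?thesis using 2 p[of k] by (simp add: C_def)
 next
 case 3
 thus ?thesis using p_eq[of k l] p(1)[of k] p(1)[of l] by (auto simp: C_def)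
 qed
 qed
 ultimately show ?thesis by simp
 qed
 thus ?thesis by (simp add: vec_eq_iff mat_def)
qed

lemma C_inv: "C ** (transpose C ** F) = mat 1" using C_ort matrix_left_right_inverse[of "transpose C ** F" C] by simp

definition rho' :: "'g => complex ^ 'd ^ 'd" where "rho' x = transpose C ** F ** rho x ** C"

lemma C_rho': "C ** rho' x = rho x ** C"
proof -
 have "C ** rho' x = (C ** (transpose C ** F)) ** rho x ** C" by (simp add: rho'_def matrix_mul_assoc)
 thus ?thesis by (simp add: C_inv)
qed

lemma rho_in_so: "rho x : so_F ==> rho' x : so"
proof -
 assume "rho x : so_F"
 hence "transpose (rho x) ** F = - (F ** rho x)" unfolding so_F_iff by (simp add: eq_neg_iff_add_eq_0)
 moreover have "transpose (rho' x) = transpose C ** (transpose (rho x) ** F) ** C" by (simp add: rho'_def matrix_transpose_mul F_sym matrix_mul_assoc)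
 moreover have "A ** (- Y) ** B = - (A ** Y ** B)" for A Y B :: "complex ^ 'd ^ 'd" by (simp add: vec_eq_iff matrix_matrix_mult_def sum_negf)
 ultimately show ?thesis by (simp add: so_def rho'_def matrix_mul_assoc)
qed

lemma so_rho: assumes Y: "Y : so" shows "EX x:levd pp. rho' x = Y"
proof -
 let ?X = "C ** Y ** (transpose C ** F)"
 have "transpose ?X ** F = - (F ** ?X)"
 proof -
 have "transpose ?X ** F = F ** C ** transpose Y ** transpose C ** F" by (simp add: matrix_transpose_mul F_sym matrix_mul_assoc)
 moreover have "transpose Y = - Y" using Y by (simp add: so_def)
 moreover have "A ** (- Y) ** B = - (A ** Y ** B)" for A Y B :: "complex ^ 'd ^ 'd" by (simp add: vec_eq_iff matrix_matrix_mult_def sum_negf)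
 moreover have "(- Y) ** B = - (Y ** B)" for Y B :: "complex ^ 'd ^ 'd" by (simp add: vec_eq_iff matrix_matrix_mult_def sum_negf)
 ultimately show ?thesis by (simp add: matrix_mul_assoc)
 qed
 hence "?X : so_F" unfolding so_F_iff by simp
 hence "EX x:levd pp. rho x = ?X" by (rule so_F_sur)
 then obtain x where x: "x : levd pp" "rho x = ?X" by (elim bexE)
 have "rho' x = (transpose C ** F ** C) ** Y ** (transpose C ** F ** C)" unfolding rho'_def x(2) by (simp add: matrix_mul_assoc)
 thus ?thesis using x(1) by (auto simp: C_ort)
qed

theorem rho'_iso: "matrix_lie_iso sc br (levd pp) rho' so" unfolding matrix_lie_iso_def
proof (intro conjI ballI allI)
 have PSl: "x : PS (levi pp)" if "x : levd pp" for x using that unfolding levd_def by blast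
 show "rho' (x + y) = rho' x + rho' y" for x y unfolding rho'_def rho_add by (simp only: matrix_add_ldistrib mat_dis)
 show "rho' (sc c x) = mat c ** rho' x" for c x
 proof -
 have m: "A ** (mat c ** Y) = mat c ** (A ** Y)" for A Y :: "complex ^ 'd ^ 'd"
 proof -
 have 1: "(mat c ** X) $ i $ j = c * X $ i $ j" for X :: "complex ^ 'd ^ 'd" and i j
 by (simp add: matrix_matrix_mult_def mat_def if_distrib[of "%t. t * _"] cong: if_cong)
 have 2: "(A ** Z) $ i $ j = (SUM k:UNIV. A $ i $ k * Z $ k $ j)" for Z :: "complex ^ 'd ^ 'd" and i j by (simp add: matrix_matrix_mult_def)
 show ?thesis unfolding vec_eq_iff 1 2 by (simp add: sum_distrib_left mult_ac)
 qed
 show ?thesis unfolding rho'_def rho_sca matrix_mul_assoc[symmetric] m ..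
 qed
 show br: "rho' (br x y) = rho' x ** rho' y - rho' y ** rho' x" if "x : levd pp" "y : levd pp" for x y
 proof -
 have m: "rho' x ** rho' y = transpose C ** F ** (rho x ** rho y) ** C" for x y
 proof -
 have "rho' x ** rho' y = transpose C ** F ** rho x ** (C ** rho' y)" by (simp add: rho'_def[of x] matrix_mul_assoc)
 thus ?thesis unfolding C_rho' by (simp add: matrix_mul_assoc)
 qed
 show ?thesis unfolding m unfolding rho'_def rho_br[OF PSl[OF that(1)] PSl[OF that(2)]] by (simp only: mat_dis)
 qed
 show "bij_betw rho' (levd pp) so" unfolding bij_betw_def
 proof
 show "inj_on rho' (levd pp)"
 proof (rule inj_onI)
 fix x y assume xy: "x : levd pp" "y : levd pp" "rho' x = rho' y"
 have recover: "rho x = C ** rho' x ** (transpose C ** F)" for x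
 proof -
 have "C ** rho' x ** (transpose C ** F) = rho x ** (C ** (transpose C ** F))" unfolding C_rho' by (simp add: matrix_mul_assoc)
 thus ?thesis by (simp add: C_inv)
 qed
 have "rho (x - y) + rho y = rho x" using rho_add[of "x - y" y] by simp
 hence "rho (x - y) = 0" using xy(3) recover[of x] recover[of y] by simp
 hence "x - y = 0" using rho_inj subspace_diff[OF lev_der_sub xy(1,2)] by blast
 thus "x = y" by simp
 qed
 show "rho' ` levd pp = so" using rho_in_so[OF rho_in] so_rho by (auto simp: image_iff)
 qed
qed

lemma S_rt: "b : set [N z, N (p z)] ==> rt b" and S_pos: "b : set [N z, N (p z)] ==> pos_on m b" using S by (auto simp: form_data_def rt_def)

lemma N_para: "N i : para pp"
proof -
 have "N z : para pp" using S_pos[of "N z"] mask by auto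
 hence "N z + (N i - N z) : para pp" using N_levi(2)[of i z] by (auto simp: para_def levi_def)
 thus ?thesis by simp
qed

lemma cfo_z: "cform [N z, N (p z)] 0 (br x (ev (N j))) = rho x $ z $ j + rho x $ p z $ j" using wt_add[of 0 0] by (simp add: cform_def rho_def)

lemma fst_lev: assumes x: "x : fstab m [N z, N (p z)] 0" shows "x : levd pp"
proof -
 have "x : PS (levi pp)" using zero[OF x] by (auto simp: PS_def)
 moreover have "hp x : {H : h. ALL b:set [N z, N (p z)]. wt b H = 0}" using fst_hp[OF S x] by simp
 hence "hp x : span (Hl ` set R)" unfolding anni(1)[OF R(1)] .
 moreover have "span (Hl ` set R) <= span ((%i. Hl (sr i)) ` pp)" using R(2) Hl_lev[OF so_pp] by (intro span_minimal) auto
 ultimately show ?thesis unfolding levd_def by blast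
qed

text \<open>For \<open>x\<close> in the Levi subalgebra the bracket with \<open>ev c\<close> reaches
  a weight \<open>N i\<close> only if \<open>c\<close> is a weight of the module, so testing there
  is enough; on the module the form adds the rows \<open>z\<close> and \<open>p z\<close>.\<close>

lemma fst_iff:
 assumes x: "x : levd pp"
 shows "(x : fstab m [N z, N (p z)] 0) = ((ALL j. rho x $ z $ j + rho x $ p z $ j = 0))"
proof
 assume "x : fstab m [N z, N (p z)] 0"
 thus "ALL j. rho x $ z $ j + rho x $ p z $ j = 0" using PS_ev[OF rt_N] N_para unfolding mask fstab_def cfo_z[symmetric] by blast
next
 assume row: "ALL j. rho x $ z $ j + rho x $ p z $ j = 0"
 have xl: "x : PS (levi pp)" using x unfolding levd_def by blast
 have "levi pp <= para pp" by (auto simp: levi_def para_def)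
 hence xq: "x : PS {c. pos_on m c}" using xl unfolding mask by (auto simp: PS_def)
 have w0: "wt 0 H = 0" for H using wt_add[of 0 0] by simp
 have "cform [N z, N (p z)] 0 (br x y) = 0" if "y : PS {c. pos_on m c}" for y using that
 proof (induction rule: PS_ind)
 case (h H)
 have "cf (br x H) (N i) = 0" for i using cf_br_h[OF h rt_N, of x i] xl N_levi(1)[of i] rt_N[of i] by (auto simp: PS_def)
 thus ?case by (simp add: cform_def w0)
 next
 case (ev c)
 show ?case
 proof (cases "c : range N")
 case True
 then obtain j where "c = N j" by blast
 thus ?thesis using row cfo_z[of x j] by simp
 next
 case False
 have "cf (br x (ev c)) (N i) = 0" for i
 proof -
 have "cf x (N i - c) = 0" if r: "rt (N i - c)"
 proof (rule ccontr)
 assume "cf x (N i - c) ~= 0"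
 hence "N i - c : levi pp" using xl r by (auto simp: PS_def)
 hence "c - N i : levi pp" by (simp add: levi_def)
 moreover have "rt (c - N i)" using r ip_sym unfolding rt_def by (simp add: ip_lin)
 moreover have "rt (c - N i + N i)" using ev(1) by simp
 ultimately have "c - N i + N i : range N" using closed by blast
 thus False using False by simp
 qed
 thus ?thesis using cf_br_ev[OF ev(1) rt_N, of x i] False by auto
 qed
 thus ?thesis by (simp add: cform_def w0)
 qed
 next
 case (add a y y')
 thus ?case using cfo_lin[OF S_rt, of "[N z, N (p z)]" 0] by (simp add: br_add_right br_scale_right)
 qed
 thus "x : fstab m [N z, N (p z)] 0" using xq unfolding fstab_def by blast
qed

lemma rho_row: "rho' x $ z $ j = ca z * f z * (SUM k:UNIV. (rho x $ z $ k + rho x $ p z $ k) * C $ k $ j)"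
proof -
 have cz: "cb z = ca z"
 proof (cases "q z")
 case False
 hence "f z = - 1" using qz f_sq[of z] by (metis square_eq_1_iff)
 thus ?thesis using False by (simp add: ca_def cb_def)
 qed (use qz in "simp add: ca_def cb_def")
 have r: "(transpose C ** F ** rho x) $ z $ k = ca z * f z * (rho x $ z $ k + rho x $ p z $ k)" for k
 proof -
 have "(transpose C ** (F ** rho x)) $ z $ k = ca z * (F ** rho x) $ z $ k + cb z * (F ** rho x) $ p z $ k" by (rule C_mult)
 thus ?thesis unfolding cz by (simp add: matrix_mul_assoc[symmetric] F_mult p(1) f_p algebra_simps)
 qed
 have "rho' x $ z $ j = (SUM k:UNIV. (transpose C ** F ** rho x) $ z $ k * C $ k $ j)" unfolding rho'_def matrix_matrix_mult_def[of _ C] by simp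
 thus ?thesis unfolding r by (simp add: sum_distrib_left mult.assoc)
qed

lemma fst_rho:
 assumes x: "x : levd pp"
 shows "(x : fstab m [N z, N (p z)] 0) = ((ALL j. rho' x $ z $ j = 0))"
proof
 assume "x : fstab m [N z, N (p z)] 0"
 thus "ALL j. rho' x $ z $ j = 0" unfolding fst_iff[OF x] rho_row by simp
next
 assume 0: "ALL j. rho' x $ z $ j = 0"
 have nz: "ca z * f z ~= 0" using f_sq[of z] by (auto simp: ca_def)
 define r :: "complex ^ 'd ^ 'd" where "r = (\<chi> i k. if i = z then rho x $ z $ k + rho x $ p z $ k else 0)"
 have "(r ** C) $ i $ j = 0" for i j using 0 nz unfolding rho_row by (cases "i = z") (simp_all add: r_def matrix_matrix_mult_def)
 hence "r ** C = 0" by (simp add: vec_eq_iff)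
 hence "r ** (C ** (transpose C ** F)) = 0" by (simp add: matrix_mul_assoc)
 hence "r = 0" by (simp add: C_inv)
 hence "r $ z $ j = 0" for j by simp
 thus "x : fstab m [N z, N (p z)] 0" unfolding fst_iff[OF x] by (simp add: r_def)
qed

theorem fst_ima:
 fixes g :: "'e::finite option => 'd"
 assumes g: "bij g" "g None = z"
 shows "(%x. transpose (incl g (%_. 1)) ** rho' x ** incl g (%_. 1)) ` fstab m [N z, N (p z)] 0 = so" (is "?tt ` _ = _")
proof -
 have one: "!!e. (%_. 1 :: complex) e * (%_. 1) e = 1" by simp
 have tte: "?tt x $ e $ f = rho' x $ g (Some e) $ g (Some f)" for x e f unfolding inc_rig[OF g(1) one] inc_lef[OF g(1) one] by simp
 show ?thesis
 proof (intro equalityI subsetI)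
 fix X assume "X : ?tt ` fstab m [N z, N (p z)] 0"
 then obtain x where x: "x : fstab m [N z, N (p z)] 0" "X = ?tt x" by blast
 have "rho' x : so" by (rule rho_in_so[OF rho_in[OF fst_lev[OF x(1)]]])
 note so_ent[OF this]
 thus "X : so" unfolding so_iff x(2) tte by blast
 next
 fix X :: "complex ^ 'e ^ 'e" assume X: "X : so"
 define Y :: "complex ^ 'd ^ 'd" where "Y = (\<chi> i j. case (inv_into UNIV g i, inv_into UNIV g j) of (Some e, Some e') => X $ e $ e' | _ => 0)"
 have ig: "inv_into UNIV g (g a) = a" for a using bij_is_inj[OF g(1)] by simp
 have Xs: "X $ f $ e = - X $ e $ f" for e f by (rule so_ent[OF X])
 have Yg: "Y $ g a $ g b = (case (a, b) of (Some e, Some e') => X $ e $ e' | _ => 0)" for a b unfolding Y_def by (simp only: vec_lambda_beta ig)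
 have "Y $ g b $ g a = - Y $ g a $ g b" for a b unfolding Yg by (cases a; cases b; simp only: prod.case option.case minus_zero; rule Xs)
 hence "Y $ j $ i = - Y $ i $ j" for i j using bij_is_surj[OF g(1)] by (metis surjD)
 hence "Y : so" unfolding so_iff by blast
 hence "EX x:levd pp. rho' x = Y" by (rule so_rho)
 then obtain x where x: "x : levd pp" "rho' x = Y" by (elim bexE)
 have "rho' x $ z $ j = 0" for j unfolding x(2) Y_def using ig[of None] g(2) by simp
 hence "x : fstab m [N z, N (p z)] 0" using fst_rho[OF x(1)] by blast
 moreover have "?tt x = X"
 proof -
 have "?tt x $ e $ f = X $ e $ f" for e f unfolding tte unfolding x(2) Yg by simp
 thus ?thesis by (simp add: vec_eq_iff)
 qed
 ultimately show "X : ?tt ` fstab m [N z, N (p z)] 0" by blast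
 qed
qed

lemma vect_C:
 "vect (C *v u) : PS (para pp)" "vect (C *v u) = 0 ==> u = 0"
 "x : levd pp ==> br x (vect (C *v u)) = vect (C *v (rho' x *v u))"
proof -
 show "vect (C *v u) : PS (para pp)"
 unfolding vect_def by (intro subspace_sum[OF PS_subs] subspace_scale[OF PS_subs] PS_ev N(1) N_para)
 show "u = 0" if "vect (C *v u) = 0"
 proof -
 have "C *v u = 0" by (rule vec_inj[OF that])
 hence "(transpose C ** F) *v (C *v u) = 0" by simp
 thus ?thesis by (simp add: matrix_vector_mul_assoc C_ort)
 qed
 show "br x (vect (C *v u)) = vect (C *v (rho' x *v u))" if "x : levd pp"
 proof -
 have "x : PS (levi pp)" using that unfolding levd_def by blast
 thus ?thesis by (simp add: action matrix_vector_mul_assoc C_rho')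
 qed
qed

end

section \<open>The root data\<close>

definition levi_check :: "lat => lat list => lat => bool" where
 "levi_check m Ns c = ((if zero_on m c then list_ex (%a. list_ex (%b. c = a - b) Ns) Ns else True))"

definition wts_check :: "lat => lat list => bool" where
 "wts_check m Ns = (list_all (%a. ~ zero_on m a & list_all (%b. zero_on m (a - b)) Ns) Ns)"

text \<open>The order of \<open>Vs\<close> encodes the pairing: positions \<open>i\<close> and
  \<open>n - 1 - i\<close> hold opposite weights, and the form sits on the two outermost
  ones.\<close>

definition so_check :: "lat => lat list => lat list => nat => bool" where
 "so_check m Vs R n = (length Vs = n & wts_check m Vs &
 list_all (%i. Vs ! i + Vs ! (n - 1 - i) = Vs ! 0 + Vs ! (n - 1) &
 list_all (%j. ip (Vs ! i) (Vs ! j) = (if i = j then 2 else if j = n - 1 - i then 0 else 1)) [0..<n]) [0..<n] &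
 form_data m [Vs ! (n - 1), Vs ! 0] 0 & orth_basis ([Vs ! (n - 1), Vs ! 0] @ R) & list_all (zero_on m) R)"

text \<open>The order of the lists encodes the pairing: positions \<open>2 * i\<close> and
  \<open>2 * i + 1\<close> of \<open>Ls\<close> are partners and belong to \<open>Bs ! i\<close>.
  The head of \<open>S\<close> is the weight of the trivial line.\<close>

definition sp_check :: "lat => lat => lat list => lat list => lat list => lat list => bool" where
 "sp_check m m' S R Ls Bs = ((case S of th # th' # S' =>
 length Ls = 2 * length Bs & wts_check m (th # Ls) & distinct (th # Ls) &
 list_all (%a. list_all (%b. ip a b = (if a = b then 2 else 1)) (th # Ls)) (th # Ls) &
 list_all (%i. lc m i = 0 | lc m' i ~= 0) [1,2,3,4,5,6,7,8] &
 list_all (%a. ~ zero_on m' (a - th) & ~ zero_on m' (th - a)) Ls &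
 form_data m S 0 & list_all (%b. ~ zero_on m b) S & orth_basis (S @ R) & list_all (zero_on m) R &
 list_all (%b. list_ex (%b'. b = b') S') Bs &
 list_all (%i. Ls ! (2 * i) + Ls ! (2 * i + 1) = th + th' + Bs ! i) [0..<length Bs] &
 list_all (%b. list_ex (%b'. b = b') Bs | list_all (%a. list_all (%a'. ip b a = ip b a') Ls) Ls) S
 | _ => False))"

definition sympl_check :: "lat => lat => lat list => lat => lat list => lat list => lat list => bool" where
 "sympl_check m m' S d R Ls Bs = (for_roots (check m m' S d) & form_data m S d &
 sp_check m m' S R Ls Bs & for_roots (levi_check m (hd S # Ls)))"

definition orth_check :: "lat => lat => lat list => lat list => nat => bool" where
 "orth_check m d R Vs k = (for_roots (check m m [Vs ! (k - 1), Vs ! 0] d) & form_data m [Vs ! (k - 1), Vs ! 0] d &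
 so_check m Vs R k & for_roots (levi_check m Vs))"

text \<open>The roots \<open>tt\<^sub>1, tt\<^sub>2, tt\<^sub>3, tt\<^sub>4\<close> of the Kostant cascade of \<open>E\<^sub>8\<close> that are not simple.\<close>

definition cascade :: "lat list" where
 "cascade = [L 2 3 4 5 6 4 2 3, L 0 1 2 3 4 3 2 2, L 0 1 2 2 2 1 0 1, L 0 0 0 1 2 1 0 1]"

text \<open>The highest root has product 1 with simple root 1 and 0 with the others, so walking down
  from it along a chain of simple roots starting at 1 gives the remaining weights of a module of
  type A.\<close>

fun descend :: "lat => nat list => lat list" where
 "descend c [] = []"
| "descend c (i # is) = (c - sr i) # descend (c - sr i) is"

text \<open>The roots with coefficient 2 at simple root 7, spanning the centre of the nilradical, on
  which the Levi subalgebra of type D_7 acts by its vector representation. Opposite entries have a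
  constant sum; the outermost ones are the first two members of \<open>cascade\<close>.\<close>

definition module14 :: "lat list" where
 "module14 = [L 0 1 2 3 4 3 2 2,
 L 1 1 2 3 4 3 2 2,
 L 1 2 2 3 4 3 2 2,
 L 1 2 3 3 4 3 2 2,
 L 1 2 3 4 4 3 2 2,
 L 1 2 3 4 5 3 2 2,
 L 1 2 3 4 5 4 2 2,
 L 1 2 3 4 5 3 2 3,
 L 1 2 3 4 5 4 2 3,
 L 1 2 3 4 6 4 2 3,
 L 1 2 3 5 6 4 2 3,
 L 1 2 4 5 6 4 2 3,
 L 1 3 4 5 6 4 2 3,
 L 2 3 4 5 6 4 2 3]"

text \<open>\<open>d\<close> has coefficients 1, 5, 2, 1, 11, 4 on \<open>R\<close>. In the usual
  orthonormal coordinates of D_7 it is (0, 3, -1, 6, 4, 15, -7); the last six entries are non-zero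
  with distinct absolute values, so \<open>d\<close> is regular for B_6.\<close>

lemma check1: "orth_check (L 0 0 0 0 0 0 1 0) (L 0 3 2 8 12 17 0 10)
 (drop 2 cascade @ [sr 2, sr 4, sr 6, sr 8]) module14 14"
 by code_simp

text \<open>The second mask also marks simple root 1, since only Levi roots free of it are
  orthogonal to the highest root. The coefficients 1, 2, 3 of \<open>d\<close> on \<open>R\<close>
  are non-zero and distinct, which makes \<open>d\<close> regular for C_3.\<close>

lemma check2: "sympl_check (L 0 0 0 0 0 0 1 1) (L 1 0 0 0 0 0 1 1) (cascade @ [sr 8]) (L 0 1 0 2 0 3 0 0)
 [sr 2, sr 4, sr 6] (descend (hd cascade) [1,2,3,4,5,6]) (drop 2 cascade @ [sr 8])"
 by code_simp

lemma check3: "sympl_check (L 0 0 0 0 0 1 1 0) (L 1 0 0 0 0 1 1 0) (cascade @ [sr 6]) (L 0 1 0 2 0 0 0 3)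
 [sr 2, sr 4, sr 8] (descend (hd cascade) [1,2,3,4,5,8]) (drop 2 cascade @ [sr 6])"
 by code_simp

lemma check4: "sympl_check (L 0 0 0 0 1 1 1 1) (L 1 0 0 0 1 1 1 1) (cascade @ [sr 6, sr 8]) (L 0 1 0 2 0 0 0 0)
 [sr 2, sr 4] (descend (hd cascade) [1,2,3,4]) (drop 2 cascade)"
 by code_simp

lemma check5: "sympl_check (L 0 0 1 1 1 1 1 1) (L 1 0 1 1 1 1 1 1) (cascade @ [sr 4, sr 6, sr 8]) (L 0 1 0 0 0 0 0 0)
 [sr 2] (descend (hd cascade) [1,2]) [cascade ! 2]"
 by code_simp

section \<open>Soundness of the checks and the five cases\<close>

context e8
begin

lemma mas_par:
 assumes "!!i. i : {1..8} ==> lc m i = 0 \<longleftrightarrow> i : pp"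
 shows "{c. pos_on m c} = para pp" "{c. zero_on m c} = levi pp" unfolding para_def levi_def pos_on_iff zer_on_iff using assms by blast+

lemma lev_che_sou:
 assumes "for_roots (levi_check m Ns)" and mask: "{c. zero_on m c} = levi pp" and c: "rt c" "c : levi pp"
 shows "EX a:set Ns. EX b:set Ns. c = a - b"
proof -
 have "levi_check m Ns c" by (rule all_roo[OF assms(1) c(1)])
 moreover have "zero_on m c" using mask c(2) by blast
 ultimately show ?thesis unfolding levi_check_def list_ex_iff by simp
qed

lemma wei_che_sou:
 assumes "wts_check m Ns" and mask: "{c. zero_on m c} = levi pp"
 shows "a : set Ns ==> a ~: levi pp" "a : set Ns ==> b : set Ns ==> a - b : levi pp"
 using assms(1) unfolding wts_check_def list_all_iff mask[symmetric] by blast+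

lemma par_ind:
 assumes pp: "pp <= {1..8}" and m: "!!i. i : {1..8} ==> lc m i = 0 \<longleftrightarrow> i : pp" and ck: "for_roots (check m m' S d)"
 and S: "form_data m S d" "form_data m S 0" and K: "orth_basis (S @ R)"
 shows "lie_index sc br (parab pp) = length R"
proof -
 have mask: "{c. pos_on m c} = para pp" by (rule mas_par(1)[OF m])
 show ?thesis unfolding sta_par_eq[OF pp] mask[symmetric] by (rule inde_of_chec[OF ck S K])
qed

end

lemma bij_opt_ext:
 fixes z :: "'d::finite"
 assumes "CARD('d) = Suc CARD('e::finite)"
 shows "EX g :: 'e option => 'd. bij g & g None = z"
proof -
 have "card (UNIV :: 'e set) = card (UNIV - {z :: 'd})" using assms by (simp add: card_Diff_singleton)
 then obtain k where k: "bij_betw k (UNIV :: 'e set) (UNIV - {z})" using finite_same_card_bij by (metis finite_code)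
 have "bij (case_option z k)" unfolding bij_def inj_def surj_def
 proof (intro conjI allI impI)
 fix x y assume "case_option z k x = case_option z k y"
 moreover have "k e ~= z" for e using k by (auto simp: bij_betw_def)
 moreover have "k e = k e' ==> e = e'" for e e' using k by (auto simp: bij_betw_def inj_on_def)
 ultimately show "x = y" by (cases x; cases y) (auto dest: sym)
 next
 fix y
 show "EX x. y = case_option z k x"
 proof (cases "y = z")
 case False
 hence "y : range k" using k by (auto simp: bij_betw_def)
 thus ?thesis by (metis imageE option.case(2))
 qed (auto intro: exI[of _ None])
 qed
 thus ?thesis by (intro exI[of _ "case_option z k"]) simp
qed

text \<open>The Lie algebra of the bilinear form whose only non-zero entries are \<open>v e\<close>
  in row \<open>e\<close>, column \<open>p e\<close>. With \<open>p\<close> and \<open>v\<close>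
  left open it covers \<open>sp\<close>, and also \<open>sl\<close> in dimension 2.\<close>

definition pair_form :: "('e::finite => 'e) => ('e => complex) => (complex ^ 'e ^ 'e) set" where
 "pair_form p v = {X. ALL b j. X $ p j $ b * v (p j) + v b * X $ p b $ j = 0}"

text \<open>The \<open>v e\<close> are signs, so the form has a real orthogonal matrix, and adjoints
  preserve it as well.\<close>

lemma pai_for_adj:
 fixes v :: "'e::finite => complex"
 assumes p: "!!e. p (p e) = e" and v: "!!e. v e * v e = 1" and X: "X : pair_form p v"
 shows "adjm X : pair_form p v" unfolding pair_form_def mem_Collect_eq
proof (intro allI)
 fix b j
 have cv: "cnj (v e) = v e" for e using v[of e] square_eq_1_iff[of "v e"] by auto
 have "X $ p (p b) $ p j * v (p (p b)) + v (p j) * X $ p (p j) $ p b = 0" using X unfolding pair_form_def by blast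
 hence "cnj (X $ b $ p j * v b + v (p j) * X $ j $ p b) = cnj 0" unfolding p by (rule arg_cong)
 hence "cnj (X $ b $ p j) * v b + v (p j) * cnj (X $ j $ p b) = 0" by (simp add: cv)
 hence "cnj (X $ b $ p j) * v (p j) + v b * cnj (X $ j $ p b) = 0" using v[of b] v[of "p j"] by algebra
 thus "adjm X $ p j $ b * v (p j) + v b * adjm X $ p b $ j = 0" by (simp add: adjm_def)
qed

lemma so_adj: "X : so ==> adjm X : so"
proof -
 assume X: "X : so"
 have "cnj (X $ i $ j) = - cnj (X $ j $ i)" for i j unfolding so_ent[OF X, of i j] by simp
 thus ?thesis unfolding so_iff adjm_def vec_lambda_beta by blast
qed

lemma sp_eq_pai_for:
 "sp = pair_form (case_sum Inr Inl) (case_sum (%_. 1) (%_. - 1 :: complex) :: 'k::finite + 'k => complex)"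
proof -
 let ?p = "case_sum Inr Inl :: 'k + 'k => 'k + 'k" and ?v = "case_sum (%_. 1) (%_. - 1 :: complex) :: 'k + 'k => complex"
 have J: "symplectic_form $ i $ k = (if k = ?p i then ?v i else 0)" for i k :: "'k + 'k" by (cases i; cases k) (auto simp: symplectic_form_def)
 have J': "symplectic_form $ k $ j = (if k = ?p j then ?v (?p j) else 0)" for k j :: "'k + 'k" by (cases j; cases k) (auto simp: symplectic_form_def)
 have "(transpose X ** symplectic_form + symplectic_form ** X) $ b $ j = X $ ?p j $ b * ?v (?p j) + ?v b * X $ ?p b $ j"
 for X :: "complex ^ ('k + 'k) ^ ('k + 'k)" and b j
 proof -
 have "(transpose X ** symplectic_form) $ b $ j = X $ ?p j $ b * ?v (?p j)"
 by (simp add: matrix_matrix_mult_def transpose_def J' if_distrib[of "%t. _ * t"] cong: if_cong)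
 moreover have "(symplectic_form ** X) $ b $ j = ?v b * X $ ?p b $ j"
 by (simp add: matrix_matrix_mult_def J if_distrib[of "%t. t * _"] cong: if_cong)
 ultimately show ?thesis by simp
 qed
 thus ?thesis unfolding sp_def pair_form_def vec_eq_iff by simp
qed

text \<open>In dimension 2, preserving a skew form means having trace 0; A_1 is thereby treated as
  C_1.\<close>

lemma sl2_eq_pai_for:
 fixes v :: "2 => complex"
 assumes p: "!!e. p e ~= e" "!!e. p (p e) = e" and v: "!!e. v (p e) = - v e" "!!e. v e * v e = 1"
 shows "sl = pair_form p v"
proof -
 have p1: "p 1 = 2" using p(1)[of 1] exhaust_2[of "p 1"] by auto
 hence p2: "p 2 = 1" using p(2)[of 1] by simp
 have v2: "v 2 = - v 1" using v(1)[of 1] p1 by simp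
 have nz: "v 1 ~= 0" using v(2)[of 1] by auto
 have "(trace X = 0) = ((ALL b j. X $ p j $ b * v (p j) + v b * X $ p b $ j = 0))" for X :: "complex ^ 2 ^ 2"
 proof -
 have "((ALL b j. X $ p j $ b * v (p j) + v b * X $ p b $ j = 0)) = (v 1 * (X $ 1 $ 1 + X $ 2 $ 2) = 0)"
 unfolding forall_2 p1 p2 v2 by (auto simp: algebra_simps add_eq_0_iff)
 thus ?thesis using nz by (simp add: trace_def UNIV_2)
 qed
 thus ?thesis unfolding sl_def pair_form_def by simp
qed

definition partner :: "nat => nat" where "partner i = (if even i then i + 1 else i - 1)"

context e8
begin

text \<open>\<open>E\<close> places the index type on list positions so that \<open>p\<close>
  becomes \<open>partner\<close>. The signs of the skew form are not computed; hypothesis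
  \<open>T\<close> says that the target algebra absorbs any alternating choice of them by a diagonal
  change of basis \<open>s\<close>.\<close>

theorem sp_cas:
 fixes E :: "'e::finite => nat" and Q :: "(complex ^ 'n => complex ^ 'n) set" and T :: "(complex ^ 'e ^ 'e) set"
 assumes pp: "pp <= {1..8}" and m: "!!i. i : {1..8} ==> lc m i = 0 \<longleftrightarrow> i : pp" and ck: "for_roots (check m m' S d)"
 and Sd: "form_data m S d" and sp: "sp_check m m' S R Ls Bs" and th: "S = th # S''" and lv: "for_roots (levi_check m (th # Ls))"
 and E: "bij_betw E UNIV {..<length Ls}" "!!e. E (p e) = partner (E e)" and card: "CARD('d::finite) = Suc CARD('e)"
 and T: "!!w :: 'e => complex. (!!e. w e * w e = 1) ==> (!!e. w (p e) = - w e) ==>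
 EX s. (ALL e. s e * s e = 1) & T = pair_form p (%e. s e * s (p e) * w e)"
 and Q: "has_lie_algebra sc br (parab pp) Q ph"
 shows "embeds pp (sl :: (complex ^ 'd ^ 'd) set) T Q ph"
proof -
 obtain th' S' where Sth: "S = th # th' # S'" using sp unfolding th sp_check_def by (auto split: list.splits)
 from sp[unfolded sp_check_def Sth list.case list_all_iff list_ex_iff I8_lis, folded Sth]
 have len: "length Ls = 2 * length Bs" and wck: "wts_check m (th # Ls)" and dist: "distinct (th # Ls)"
 and ips: "ALL a:set (th # Ls). ALL b:set (th # Ls). ip a b = (if a = b then 2 else 1)" and mm: "ALL i:{1..8}. lc m i = 0 | lc m' i ~= 0"
 and nz: "ALL a:set Ls. ~ zero_on m' (a - th) & ~ zero_on m' (th - a)" and S0: "form_data m S 0" and Snz: "ALL b:set S. ~ zero_on m b"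
 and K: "orth_basis (S @ R)" and Rz: "ALL b:set R. zero_on m b" and BS': "ALL b:set Bs. EX b':set S'. b = b'"
 and pair': "ALL i:set [0..<length Bs]. Ls ! (2 * i) + Ls ! (2 * i + 1) = th + th' + Bs ! i"
 and orth': "ALL b:set S. (EX b':set Bs. b = b') | (ALL a:set Ls. ALL a':set Ls. ip b a = ip b a')" by - (elim conjE, assumption)+
 have BS: "set Bs <= set S'" using BS' by auto
 have pair: "Ls ! (2 * i) + Ls ! (2 * i + 1) = th + th' + Bs ! i" if "i < length Bs" for i by (rule bspec[OF pair']) (use that in simp)
 obtain g :: "'e option => 'd" where g: "bij g" using bij_opt_ext[OF card, of undefined] by (elim exE conjE)
 define N where "N i = (case inv_into UNIV g i of None => th | Some e => Ls ! E e)" for i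
 have ig: "inv_into UNIV g (g a) = a" for a using bij_is_inj[OF g] by simp
 have N0: "N (g None) = th" and Ne: "N (g (Some e)) = Ls ! E e" for e by (simp_all add: N_def ig)
 have El: "E e < length Ls" for e using E(1) by (auto simp: bij_betw_def)
 have Ein: "E e = E e' ==> e = e'" for e e' using E(1) by (auto simp: bij_betw_def inj_on_def)
 have Nin: "N i : set (th # Ls)" for i using El by (cases "inv_into UNIV g i") (simp_all add: N_def)
 have Ninj: "N i = N j ==> i = j" for i j
 proof -
 assume e: "N i = N j"
 have "inv_into UNIV g i = inv_into UNIV g j"
 proof (cases "inv_into UNIV g i"; cases "inv_into UNIV g j")
 fix a b assume ab: "inv_into UNIV g i = Some a" "inv_into UNIV g j = Some b"
 hence "E a = E b" using e dist El[of a] El[of b] by (simp add: N_def nth_eq_iff_index_eq)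
 thus ?thesis using ab Ein by simp
 qed (use e dist El in "auto simp: N_def")
 thus "i = j" using inv_into_injective bij_is_surj[OF g] by (metis UNIV_I)
 qed
 have Nall: "a : set (th # Ls) ==> EX i. a = N i" for a
 proof -
 assume a: "a : set (th # Ls)"
 show "EX i. a = N i"
 proof (cases "a = th")
 case False
 then obtain k where k: "k < length Ls" "a = Ls ! k" using a by (auto simp: in_set_conv_nth)
 hence "k : range E" using E(1) by (auto simp: bij_betw_def)
 then obtain e where "k = E e" by blast
 hence "a = N (g (Some e))" using k Ne by simp
 thus ?thesis by (rule exI)
 qed (use N0 in blast)
 qed
 have mask: "{c. pos_on m c} = para pp" "{c. zero_on m c} = levi pp" by (rule mas_par[OF m], assumption)+
 have pE: "p (p e) = e" "p e ~= e" for e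
 proof -
 have "E (p (p e)) = E e" unfolding E(2) partner_def by auto
 thus "p (p e) = e" by (rule Ein)
 show "p e ~= e" using E(2)[of e] unfolding partner_def by (cases "E e") (auto split: if_splits)
 qed
 define B where "B e = Bs ! (E e div 2)" for e
 have Eb: "E e div 2 < length Bs" for e using El[of e] len by simp
 have BSe: "B e : set S'" for e using nth_mem[OF Eb[of e]] BS unfolding B_def by blast
 have dS: "distinct S" using S0 unfolding form_data_def by blast
 have rB: "b : set Bs ==> b : range B" for b
 proof -
 assume "b : set Bs"
 then obtain k where k: "k < length Bs" "b = Bs ! k" by (auto simp: in_set_conv_nth)
 hence "2 * k : {..<length Ls}" using len by simp
 hence "2 * k : range E" using E(1) by (simp add: bij_betw_def)
 then obtain e where "2 * k = E e" by blast
 hence "E e div 2 = k" by simp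
 hence "b = B e" using k(2) by (simp add: B_def)
 thus "b : range B" by blast
 qed
 interpret sp_data sc br h al pp N g p B th th' m m' S R
 proof
 show "pp <= {1..8}" by (rule pp)
 show "ip (N a) (N b) = (if a = b then 2 else 1)" for a b using bspec[OF bspec[OF ips Nin] Nin, of a b] Ninj[of a b] by auto
 show "N i ~: levi pp" for i by (rule wei_che_sou(1)[OF wck mask(2) Nin])
 show "N a - N b : levi pp" for a b by (rule wei_che_sou(2)[OF wck mask(2) Nin Nin])
 show "EX a b. c = N a - N b" if "rt c" "c : levi pp" for c
 proof -
 have "EX a:set (th # Ls). EX b:set (th # Ls). c = a - b" by (rule lev_che_sou[OF lv mask(2) that])
 then obtain a b where ab: "a : set (th # Ls)" "b : set (th # Ls)" "c = a - b" by (elim bexE)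
 obtain i j where "a = N i" "b = N j" using Nall[OF ab(1)] Nall[OF ab(2)] by (elim exE)
 thus ?thesis using ab(3) by (intro exI[of _ i] exI[of _ j]) simp
 qed
 show "bij g" by (rule g)
 show "p (p e) = e" "p e ~= e" for e by (rule pE)+
 show "{c. pos_on m c} = para pp" by (rule mask)
 show "c : levi pp" if "zero_on m' c" for c
 proof -
 have "zero_on m c" using that mm unfolding zer_on_iff by blast
 thus ?thesis using mask(2) by blast
 qed
 show "~ zero_on m' (N (g (Some e)) - N (g None))" "~ zero_on m' (N (g None) - N (g (Some e)))" for e
 using bspec[OF nz nth_mem[OF El[of e]]] unfolding N0 Ne by blast+
 show "form_data m S 0" by (rule S0)
 show "b ~: levi pp" if "b : set S" for b using Snz that mask(2) by blast
 show "orth_basis (S @ R)" by (rule K)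
 show "set R <= levi pp" using Rz mask(2) by blast
 show "N (g None) = th" by (rule N0)
 show "th : set S" "th' : set S" "th ~= th'" using dS unfolding Sth by auto
 show "B e : set S" "B e ~= th" "B e ~= th'" for e using BSe[of e] dS unfolding Sth by auto
 show "N (g (Some e)) + N (g (Some (p e))) = th + th' + B e" for e
 proof (cases "even (E e)")
 case True
 hence "E e = 2 * (E e div 2)" "E (p e) = 2 * (E e div 2) + 1" unfolding E(2) partner_def by auto
 thus ?thesis using pair[OF Eb[of e]] unfolding Ne B_def by simp
 next
 case False
 hence "E e = 2 * (E e div 2) + 1" "E (p e) = 2 * (E e div 2)" unfolding E(2) partner_def by auto
 thus ?thesis using pair[OF Eb[of e]] unfolding Ne B_def by (simp add: add.commute)
 qed
 show "ip b (N (g (Some e))) = ip b (N (g (Some f)))" if b: "b : set S" "b ~: range B" for b e f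
 proof -
 have "~ (EX b':set Bs. b = b')" using rB b(2) by blast
 hence "ALL a:set Ls. ALL a':set Ls. ip b a = ip b a'" using orth' b(1) by blast
 thus ?thesis unfolding Ne using nth_mem[OF El[of e]] nth_mem[OF El[of f]] by blast
 qed
 show "cf x c = 0" if "x : fstab m S 0" "rt c" "~ zero_on m' c" for x c by (rule che_zer(1)[OF ck Sd S0 that(2,1,3)])
 qed
 have "EX s. (ALL e. s e * s e = 1) & T = pair_form p (%e. s e * s (p e) * w e)" by (rule T) (rule w_sq, rule w_skew)
 then obtain s where s: "!!e. s e * s e = 1" and Ts: "T = pair_form p (%e. s e * s (p e) * w e)" by blast
 define v where "v e = s e * s (p e) * w e" for e
 have v1: "v e * v e = 1" for e unfolding v_def using s[of e] s[of "p e"] w_sq[of e] by algebra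
 have Tv: "T = pair_form p v" unfolding Ts v_def ..
 show ?thesis
 proof (rule emb_cas[OF pp mask(1) S0 S(2) rho_iso vec_par vec_inj _ g s _ fst_row _ _ Q])
 show "br x (vect u) = vect (rho x *v u)" if "x : levd pp" for x u using that by (intro action) (simp add: levd_def)
 show "fstab m S 0 <= levd pp" using fst_lev by blast
 show "(%x. transpose (incl g s) ** rho x ** incl g s) ` fstab m S 0 = T" unfolding Tv pair_form_def by (rule fst_ima[OF s]) (rule v_def)
 show "adjm X : T" if "X : T" for X using pai_for_adj[of p v, OF pE(1) v1] that unfolding Tv by blast
 qed
qed

theorem so_cas:
 fixes Q :: "(complex ^ 'n => complex ^ 'n) set"
 assumes pp: "pp <= {1..8}" and m: "!!i. i : {1..8} ==> lc m i = 0 \<longleftrightarrow> i : pp" and ck: "for_roots (check m m S d)"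
 and Sd: "form_data m S d" and SV: "S = [Vs ! (k - 1), Vs ! 0]" and so: "so_check m Vs R k" and lv: "for_roots (levi_check m Vs)"
 and k: "even k" "0 < k" "CARD('d::finite) = k" "CARD('d) = Suc CARD('e::finite)" and Q: "has_lie_algebra sc br (parab pp) Q ph"
 shows "embeds pp (so :: (complex ^ 'd ^ 'd) set) (so :: (complex ^ 'e ^ 'e) set) Q ph"
proof -
 from so[unfolded so_check_def list_all_iff, folded SV]
 have len: "length Vs = k" and wck: "wts_check m Vs" and P: "ALL i:set [0..<k]. Vs ! i + Vs ! (k - 1 - i) = Vs ! 0 + Vs ! (k - 1) &
 (ALL j:set [0..<k]. ip (Vs ! i) (Vs ! j) = (if i = j then 2 else if j = k - 1 - i then 0 else 1))"
 and S0: "form_data m S 0" and K: "orth_basis (S @ R)" and Rz: "ALL b:set R. zero_on m b" by - (elim conjE, assumption)+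
 have pair: "Vs ! i + Vs ! (k - 1 - i) = Vs ! 0 + Vs ! (k - 1)" if "i < k" for i by (rule conjunct1[OF bspec[OF P]]) (use that in simp)
 have ips: "ip (Vs ! i) (Vs ! j) = (if i = j then 2 else if j = k - 1 - i then 0 else 1)" if "i < k" "j < k" for i j
 by (rule bspec[OF conjunct2[OF bspec[OF P]]]) (use that in simp_all)
 have "card (UNIV :: 'd set) = card {..<k}" using k by simp
 then obtain E where E: "bij_betw E (UNIV :: 'd set) {..<k}" using finite_same_card_bij by (metis finite_code finite_lessThan)
 define I where "I = inv_into UNIV E"
 define p where "p a = I (k - 1 - E a)" for a
 define z where "z = I (k - 1)"
 define N where "N a = Vs ! E a" for a
 have El: "E a < k" for a using E by (auto simp: bij_betw_def)
 have Ein: "E a = E b ==> a = b" for a b using E by (auto simp: bij_betw_def inj_on_def)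
 have EI: "i < k ==> E (I i) = i" for i unfolding I_def using bij_betw_inv_into_right[OF E, of i] by simp
 have Ep: "E (p a) = k - 1 - E a" for a unfolding p_def by (rule EI) (use El[of a] in simp)
 have Ez: "E z = k - 1" unfolding z_def by (rule EI) (use k in simp)
 have Nz: "[N z, N (p z)] = S" by (simp add: N_def Ez Ep SV)
 have Nin: "N a : set Vs" for a using El[of a] len by (simp add: N_def)
 have mask: "{c. pos_on m c} = para pp" "{c. zero_on m c} = levi pp" by (rule mas_par[OF m], assumption)+
 obtain g :: "'e option => 'd" where g: "bij g" "g None = z" using bij_opt_ext[OF k(4), of z] by (elim exE conjE)
 interpret M: so_module sc br h al pp N p "Vs ! 0 + Vs ! (k - 1)"
 proof
 show "pp <= {1..8}" by (rule pp)
 show "p (p a) = a" for a by (rule Ein) (use El[of a] in "simp add: Ep")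
 show "p a ~= a" for a
 proof
 assume "p a = a"
 hence "E a = k - 1 - E a" using Ep[of a] by simp
 hence "k = 2 * E a + 1" using El[of a] by simp
 thus False using k(1) by simp
 qed
 show "ip (N a) (N b) = (if a = b then 2 else if b = p a then 0 else 1)" for a b
 proof -
 have "(E a = E b) = (a = b)" "(E b = k - 1 - E a) = (b = p a)"
 using Ein[of a b] Ein[of b "p a"] unfolding Ep by (blast, metis Ep)
 thus ?thesis unfolding N_def using ips[OF El El, of a b] by (simp only:)
 qed
 show "N i ~: levi pp" for i by (rule wei_che_sou(1)[OF wck mask(2) Nin])
 show "N a - N b : levi pp" for a b by (rule wei_che_sou(2)[OF wck mask(2) Nin Nin])
 show "EX a b. c = N a - N b" if "rt c" "c : levi pp" for c
 proof -
 have "EX a:set Vs. EX b:set Vs. c = a - b" by (rule lev_che_sou[OF lv mask(2) that])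
 then obtain a b where ab: "a : set Vs" "b : set Vs" "c = a - b" by (elim bexE)
 obtain i j where "i < k" "a = Vs ! i" "j < k" "b = Vs ! j" using ab(1,2) len by (auto simp: in_set_conv_nth)
 hence "c = N (I i) - N (I j)" using ab(3) by (simp add: N_def EI)
 thus ?thesis by blast
 qed
 show "N a + N (p a) = Vs ! 0 + Vs ! (k - 1)" for a unfolding N_def Ep by (rule pair[OF El])
 qed
 \<comment> \<open>Half of the list positions, one from each pair. The index \<open>z\<close> lies
   in the upper half, and the outer equivalence flips the choice when \<open>M.f z\<close> is
   -1.\<close>
 define q where "q a \<longleftrightarrow> (k div 2 <= E a \<longleftrightarrow> M.f z = 1)" for a
 interpret so_data sc br h al pp N p "Vs ! 0 + Vs ! (k - 1)" q z m R
 proof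
 show "(q (p a)) = (~ q a)" for a
 proof -
 obtain j where j: "k = 2 * j" using k(1) by (elim evenE)
 have "(k div 2 <= E (p a)) = (~ k div 2 <= E a)" unfolding Ep j using El[of a] unfolding j by auto
 thus ?thesis unfolding q_def by blast
 qed
 show "q z = (M.f z = 1)"
 proof -
 have "k div 2 <= E z" unfolding Ez using k(1,2) by (elim evenE) auto
 thus ?thesis unfolding q_def by simp
 qed
 show "{c. pos_on m c} = para pp" by (rule mask)
 show "form_data m [N z, N (p z)] 0" unfolding Nz by (rule S0)
 show "orth_basis ([N z, N (p z)] @ R)" unfolding Nz by (rule K)
 show "set R <= levi pp" using Rz mask(2) by blast
 show "cf x c = 0" if x: "x : fstab m [N z, N (p z)] 0" "rt c" "c ~: levi pp" for x c
 proof (rule che_zer(1)[OF ck Sd S0 x(2)])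
 show "x : fstab m S 0" using x(1) unfolding Nz .
 show "~ zero_on m c" using x(3) mask(2) by blast
 qed
 qed
 show ?thesis
 proof (rule emb_cas[where w = "%u. M.vect (C *v u)" and s = "%_. 1",
 OF pp mask(1) S _ rho'_iso vect_C g(1)])
 show "adjm X : so" if "X : so" for X :: "complex ^ 'e ^ 'e" using that by (rule so_adj)
 show "has_lie_algebra sc br (parab pp) Q ph" by (rule Q)
 show "b ~: levi pp" if "b : set [N z, N (p z)]" for b using that M.N_levi(1) by auto
 show "(1 :: complex) * 1 = 1" by simp
 show "fstab m [N z, N (p z)] 0 <= levd pp" using fst_lev by blast
 show row: "rho' x $ g None $ j = 0" if "x : fstab m [N z, N (p z)] 0" for x j
 using fst_rho[OF fst_lev[OF that]] that unfolding g(2) by blast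
 show "rho' x $ j $ g None = 0" if x: "x : fstab m [N z, N (p z)] 0" for x j
 using so_ent[OF rho_in_so[OF M.rho_in[OF fst_lev[OF x]]], of j "g None"] row[OF x, of j] by simp
 show "(%x. transpose (incl g (%_. 1)) ** rho' x ** incl g (%_. 1)) ` fstab m [N z, N (p z)] 0 = so" by (rule fst_ima[OF g])
 qed
qed


lemma sp_che_bas:
 assumes "sp_check m m' S R Ls Bs"
 shows "form_data m S 0" "orth_basis (S @ R)" "length Ls = 2 * length Bs" using assms unfolding sp_check_def by (simp_all split: list.splits)

lemma sum_enu:
 "EX E :: 'k::finite + 'k => nat. bij_betw E UNIV {..<2 * CARD('k)} & (ALL e. E (case_sum Inr Inl e) = partner (E e))"
proof -
 have "card (UNIV :: 'k set) = card {..<CARD('k)}" by simp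
 then obtain F where F: "bij_betw F (UNIV :: 'k set) {..<CARD('k)}" using finite_same_card_bij by (metis finite_code finite_lessThan)
 have Fl: "F a < CARD('k)" for a using F by (auto simp: bij_betw_def)
 have Fi: "(F a = F b) = (a = b)" for a b using F by (auto simp: bij_betw_def inj_on_def)
 let ?E = "case_sum (%a. 2 * F a) (%a. 2 * F a + 1) :: 'k + 'k => nat"
 have inj: "inj ?E"
 proof (rule injI)
 fix x y :: "'k + 'k" assume xy: "?E x = ?E y"
 hence "even (?E x) = even (?E y)" by simp
 thus "x = y" using xy by (cases x; cases y) (simp_all add: Fi)
 qed
 have "2 * F a + 1 < 2 * CARD('k)" for a using Fl[of a] by linarith
 hence "?E x < 2 * CARD('k)" for x using Fl by (cases x) auto
 hence "range ?E <= {..<2 * CARD('k)}" by blast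
 moreover have "card (range ?E) = 2 * CARD('k)" using card_image[OF inj] by (simp add: card_UNIV_sum)
 ultimately have "range ?E = {..<2 * CARD('k)}" by (intro card_subset_eq) auto
 hence "bij_betw ?E UNIV {..<2 * CARD('k)}" unfolding bij_betw_def using inj by blast
 moreover have "?E (case_sum Inr Inl e) = partner (?E e)" for e by (cases e) (simp_all add: partner_def)
 ultimately show ?thesis by blast
qed

lemma sp_sig:
 fixes w :: "'k::finite + 'k => complex"
 assumes "!!e. w e * w e = 1" "!!e. w (case_sum Inr Inl e) = - w e"
 shows "EX s. (ALL e. s e * s e = 1) & sp = pair_form (case_sum Inr Inl) (%e. s e * s (case_sum Inr Inl e) * w e)"
proof -
 \<comment> \<open>With this choice the product in the claim becomes 1 on the left summand and -1 on
   the right one, the signs of \<open>symplectic_form\<close>.\<close>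
 let ?s = "case_sum (%_. 1) (%a. w (Inl a))"
 have 1: "?s e * ?s e = 1" for e using assms(1) by (cases e) simp_all
 have 2: "(%e. ?s e * ?s (case_sum Inr Inl e) * w e) = case_sum (%_. 1) (%_. - 1)"
 proof
 fix e show "?s e * ?s (case_sum Inr Inl e) * w e = case_sum (%_. 1) (%_. - 1) e"
 proof (cases e)
 case (Inr a)
 thus ?thesis using assms(2)[of "Inl a"] assms(1)[of "Inl a"] by simp
 qed (use assms(1) in simp)
 qed
 show ?thesis
 proof (intro exI conjI allI)
 show "?s e * ?s e = 1" for e by (rule 1)
 show "sp = pair_form (case_sum Inr Inl) (%e. ?s e * ?s (case_sum Inr Inl e) * w e)" unfolding 2 by (rule sp_eq_pai_for)
 qed
qed

lemma ind_of_che: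
 assumes "pp <= {1..8}" "!!i. i : {1..8} ==> lc m i = 0 \<longleftrightarrow> i : pp"
 shows "sympl_check m m' S d R Ls Bs ==> lie_index sc br (parab pp) = length R"
 "orth_check m d R Vs k ==> lie_index sc br (parab pp) = length R"
 unfolding sympl_check_def orth_check_def so_check_def using par_ind[OF assms] sp_che_bas(1,2) by meson+

theorem sym_cas:
 fixes Q :: "(complex ^ 'n => complex ^ 'n) set"
 assumes pp: "pp <= {1..8}" and m: "!!i. i : {1..8} ==> lc m i = 0 \<longleftrightarrow> i : pp"
 and ck: "sympl_check m m' S d R Ls Bs" and th: "S = th # S''"
 and card: "length Bs = CARD('k::finite)" "CARD('d::finite) = Suc (CARD('k) + CARD('k))" and Q: "has_lie_algebra sc br (parab pp) Q ph"
 shows "embeds pp (sl :: (complex ^ 'd ^ 'd) set) (sp :: (complex ^ ('k + 'k) ^ ('k + 'k)) set) Q ph"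
proof -
 have ck': "for_roots (check m m' S d)" "form_data m S d" "sp_check m m' S R Ls Bs" "for_roots (levi_check m (th # Ls))"
 using ck th unfolding sympl_check_def by auto
 obtain E :: "'k + 'k => nat" where E: "bij_betw E UNIV {..<2 * CARD('k)}" "!!e. E (case_sum Inr Inl e) = partner (E e)"
 using sum_enu by blast
 show ?thesis
 proof (rule sp_cas[where E = E and p = "case_sum Inr Inl", OF pp m ck'(1-3) th ck'(4) _ E(2) _ sp_sig Q])
 show "bij_betw E UNIV {..<length Ls}" using E(1) card(1) sp_che_bas(3)[OF ck'(3)] by simp
 show "CARD('d) = Suc CARD('k + 'k)" using card(2) by (simp add: card_UNIV_sum)
 qed
qed

theorem sl2_cas:
 fixes Q :: "(complex ^ 'n => complex ^ 'n) set"
 assumes pp: "pp <= {1..8}" and m: "!!i. i : {1..8} ==> lc m i = 0 \<longleftrightarrow> i : pp"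
 and ck: "sympl_check m m' S d R Ls Bs" and th: "S = th # S''" and card: "length Bs = 1" "CARD('d::finite) = 3"
 and Q: "has_lie_algebra sc br (parab pp) Q ph"
 shows "embeds pp (sl :: (complex ^ 'd ^ 'd) set) (sl :: (complex ^ 2 ^ 2) set) Q ph"
proof -
 have ck': "for_roots (check m m' S d)" "form_data m S d" "sp_check m m' S R Ls Bs" "for_roots (levi_check m (th # Ls))"
 using ck th unfolding sympl_check_def by auto
 define E :: "2 => nat" where "E e = (if e = 1 then 0 else 1)" for e
 define p :: "2 => 2" where "p e = (if e = 1 then 2 else 1)" for e
 have ne: "(2 :: 2) ~= 1" by simp
 have p: "p e ~= e" "p (p e) = e" for e using exhaust_2[of e] ne by (auto simp: p_def)
 show ?thesis
 proof (rule sp_cas[where E = E and p = p, OF pp m ck'(1-3) th ck'(4) _ _ _ _ Q])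
 have "range E = {..<2}" unfolding UNIV_2 using ne by (auto simp: E_def)
 moreover have "inj E" by (rule injI) (metis E_def exhaust_2 zero_neq_one)
 ultimately show "bij_betw E UNIV {..<length Ls}" using card(1) sp_che_bas(3)[OF ck'(3)] by (simp add: bij_betw_def)
 show "E (p e) = partner (E e)" for e using exhaust_2[of e] ne by (auto simp: E_def p_def partner_def)
 show "CARD('d) = Suc CARD(2)" using card(2) by simp
 show "EX s. (ALL e. s e * s e = 1) & sl = pair_form p (%e. s e * s (p e) * w e)"
 if w: "!!e. w e * w e = 1" "!!e. w (p e) = - w e" for w :: "2 => complex"
 using sl2_eq_pai_for[of p w, OF p w(2,1)] by (intro exI[of _ "%_. 1"]) simp
 qed
qed

theorem ort_cas:
 fixes Q :: "(complex ^ 'n => complex ^ 'n) set"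
 assumes pp: "pp <= {1..8}" and m: "!!i. i : {1..8} ==> lc m i = 0 \<longleftrightarrow> i : pp"
 and ck: "orth_check m d R Vs k" and k: "even k" "0 < k" "CARD('d::finite) = k" "CARD('d) = Suc CARD('e::finite)"
 and Q: "has_lie_algebra sc br (parab pp) Q ph"
 shows "embeds pp (so :: (complex ^ 'd ^ 'd) set) (so :: (complex ^ 'e ^ 'e) set) Q ph"
proof -
 let ?S = "[Vs ! (k - 1), Vs ! 0]"
 have ck': "for_roots (check m m ?S d)" "form_data m ?S d" "so_check m Vs R k" "for_roots (levi_check m Vs)"
 using ck unfolding orth_check_def by blast+
 show ?thesis by (rule so_cas[OF pp m ck'(1,2) refl ck'(3,4) k Q])
qed

end

theorem mainTheorem7:
  fixes sc :: "complex \<Rightarrow> 'g::ab_group_add \<Rightarrow> 'g"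
    and br :: "'g \<Rightarrow> 'g \<Rightarrow> 'g"
    and h :: "'g set"
    and \<alpha> :: "nat \<Rightarrow> 'g \<Rightarrow> complex"
  assumes "simple_lie_algebra_E8 sc br h \<alpha>"
  shows "(let p = standard_parabolic sc br h {1..8} \<alpha> {1,2,3,4,5,6,8};
          l = standard_levi sc br h \<alpha> {1,2,3,4,5,6,8}
      in lie_index sc br p = 6 \<and>
         (\<forall>(Q :: (complex ^ 'n \<Rightarrow> complex ^ 'n) set) \<phi>. has_lie_algebra sc br p Q \<phi> \<longrightarrow>
            quasi_reductive sc p Q \<phi> \<and>
            (\<exists>M. maximal_reductive_stabiliser_algebra sc br p Q \<phi> M \<and>
                 embedded_as_natural_plus_trivial sc br M l
                   (so :: (complex ^ 14 ^ 14) set) (so :: (complex ^ 13 ^ 13) set)))) \<and>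
     (let p = standard_parabolic sc br h {1..8} \<alpha> {1,2,3,4,5,6};
          l = standard_levi sc br h \<alpha> {1,2,3,4,5,6}
      in lie_index sc br p = 3 \<and>
         (\<forall>(Q :: (complex ^ 'n \<Rightarrow> complex ^ 'n) set) \<phi>. has_lie_algebra sc br p Q \<phi> \<longrightarrow>
            quasi_reductive sc p Q \<phi> \<and>
            (\<exists>M. maximal_reductive_stabiliser_algebra sc br p Q \<phi> M \<and>
                 embedded_as_natural_plus_trivial sc br M l
                   (sl :: (complex ^ 7 ^ 7) set) (sp :: (complex ^ (3 + 3) ^ (3 + 3)) set)))) \<and>
     (let p = standard_parabolic sc br h {1..8} \<alpha> {1,2,3,4,5,8};
          l = standard_levi sc br h \<alpha> {1,2,3,4,5,8}
      in lie_index sc br p = 3 \<and>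
         (\<forall>(Q :: (complex ^ 'n \<Rightarrow> complex ^ 'n) set) \<phi>. has_lie_algebra sc br p Q \<phi> \<longrightarrow>
            quasi_reductive sc p Q \<phi> \<and>
            (\<exists>M. maximal_reductive_stabiliser_algebra sc br p Q \<phi> M \<and>
                 embedded_as_natural_plus_trivial sc br M l
                   (sl :: (complex ^ 7 ^ 7) set) (sp :: (complex ^ (3 + 3) ^ (3 + 3)) set)))) \<and>
     (let p = standard_parabolic sc br h {1..8} \<alpha> {1,2,3,4};
          l = standard_levi sc br h \<alpha> {1,2,3,4}
      in lie_index sc br p = 2 \<and>
         (\<forall>(Q :: (complex ^ 'n \<Rightarrow> complex ^ 'n) set) \<phi>. has_lie_algebra sc br p Q \<phi> \<longrightarrow>
            quasi_reductive sc p Q \<phi> \<and>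
            (\<exists>M. maximal_reductive_stabiliser_algebra sc br p Q \<phi> M \<and>
                 embedded_as_natural_plus_trivial sc br M l
                   (sl :: (complex ^ 5 ^ 5) set) (sp :: (complex ^ (2 + 2) ^ (2 + 2)) set)))) \<and>
     (let p = standard_parabolic sc br h {1..8} \<alpha> {1,2};
          l = standard_levi sc br h \<alpha> {1,2}
      in lie_index sc br p = 1 \<and>
         (\<forall>(Q :: (complex ^ 'n \<Rightarrow> complex ^ 'n) set) \<phi>. has_lie_algebra sc br p Q \<phi> \<longrightarrow>
            quasi_reductive sc p Q \<phi> \<and>
            (\<exists>M. maximal_reductive_stabiliser_algebra sc br p Q \<phi> M \<and>
                 embedded_as_natural_plus_trivial sc br M l
                   (sl :: (complex ^ 3 ^ 3) set) (sl :: (complex ^ 2 ^ 2) set))))"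
proof -
 interpret e8 sc br h \<alpha> using assms by unfold_locales
 have m1: "lc (L 0 0 0 0 0 0 1 0) i = 0 \<longleftrightarrow> i : {1,2,3,4,5,6,8}" if "i : {1..8}" for i
 using that unfolding I8 by (elim insertE emptyE; simp)
 have m2: "lc (L 0 0 0 0 0 0 1 1) i = 0 \<longleftrightarrow> i : {1,2,3,4,5,6}" if "i : {1..8}" for i
 using that unfolding I8 by (elim insertE emptyE; simp)
 have m3: "lc (L 0 0 0 0 0 1 1 0) i = 0 \<longleftrightarrow> i : {1,2,3,4,5,8}" if "i : {1..8}" for i
 using that unfolding I8 by (elim insertE emptyE; simp)
 have m4: "lc (L 0 0 0 0 1 1 1 1) i = 0 \<longleftrightarrow> i : {1,2,3,4}" if "i : {1..8}" for i
 using that unfolding I8 by (elim insertE emptyE; simp)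
 have m5: "lc (L 0 0 1 1 1 1 1 1) i = 0 \<longleftrightarrow> i : {1,2}" if "i : {1..8}" for i
 using that unfolding I8 by (elim insertE emptyE; simp)
 have p: "{1,2,3,4,5,6,8} <= {1..8::nat}" "{1,2,3,4,5,6} <= {1..8::nat}" "{1,2,3,4,5,8} <= {1..8::nat}"
 "{1,2,3,4} <= {1..8::nat}" "{1,2} <= {1..8::nat}" by auto
 have i1: "lie_index sc br (parab {1,2,3,4,5,6,8}) = 6" using ind_of_che(2)[OF p(1) m1 check1] by (simp add: cascade_def)
 have i2: "lie_index sc br (parab {1,2,3,4,5,6}) = 3" using ind_of_che(1)[OF p(2) m2 check2] by (simp add: cascade_def)
 have i3: "lie_index sc br (parab {1,2,3,4,5,8}) = 3" using ind_of_che(1)[OF p(3) m3 check3] by (simp add: cascade_def)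
 have i4: "lie_index sc br (parab {1,2,3,4}) = 2" using ind_of_che(1)[OF p(4) m4 check4] by (simp add: cascade_def)
 have i5: "lie_index sc br (parab {1,2}) = 1" using ind_of_che(1)[OF p(5) m5 check5] by (simp add: cascade_def)
 have e1: "embeds {1,2,3,4,5,6,8} (so :: (complex ^ 14 ^ 14) set) (so :: (complex ^ 13 ^ 13) set) Q \<phi>"
 if "has_lie_algebra sc br (parab {1,2,3,4,5,6,8}) Q \<phi>" for Q :: "(complex ^ 'n => complex ^ 'n) set" and \<phi>
 by (rule ort_cas[OF p(1) m1 check1 _ _ _ _ that]) simp_all
 have e2: "embeds {1,2,3,4,5,6} (sl :: (complex ^ 7 ^ 7) set) (sp :: (complex ^ (3 + 3) ^ (3 + 3)) set) Q \<phi>"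
 if "has_lie_algebra sc br (parab {1,2,3,4,5,6}) Q \<phi>" for Q :: "(complex ^ 'n => complex ^ 'n) set" and \<phi>
 by (rule sym_cas[OF p(2) m2 check2 _ _ _ that]) (simp_all add: cascade_def)
 have e3: "embeds {1,2,3,4,5,8} (sl :: (complex ^ 7 ^ 7) set) (sp :: (complex ^ (3 + 3) ^ (3 + 3)) set) Q \<phi>"
 if "has_lie_algebra sc br (parab {1,2,3,4,5,8}) Q \<phi>" for Q :: "(complex ^ 'n => complex ^ 'n) set" and \<phi>
 by (rule sym_cas[OF p(3) m3 check3 _ _ _ that]) (simp_all add: cascade_def)
 have e4: "embeds {1,2,3,4} (sl :: (complex ^ 5 ^ 5) set) (sp :: (complex ^ (2 + 2) ^ (2 + 2)) set) Q \<phi>"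
 if "has_lie_algebra sc br (parab {1,2,3,4}) Q \<phi>" for Q :: "(complex ^ 'n => complex ^ 'n) set" and \<phi>
 by (rule sym_cas[OF p(4) m4 check4 _ _ _ that]) (simp_all add: cascade_def)
 have e5: "embeds {1,2} (sl :: (complex ^ 3 ^ 3) set) (sl :: (complex ^ 2 ^ 2) set) Q \<phi>"
 if "has_lie_algebra sc br (parab {1,2}) Q \<phi>" for Q :: "(complex ^ 'n => complex ^ 'n) set" and \<phi>
 by (rule sl2_cas[OF p(5) m5 check5 _ _ _ that]) (simp_all add: cascade_def)
 show ?thesis unfolding Let_def using i1 i2 i3 i4 i5 e1 e2 e3 e4 e5 by blast
qed

end
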